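(* Let $\omega$ be a radial weight, $1<p<\infty$ and $k\in\mathbb{N}$. Then the following statements are equivalent: (i) $P_\omega:L^p_\omega\to D^p_{\omega,k}$ is bounded and onto; (ii) $(A^{p'}_\omega)^\star\simeq D^p_{\omega,k}$ via the $A^2_\omega$-pairing with equivalence of norms; (iii) $A^p_\omega=D^p_{\omega,k}$ with equivalence of norms; (iv) $\omega\in\mathcal{D}$.
   Context: $\mathbb{D}$ is the open unit disc of $\mathbb{C}$, $\mathcal{H}(\mathbb{D})$ the space of analytic functions in $\mathbb{D}$, and $dA(z)=\frac{dx\,dy}{\pi}$. A radial weight is a nonnegative function $\omega\in L^1([0,1))$ extended to $\mathbb{D}$ by $\omega(z)=\omega(|z|)$; it is assumed throughout that $\widehat{\omega}(z)=\int_{|z|}^1\omega(s)\,ds>0$ for all $z\in\mathbb{D}$. $\omega\in\widehat{\mathcal{D}}$ if there is $C\ge1$ with $\widehat{\omega}(r)\le C\widehat{\omega}\left(\frac{1+r}{2}\right)$ for all $0\le r<1$; $\omega\in\check{\mathcal{D}}$ if there are $K>1$ and $C>1$ with $\widehat{\omega}(r)\ge C\widehat{\omega}\left(1-\frac{1-r}{K}\right)$ for all $0\le r<1$; $\mathcal{D}=\widehat{\mathcal{D}}\cap\check{\mathcal{D}}$. $L^p_\omega$ is the space of measurable $f$ on $\mathbb{D}$ with $\|f\|_{L^p_\omega}^p=\int_{\mathbb{D}}|f(z)|^p\omega(z)\,dA(z)<\infty$, and $A^p_\omega=L^p_\omega\cap\mathcal{H}(\mathbb{D})$. $p'$ is the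 conjugate exponent, $\frac1p+\frac1{p'}=1$. Write $\omega_{[\beta]}(z)=\omega(z)(1-|z|)^\beta$. The Dirichlet-type space $D^p_{\omega,k}$ consists of $f\in\mathcal{H}(\mathbb{D})$ with $\|f\|_{D^p_{\omega,k}}=\|f^{(k)}\|_{A^p_{\omega_{[kp]}}}+\sum_{j=0}^k|f^{(j)}(0)|<\infty$. Write $\omega_x=\int_0^1r^x\omega(r)\,dr$ for $x\ge0$. The Bergman projection is $P_\omega(f)(z)=\int_{\mathbb{D}}f(\zeta)\overline{B^\omega_z(\zeta)}\,\omega(\zeta)\,dA(\zeta)$, where $B^\omega_z(\zeta)=\sum_{n=0}^\infty\frac{(\overline{z}\zeta)^n}{2\omega_{2n+1}}$ is the reproducing kernel of $A^2_\omega$. The $A^2_\omega$-pairing is $\langle f,g\rangle_{A^2_\omega}=\lim_{r\to1^-}\int_{\mathbb{D}}f_r(z)\overline{g(z)}\,\omega(z)\,dA(z)$, where $f_r(z)=f(rz)$. "$X^\star\simeq Y$ via the $A^2_\omega$-pairing with equivalence of norms" means that each $g\in Y$ induces a bounded linear functional $L_g(f)=\langle f,g\rangle_{A^2_\omega}$ on $X$, each element of the dual $X^\star$ equals $L_g$ for a unique $g\in Y$, and $\|L_g\|$ and $\|g\|_Y$ are comparable with constants independent of $g$. *)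

theory Defs
  imports "HOL-Complex_Analysis.Complex_Analysis"
begin

text \<open>
  Functions on the unit disc are represented by total functions of type
  \<open>complex \<Rightarrow> complex\<close>, of which only the values on \<open>ball 0 1\<close> matter; equality of two
  functions on the disc is therefore equality on \<open>ball 0 1\<close>. A radial weight \<open>\<omega>\<close> is represented
  by its profile on \<open>[0,1)\<close>, its value at a point \<open>z\<close> of the disc being \<open>\<omega> (norm z)\<close>.
\<close>

abbreviation disc :: "complex set"
  where "disc \<equiv> ball 0 1"

definition dA :: "complex measure"
  where "dA = density (lebesgue_on disc) (\<lambda>_. ennreal (1 / pi))"

definition tail :: "(real \<Rightarrow> real) \<Rightarrow> real \<Rightarrow> real"
  where "tail \<omega> r = (LINT s:{r..<1}|lebesgue. \<omega> s)"

definition radial_weight :: "(real \<Rightarrow> real) \<Rightarrow> bool"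
  where "radial_weight \<omega> \<longleftrightarrow>
    (\<forall>r\<in>{0..<1}. 0 \<le> \<omega> r) \<and>
    set_integrable lebesgue {0..<1} \<omega> \<and>
    (\<forall>r\<in>{0..<1}. 0 < tail \<omega> r)"

definition D_hat :: "(real \<Rightarrow> real) set"
  where "D_hat = {\<omega>. radial_weight \<omega> \<and>
    (\<exists>C\<ge>1. \<forall>r\<in>{0..<1}. tail \<omega> r \<le> C * tail \<omega> ((1 + r) / 2))}"

definition D_check :: "(real \<Rightarrow> real) set"
  where "D_check = {\<omega>. radial_weight \<omega> \<and>
    (\<exists>K>1. \<exists>C>1. \<forall>r\<in>{0..<1}. tail \<omega> r \<ge> C * tail \<omega> (1 - (1 - r) / K))}"

definition D_class :: "(real \<Rightarrow> real) set"
  where "D_class = D_hat \<inter> D_check"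

definition shifted_weight :: "(real \<Rightarrow> real) \<Rightarrow> real \<Rightarrow> real \<Rightarrow> real"
  where "shifted_weight \<omega> \<beta> r = \<omega> r * (1 - r) powr \<beta>"

text \<open>The convention \<open>0 powr 0 = 0\<close> only affects the integrand at the single point \<open>r = 0\<close>.\<close>

definition moment :: "(real \<Rightarrow> real) \<Rightarrow> real \<Rightarrow> real"
  where "moment \<omega> x = (LINT r:{0..<1}|lebesgue. r powr x * \<omega> r)"

definition Lp :: "(real \<Rightarrow> real) \<Rightarrow> real \<Rightarrow> (complex \<Rightarrow> complex) set"
  where "Lp \<omega> p = {f. f \<in> borel_measurable dA \<and>
    integrable dA (\<lambda>z. norm (f z) powr p * \<omega> (norm z))}"

definition Lp_norm :: "(real \<Rightarrow> real) \<Rightarrow> real \<Rightarrow> (complex \<Rightarrow> complex) \<Rightarrow> real"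
  where "Lp_norm \<omega> p f = (LINT z|dA. norm (f z) powr p * \<omega> (norm z)) powr (1 / p)"

definition Bergman :: "(real \<Rightarrow> real) \<Rightarrow> real \<Rightarrow> (complex \<Rightarrow> complex) set"
  where "Bergman \<omega> p = Lp \<omega> p \<inter> {f. f holomorphic_on disc}"

definition Dirichlet :: "(real \<Rightarrow> real) \<Rightarrow> real \<Rightarrow> nat \<Rightarrow> (complex \<Rightarrow> complex) set"
  where "Dirichlet \<omega> p k = {f. f holomorphic_on disc \<and>
    (deriv ^^ k) f \<in> Bergman (shifted_weight \<omega> (real k * p)) p}"

definition Dirichlet_norm :: "(real \<Rightarrow> real) \<Rightarrow> real \<Rightarrow> nat \<Rightarrow> (complex \<Rightarrow> complex) \<Rightarrow> real"
  where "Dirichlet_norm \<omega> p k f =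
    Lp_norm (shifted_weight \<omega> (real k * p)) p ((deriv ^^ k) f) +
    (\<Sum>j=0..k. norm ((deriv ^^ j) f 0))"

definition same_space_equivalent_norms ::
  "(complex \<Rightarrow> complex) set \<Rightarrow> ((complex \<Rightarrow> complex) \<Rightarrow> real) \<Rightarrow>
   (complex \<Rightarrow> complex) set \<Rightarrow> ((complex \<Rightarrow> complex) \<Rightarrow> real) \<Rightarrow> bool"
  where "same_space_equivalent_norms X NX Y NY \<longleftrightarrow>
    X = Y \<and> (\<exists>c>0. \<exists>C>0. \<forall>f\<in>X. c * NY f \<le> NX f \<and> NX f \<le> C * NY f)"

definition kernel :: "(real \<Rightarrow> real) \<Rightarrow> complex \<Rightarrow> complex \<Rightarrow> complex"
  where "kernel \<omega> z \<zeta> =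
    (\<Sum>n. (cnj z * \<zeta>) ^ n / complex_of_real (2 * moment \<omega> (2 * real n + 1)))"

definition projection :: "(real \<Rightarrow> real) \<Rightarrow> (complex \<Rightarrow> complex) \<Rightarrow> complex \<Rightarrow> complex"
  where "projection \<omega> f z =
    (LINT \<zeta>|dA. f \<zeta> * cnj (kernel \<omega> z \<zeta>) * complex_of_real (\<omega> (norm \<zeta>)))"

definition bounded_operator ::
  "((complex \<Rightarrow> complex) \<Rightarrow> (complex \<Rightarrow> complex)) \<Rightarrow>
   (complex \<Rightarrow> complex) set \<Rightarrow> ((complex \<Rightarrow> complex) \<Rightarrow> real) \<Rightarrow>
   (complex \<Rightarrow> complex) set \<Rightarrow> ((complex \<Rightarrow> complex) \<Rightarrow> real) \<Rightarrow> bool"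
  where "bounded_operator T X NX Y NY \<longleftrightarrow>
    (\<forall>f\<in>X. T f \<in> Y) \<and> (\<exists>C. \<forall>f\<in>X. NY (T f) \<le> C * NX f)"

definition onto_operator ::
  "((complex \<Rightarrow> complex) \<Rightarrow> (complex \<Rightarrow> complex)) \<Rightarrow>
   (complex \<Rightarrow> complex) set \<Rightarrow> (complex \<Rightarrow> complex) set \<Rightarrow> bool"
  where "onto_operator T X Y \<longleftrightarrow> (\<forall>g\<in>Y. \<exists>f\<in>X. \<forall>z\<in>disc. T f z = g z)"

definition dilated_integrand ::
  "(real \<Rightarrow> real) \<Rightarrow> (complex \<Rightarrow> complex) \<Rightarrow> (complex \<Rightarrow> complex) \<Rightarrow> real \<Rightarrow> complex \<Rightarrow> complex"
  where "dilated_integrand \<omega> f g r z =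
    f (complex_of_real r * z) * cnj (g z) * complex_of_real (\<omega> (norm z))"

definition pairing ::
  "(real \<Rightarrow> real) \<Rightarrow> (complex \<Rightarrow> complex) \<Rightarrow> (complex \<Rightarrow> complex) \<Rightarrow> complex"
  where "pairing \<omega> f g = Lim (at_left 1) (\<lambda>r. LINT z|dA. dilated_integrand \<omega> f g r z)"

text \<open>
  For a general weight, neither the integrals nor the limit in the pairing need exist, so their
  existence has to be demanded wherever the pairing is said to induce a functional.
\<close>

definition pairing_defined ::
  "(real \<Rightarrow> real) \<Rightarrow> (complex \<Rightarrow> complex) \<Rightarrow> (complex \<Rightarrow> complex) \<Rightarrow> bool"
  where "pairing_defined \<omega> f g \<longleftrightarrow>
    (\<forall>r\<in>{0<..<1}. integrable dA (dilated_integrand \<omega> f g r)) \<and>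
    (\<exists>l. ((\<lambda>r. LINT z|dA. dilated_integrand \<omega> f g r z) \<longlongrightarrow> l) (at_left 1))"

text \<open>
  A functional bounded in this sense takes equal values on functions in the space that agree on
  the disc, since their difference has norm zero.
\<close>

definition dual_space ::
  "(complex \<Rightarrow> complex) set \<Rightarrow> ((complex \<Rightarrow> complex) \<Rightarrow> real) \<Rightarrow>
   ((complex \<Rightarrow> complex) \<Rightarrow> complex) set"
  where "dual_space X NX = {\<Lambda>.
    (\<forall>f\<in>X. \<forall>h\<in>X. \<Lambda> (\<lambda>z. f z + h z) = \<Lambda> f + \<Lambda> h) \<and>
    (\<forall>c. \<forall>f\<in>X. \<Lambda> (\<lambda>z. c * f z) = c * \<Lambda> f) \<and>
    (\<exists>C. \<forall>f\<in>X. norm (\<Lambda> f) \<le> C * NX f)}"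

definition dual_norm ::
  "(complex \<Rightarrow> complex) set \<Rightarrow> ((complex \<Rightarrow> complex) \<Rightarrow> real) \<Rightarrow>
   ((complex \<Rightarrow> complex) \<Rightarrow> complex) \<Rightarrow> real"
  where "dual_norm X NX \<Lambda> = (SUP f\<in>{f\<in>X. NX f \<le> 1}. norm (\<Lambda> f))"

definition dual_via_pairing ::
  "(real \<Rightarrow> real) \<Rightarrow>
   (complex \<Rightarrow> complex) set \<Rightarrow> ((complex \<Rightarrow> complex) \<Rightarrow> real) \<Rightarrow>
   (complex \<Rightarrow> complex) set \<Rightarrow> ((complex \<Rightarrow> complex) \<Rightarrow> real) \<Rightarrow> bool"
  where "dual_via_pairing \<omega> X NX Y NY \<longleftrightarrow>
    (\<forall>g\<in>Y. (\<forall>f\<in>X. pairing_defined \<omega> f g) \<and> (\<lambda>f. pairing \<omega> f g) \<in> dual_space X NX) \<and>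
    (\<forall>\<Lambda>\<in>dual_space X NX. \<exists>g\<in>Y. (\<forall>f\<in>X. \<Lambda> f = pairing \<omega> f g) \<and>
      (\<forall>h\<in>Y. (\<forall>f\<in>X. \<Lambda> f = pairing \<omega> f h) \<longrightarrow> (\<forall>z\<in>disc. h z = g z))) \<and>
    (\<exists>c>0. \<exists>C>0. \<forall>g\<in>Y.
      c * NY g \<le> dual_norm X NX (\<lambda>f. pairing \<omega> f g) \<and>
      dual_norm X NX (\<lambda>f. pairing \<omega> f g) \<le> C * NY g)"

end

(* Polar coordinates turn all norms into integrals of the circle means M_p(f, r) against the image mu
   of w dA under |z|, and membership of w in D into two conditions on h(x) = mu {r. 1 - r <= x}:
   h(x) <= C h(x / 2) and C h(x / K) <= h(x).

   (iv) => (iii): M_p(f, .) is increasing, and the conditions on h say how the integral of an increasing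
   function changes when 1 - r is scaled. Cauchy's estimate M_p(f', r) <= d^-p M_p(f, r + d) and an
   inequality in the other direction, from duality on the circle, then compare f with f'. The measure
   (1 - r)^p mu inherits both conditions, so the comparison can be iterated k times.

   (iv) => (i): Schur's test with a power of h(1 - |z|), applied to the derivative of the kernel, whose
   mean over a circle is at most C / ((1 - s) h(1 - s)) by Cauchy-Schwarz and Parseval; then (iii) with
   k = 1. Surjectivity holds because P reproduces holomorphic functions.

   (iv) => (ii): a functional L on A^q is represented by the series g with coefficients
   cnj (L z^n) / (2 w_(2n+1)). Testing L on the dilated projection of g_r |g_r|^(p-2) and using the
   boundedness of P on L^q shows that g is in A^p.

   Necessity: each of (i), (ii), (iii) gives, for monomials, |z^n|_D <= C |z^n|_(A^p) and
   w_(2n+1) <= C |z^n|_D |z^n|_(A^p'). The first forces h(x) <= C h(x / 2) by Chebyshev's inequality,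
   and both together force the second condition. For (i) the second inequality comes from a gliding
   hump, which takes the place of the open mapping theorem. *)

theory Submission
  imports Defs "HOL-Probability.Probability" "HOL-Real_Asymp.Real_Asymp"
begin

subsection \<open>Measures attached to a radial weight\<close>

text \<open>The estimates of circle means share one device. A function f is paired on the circle
  with the fixed dual factor of its own boundary values; the pairing is a holomorphic function of
  one variable, to which the maximum principle, Cauchy's inequality or the mean value inequality
  applies. Young's inequality with a free parameter replaces Hoelder's, so that a fraction of the
  quantity being estimated reappears on the right and is absorbed. After integration in r,
  absorption needs finiteness; hence dilates come first and Fatou's lemma follows.

  The projection is treated through its derivative because the mean bound for the derivative of the
  kernel uses only h(x) <= C h(x / 2); in that argument the second condition enters only when a
  function is recovered from its derivative. Powers of h fit every measure: the law of h(1 - r)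
  under mu is dominated by Lebesgue measure, so the Schur integrals behave like integrals of powers
  of one variable.

  The weight is merely Lebesgue measurable, whereas polar coordinates are proved for Borel
  functions; \<open>profile\<close> bridges the gap.\<close>

definition disc_measure :: "(real \<Rightarrow> real) \<Rightarrow> complex measure"
  where "disc_measure \<omega> = density dA (\<lambda>z. ennreal (\<omega> (norm z)))"

definition radial_measure :: "(real \<Rightarrow> real) \<Rightarrow> real measure"
  where "radial_measure \<omega> = distr (disc_measure \<omega>) (restrict_space borel {0..<1}) norm"

text \<open>Normalized arc length, taken as the law of z / |z| under \<open>dA\<close>, so that
  rotation invariance is inherited from planar Lebesgue measure without any parametrization by an
  angle. The value 1 at the origin concerns a null set and keeps the map inside the unit
  circle.\<close>

definition circle :: "complex measure"
  where "circle = distr dA (restrict_space borel (sphere 0 1)) (\<lambda>z. if z = 0 then 1 else sgn z)"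

lemma disc_borel [measurable]: "disc \<in> sets borel"
  by simp

lemma space_dA [simp]: "space dA = disc"
  by (simp add: dA_def)

lemma sets_dA [simp]: "sets dA = sets (lebesgue_on disc)"
  by (simp add: dA_def)

lemma nn_integral_dA:
  assumes [measurable]: "F \<in> borel_measurable borel"
  shows "(\<integral>\<^sup>+z. F z \<partial>dA) = (\<integral>\<^sup>+z. F z * indicator disc z * ennreal (1 / pi) \<partial>lborel)"
proof -
  have F: "F \<in> borel_measurable (lebesgue_on disc)"
    by (intro measurable_restrict_space1 measurable_completion) simp
  have "(\<integral>\<^sup>+z. F z \<partial>dA) = (\<integral>\<^sup>+z. ennreal (1 / pi) * F z \<partial>lebesgue_on disc)"
    unfolding dA_def by (rule nn_integral_density) (use F in auto)
  also have "\<dots> = (\<integral>\<^sup>+z. (ennreal (1 / pi) * F z) * indicator disc z \<partial>lebesgue)"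
    by (rule nn_integral_restrict_space) simp
  also have "\<dots> = (\<integral>\<^sup>+z. (ennreal (1 / pi) * F z) * indicator disc z \<partial>lborel)"
    by (simp add: nn_integral_completion)
  finally show ?thesis
    by (simp add: mult_ac)
qed

lemma id_measurable_dA: "(\<lambda>z. z) \<in> dA \<rightarrow>\<^sub>M borel"
proof -
  have "(\<lambda>z. z) \<in> lebesgue_on disc \<rightarrow>\<^sub>M borel"
    by (intro measurable_restrict_space1 measurable_completion) simp
  then show ?thesis
    by (simp cong: measurable_cong_sets)
qed

lemma borel_measurable_dA: "F \<in> borel \<rightarrow>\<^sub>M M \<Longrightarrow> F \<in> dA \<rightarrow>\<^sub>M M"
  by (rule measurable_compose[OF id_measurable_dA])

text \<open>Two shears compose to a rotation. In the double integral of 1_A(u x) 1_B(y) with B the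
  unit ball, the translations y -> y - u x and x -> x + cnj u * y turn the integrand into 1_A(y + u
  x) 1_B(-u x), and B is invariant under multiplication by -u. Thus both measures of A agree after
  multiplication by the area of B, which is positive and finite.\<close>

lemma distr_lborel_rotate:
  assumes u: "norm u = 1"
  shows "distr lborel borel ((*) u) = (lborel :: complex measure)"
proof (rule measure_eqI)
  fix A :: "complex set" assume "A \<in> sets (distr lborel borel ((*) u))"
  then have A[measurable]: "A \<in> sets borel"
    by simp
  let ?N = "distr lborel borel ((*) u) :: complex measure"
  let ?B = "ball 0 1 :: complex set"
  have cu: "u * cnj u = 1"
    using u by (simp add: complex_norm_square[symmetric])
  have shift: "(\<integral>\<^sup>+x. f (x + a) \<partial>lborel) = (\<integral>\<^sup>+x. f x \<partial>lborel)"
    if [measurable]: "f \<in> borel_measurable borel" for f :: "complex \<Rightarrow> ennreal" and a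
  proof -
    have "(\<integral>\<^sup>+x. f x \<partial>lborel) = (\<integral>\<^sup>+x. f x \<partial>distr lborel borel ((+) a))"
      by (simp add: lborel_distr_plus)
    also have "\<dots> = (\<integral>\<^sup>+x. f (x + a) \<partial>lborel)"
      by (subst nn_integral_distr) (simp_all add: add.commute)
    finally show ?thesis ..
  qed
  have fub: "(\<integral>\<^sup>+x. \<integral>\<^sup>+y. f x y \<partial>lborel \<partial>lborel) = (\<integral>\<^sup>+y. \<integral>\<^sup>+x. f x y \<partial>lborel \<partial>lborel)"
    if [measurable]: "case_prod f \<in> borel_measurable (borel \<Otimes>\<^sub>M borel)" for f :: "complex \<Rightarrow> complex \<Rightarrow> ennreal"
  proof -
    have "case_prod f \<in> borel_measurable (lborel \<Otimes>\<^sub>M lborel)"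
      using that by (simp cong: measurable_cong_sets sets_pair_measure_cong)
    from lborel_pair.Fubini'[OF this] show ?thesis
      by simp
  qed
  have [measurable]: "?B \<in> sets borel"
    by simp
  have "emeasure ?N A * emeasure lborel ?B =
      (\<integral>\<^sup>+x. \<integral>\<^sup>+y. indicator A (u * x) * indicator ?B y \<partial>lborel \<partial>lborel)"
  proof -
    have "emeasure ?N A = (\<integral>\<^sup>+x. indicator A x \<partial>?N)"
      by simp
    also have "\<dots> = (\<integral>\<^sup>+x. indicator A (u * x) \<partial>lborel)"
      by (subst nn_integral_distr) simp_all
    moreover have "(\<integral>\<^sup>+y. indicator A (u * x) * indicator ?B y \<partial>lborel) = indicator A (u * x) * emeasure lborel ?B" for x
      by (subst nn_integral_cmult) simp_all
    ultimately show ?thesis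
      by (simp add: nn_integral_multc)
  qed
  also have "\<dots> = (\<integral>\<^sup>+x. \<integral>\<^sup>+y. indicator A (u * x) * indicator ?B (y + - (u * x)) \<partial>lborel \<partial>lborel)"
  proof (rule nn_integral_cong)
    fix x
    have "(\<integral>\<^sup>+y. indicator A (u * x) * indicator ?B (y + - (u * x)) \<partial>lborel) =
        indicator A (u * x) * (\<integral>\<^sup>+y. indicator ?B (y + - (u * x)) \<partial>lborel)"
      by (rule nn_integral_cmult) measurable
    also have "\<dots> = indicator A (u * x) * (\<integral>\<^sup>+y. indicator ?B y \<partial>lborel)"
      by (subst shift) simp_all
    also have "\<dots> = (\<integral>\<^sup>+y. indicator A (u * x) * indicator ?B y \<partial>lborel)"
      by (rule nn_integral_cmult[symmetric]) measurable
    finally show "(\<integral>\<^sup>+y. indicator A (u * x) * indicator ?B y \<partial>lborel) =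
        (\<integral>\<^sup>+y. indicator A (u * x) * indicator ?B (y + - (u * x)) \<partial>lborel)" ..
  qed
  also have "\<dots> = (\<integral>\<^sup>+y. \<integral>\<^sup>+x. indicator A (u * x) * indicator ?B (y + - (u * x)) \<partial>lborel \<partial>lborel)"
    by (rule fub) measurable
  also have "\<dots> = (\<integral>\<^sup>+y. \<integral>\<^sup>+x. indicator A (u * (x + cnj u * y)) * indicator ?B (y + - (u * (x + cnj u * y))) \<partial>lborel \<partial>lborel)"
    by (intro nn_integral_cong shift[symmetric]) measurable
  also have "\<dots> = (\<integral>\<^sup>+y. \<integral>\<^sup>+x. indicator A (y + u * x) * indicator ?B x \<partial>lborel \<partial>lborel)"
  proof (intro nn_integral_cong)
    fix x y
    have "u * (x + cnj u * y) = u * x + (u * cnj u) * y"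
      by (simp only: mult.assoc distrib_left)
    then have "u * (x + cnj u * y) = y + u * x"
      by (simp only: cu) simp
    then show "indicator A (u * (x + cnj u * y)) * indicator ?B (y + - (u * (x + cnj u * y))) =
        (indicator A (y + u * x) * indicator ?B x :: ennreal)"
      using u by (auto simp: indicator_def norm_mult)
  qed
  also have "\<dots> = (\<integral>\<^sup>+x. \<integral>\<^sup>+y. indicator A (y + u * x) * indicator ?B x \<partial>lborel \<partial>lborel)"
    by (rule fub) measurable
  also have "\<dots> = (\<integral>\<^sup>+x. emeasure lborel A * indicator ?B x \<partial>lborel)"
    by (intro nn_integral_cong) (simp add: nn_integral_multc shift[of "indicator A"])
  also have "\<dots> = emeasure lborel A * emeasure lborel ?B"
    by (simp add: nn_integral_cmult)
  finally have "emeasure ?N A * emeasure lborel ?B = emeasure lborel A * emeasure lborel ?B" .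
  moreover have "emeasure lborel ?B = ennreal pi"
    by (simp add: emeasure_ball unit_ball_vol_2)
  ultimately show "emeasure ?N A = emeasure lborel A"
    by (simp add: mult.commute[of _ "ennreal pi"] ennreal_mult_cancel_left)
qed simp

lemma nn_integral_lborel_rotate:
  assumes "norm u = 1" and [measurable]: "F \<in> borel_measurable borel"
  shows "(\<integral>\<^sup>+z. F (u * z) \<partial>lborel) = (\<integral>\<^sup>+z. F (z::complex) \<partial>lborel)"
proof -
  have "(\<integral>\<^sup>+z. F z \<partial>lborel) = (\<integral>\<^sup>+z. F z \<partial>distr lborel borel ((*) u))"
    using distr_lborel_rotate[OF assms(1)] by simp
  also have "\<dots> = (\<integral>\<^sup>+z. F (u * z) \<partial>lborel)"
    by (rule nn_integral_distr) simp_all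
  finally show ?thesis ..
qed

lemma distr_norm_disc:
  "distr (density lborel (indicator disc)) borel norm =
    density lborel (\<lambda>r. ennreal (2 * pi * r) * indicator {0..<1} r)"
proof (rule measure_eqI_lessThan)
  fix x :: real
  have E: "emeasure (distr (density lborel (indicator disc)) borel norm) {x<..} =
      emeasure lborel (disc - cball 0 x)"
  proof -
    have "emeasure (distr (density lborel (indicator disc)) borel norm) {x<..} =
        emeasure (density lborel (indicator disc)) (norm -` {x<..} :: complex set)"
      by (subst emeasure_distr) auto
    also have "\<dots> = (\<integral>\<^sup>+z. indicator disc z * indicator (norm -` {x<..}) z \<partial>lborel)"
    proof (rule emeasure_density)
      have "{z::complex. x < norm z} \<in> sets borel"
        by measurable
      then show "norm -` {x<..} \<in> sets (lborel :: complex measure)"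
        by (simp add: vimage_def)
    qed auto
    also have "\<dots> = (\<integral>\<^sup>+z. indicator (disc - cball 0 x) z \<partial>lborel)"
      by (intro nn_integral_cong) (auto simp: indicator_def)
    finally show ?thesis
      by simp
  qed
  have "emeasure lborel (disc - cball 0 x) \<le> emeasure lborel disc"
    by (intro emeasure_mono) auto
  also have "\<dots> < \<infinity>"
    by (simp add: emeasure_ball)
  finally show "emeasure (distr (density lborel (indicator disc)) borel norm) {x<..} < \<infinity>"
    unfolding E .
  \<comment> \<open>Clamping x to [0,1] lets the single value pi - pi y^2 describe the tail for
    negative x, for x in [0,1] and for x beyond 1.\<close>
  define y where "y = max 0 (min x 1)"
  have y: "0 \<le> y" "y \<le> 1"
    by (auto simp: y_def)
  have "emeasure lborel (disc - cball 0 x) = ennreal (pi - pi * y\<^sup>2)"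
  proof -
    consider "x < 0" | "0 \<le> x" "x < 1" | "1 \<le> x"
      by linarith
    then show ?thesis
    proof cases
      case 1
      then show ?thesis
        by (simp add: y_def emeasure_ball unit_ball_vol_2)
    next
      case 2
      have "emeasure lborel (disc - cball 0 x) = emeasure lborel disc - emeasure lborel (cball 0 x :: complex set)"
        by (rule emeasure_Diff) (use 2 in \<open>auto simp: emeasure_cball\<close>)
      also have "\<dots> = ennreal (pi - pi * x\<^sup>2)"
        using 2 by (simp add: emeasure_ball emeasure_cball unit_ball_vol_2 ennreal_minus[symmetric])
      finally show ?thesis
        using 2 by (simp add: y_def)
    next
      case 3
      then have *: "disc - cball 0 x = {}"
        by auto
      show ?thesis
        unfolding * using 3 by (simp add: y_def)
    qed
  qed
  moreover have "emeasure (density lborel (\<lambda>r. ennreal (2 * pi * r) * indicator {0..<1} r)) {x<..} =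
      ennreal (pi - pi * y\<^sup>2)"
  proof -
    have "emeasure (density lborel (\<lambda>r. ennreal (2 * pi * r) * indicator {0..<1} r)) {x<..} =
        (\<integral>\<^sup>+r. ennreal (2 * pi * r) * indicator {0..<1} r * indicator {x<..} r \<partial>lborel)"
      by (rule emeasure_density) auto
    also have "\<dots> = (\<integral>\<^sup>+r. ennreal (2 * pi * r) * indicator {y..1} r \<partial>lborel)"
    proof (rule nn_integral_cong_AE)
      have "AE r in lborel. r \<noteq> y \<and> r \<noteq> 1"
        by (intro AE_conjI AE_lborel_singleton)
      then show "AE r in lborel. ennreal (2 * pi * r) * indicator {0..<1} r * indicator {x<..} r =
          ennreal (2 * pi * r) * indicator {y..1} r"
        by eventually_elim (auto simp: indicator_def y_def)
    qed
    also have "\<dots> = ennreal (pi * 1\<^sup>2 - pi * y\<^sup>2)"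
      by (rule nn_integral_FTC_Icc) (use y in \<open>auto intro!: derivative_eq_intros\<close>)
    finally show ?thesis
      by simp
  qed
  ultimately show "emeasure (distr (density lborel (indicator disc)) borel norm) {x<..} =
      emeasure (density lborel (\<lambda>r. ennreal (2 * pi * r) * indicator {0..<1} r)) {x<..}"
    using E by simp
qed simp_all

lemma nn_integral_norm_disc:
  assumes [measurable]: "g \<in> borel_measurable borel"
  shows "(\<integral>\<^sup>+z. g (norm z) * indicator disc z \<partial>lborel) =
    (\<integral>\<^sup>+r. g r * (ennreal (2 * pi * r) * indicator {0..<1} r) \<partial>lborel)"
proof -
  have "(\<integral>\<^sup>+z. g (norm z) * indicator disc z \<partial>lborel) =
      (\<integral>\<^sup>+z. g (norm z) \<partial>density lborel (indicator disc))"
    by (subst nn_integral_density) (auto simp: mult.commute)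
  also have "\<dots> = (\<integral>\<^sup>+r. g r \<partial>distr (density lborel (indicator disc)) borel norm)"
    by (rule nn_integral_distr[symmetric]) auto
  also have "\<dots> = (\<integral>\<^sup>+r. (ennreal (2 * pi * r) * indicator {0..<1} r) * g r \<partial>lborel)"
    unfolding distr_norm_disc by (rule nn_integral_density) auto
  finally show ?thesis
    by (simp add: mult.commute)
qed

lemma prob_space_dA: "prob_space dA"
proof
  have "emeasure dA (space dA) = (\<integral>\<^sup>+z. 1 \<partial>dA)"
    by simp
  also have "\<dots> = ennreal (1 / pi) * emeasure lborel disc"
    by (subst nn_integral_dA) (simp_all add: nn_integral_cmult mult.commute)
  also have "\<dots> = 1"
    by (simp add: emeasure_ball unit_ball_vol_2 ennreal_mult[symmetric] flip: ennreal_1)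
  finally show "emeasure dA (space dA) = 1" .
qed

section \<open>Rotation invariance and orthogonality on the unit circle\<close>

lemma space_circle [simp]: "space circle = sphere 0 1"
  by (simp add: circle_def space_restrict_space)

lemma sets_circle [simp]: "sets circle = sets (restrict_space borel (sphere 0 1))"
  by (simp add: circle_def)

lemma sgn_measurable_dA:
  "(\<lambda>z. if z = 0 then 1 else sgn z) \<in> dA \<rightarrow>\<^sub>M restrict_space borel (sphere 0 1)"
proof (rule measurable_restrict_space2)
  show "(\<lambda>z::complex. if z = 0 then 1 else sgn z) \<in> borel_measurable dA"
    unfolding sgn_div_norm by (rule borel_measurable_dA) measurable
qed (auto simp: norm_sgn)

lemma prob_space_circle: "prob_space circle"
  unfolding circle_def by (rule prob_space.prob_space_distr[OF prob_space_dA sgn_measurable_dA])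

lemma circle_measurableI:
  "continuous_on (sphere 0 1) f \<Longrightarrow> f \<in> borel_measurable circle"
  for f :: "complex \<Rightarrow> 'a :: topological_space"
  using borel_measurable_continuous_on_restrict[of "sphere 0 1" f] by (simp cong: measurable_cong_sets)

lemma borel_measurable_circle:
  assumes "F \<in> borel_measurable borel" shows "F \<in> borel_measurable circle"
proof -
  have "F \<in> borel_measurable (restrict_space borel (sphere 0 1))"
    using assms by (rule measurable_restrict_space1)
  then show ?thesis
    by (simp cong: measurable_cong_sets)
qed

lemma nn_integral_circle_rotate:
  assumes u: "norm u = 1" and [measurable]: "F \<in> borel_measurable borel"
  shows "(\<integral>\<^sup>+\<xi>. F (u * \<xi>) \<partial>circle) = (\<integral>\<^sup>+\<xi>. F \<xi> \<partial>circle)"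
proof -
  let ?s = "\<lambda>z::complex. if z = 0 then 1 else sgn z"
  have s[measurable]: "?s \<in> borel_measurable borel"
    unfolding sgn_div_norm by measurable
  have eq: "(\<integral>\<^sup>+\<xi>. G \<xi> \<partial>circle) = (\<integral>\<^sup>+z. G (?s z) * indicator disc z * ennreal (1 / pi) \<partial>lborel)"
    if [measurable]: "G \<in> borel_measurable borel" for G
  proof -
    have "(\<integral>\<^sup>+\<xi>. G \<xi> \<partial>circle) = (\<integral>\<^sup>+z. G (?s z) \<partial>dA)"
      unfolding circle_def
      by (rule nn_integral_distr[OF sgn_measurable_dA]) (auto intro: measurable_restrict_space1)
    then show ?thesis
      by (simp add: nn_integral_dA)
  qed
  have "(\<integral>\<^sup>+\<xi>. F (u * \<xi>) \<partial>circle) = (\<integral>\<^sup>+z. F (u * ?s z) * indicator disc z * ennreal (1 / pi) \<partial>lborel)"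
    by (rule eq) measurable
  also have "\<dots> = (\<integral>\<^sup>+z. F (?s (u * z)) * indicator disc (u * z) * ennreal (1 / pi) \<partial>lborel)"
  proof (rule nn_integral_cong_AE)
    have "u \<noteq> 0"
      using u by auto
    moreover have "sgn u = u"
      using u by (simp add: sgn_div_norm)
    ultimately have "F (u * ?s z) * indicator disc z * ennreal (1 / pi) =
        F (?s (u * z)) * indicator disc (u * z) * ennreal (1 / pi)" if "z \<noteq> 0" for z
      using that u by (simp add: indicator_def norm_mult sgn_mult)
    with AE_lborel_singleton[of "0::complex"]
    show "AE z in lborel. F (u * ?s z) * indicator disc z * ennreal (1 / pi) =
        F (?s (u * z)) * indicator disc (u * z) * ennreal (1 / pi)"
      by (rule eventually_mono)
  qed
  also have "\<dots> = (\<integral>\<^sup>+z. F (?s z) * indicator disc z * ennreal (1 / pi) \<partial>lborel)"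
    by (rule nn_integral_lborel_rotate[OF u]) measurable
  also have "\<dots> = (\<integral>\<^sup>+\<xi>. F \<xi> \<partial>circle)"
    by (rule eq[symmetric]) measurable
  finally show ?thesis .
qed

lemma distr_circle_rotate:
  assumes u: "norm u = 1"
  shows "distr circle circle ((*) u) = circle"
proof (rule measure_eqI)
  have m: "(*) u \<in> circle \<rightarrow>\<^sub>M circle"
  proof -
    have "(*) u \<in> restrict_space borel (sphere 0 1) \<rightarrow>\<^sub>M restrict_space borel (sphere 0 1)"
      by (intro measurable_restrict_space3) (use u in \<open>auto simp: norm_mult\<close>)
    then show ?thesis
      by (simp cong: measurable_cong_sets)
  qed
  fix A assume "A \<in> sets (distr circle circle ((*) u))"
  then have A: "A \<in> sets circle" "A \<in> sets borel"
    by (auto simp: sets_restrict_space_iff)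
  note A(2)[measurable]
  have "emeasure (distr circle circle ((*) u)) A = (\<integral>\<^sup>+\<xi>. indicator A \<xi> \<partial>distr circle circle ((*) u))"
    using A by simp
  also have "\<dots> = (\<integral>\<^sup>+\<xi>. indicator A (u * \<xi>) \<partial>circle)"
    by (rule nn_integral_distr[OF m]) (use A in \<open>auto intro!: borel_measurable_indicator\<close>)
  also have "\<dots> = (\<integral>\<^sup>+\<xi>. indicator A \<xi> \<partial>circle)"
    by (rule nn_integral_circle_rotate[OF u]) measurable
  also have "\<dots> = emeasure circle A"
    using A by simp
  finally show "emeasure (distr circle circle ((*) u)) A = emeasure circle A" .
qed simp

lemma integral_circle_rotate:
  fixes f :: "complex \<Rightarrow> 'a :: {banach, second_countable_topology}"
  assumes u: "norm u = 1" and f: "f \<in> borel_measurable circle"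
  shows "(LINT \<xi>|circle. f (u * \<xi>)) = (LINT \<xi>|circle. f \<xi>)"
proof -
  have m: "(*) u \<in> circle \<rightarrow>\<^sub>M circle"
  proof -
    have "(*) u \<in> restrict_space borel (sphere 0 1) \<rightarrow>\<^sub>M restrict_space borel (sphere 0 1)"
      by (intro measurable_restrict_space3) (use u in \<open>auto simp: norm_mult\<close>)
    then show ?thesis
      by (simp cong: measurable_cong_sets)
  qed
  have "(LINT \<xi>|circle. f \<xi>) = (LINT \<xi>|distr circle circle ((*) u). f \<xi>)"
    by (simp add: distr_circle_rotate[OF u])
  also have "\<dots> = (LINT \<xi>|circle. f (u * \<xi>))"
    by (rule integral_distr[OF m f])
  finally show ?thesis ..
qed

lemma circle_integrable_bounded:
  fixes f :: "complex \<Rightarrow> 'a :: {banach, second_countable_topology}"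
  assumes "f \<in> borel_measurable circle" and "\<And>\<xi>. norm \<xi> = 1 \<Longrightarrow> norm (f \<xi>) \<le> B"
  shows "integrable circle f"
proof -
  interpret prob_space circle
    by (rule prob_space_circle)
  show ?thesis
    by (rule integrable_const_bound[of _ B]) (use assms in \<open>auto intro!: AE_I2\<close>)
qed

lemma circle_integrable_continuous:
  fixes f :: "complex \<Rightarrow> 'a :: {banach, second_countable_topology}"
  assumes "continuous_on (sphere 0 1) f"
  shows "integrable circle f"
proof -
  have "compact (f ` sphere 0 1)"
    by (rule compact_continuous_image[OF assms]) simp
  then obtain B where "\<forall>y\<in>f ` sphere 0 1. norm y \<le> B"
    by (meson bounded_iff compact_imp_bounded)
  then show ?thesis
    by (intro circle_integrable_bounded[of _ B] circle_measurableI assms) auto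
qed

lemma circle_integral_monomial:
  "(LINT \<xi>|circle. \<xi> ^ n * cnj \<xi> ^ m) = (if n = m then 1 else 0)"
proof (cases "n = m")
  case True
  interpret prob_space circle
    by (rule prob_space_circle)
  have "(LINT \<xi>|circle. \<xi> ^ n * cnj \<xi> ^ m) = (LINT \<xi>|circle. 1)"
    by (rule Bochner_Integration.integral_cong)
      (auto simp: True power_mult_distrib[symmetric] complex_norm_square[symmetric])
  then show ?thesis
    using True prob_space by simp
next
  case False
  \<comment> \<open>The angle is chosen so that the monomial picks up the factor -1 under rotation;
    invariance then makes the integral equal to its own negative.\<close>
  define u where "u = cis (pi / (real n - real m))"
  have u: "norm u = 1" "u ^ n * cnj u ^ m = -1"
  proof -
    have "u ^ n * cnj u ^ m = cis (real n * (pi / (real n - real m))) * cis (real m * - (pi / (real n - real m)))"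
      unfolding u_def cis_cnj Complex.DeMoivre ..
    also have "\<dots> = cis ((real n - real m) * (pi / (real n - real m)))"
      by (simp only: cis_mult left_diff_distrib) simp
    also have "\<dots> = -1"
      using False by simp
    finally show "u ^ n * cnj u ^ m = -1" .
  qed (simp add: u_def)
  have "(LINT \<xi>|circle. \<xi> ^ n * cnj \<xi> ^ m) = (LINT \<xi>|circle. (u * \<xi>) ^ n * cnj (u * \<xi>) ^ m)"
    by (rule integral_circle_rotate[OF u(1), symmetric]) (intro circle_measurableI continuous_intros)
  also have "\<dots> = (LINT \<xi>|circle. (u ^ n * cnj u ^ m) * (\<xi> ^ n * cnj \<xi> ^ m))"
    by (simp add: power_mult_distrib mult_ac)
  also have "\<dots> = - (LINT \<xi>|circle. \<xi> ^ n * cnj \<xi> ^ m)"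
    by (simp add: u)
  finally show ?thesis
    using False by (simp add: equation_minus_iff)
qed

section \<open>Radial weights, their image measures and polar coordinates\<close>

locale weight =
  fixes \<omega> :: "real \<Rightarrow> real"
  assumes radial_weight: "radial_weight \<omega>"
begin

lemma nonneg: "0 \<le> r \<Longrightarrow> r < 1 \<Longrightarrow> 0 \<le> \<omega> r"
  using radial_weight by (simp add: radial_weight_def)

lemma set_integrable: "set_integrable lebesgue {0..<1} \<omega>"
  using radial_weight by (simp add: radial_weight_def)

lemma tail_pos: "0 \<le> r \<Longrightarrow> r < 1 \<Longrightarrow> 0 < tail \<omega> r"
  using radial_weight by (simp add: radial_weight_def)

text \<open>A Borel representative: \<open>\<omega>\<close> is only Lebesgue measurable on [0,1) and
  arbitrary elsewhere, while the Fubini arguments below run over Borel functions on the line.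
  Vanishing off [0,1) removes indicators from later integrands.\<close>

definition profile :: "real \<Rightarrow> real"
  where "profile = (SOME v. v \<in> borel_measurable borel \<and> (\<forall>r. 0 \<le> v r) \<and> (\<forall>r. r \<notin> {0..<1} \<longrightarrow> v r = 0) \<and>
    (AE r in lborel. indicator {0..<1} r * \<omega> r = v r))"

lemma profile:
  shows profile_measurable [measurable]: "profile \<in> borel_measurable borel"
    and profile_nonneg [simp]: "0 \<le> profile r"
    and profile_outside: "r \<notin> {0..<1} \<Longrightarrow> profile r = 0"
    and AE_profile: "AE r in lborel. indicator {0..<1} r * \<omega> r = profile r"
proof -
  have "(\<lambda>r. indicator {0..<1} r * \<omega> r) \<in> borel_measurable lebesgue"
    using set_integrable by (auto simp: set_integrable_def)
  then obtain v where v: "v \<in> borel_measurable lborel" "AE r in lborel. indicator {0..<1} r * \<omega> r = v r"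
    using completion_ex_borel_measurable_real by blast
  have [measurable]: "v \<in> borel_measurable borel"
    using v(1) by simp
  define w where "w r = \<bar>v r\<bar> * indicator {0..<1} r" for r
  have "w \<in> borel_measurable borel"
    unfolding w_def by measurable
  moreover have "AE r in lborel. indicator {0..<1} r * \<omega> r = w r"
    using v(2)
  proof eventually_elim
    case (elim r)
    then show ?case
      using nonneg[of r] by (cases "r \<in> {0..<1}") (auto simp: w_def)
  qed
  ultimately have "\<exists>v. v \<in> borel_measurable borel \<and> (\<forall>r. 0 \<le> v r) \<and> (\<forall>r. r \<notin> {0..<1} \<longrightarrow> v r = 0) \<and>
    (AE r in lborel. indicator {0..<1} r * \<omega> r = v r)"
    by (intro exI[of _ w]) (auto simp: w_def)
  from someI_ex[OF this, folded profile_def]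
  show "profile \<in> borel_measurable borel" "0 \<le> profile r" "r \<notin> {0..<1} \<Longrightarrow> profile r = 0"
    "AE r in lborel. indicator {0..<1} r * \<omega> r = profile r"
    by auto
qed

text \<open>A null set of radii lifts to a null set of the disc, because the law of |z| under area
  has the density 2 pi r.\<close>

lemma AE_dA_profile: "AE z in dA. \<omega> (norm z) = profile (norm z)"
proof -
  obtain N where N: "{r \<in> space lborel. \<not> indicator {0..<1} r * \<omega> r = profile r} \<subseteq> N"
      "emeasure lborel N = 0" "N \<in> sets lborel"
    using AE_profile by (rule AE_E)
  have [measurable]: "N \<in> sets borel"
    using N(3) by simp
  have m: "(\<lambda>z::complex. indicator N (norm z) :: ennreal) \<in> borel_measurable borel"
    by measurable
  have "(\<integral>\<^sup>+z. indicator N (norm z) \<partial>dA) =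
      (\<integral>\<^sup>+z. indicator N (norm z) * indicator disc z \<partial>lborel) * ennreal (1 / pi)"
    unfolding nn_integral_dA[OF m] by (rule nn_integral_multc) measurable
  also have "(\<integral>\<^sup>+z. indicator N (norm z) * indicator disc z \<partial>lborel) =
      (\<integral>\<^sup>+r. indicator N r * (ennreal (2 * pi * r) * indicator {0..<1} r) \<partial>lborel)"
    by (rule nn_integral_norm_disc) measurable
  also have "\<dots> = 0"
  proof -
    have "AE r in lborel. r \<notin> N"
      using N by (intro AE_not_in) auto
    then have "AE r in lborel. indicator N r * (ennreal (2 * pi * r) * indicator {0..<1} r) = (0::ennreal)"
      by eventually_elim simp
    then show ?thesis
      by (subst nn_integral_0_iff_AE) auto
  qed
  finally have "AE z in dA. indicator N (norm z) = (0 :: ennreal)"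
    using nn_integral_0_iff_AE[OF borel_measurable_dA[OF m]] by simp
  then show ?thesis
    using AE_space
  proof eventually_elim
    case (elim z)
    then have "norm z \<notin> N" "norm z \<in> {0..<1}"
      by (auto simp: indicator_def split: if_splits)
    then show ?case
      using N(1) by (force simp: indicator_def)
  qed
qed

text \<open>Each preimage differs by a null set from a Borel preimage under \<open>profile\<close>,
  and Lebesgue measure is complete.\<close>

lemma weight_measurable: "(\<lambda>z. \<omega> (norm z)) \<in> borel_measurable dA"
proof (rule measurableI)
  fix B :: "real set" assume B: "B \<in> sets borel"
  let ?S = "{z \<in> disc. profile (norm z) \<in> B}" and ?R = "{z \<in> disc. \<omega> (norm z) \<in> B}"
  have [measurable]: "B \<in> sets borel"
    by fact
  have S: "?S \<in> sets borel"
    by measurable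
  have "AE z in lebesgue_on disc. z \<in> ?S \<longleftrightarrow> z \<in> ?R"
  proof -
    have "AE z in lebesgue_on disc. 0 < ennreal (1 / pi) \<longrightarrow> \<omega> (norm z) = profile (norm z)"
      using AE_dA_profile unfolding dA_def by (subst (asm) AE_density) auto
    then show ?thesis
      using AE_space by eventually_elim auto
  qed
  then have "AE z in lebesgue. z \<in> disc \<longrightarrow> (z \<in> ?S \<longleftrightarrow> z \<in> ?R)"
    by (subst (asm) AE_restrict_space_iff) auto
  then have "AE z in lebesgue. z \<in> ?S \<longleftrightarrow> z \<in> ?R"
    by eventually_elim auto
  then have "?R \<in> sets lebesgue"
    by (rule completion.in_sets_AE) (use S in \<open>auto intro: sets_completionI_sets\<close>)
  then have "?R \<in> sets (lebesgue_on disc)"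
    by (subst sets_restrict_space_iff) auto
  moreover have "(\<lambda>z. \<omega> (norm z)) -` B \<inter> space dA = ?R"
    by auto
  ultimately show "(\<lambda>z. \<omega> (norm z)) -` B \<inter> space dA \<in> sets dA"
    by simp
qed simp

abbreviation "W \<equiv> disc_measure \<omega>"
abbreviation "\<mu> \<equiv> radial_measure \<omega>"

lemma space_W [simp]: "space (disc_measure \<nu>) = disc"
  and sets_W [simp]: "sets (disc_measure \<nu>) = sets (lebesgue_on disc)"
  by (simp_all add: disc_measure_def)

lemma measurable_W: "f \<in> disc_measure \<nu> \<rightarrow>\<^sub>M M \<longleftrightarrow> f \<in> dA \<rightarrow>\<^sub>M M"
  by (simp cong: measurable_cong_sets)

lemma borel_measurable_W: "F \<in> borel \<rightarrow>\<^sub>M M \<Longrightarrow> F \<in> disc_measure \<nu> \<rightarrow>\<^sub>M M"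
  unfolding measurable_W by (rule borel_measurable_dA)

lemma nn_integral_W:
  assumes "F \<in> borel_measurable dA"
  shows "(\<integral>\<^sup>+z. F z \<partial>W) = (\<integral>\<^sup>+z. ennreal (\<omega> (norm z)) * F z \<partial>dA)"
  unfolding disc_measure_def by (rule nn_integral_density) (use assms weight_measurable in auto)

lemma nn_integral_W_borel:
  assumes [measurable]: "F \<in> borel_measurable borel"
  shows "(\<integral>\<^sup>+z. F z \<partial>W) =
    (\<integral>\<^sup>+z. F z * (ennreal (profile (norm z)) * (indicator disc z * ennreal (1 / pi))) \<partial>lborel)"
proof -
  have "(\<integral>\<^sup>+z. F z \<partial>W) = (\<integral>\<^sup>+z. ennreal (\<omega> (norm z)) * F z \<partial>dA)"
    by (intro nn_integral_W borel_measurable_dA) simp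
  also have "\<dots> = (\<integral>\<^sup>+z. ennreal (profile (norm z)) * F z \<partial>dA)"
    using AE_dA_profile by (intro nn_integral_cong_AE) (auto elim: eventually_mono)
  also have "\<dots> = (\<integral>\<^sup>+z. ennreal (profile (norm z)) * F z * indicator disc z * ennreal (1 / pi) \<partial>lborel)"
    by (rule nn_integral_dA) measurable
  finally show ?thesis
    by (simp add: mult_ac)
qed

lemma nn_integral_W_rotate:
  assumes u: "norm u = 1" and [measurable]: "F \<in> borel_measurable borel"
  shows "(\<integral>\<^sup>+z. F (u * z) \<partial>W) = (\<integral>\<^sup>+z. F z \<partial>W)"
proof -
  let ?g = "\<lambda>z. ennreal (profile (norm z)) * (indicator disc z * ennreal (1 / pi))"
  have "(\<integral>\<^sup>+z. F (u * z) \<partial>W) = (\<integral>\<^sup>+z. F (u * z) * ?g z \<partial>lborel)"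
    by (rule nn_integral_W_borel) measurable
  also have "\<dots> = (\<integral>\<^sup>+z. F (u * z) * ?g (u * z) \<partial>lborel)"
    using u by (intro nn_integral_cong) (simp add: norm_mult indicator_def)
  also have "\<dots> = (\<integral>\<^sup>+z. F z * ?g z \<partial>lborel)"
    by (rule nn_integral_lborel_rotate[OF u]) measurable
  also have "\<dots> = (\<integral>\<^sup>+z. F z \<partial>W)"
    by (rule nn_integral_W_borel[symmetric]) measurable
  finally show ?thesis .
qed

lemma space_\<mu> [simp]: "space (radial_measure \<nu>) = {0..<1}"
  and sets_\<mu> [simp]: "sets (radial_measure \<nu>) = sets (restrict_space borel {0..<1})"
  by (simp_all add: radial_measure_def space_restrict_space)

lemma norm_measurable_W: "norm \<in> disc_measure \<nu> \<rightarrow>\<^sub>M restrict_space borel {0..<1}"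
  by (rule measurable_restrict_space2) (auto intro!: borel_measurable_W)

lemma borel_measurable_\<mu>: "F \<in> borel \<rightarrow>\<^sub>M M \<Longrightarrow> F \<in> radial_measure \<nu> \<rightarrow>\<^sub>M M"
proof -
  assume "F \<in> borel \<rightarrow>\<^sub>M M"
  then have "F \<in> restrict_space borel {0..<1} \<rightarrow>\<^sub>M M"
    by (rule measurable_restrict_space1)
  then show ?thesis
    by (simp cong: measurable_cong_sets)
qed

lemma nn_integral_\<mu>:
  assumes "g \<in> borel_measurable \<mu>"
  shows "(\<integral>\<^sup>+r. g r \<partial>\<mu>) = (\<integral>\<^sup>+z. g (norm z) \<partial>W)"
  unfolding radial_measure_def
  by (rule nn_integral_distr[OF norm_measurable_W]) (use assms in \<open>simp cong: measurable_cong_sets\<close>)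

lemma nn_integral_\<mu>_profile:
  assumes [measurable]: "g \<in> borel_measurable borel"
  shows "(\<integral>\<^sup>+r. g r \<partial>\<mu>) = (\<integral>\<^sup>+r. g r * ennreal (2 * r * profile r) \<partial>lborel)"
proof -
  have "(\<integral>\<^sup>+r. g r \<partial>\<mu>) = (\<integral>\<^sup>+z. g (norm z) \<partial>W)"
    by (intro nn_integral_\<mu> borel_measurable_\<mu>) simp
  also have "\<dots> = (\<integral>\<^sup>+z. g (norm z) * (ennreal (profile (norm z)) * (indicator disc z * ennreal (1 / pi))) \<partial>lborel)"
    by (rule nn_integral_W_borel) measurable
  also have "\<dots> = (\<integral>\<^sup>+z. g (norm z) * ennreal (profile (norm z)) * ennreal (1 / pi) * indicator disc z \<partial>lborel)"
    by (simp add: mult_ac)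
  also have "\<dots> = (\<integral>\<^sup>+r. g r * ennreal (profile r) * ennreal (1 / pi) * (ennreal (2 * pi * r) * indicator {0..<1} r) \<partial>lborel)"
    by (rule nn_integral_norm_disc) measurable
  also have "\<dots> = (\<integral>\<^sup>+r. g r * ennreal (2 * r * profile r) \<partial>lborel)"
  proof (rule nn_integral_cong)
    fix r :: real
    show "g r * ennreal (profile r) * ennreal (1 / pi) * (ennreal (2 * pi * r) * indicator {0..<1} r) =
        g r * ennreal (2 * r * profile r)"
    proof (cases "r \<in> {0..<1}")
      case True
      have "ennreal (profile r) * ennreal (1 / pi) * ennreal (2 * pi * r) = ennreal (2 * r * profile r)"
        using True by (simp add: ennreal_mult[symmetric] field_simps)
      then show ?thesis
        using True by (simp add: mult.assoc)
    qed (simp add: profile_outside)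
  qed
  finally show ?thesis .
qed

lemma nn_integral_profile:
  assumes [measurable]: "g \<in> borel_measurable borel" and nn: "\<And>r. 0 \<le> g r" and b: "\<And>r. r \<in> {0..<1} \<Longrightarrow> g r \<le> 1"
  shows "(\<integral>\<^sup>+r. ennreal (g r * profile r) \<partial>lborel) = ennreal (LINT r:{0..<1}|lebesgue. g r * \<omega> r)"
    and "set_integrable lebesgue {0..<1} (\<lambda>r. g r * \<omega> r)"
proof -
  have gl: "g \<in> borel_measurable lebesgue"
    by (rule measurable_completion) simp
  show int: "set_integrable lebesgue {0..<1} (\<lambda>r. g r * \<omega> r)"
    unfolding set_integrable_def
  proof (rule Bochner_Integration.integrable_bound)
    show "integrable lebesgue (\<lambda>r. indicator {0..<1} r *\<^sub>R \<omega> r)"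
      using set_integrable by (simp add: set_integrable_def)
    have "(\<lambda>r. g r * (indicator {0..<1} r *\<^sub>R \<omega> r)) \<in> borel_measurable lebesgue"
      using set_integrable gl by (intro borel_measurable_times) (auto simp: set_integrable_def)
    then show "(\<lambda>r. indicator {0..<1} r *\<^sub>R (g r * \<omega> r)) \<in> borel_measurable lebesgue"
      by (simp add: mult_ac)
    show "AE r in lebesgue. norm (indicator {0..<1} r *\<^sub>R (g r * \<omega> r)) \<le> norm (indicator {0..<1} r *\<^sub>R \<omega> r)"
      using nn b by (intro AE_I2) (auto simp: indicator_def abs_mult intro!: mult_left_le_one_le)
  qed
  have "(\<integral>\<^sup>+r. ennreal (g r * profile r) \<partial>lborel) = (\<integral>\<^sup>+r. ennreal (g r * (indicator {0..<1} r * \<omega> r)) \<partial>lborel)"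
    using AE_profile by (intro nn_integral_cong_AE) (auto elim: eventually_mono)
  also have "\<dots> = (\<integral>\<^sup>+r. ennreal (indicator {0..<1} r *\<^sub>R (g r * \<omega> r)) \<partial>lebesgue)"
    by (simp add: nn_integral_completion mult_ac)
  also have "\<dots> = ennreal (LINT r:{0..<1}|lebesgue. g r * \<omega> r)"
    unfolding set_lebesgue_integral_def
    by (rule nn_integral_eq_integral)
      (use int nonneg nn in \<open>auto simp: set_integrable_def indicator_def\<close>)
  finally show "(\<integral>\<^sup>+r. ennreal (g r * profile r) \<partial>lborel) = ennreal (LINT r:{0..<1}|lebesgue. g r * \<omega> r)" .
qed

lemma moment_nonneg: "0 \<le> moment \<omega> x"
  unfolding moment_def set_lebesgue_integral_def
  by (rule integral_nonneg_AE) (use nonneg in \<open>auto simp: indicator_def\<close>)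

text \<open>The index moves by one because \<open>\<mu>\<close> has the density 2 r omega(r); even
  exponents thereby give exactly the denominators of the Bergman kernel.\<close>

lemma nn_integral_moment:
  "(\<integral>\<^sup>+r. ennreal (r ^ n) \<partial>\<mu>) = ennreal (2 * moment \<omega> (real n + 1))"
proof -
  have "(\<integral>\<^sup>+r. ennreal (r ^ n) \<partial>\<mu>) = (\<integral>\<^sup>+r. ennreal (r ^ n) * ennreal (2 * r * profile r) \<partial>lborel)"
    by (rule nn_integral_\<mu>_profile) measurable
  also have "\<dots> = (\<integral>\<^sup>+r. ennreal 2 * ennreal (r powr (real n + 1) * profile r) \<partial>lborel)"
  proof (rule nn_integral_cong)
    fix r :: real
    show "ennreal (r ^ n) * ennreal (2 * r * profile r) = ennreal 2 * ennreal (r powr (real n + 1) * profile r)"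
    proof (cases "r \<in> {0<..<1}")
      case True
      then have "r powr (real n + 1) = r ^ n * r"
        by (simp add: powr_add powr_realpow)
      then show ?thesis
        using True by (simp add: ennreal_mult[symmetric] mult_ac del: ennreal_numeral)
    next
      case False
      then have "r = 0 \<or> r \<notin> {0..<1}"
        by auto
      then show ?thesis
        by (auto simp: profile_outside)
    qed
  qed
  also have "\<dots> = ennreal 2 * ennreal (moment \<omega> (real n + 1))"
    unfolding moment_def
    by (subst nn_integral_cmult, measurable, subst nn_integral_profile) (auto simp: powr_le1)
  finally show ?thesis
    by (simp add: ennreal_mult moment_nonneg)
qed

lemma nn_integral_tail:
  assumes "0 \<le> s" "s < 1"
  shows "(\<integral>\<^sup>+r. ennreal (indicator {s..} r * profile r) \<partial>lborel) = ennreal (tail \<omega> s)"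
proof -
  have "(\<integral>\<^sup>+r. ennreal (indicator {s..} r * profile r) \<partial>lborel) =
      ennreal (LINT r:{0..<1}|lebesgue. indicator {s..} r * \<omega> r)"
    by (rule nn_integral_profile) (auto simp: indicator_def)
  also have "(LINT r:{0..<1}|lebesgue. indicator {s..} r * \<omega> r) = tail \<omega> s"
    unfolding tail_def set_lebesgue_integral_def
    by (rule Bochner_Integration.integral_cong) (use assms in \<open>auto simp: indicator_def\<close>)
  finally show ?thesis .
qed

lemma finite_measure_\<mu>: "finite_measure \<mu>"
proof
  have "emeasure \<mu> (space \<mu>) = (\<integral>\<^sup>+r. ennreal (r ^ 0) \<partial>\<mu>)"
    by simp
  also have "\<dots> \<noteq> \<infinity>"
    by (subst nn_integral_moment) simp
  finally show "emeasure \<mu> (space \<mu>) \<noteq> \<infinity>" .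
qed

lemma finite_measure_W: "finite_measure W"
proof
  have "emeasure W (space W) = (\<integral>\<^sup>+r. 1 \<partial>\<mu>)"
    by (subst nn_integral_\<mu>) auto
  also have "\<dots> \<noteq> \<infinity>"
    using finite_measure.emeasure_finite[OF finite_measure_\<mu>, of "space \<mu>"] by simp
  finally show "emeasure W (space W) \<noteq> \<infinity>" .
qed

text \<open>\<open>W\<close> is rotation invariant, so F may be averaged over all rotations. After
  Fubini the inner average over the circle depends on z only through |z|, and the outer integral
  passes to the image measure.\<close>

lemma polar:
  assumes [measurable]: "F \<in> borel_measurable borel"
  shows "(\<integral>\<^sup>+z. F z \<partial>W) = (\<integral>\<^sup>+r. \<integral>\<^sup>+\<xi>. F (of_real r * \<xi>) \<partial>circle \<partial>\<mu>)"
    and "(\<lambda>r. \<integral>\<^sup>+\<xi>. F (of_real r * \<xi>) \<partial>circle) \<in> borel_measurable borel"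
proof -
  interpret C: prob_space circle
    by (rule prob_space_circle)
  interpret W: finite_measure W
    by (rule finite_measure_W)
  interpret P: pair_sigma_finite W circle ..
  have sc: "(\<lambda>x. x) \<in> circle \<rightarrow>\<^sub>M borel"
    by (rule borel_measurable_circle) simp
  have j: "(\<lambda>(x::'b, \<xi>). F (g x * \<xi>)) \<in> borel_measurable (M \<Otimes>\<^sub>M circle)"
    if [measurable]: "g \<in> borel_measurable M" for M and g :: "'b \<Rightarrow> complex"
  proof -
    have [measurable]: "snd \<in> M \<Otimes>\<^sub>M circle \<rightarrow>\<^sub>M borel"
      by (rule measurable_compose[OF measurable_snd sc])
    show ?thesis
      unfolding case_prod_beta by measurable
  qed
  show m: "(\<lambda>r. \<integral>\<^sup>+\<xi>. F (of_real r * \<xi>) \<partial>circle) \<in> borel_measurable borel"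
    by (rule C.borel_measurable_nn_integral) (rule j, measurable)
  have "(\<integral>\<^sup>+z. F z \<partial>W) = (\<integral>\<^sup>+\<xi>. (\<integral>\<^sup>+z. F z \<partial>W) \<partial>circle)"
    using C.emeasure_space_1 by simp
  also have "\<dots> = (\<integral>\<^sup>+\<xi>. (\<integral>\<^sup>+z. F (z * \<xi>) \<partial>W) \<partial>circle)"
  proof (rule nn_integral_cong)
    fix \<xi> assume "\<xi> \<in> space circle"
    then have "(\<integral>\<^sup>+z. F (\<xi> * z) \<partial>W) = (\<integral>\<^sup>+z. F z \<partial>W)"
      by (intro nn_integral_W_rotate) auto
    then show "(\<integral>\<^sup>+z. F z \<partial>W) = (\<integral>\<^sup>+z. F (z * \<xi>) \<partial>W)"
      by (simp add: mult.commute)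
  qed
  also have "\<dots> = (\<integral>\<^sup>+z. (\<integral>\<^sup>+\<xi>. F (z * \<xi>) \<partial>circle) \<partial>W)"
    by (rule P.Fubini') (rule j, rule borel_measurable_W, simp)
  also have "\<dots> = (\<integral>\<^sup>+z. (\<integral>\<^sup>+\<xi>. F (of_real (norm z) * \<xi>) \<partial>circle) \<partial>W)"
  proof (rule nn_integral_cong)
    fix z :: complex
    define u where "u = (if z = 0 then 1 else sgn z)"
    have u: "norm u = 1"
      by (simp add: u_def norm_sgn)
    have z: "z = of_real (norm z) * u"
      by (simp add: u_def sgn_div_norm scaleR_conv_of_real)
    have "(\<integral>\<^sup>+\<xi>. F (z * \<xi>) \<partial>circle) = (\<integral>\<^sup>+\<xi>. F (of_real (norm z) * (u * \<xi>)) \<partial>circle)"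
      by (subst z) (simp add: mult.assoc)
    also have "\<dots> = (\<integral>\<^sup>+\<xi>. F (of_real (norm z) * \<xi>) \<partial>circle)"
      by (rule nn_integral_circle_rotate[OF u]) measurable
    finally show "(\<integral>\<^sup>+\<xi>. F (z * \<xi>) \<partial>circle) = (\<integral>\<^sup>+\<xi>. F (of_real (norm z) * \<xi>) \<partial>circle)" .
  qed
  also have "\<dots> = (\<integral>\<^sup>+r. \<integral>\<^sup>+\<xi>. F (of_real r * \<xi>) \<partial>circle \<partial>\<mu>)"
    by (rule nn_integral_\<mu>[symmetric]) (rule borel_measurable_\<mu>, rule m)
  finally show "(\<integral>\<^sup>+z. F z \<partial>W) = (\<integral>\<^sup>+r. \<integral>\<^sup>+\<xi>. F (of_real r * \<xi>) \<partial>circle \<partial>\<mu>)" .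
qed

end

subsection \<open>Integral means over circles\<close>

text \<open>Young's inequality for the factors a / c and c b^(p-1). The parameter d decides how much
  of the b-term is created, and hence how much can be absorbed where b is the quantity being
  estimated.\<close>

lemma young_powr:
  fixes a b d p :: real
  assumes p: "1 < p" and ab: "0 \<le> a" "0 \<le> b" and d: "0 < d"
  shows "a * b powr (p - 1) \<le> d powr (1 - p) / p * a powr p + d * (1 - 1 / p) * b powr p"
proof -
  define q where "q = p / (p - 1)"
  \<comment> \<open>This c satisfies c^q = d, which fixes the coefficient of b^p, and c^p = d^(p-1),
    which produces the coefficient of a^p.\<close>
  define c where "c = d powr ((p - 1) / p)"
  have q: "1 < q" "1 / p + 1 / q = 1" "1 / q = 1 - 1 / p"
    using p by (auto simp: q_def field_simps)
  have c: "0 < c" "c powr p = d powr (p - 1)" "c powr q = d"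
    using p d by (auto simp: c_def q_def powr_powr)
  have "a * b powr (p - 1) = (a / c) * (b powr (p - 1) * c)"
    using c by simp
  also have "\<dots> \<le> (a / c) powr p / p + (b powr (p - 1) * c) powr q / q"
    by (rule Youngs_inequality) (use p q ab c in auto)
  also have "(a / c) powr p / p = d powr (1 - p) / p * a powr p"
    using ab c d p by (simp add: powr_divide powr_diff field_simps)
  also have "(b powr (p - 1) * c) powr q / q = d * (1 - 1 / p) * b powr p"
  proof -
    have "(p - 1) * q = p"
      using p by (simp add: q_def)
    then have "(b powr (p - 1) * c) powr q = b powr p * d"
      using ab c by (simp add: powr_mult powr_powr)
    then have "(b powr (p - 1) * c) powr q / q = b powr p * d * (1 / q)"
      by simp
    then show ?thesis
      unfolding q(3) by (simp add: mult_ac)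
  qed
  finally show ?thesis .
qed

text \<open>The extremal function of L^p duality, |v|^(p-2) cnj v: its product with v is |v|^p and
  its modulus is |v|^(p-1). For v = 0 the conjugate makes the product 0, also when p < 2.\<close>

definition dual_factor :: "real \<Rightarrow> complex \<Rightarrow> complex"
  where "dual_factor p v = cnj v * of_real (norm v powr (p - 2))"

lemma norm_dual_factor: "norm (dual_factor p v) = norm v powr (p - 1)"
proof (cases "v = 0")
  case False
  then have "norm v * norm v powr (p - 2) = norm v powr 1 * norm v powr (p - 2)"
    by simp
  also have "\<dots> = norm v powr (p - 1)"
    by (subst powr_add[symmetric]) simp
  finally show ?thesis
    by (simp add: dual_factor_def norm_mult)
qed (simp add: dual_factor_def)

lemma mult_dual_factor: "v * dual_factor p v = of_real (norm v powr p)"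
proof (cases "v = 0")
  case False
  then have "norm v ^ 2 * norm v powr (p - 2) = norm v powr 2 * norm v powr (p - 2)"
    by (simp add: powr_numeral)
  also have "\<dots> = norm v powr p"
    by (subst powr_add[symmetric]) simp
  finally have "of_real (norm v ^ 2 * norm v powr (p - 2)) = (of_real (norm v powr p) :: complex)"
    by simp
  then have "of_real (norm v ^ 2) * of_real (norm v powr (p - 2)) = (of_real (norm v powr p) :: complex)"
    by (simp only: of_real_mult)
  then show ?thesis
    unfolding complex_norm_square dual_factor_def by (simp only: mult.assoc)
qed (simp add: dual_factor_def)

lemma dual_factor_measurable [measurable]: "dual_factor p \<in> borel_measurable borel"
proof -
  have [measurable]: "cnj \<in> borel_measurable borel"
    by (intro borel_measurable_continuous_onI continuous_intros)
  show ?thesis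
    unfolding dual_factor_def by measurable
qed

lemma circle_dual_measurable:
  assumes "continuous_on (sphere 0 1) v"
  shows "(\<lambda>\<xi>. dual_factor p (v \<xi>)) \<in> borel_measurable circle"
  by (rule measurable_compose[OF circle_measurableI[OF assms] dual_factor_measurable])

lemma circle_dual_bounded:
  fixes v :: "complex \<Rightarrow> complex"
  assumes "continuous_on (sphere 0 1) v" and "1 < p"
  shows "\<exists>B. \<forall>\<xi>. norm \<xi> = 1 \<longrightarrow> norm (dual_factor p (v \<xi>)) \<le> B"
proof -
  have "compact (v ` sphere 0 1)"
    by (rule compact_continuous_image[OF assms(1)]) simp
  then obtain B where B: "\<And>\<xi>. norm \<xi> = 1 \<Longrightarrow> norm (v \<xi>) \<le> B"
    by (fastforce dest: compact_imp_bounded simp: bounded_iff)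
  have "norm (dual_factor p (v \<xi>)) \<le> B powr (p - 1)" if "norm \<xi> = 1" for \<xi>
    unfolding norm_dual_factor using B[OF that] assms(2) by (intro powr_mono2) auto
  then show ?thesis
    by blast
qed

lemma continuous_on_norm_powr:
  fixes v :: "'a :: topological_space \<Rightarrow> complex"
  assumes "continuous_on S v" "0 < p"
  shows "continuous_on S (\<lambda>\<xi>. norm (v \<xi>) powr p)"
  using assms by (intro continuous_on_powr' continuous_intros) auto

text \<open>An additive substitute for Hoelder's inequality that avoids p-th roots of means; d is
  the free parameter of Young's inequality.\<close>

lemma circle_pairing_bound:
  assumes u: "continuous_on (sphere 0 1) u" and v: "continuous_on (sphere 0 1) v"
    and p: "1 < p" and d: "0 < d"
  shows "norm (LINT \<xi>|circle. u \<xi> * dual_factor p (v \<xi>)) \<le>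
    d powr (1 - p) / p * (LINT \<xi>|circle. norm (u \<xi>) powr p) +
    d * (1 - 1 / p) * (LINT \<xi>|circle. norm (v \<xi>) powr p)"
proof -
  have iu: "integrable circle (\<lambda>\<xi>. norm (u \<xi>) powr p)" and iv: "integrable circle (\<lambda>\<xi>. norm (v \<xi>) powr p)"
    using p by (intro circle_integrable_continuous continuous_on_norm_powr u v; simp)+
  have "norm (LINT \<xi>|circle. u \<xi> * dual_factor p (v \<xi>)) \<le>
      (LINT \<xi>|circle. norm (u \<xi> * dual_factor p (v \<xi>)))"
    by (rule integral_norm_bound)
  also have "\<dots> \<le> (LINT \<xi>|circle. d powr (1 - p) / p * norm (u \<xi>) powr p + d * (1 - 1 / p) * norm (v \<xi>) powr p)"
  proof (rule integral_mono')
    show "integrable circle (\<lambda>\<xi>. d powr (1 - p) / p * norm (u \<xi>) powr p + d * (1 - 1 / p) * norm (v \<xi>) powr p)"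
      using iu iv by simp
    fix \<xi>
    show "norm (u \<xi> * dual_factor p (v \<xi>)) \<le> d powr (1 - p) / p * norm (u \<xi>) powr p + d * (1 - 1 / p) * norm (v \<xi>) powr p"
      unfolding norm_mult norm_dual_factor by (rule young_powr) (use p d in auto)
  qed (use p d in auto)
  also have "\<dots> = d powr (1 - p) / p * (LINT \<xi>|circle. norm (u \<xi>) powr p) +
    d * (1 - 1 / p) * (LINT \<xi>|circle. norm (v \<xi>) powr p)"
    using iu iv by simp
  finally show ?thesis .
qed

abbreviation taylor :: "(complex \<Rightarrow> complex) \<Rightarrow> nat \<Rightarrow> complex"
  where "taylor f n \<equiv> (deriv ^^ n) f 0 / fact n"

lemma taylor_sums:
  assumes "f holomorphic_on disc" "norm z < 1"
  shows "(\<lambda>n. taylor f n * z ^ n) sums f z"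
  using holomorphic_power_series[OF assms(1), of z] assms(2) by simp

lemma taylor_norm_summable:
  assumes f: "f holomorphic_on disc" and r: "0 \<le> r" "r < 1"
  shows "summable (\<lambda>n. norm (taylor f n) * r ^ n)"
proof -
  define x where "x = complex_of_real ((1 + r) / 2)"
  have x: "norm x < 1" "norm (complex_of_real r) < norm x"
    using r unfolding x_def norm_of_real by auto
  have "summable (\<lambda>n. taylor f n * x ^ n)"
    using taylor_sums[OF f x(1)] by (rule sums_summable)
  from powser_insidea[OF this x(2)] show ?thesis
    using r by (simp add: norm_mult norm_power norm_divide)
qed

lemma continuous_on_circle_compose:
  assumes "f holomorphic_on disc" "norm z < 1"
  shows "continuous_on (sphere 0 1) (\<lambda>\<xi>. f (z * \<xi>))"
  by (rule continuous_on_compose2[OF holomorphic_on_imp_continuous_on[OF assms(1)]])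
    (use assms(2) in \<open>auto intro!: continuous_intros simp: norm_mult\<close>)

text \<open>Termwise integration of the Taylor series: integrating against a fixed bounded factor
  multiplies each coefficient by a moment of that factor. This is what makes dual pairings
  holomorphic in z.\<close>

lemma circle_convolution_sums:
  assumes f: "f holomorphic_on disc" and z: "norm z < 1"
    and m: "\<phi> \<in> borel_measurable circle" and B: "\<And>\<xi>. norm \<xi> = 1 \<Longrightarrow> norm (\<phi> \<xi>) \<le> B"
  shows "(\<lambda>n. taylor f n * (LINT \<xi>|circle. \<xi> ^ n * \<phi> \<xi>) * z ^ n) sums (LINT \<xi>|circle. f (z * \<xi>) * \<phi> \<xi>)"
proof -
  interpret C: prob_space circle
    by (rule prob_space_circle)
  let ?t = "\<lambda>n \<xi>. taylor f n * z ^ n * (\<xi> ^ n * \<phi> \<xi>)"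
  have mon: "(\<lambda>\<xi>. \<xi> ^ n * \<phi> \<xi>) \<in> borel_measurable circle" for n
    by (intro borel_measurable_times m circle_measurableI continuous_intros)
  have iphi: "integrable circle (\<lambda>\<xi>. \<xi> ^ n * \<phi> \<xi>)" for n
    by (rule circle_integrable_bounded[of _ B]) (use mon B in \<open>auto simp: norm_mult norm_power\<close>)
  have bd: "norm (?t n \<xi>) \<le> norm (taylor f n) * norm z ^ n * B" if "norm \<xi> = 1" for n \<xi>
  proof -
    have "norm (?t n \<xi>) = norm (taylor f n) * norm z ^ n * norm (\<phi> \<xi>)"
      using that by (simp add: norm_mult norm_power norm_divide)
    also have "\<dots> \<le> norm (taylor f n) * norm z ^ n * B"
      using B[OF that] by (intro mult_left_mono) auto
    finally show ?thesis .
  qed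
  have S: "summable (\<lambda>n. norm (taylor f n) * norm z ^ n * B)"
    by (intro summable_mult2 taylor_norm_summable f) (use z in auto)
  have "(\<lambda>n. LINT \<xi>|circle. ?t n \<xi>) sums (LINT \<xi>|circle. (\<Sum>n. ?t n \<xi>))"
  proof (rule sums_integral)
    show "integrable circle (?t n)" for n
      using iphi by simp
    show "AE \<xi> in circle. summable (\<lambda>n. norm (?t n \<xi>))"
      by (rule AE_I2) (use bd in \<open>auto intro!: summable_comparison_test'[OF S]\<close>)
    show "summable (\<lambda>n. LINT \<xi>|circle. norm (?t n \<xi>))"
    proof (rule summable_comparison_test'[OF S])
      fix n
      have "(LINT \<xi>|circle. norm (?t n \<xi>)) \<le> (LINT \<xi>|circle. norm (taylor f n) * norm z ^ n * B)"
        by (rule integral_mono) (use iphi bd in \<open>auto intro!: integrable_norm\<close>)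
      then show "norm (LINT \<xi>|circle. norm (?t n \<xi>)) \<le> norm (taylor f n) * norm z ^ n * B"
        by (simp add: C.prob_space[simplified])
    qed
  qed
  also have "(LINT \<xi>|circle. (\<Sum>n. ?t n \<xi>)) = (LINT \<xi>|circle. f (z * \<xi>) * \<phi> \<xi>)"
  proof (rule Bochner_Integration.integral_cong[OF refl])
    fix \<xi> assume "\<xi> \<in> space circle"
    then have "norm (z * \<xi>) < 1"
      using z by (simp add: norm_mult)
    from sums_mult2[OF taylor_sums[OF f this], of "\<phi> \<xi>"]
    show "(\<Sum>n. ?t n \<xi>) = f (z * \<xi>) * \<phi> \<xi>"
      by (simp add: sums_iff power_mult_distrib mult_ac)
  qed
  also have "(\<lambda>n. LINT \<xi>|circle. ?t n \<xi>) =
      (\<lambda>n. taylor f n * (LINT \<xi>|circle. \<xi> ^ n * \<phi> \<xi>) * z ^ n)"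
    by (simp only: integral_mult_right_zero) (simp only: mult_ac)
  finally show ?thesis .
qed

text \<open>Differentiating the power series termwise and recognizing the result as the analogous
  series for f', with the dual factor multiplied by the extra \<xi> of the chain rule, avoids
  differentiation under the integral.\<close>

lemma circle_convolution_deriv:
  assumes f: "f holomorphic_on disc"
    and m: "\<phi> \<in> borel_measurable circle" and B: "\<And>\<xi>. norm \<xi> = 1 \<Longrightarrow> norm (\<phi> \<xi>) \<le> B"
  defines "G \<equiv> \<lambda>z. LINT \<xi>|circle. f (z * \<xi>) * \<phi> \<xi>"
  shows "G holomorphic_on disc"
    and "norm z < 1 \<Longrightarrow> (G has_field_derivative (LINT \<xi>|circle. deriv f (z * \<xi>) * (\<xi> * \<phi> \<xi>))) (at z)"
proof -
  define c where "c n = taylor f n * (LINT \<xi>|circle. \<xi> ^ n * \<phi> \<xi>)" for n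
  have G: "(\<lambda>n. c n * z ^ n) sums G z" if "norm z < 1" for z
    unfolding c_def G_def by (rule circle_convolution_sums[OF f that m B])
  show "G holomorphic_on disc"
    by (rule power_series_holomorphic[where a = c]) (use G in auto)
  show "(G has_field_derivative (LINT \<xi>|circle. deriv f (z * \<xi>) * (\<xi> * \<phi> \<xi>))) (at z)" if z: "norm z < 1"
  proof -
    define K where "K = complex_of_real ((1 + norm z) / 2)"
    have K: "norm K < 1" "norm z < norm K"
      using z unfolding K_def norm_of_real by auto
    have D: "((\<lambda>x. \<Sum>n. c n * x ^ n) has_field_derivative (\<Sum>n. diffs c n * z ^ n)) (at z)"
      by (rule termdiffs_strong[OF sums_summable[OF G[OF K(1)]] K(2)])
    have E: "(\<Sum>n. diffs c n * z ^ n) = (LINT \<xi>|circle. deriv f (z * \<xi>) * (\<xi> * \<phi> \<xi>))"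
    proof -
      have f': "deriv f holomorphic_on disc"
        using f by (rule holomorphic_deriv) simp
      have "(\<lambda>n. taylor (deriv f) n * (LINT \<xi>|circle. \<xi> ^ n * (\<xi> * \<phi> \<xi>)) * z ^ n) sums
          (LINT \<xi>|circle. deriv f (z * \<xi>) * (\<xi> * \<phi> \<xi>))"
      proof (rule circle_convolution_sums[OF f' z])
        show "(\<lambda>\<xi>. \<xi> * \<phi> \<xi>) \<in> borel_measurable circle"
          by (intro borel_measurable_times m circle_measurableI continuous_intros)
      qed (use B in \<open>auto simp: norm_mult\<close>)
      moreover have "taylor (deriv f) n * (LINT \<xi>|circle. \<xi> ^ n * (\<xi> * \<phi> \<xi>)) = diffs c n" for n
      proof -
        have "taylor (deriv f) n = of_nat (Suc n) * taylor f (Suc n)"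
          by (simp add: funpow_Suc_right del: funpow.simps of_nat_Suc)
        then show ?thesis
          by (simp add: diffs_def c_def mult_ac)
      qed
      ultimately have "(\<lambda>n. diffs c n * z ^ n) sums (LINT \<xi>|circle. deriv f (z * \<xi>) * (\<xi> * \<phi> \<xi>))"
        by (simp only:)
      then show ?thesis
        by (rule sums_unique[symmetric])
    qed
    have ev: "\<forall>\<^sub>F x in nhds z. (\<Sum>n. c n * x ^ n) = G x"
    proof -
      have "\<forall>\<^sub>F x in nhds z. x \<in> disc"
        using z by (intro eventually_nhds_in_open) auto
      then show ?thesis
        by eventually_elim (use G in \<open>auto simp: sums_iff\<close>)
    qed
    show ?thesis
      using D unfolding DERIV_cong_ev[OF refl ev E] .
  qed
qed

text \<open>The p-th power of the classical integral mean; no root is taken, so that it can be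
  integrated in r directly.\<close>

definition circle_mean :: "real \<Rightarrow> (complex \<Rightarrow> complex) \<Rightarrow> real \<Rightarrow> real"
  where "circle_mean p f r = (LINT \<xi>|circle. norm (f (of_real r * \<xi>)) powr p)"

lemma circle_mean_nonneg [simp]: "0 \<le> circle_mean p f r"
  unfolding circle_mean_def by simp

lemma circle_mean_rotate:
  assumes f: "f holomorphic_on disc" and z: "norm z < 1" and p: "0 < p"
  shows "(LINT \<xi>|circle. norm (f (z * \<xi>)) powr p) = circle_mean p f (norm z)"
proof -
  define u where "u = (if z = 0 then 1 else sgn z)"
  have u: "norm u = 1"
    by (simp add: u_def norm_sgn)
  have zu: "z = of_real (norm z) * u"
    by (simp add: u_def sgn_div_norm scaleR_conv_of_real)
  have "(LINT \<xi>|circle. norm (f (z * \<xi>)) powr p) = (LINT \<xi>|circle. norm (f (of_real (norm z) * (u * \<xi>))) powr p)"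
    by (subst zu) (simp add: mult.assoc)
  also have "\<dots> = circle_mean p f (norm z)"
    unfolding circle_mean_def
  proof (rule integral_circle_rotate[OF u])
    show "(\<lambda>\<xi>. norm (f (of_real (norm z) * \<xi>)) powr p) \<in> borel_measurable circle"
      using p z by (intro circle_measurableI continuous_on_norm_powr continuous_on_circle_compose f) auto
  qed
  finally show ?thesis .
qed

lemma ennreal_circle_mean:
  assumes f: "f holomorphic_on disc" and r: "0 \<le> r" "r < 1" and p: "0 < p"
  shows "ennreal (circle_mean p f r) = (\<integral>\<^sup>+\<xi>. ennreal (norm (f (of_real r * \<xi>)) powr p) \<partial>circle)"
  unfolding circle_mean_def
  by (rule nn_integral_eq_integral[symmetric])
    (use p r in \<open>auto intro!: circle_integrable_continuous continuous_on_norm_powr continuous_on_circle_compose f\<close>)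

lemma circle_mean_zero [simp]: "circle_mean p f 0 = norm (f 0) powr p"
proof -
  interpret C: prob_space circle
    by (rule prob_space_circle)
  show ?thesis
    unfolding circle_mean_def using C.prob_space by simp
qed

text \<open>Let G(z) be the pairing of f(z \<xi>) with the dual factor of f on the circle of radius
  r. Then G(r) is the mean at r, while on |z| = \<rho> Young's inequality bounds |G| by M(\<rho>) /
  p + (1 - 1/p) M(r). The maximum principle compares the two, and the M(r) term is absorbed.\<close>

lemma circle_mean_mono:
  assumes f: "f holomorphic_on disc" and r: "0 \<le> r" "r \<le> \<rho>" "\<rho> < 1" and p: "1 < p"
  shows "circle_mean p f r \<le> circle_mean p f \<rho>"
proof (cases "\<rho> = 0")
  case False
  then have \<rho>: "0 < \<rho>"
    using r by auto
  define v where "v \<xi> = f (of_real r * \<xi>)" for \<xi>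
  have v: "continuous_on (sphere 0 1) v"
    unfolding v_def using r by (intro continuous_on_circle_compose f) auto
  note vm = circle_dual_measurable[OF v, of p]
  obtain B where B: "\<And>\<xi>. norm \<xi> = 1 \<Longrightarrow> norm (dual_factor p (v \<xi>)) \<le> B"
    using circle_dual_bounded[OF v p] by blast
  define G where "G z = (LINT \<xi>|circle. f (z * \<xi>) * dual_factor p (v \<xi>))" for z
  have G: "G holomorphic_on disc"
    unfolding G_def by (rule circle_convolution_deriv[OF f vm B])
  have Mr: "circle_mean p f r = (LINT \<xi>|circle. norm (v \<xi>) powr p)"
    by (simp add: circle_mean_def v_def)
  have "norm (G (of_real r)) \<le> 1 / p * circle_mean p f \<rho> + (1 - 1 / p) * circle_mean p f r"
  proof (rule maximum_modulus_frontier[of G "cball 0 \<rho>"])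
    show "G holomorphic_on interior (cball 0 \<rho>)"
      by (rule holomorphic_on_subset[OF G]) (use r in auto)
    show "continuous_on (closure (cball 0 \<rho>)) G"
      by (rule continuous_on_subset[OF holomorphic_on_imp_continuous_on[OF G]]) (use r in auto)
    fix z assume "z \<in> frontier (cball (0::complex) \<rho>)"
    then have z: "norm z = \<rho>"
      using \<rho> by (simp add: frontier_cball)
    have "norm (G z) \<le> 1 powr (1 - p) / p * (LINT \<xi>|circle. norm (f (z * \<xi>)) powr p) +
        1 * (1 - 1 / p) * (LINT \<xi>|circle. norm (v \<xi>) powr p)"
      unfolding G_def using z r
      by (intro circle_pairing_bound continuous_on_circle_compose f v p) auto
    then show "norm (G z) \<le> 1 / p * circle_mean p f \<rho> + (1 - 1 / p) * circle_mean p f r"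
      using circle_mean_rotate[OF f, of z p] z r p by (simp add: Mr)
  qed (use r in auto)
  moreover have "G (of_real r) = of_real (circle_mean p f r)"
    unfolding Mr G_def v_def[symmetric] mult_dual_factor by (rule integral_complex_of_real)
  ultimately have "circle_mean p f r \<le> 1 / p * circle_mean p f \<rho> + (1 - 1 / p) * circle_mean p f r"
    by simp
  then show ?thesis
    using p by (simp add: field_simps)
qed (use r in simp)

text \<open>Cauchy's inequality on the circle of radius d about r, applied to the pairing G with the
  dual factor of f' at radius r, so that G'(r) is the mean to be estimated. Taking d also as the
  parameter in Young's inequality cancels the 1/d of Cauchy's inequality in the term that is
  absorbed.\<close>

lemma circle_mean_deriv_le:
  assumes f: "f holomorphic_on disc" and r: "0 \<le> r" "0 < d" "r + d < 1" and p: "1 < p"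
  shows "circle_mean p (deriv f) r \<le> d powr (- p) * circle_mean p f (r + d)"
proof -
  have f': "deriv f holomorphic_on disc"
    using f by (rule holomorphic_deriv) simp
  \<comment> \<open>The factor \<xi> matches the chain rule for z -> f(z \<xi>) and does not change
    the modulus on the circle.\<close>
  define v where "v \<xi> = \<xi> * deriv f (of_real r * \<xi>)" for \<xi>
  have v: "continuous_on (sphere 0 1) v"
    unfolding v_def using r by (intro continuous_intros continuous_on_circle_compose f') auto
  note vm = circle_dual_measurable[OF v, of p]
  obtain B where B: "\<And>\<xi>. norm \<xi> = 1 \<Longrightarrow> norm (dual_factor p (v \<xi>)) \<le> B"
    using circle_dual_bounded[OF v p] by blast
  define G where "G z = (LINT \<xi>|circle. f (z * \<xi>) * dual_factor p (v \<xi>))" for z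
  have G: "G holomorphic_on disc"
    unfolding G_def by (rule circle_convolution_deriv(1)[OF f vm B])
  have Mr: "circle_mean p (deriv f) r = (LINT \<xi>|circle. norm (v \<xi>) powr p)"
    unfolding circle_mean_def v_def
    by (rule Bochner_Integration.integral_cong) (auto simp: norm_mult)
  have "(G has_field_derivative (LINT \<xi>|circle. deriv f (of_real r * \<xi>) * (\<xi> * dual_factor p (v \<xi>)))) (at (of_real r))"
    unfolding G_def by (rule circle_convolution_deriv(2)[OF f vm B]) (use r in auto)
  also have "(LINT \<xi>|circle. deriv f (of_real r * \<xi>) * (\<xi> * dual_factor p (v \<xi>))) =
      (LINT \<xi>|circle. of_real (norm (v \<xi>) powr p))"
    unfolding mult_dual_factor[symmetric] by (simp add: v_def mult_ac)
  finally have dG: "deriv G (of_real r) = of_real (circle_mean p (deriv f) r)"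
    unfolding Mr by (simp add: DERIV_imp_deriv)
  have "norm ((deriv ^^ 1) G (of_real r)) \<le>
      fact 1 * (d powr (1 - p) / p * circle_mean p f (r + d) + d * (1 - 1 / p) * circle_mean p (deriv f) r) / d ^ 1"
  proof (rule Cauchy_inequality)
    show "G holomorphic_on ball (of_real r) d"
      by (rule holomorphic_on_subset[OF G]) (use r in \<open>auto simp: ball_subset_ball_iff dist_norm\<close>)
    show "continuous_on (cball (of_real r) d) G"
      by (rule continuous_on_subset[OF holomorphic_on_imp_continuous_on[OF G]])
        (use r in \<open>auto simp: cball_subset_ball_iff dist_norm\<close>)
    fix z :: complex assume z: "norm (of_real r - z) = d"
    have nz: "norm z \<le> r + d"
      using norm_triangle_ineq4[of "of_real r" "of_real r - z"] z r by simp
    have "norm (G z) \<le> d powr (1 - p) / p * (LINT \<xi>|circle. norm (f (z * \<xi>)) powr p) +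
        d * (1 - 1 / p) * (LINT \<xi>|circle. norm (v \<xi>) powr p)"
      unfolding G_def using nz r
      by (intro circle_pairing_bound continuous_on_circle_compose f v p) auto
    also have "(LINT \<xi>|circle. norm (f (z * \<xi>)) powr p) = circle_mean p f (norm z)"
      using nz r p by (intro circle_mean_rotate f) auto
    also have "d powr (1 - p) / p * circle_mean p f (norm z) \<le> d powr (1 - p) / p * circle_mean p f (r + d)"
      using nz r p by (intro mult_left_mono circle_mean_mono f) auto
    finally show "norm (G z) \<le> d powr (1 - p) / p * circle_mean p f (r + d) + d * (1 - 1 / p) * circle_mean p (deriv f) r"
      by (simp add: Mr)
  qed (use r in auto)
  then have "circle_mean p (deriv f) r \<le>
      d powr (1 - p) / d / p * circle_mean p f (r + d) + (1 - 1 / p) * circle_mean p (deriv f) r"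
    using r by (simp add: dG add_divide_distrib mult.commute[of d p])
  moreover have "d powr (1 - p) / d = d powr (- p)"
    using r by (simp add: powr_diff powr_minus field_simps)
  ultimately show ?thesis
    using p by (simp add: field_simps)
qed

text \<open>Here the dual factor is that of f at the larger radius \<rho>, so G(\<rho>) is the mean
  at \<rho>. It is at most |G(r)| plus (\<rho> - r) times the supremum of |G'| on the segment; each
  part returns a multiple of M(\<rho>), and d keeps the second multiple small.\<close>

lemma circle_mean_le_deriv:
  assumes f: "f holomorphic_on disc" and r: "0 \<le> r" "r \<le> \<rho>" "\<rho> < 1" and p: "1 < p" and d: "0 < d"
  shows "circle_mean p f \<rho> * (1 - d * (p - 1)) \<le>
    circle_mean p f r + d powr (1 - p) * (\<rho> - r) powr p * circle_mean p (deriv f) \<rho>"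
proof (cases "r = \<rho>")
  case True
  have "circle_mean p f \<rho> * (1 - d * (p - 1)) \<le> circle_mean p f \<rho> * 1"
    using p d by (intro mult_left_mono) auto
  then show ?thesis
    using True by simp
next
  case False
  then have lt: "r < \<rho>"
    using r by simp
  have f': "deriv f holomorphic_on disc"
    using f by (rule holomorphic_deriv) simp
  define v where "v \<xi> = f (of_real \<rho> * \<xi>)" for \<xi>
  have v: "continuous_on (sphere 0 1) v"
    unfolding v_def using r by (intro continuous_on_circle_compose f) auto
  note vm = circle_dual_measurable[OF v, of p]
  obtain B where B: "\<And>\<xi>. norm \<xi> = 1 \<Longrightarrow> norm (dual_factor p (v \<xi>)) \<le> B"
    using circle_dual_bounded[OF v p] by blast
  define G where "G z = (LINT \<xi>|circle. f (z * \<xi>) * dual_factor p (v \<xi>))" for z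
  define G' where "G' z = (LINT \<xi>|circle. deriv f (z * \<xi>) * (\<xi> * dual_factor p (v \<xi>)))" for z
  have dG: "(G has_field_derivative G' z) (at z)" if "norm z < 1" for z
    unfolding G_def G'_def by (rule circle_convolution_deriv(2)[OF f vm B that])
  have Mr: "circle_mean p f \<rho> = (LINT \<xi>|circle. norm (v \<xi>) powr p)"
    by (simp add: circle_mean_def v_def)
  \<comment> \<open>Scaling the Young parameter by the length of the segment makes the multiple of
    M(\<rho>) depend on d alone.\<close>
  define e where "e = d / (\<rho> - r)"
  have e: "0 < e"
    using d lt by (simp add: e_def)
  have G'b: "norm (G' z) \<le> e powr (1 - p) / p * circle_mean p (deriv f) \<rho> + e * (1 - 1 / p) * circle_mean p f \<rho>"
    if z: "norm z \<le> \<rho>" for z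
  proof -
    have "norm (G' z) = norm (LINT \<xi>|circle. (\<xi> * deriv f (z * \<xi>)) * dual_factor p (v \<xi>))"
      unfolding G'_def by (simp add: mult_ac)
    also have "\<dots> \<le> e powr (1 - p) / p * (LINT \<xi>|circle. norm (\<xi> * deriv f (z * \<xi>)) powr p) +
        e * (1 - 1 / p) * (LINT \<xi>|circle. norm (v \<xi>) powr p)"
      using z r by (intro circle_pairing_bound continuous_on_circle_compose continuous_intros f' v p e) auto
    also have "(LINT \<xi>|circle. norm (\<xi> * deriv f (z * \<xi>)) powr p) = (LINT \<xi>|circle. norm (deriv f (z * \<xi>)) powr p)"
      by (rule Bochner_Integration.integral_cong) (auto simp: norm_mult)
    also have "\<dots> = circle_mean p (deriv f) (norm z)"
      using z r p by (intro circle_mean_rotate f') auto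
    also have "e powr (1 - p) / p * circle_mean p (deriv f) (norm z) \<le> e powr (1 - p) / p * circle_mean p (deriv f) \<rho>"
      using z r p by (intro mult_left_mono circle_mean_mono f') auto
    finally show ?thesis
      by (simp add: Mr)
  qed
  have ns: "norm z \<le> \<rho>" if "z \<in> closed_segment (complex_of_real r) (of_real \<rho>)" for z
  proof -
    have "closed_segment (complex_of_real r) (of_real \<rho>) \<subseteq> cball 0 \<rho>"
      by (rule closed_segment_subset) (use r in auto)
    then show ?thesis
      using that by auto
  qed
  have "norm (G (of_real \<rho>) - G (of_real r)) \<le>
      (e powr (1 - p) / p * circle_mean p (deriv f) \<rho> + e * (1 - 1 / p) * circle_mean p f \<rho>) *
      norm (complex_of_real \<rho> - of_real r)"
  proof (rule field_differentiable_bound[of "closed_segment (complex_of_real r) (of_real \<rho>)" G G'])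
    fix z assume "z \<in> closed_segment (complex_of_real r) (of_real \<rho>)"
    then have "norm z \<le> \<rho>"
      by (rule ns)
    then show "(G has_field_derivative G' z) (at z within closed_segment (complex_of_real r) (of_real \<rho>))"
      using r by (intro has_field_derivative_at_within[OF dG]) auto
    from \<open>norm z \<le> \<rho>\<close> show
        "norm (G' z) \<le> e powr (1 - p) / p * circle_mean p (deriv f) \<rho> + e * (1 - 1 / p) * circle_mean p f \<rho>"
      by (rule G'b)
  qed auto
  also have "norm (complex_of_real \<rho> - of_real r) = \<rho> - r"
    using lt by (simp flip: of_real_diff)
  also have "(e powr (1 - p) / p * circle_mean p (deriv f) \<rho> + e * (1 - 1 / p) * circle_mean p f \<rho>) * (\<rho> - r) =
      d powr (1 - p) * (\<rho> - r) powr p / p * circle_mean p (deriv f) \<rho> + d * (1 - 1 / p) * circle_mean p f \<rho>"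
  proof -
    have e1: "e powr (1 - p) * (\<rho> - r) = d powr (1 - p) * (\<rho> - r) powr p"
      using lt d by (simp add: e_def powr_divide powr_diff)
    have e2: "e * (\<rho> - r) = d"
      using lt by (simp add: e_def)
    have A: "(E / p * M' + e * c * M) * R = (E * R) / p * M' + (e * R) * c * M" for E M' e c M R :: real
      by (simp add: algebra_simps)
    show ?thesis
      by (simp only: A e1 e2)
  qed
  finally have 1: "norm (G (of_real \<rho>) - G (of_real r)) \<le>
      d powr (1 - p) * (\<rho> - r) powr p / p * circle_mean p (deriv f) \<rho> + d * (1 - 1 / p) * circle_mean p f \<rho>" .
  \<comment> \<open>The value at the inner endpoint uses the parameter 1: it returns the fraction 1
    - 1/p of M(\<rho>), and after multiplication by p the coefficient 1 of M(\<rho>) remains on the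
    left.\<close>
  have "norm (G (of_real r)) \<le> 1 powr (1 - p) / p * (LINT \<xi>|circle. norm (f (of_real r * \<xi>)) powr p) +
      1 * (1 - 1 / p) * (LINT \<xi>|circle. norm (v \<xi>) powr p)"
    unfolding G_def using r by (intro circle_pairing_bound continuous_on_circle_compose f v p) auto
  then have 2: "norm (G (of_real r)) \<le> circle_mean p f r / p + (1 - 1 / p) * circle_mean p f \<rho>"
    unfolding Mr circle_mean_def[of p f r] by simp
  have "G (of_real \<rho>) = of_real (circle_mean p f \<rho>)"
    unfolding Mr G_def v_def[symmetric] mult_dual_factor by (rule integral_complex_of_real)
  then have "circle_mean p f \<rho> = norm (G (of_real \<rho>))"
    by simp
  also have "\<dots> \<le> norm (G (of_real \<rho>) - G (of_real r)) + norm (G (of_real r))"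
    by (metis diff_add_cancel norm_triangle_ineq)
  finally have "circle_mean p f \<rho> \<le> circle_mean p f r / p + (1 - 1 / p) * circle_mean p f \<rho> +
      (d powr (1 - p) * (\<rho> - r) powr p / p * circle_mean p (deriv f) \<rho> + d * (1 - 1 / p) * circle_mean p f \<rho>)"
    using 1 2 by linarith
  then have "p * circle_mean p f \<rho> \<le> p * (circle_mean p f r / p + (1 - 1 / p) * circle_mean p f \<rho> +
      (d powr (1 - p) * (\<rho> - r) powr p / p * circle_mean p (deriv f) \<rho> + d * (1 - 1 / p) * circle_mean p f \<rho>))"
    using p by (intro mult_left_mono) auto
  also have "\<dots> = circle_mean p f r + (p - 1) * circle_mean p f \<rho> +
      (d powr (1 - p) * (\<rho> - r) powr p * circle_mean p (deriv f) \<rho> + d * (p - 1) * circle_mean p f \<rho>)"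
    using p by (simp add: field_simps)
  finally show ?thesis
    by (simp add: algebra_simps)
qed

subsection \<open>Radial measures and the doubling conditions\<close>

definition mass :: "real measure \<Rightarrow> real \<Rightarrow> real"
  where "mass \<mu> x = measure \<mu> {r \<in> space \<mu>. 1 - r \<le> x}"

definition doubling :: "real measure \<Rightarrow> bool"
  where "doubling \<mu> \<longleftrightarrow> (\<exists>C\<ge>1. \<forall>x>0. mass \<mu> x \<le> C * mass \<mu> (x / 2))"

text \<open>The restriction to x <= 1 is essential: from x = K on, \<open>mass\<close> has the same
  positive value at x and at x / K. In \<open>doubling\<close> no bound on x is imposed, since
  beyond 2 both sides show the total mass.\<close>

definition contracting :: "real measure \<Rightarrow> bool"
  where "contracting \<mu> \<longleftrightarrow> (\<exists>K>1. \<exists>C>1. \<forall>x. 0 < x \<longrightarrow> x \<le> 1 \<longrightarrow> C * mass \<mu> (x / K) \<le> mass \<mu> x)"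

definition shifted :: "real measure \<Rightarrow> real \<Rightarrow> real measure"
  where "shifted \<mu> \<beta> = density \<mu> (\<lambda>r. ennreal ((1 - r) powr \<beta>))"

locale radial = finite_measure \<mu> for \<mu> :: "real measure" +
  assumes sets_\<mu>: "sets \<mu> = sets (restrict_space borel {0..<1})"
    and mass_pos: "0 < x \<Longrightarrow> 0 < mass \<mu> x"
begin

lemma space_\<mu>: "space \<mu> = {0..<1}"
  using sets_eq_imp_space_eq[OF sets_\<mu>] by (simp add: space_restrict_space)

lemma measurable_\<mu>: "F \<in> borel \<rightarrow>\<^sub>M M \<Longrightarrow> F \<in> \<mu> \<rightarrow>\<^sub>M M"
proof -
  assume "F \<in> borel \<rightarrow>\<^sub>M M"
  then have "F \<in> restrict_space borel {0..<1} \<rightarrow>\<^sub>M M"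
    by (rule measurable_restrict_space1)
  then show ?thesis
    using sets_\<mu> by (simp cong: measurable_cong_sets)
qed

lemma measurable_mono_on: "mono_on {0..<1} u \<Longrightarrow> u \<in> borel_measurable \<mu>" for u :: "real \<Rightarrow> real"
  using borel_measurable_mono_on_fnc[of "{0..<1}" u] sets_\<mu> by (simp cong: measurable_cong_sets)

lemma sets_\<mu>_iff: "A \<in> sets \<mu> \<longleftrightarrow> A \<subseteq> {0..<1} \<and> A \<in> sets borel"
  unfolding sets_\<mu> by (subst sets_restrict_space_iff) auto

lemma mass_set: "{r \<in> space \<mu>. 1 - r \<le> x} \<in> sets \<mu>"
proof -
  have "{r \<in> space \<mu>. 1 - r \<le> x} = {0..<1} \<inter> {1 - x..}"
    by (auto simp: space_\<mu>)
  then show ?thesis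
    unfolding sets_\<mu>_iff by auto
qed

lemma emeasure_mass: "emeasure \<mu> {r \<in> space \<mu>. 1 - r \<le> x} = ennreal (mass \<mu> x)"
  unfolding mass_def by (rule emeasure_eq_measure)

lemma mass_mono: "x \<le> y \<Longrightarrow> mass \<mu> x \<le> mass \<mu> y"
  unfolding mass_def by (rule finite_measure_mono) (auto simp: mass_set)

lemma mass_ge_1: "1 \<le> x \<Longrightarrow> mass \<mu> x = measure \<mu> (space \<mu>)"
proof -
  assume "1 \<le> x"
  then have "{r \<in> space \<mu>. 1 - r \<le> x} = space \<mu>"
    by (auto simp: space_\<mu>)
  then show ?thesis
    by (simp add: mass_def)
qed

lemma emeasure_atLeast: "0 \<le> s \<Longrightarrow> emeasure \<mu> {s..<1} = ennreal (mass \<mu> (1 - s))"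
proof -
  assume "0 \<le> s"
  then have "{r \<in> space \<mu>. 1 - r \<le> 1 - s} = {s..<1}"
    by (auto simp: space_\<mu>)
  then show ?thesis
    using emeasure_mass[of "1 - s"] by simp
qed

text \<open>A nonempty set closed upwards in [0,1) is either [s,1) or (s,1). In the open case it is
  an increasing union of half-open intervals whose left ends lie in the set, so the bound passes to
  the limit.\<close>

lemma emeasure_upset_le:
  fixes B :: ennreal
  assumes M: "sets M = sets \<mu>" and U: "U \<subseteq> {0..<1}"
    and up: "\<And>x y. y \<in> U \<Longrightarrow> y \<le> x \<Longrightarrow> x < 1 \<Longrightarrow> x \<in> U"
    and le: "\<And>s. s \<in> U \<Longrightarrow> emeasure M {s..<1} \<le> B"
  shows "emeasure M U \<le> B"
proof (cases "U = {}")
  case False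
  define s where "s = Inf U"
  have bdd: "bdd_below U"
    using U by (intro bdd_belowI[of _ 0]) auto
  have s_le: "s \<le> r" if "r \<in> U" for r
    unfolding s_def using that bdd by (rule cInf_lower)
  have s_lt: "r \<in> U" if sr: "s < r" "r < 1" for r
  proof -
    obtain y where "y \<in> U" "y < r"
      using cInf_lessD[OF False, of r] sr(1) unfolding s_def by blast
    then show ?thesis
      using up sr(2) by auto
  qed
  obtain y where "y \<in> U"
    using False by blast
  then have s1: "s < 1"
    using s_le[of y] U by (auto dest: subsetD)
  have s0: "0 \<le> s"
    unfolding s_def by (rule cInf_greatest[OF False]) (use U in auto)
  show "emeasure M U \<le> B"
  proof (cases "s \<in> U")
    case True
    have "U = {s..<1}"
    proof
      show "U \<subseteq> {s..<1}"
        using s_le U by auto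
      show "{s..<1} \<subseteq> U"
        using up[OF True] by auto
    qed
    then show ?thesis
      using le[OF True] by simp
  next
    case False
    \<comment> \<open>The shift by 2 keeps the left ends strictly between s and 1.\<close>
    define A where "A n = {s + (1 - s) / (real n + 2)..<1}" for n :: nat
    have mem: "s + (1 - s) / (real n + 2) \<in> U" for n
    proof (rule s_lt)
      have "(1 - s) / (real n + 2) < (1 - s) / 1"
        using s1 by (intro divide_strict_left_mono) auto
      then show "s + (1 - s) / (real n + 2) < 1"
        by simp
    qed (use s1 in simp)
    have UA: "U = (\<Union>n. A n)"
    proof
      show "U \<subseteq> (\<Union>n. A n)"
      proof
        fix x assume x: "x \<in> U"
        then have "s < x" "x < 1"
          using s_le[OF x] False U by (auto simp: less_le)
        then obtain n where n: "(1 - s) / (x - s) < real n"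
          using reals_Archimedean2 by blast
        have "(1 - s) / (real n + 2) \<le> x - s"
        proof -
          have "1 - s < real n * (x - s)"
            using n \<open>s < x\<close> by (simp add: pos_divide_less_eq)
          also have "\<dots> \<le> (real n + 2) * (x - s)"
            using \<open>s < x\<close> by (intro mult_right_mono) auto
          finally show ?thesis
            by (simp add: pos_divide_le_eq mult.commute)
        qed
        then show "x \<in> (\<Union>n. A n)"
          using \<open>x < 1\<close> by (auto simp: A_def intro!: exI[of _ n])
      qed
      show "(\<Union>n. A n) \<subseteq> U"
        using up[OF mem] by (auto simp: A_def)
    qed
    have inc: "incseq A"
      unfolding incseq_def A_def
    proof (intro allI impI)
      fix m n :: nat assume "m \<le> n"
      then have "(1 - s) / (real n + 2) \<le> (1 - s) / (real m + 2)"
        using s1 by (intro divide_left_mono) auto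
      then show "{s + (1 - s) / (real m + 2)..<1} \<subseteq> {s + (1 - s) / (real n + 2)..<1}"
        by auto
    qed
    have ran: "range A \<subseteq> sets \<mu>"
      using s1 s0 by (auto simp: sets_\<mu>_iff A_def intro: order_trans[OF s0])
    have "emeasure M U = (SUP n. emeasure M (A n))"
      unfolding UA using ran inc M by (intro SUP_emeasure_incseq[symmetric]) auto
    also have "\<dots> \<le> B"
      unfolding A_def by (intro SUP_least le mem)
    finally show ?thesis .
  qed
qed simp

text \<open>Layer cake: the superlevel sets of an increasing function are intervals ending at \<open>1\<close>.\<close>

lemma nn_integral_mono_le_of_tails:
  fixes u :: "real \<Rightarrow> real" and c :: ennreal
  assumes fin: "finite_measure M" and M: "sets M = sets \<mu>"
    and u: "mono_on {0..<1} u" "\<And>r. r \<in> {0..<1} \<Longrightarrow> 0 \<le> u r"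
    and le: "\<And>s. 0 \<le> s \<Longrightarrow> s < 1 \<Longrightarrow> 0 < s \<or> 0 < u 0 \<Longrightarrow> emeasure M {s..<1} \<le> c * emeasure \<mu> {s..<1}"
  shows "(\<integral>\<^sup>+r. ennreal (u r) \<partial>M) \<le> c * (\<integral>\<^sup>+r. ennreal (u r) \<partial>\<mu>)"
proof -
  interpret M: finite_measure M
    by (rule fin)
  have um: "u \<in> borel_measurable \<mu>"
    by (rule measurable_mono_on[OF u(1)])
  have level_eq: "(\<integral>\<^sup>+r. (if 0 \<le> t \<and> t < u r then 1 else 0) \<partial>N) = emeasure N {r \<in> {0..<1}. t < u r} * indicator {0..} t"
    if N: "sets N = sets \<mu>" for N t
  proof -
    have spN: "space N = {0..<1}"
      using sets_eq_imp_space_eq[OF N] space_\<mu> by simp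
    have [measurable]: "u \<in> borel_measurable N"
      using um N by (simp cong: measurable_cong_sets)
    have "{r \<in> space N. t < u r} \<in> sets N"
      by measurable
    then have "emeasure N {r \<in> {0..<1}. t < u r} = (\<integral>\<^sup>+r. indicator {r \<in> {0..<1}. t < u r} r \<partial>N)"
      by (simp add: spN)
    also have "\<dots> = (\<integral>\<^sup>+r. (if t < u r then 1 else 0) \<partial>N)"
      by (rule nn_integral_cong) (auto simp: spN indicator_def)
    finally show ?thesis
      by (auto simp: indicator_def)
  qed
  have cake: "(\<integral>\<^sup>+r. ennreal (u r) \<partial>N) = (\<integral>\<^sup>+t. emeasure N {r \<in> {0..<1}. t < u r} * indicator {0..} t \<partial>lborel)"
    if "finite_measure N" and N: "sets N = sets \<mu>" for N
  proof -
    interpret N: finite_measure N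
      by fact
    interpret P: pair_sigma_finite lborel N ..
    have [measurable]: "u \<in> borel_measurable N"
      using um N by (simp cong: measurable_cong_sets)
    have "(\<integral>\<^sup>+r. ennreal (u r) \<partial>N) = (\<integral>\<^sup>+r. \<integral>\<^sup>+t. (if 0 \<le> t \<and> t < u r then 1 else 0) \<partial>lborel \<partial>N)"
    proof (rule nn_integral_cong)
      fix r assume "r \<in> space N"
      then have "0 \<le> u r"
        using u(2) sets_eq_imp_space_eq[OF N] space_\<mu> by auto
      moreover have "(\<lambda>t. if 0 \<le> t \<and> t < u r then 1 else 0) = (indicator {0..<u r} :: real \<Rightarrow> ennreal)"
        by (auto simp: indicator_def)
      ultimately show "ennreal (u r) = (\<integral>\<^sup>+t. (if 0 \<le> t \<and> t < u r then 1 else 0) \<partial>lborel)"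
        by simp
    qed
    also have "\<dots> = (\<integral>\<^sup>+t. \<integral>\<^sup>+r. (if 0 \<le> t \<and> t < u r then 1 else 0) \<partial>N \<partial>lborel)"
      by (rule P.Fubini') measurable
    finally show ?thesis
      unfolding level_eq[OF N] .
  qed
  have level: "emeasure M {r \<in> {0..<1}. t < u r} \<le> c * emeasure \<mu> {r \<in> {0..<1}. t < u r}" if t: "0 \<le> t" for t
  proof (rule emeasure_upset_le[OF M])
    fix x y assume "y \<in> {r \<in> {0..<1}. t < u r}" "y \<le> x" "x < 1"
    then show "x \<in> {r \<in> {0..<1}. t < u r}"
      using mono_onD[OF u(1), of y x] by auto
  next
    fix s assume s: "s \<in> {r \<in> {0..<1}. t < u r}"
    have m: "{r \<in> {0..<1}. t < u r} \<in> sets \<mu>"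
    proof -
      have [measurable]: "u \<in> borel_measurable \<mu>"
        by (rule um)
      have "{r \<in> space \<mu>. t < u r} \<in> sets \<mu>"
        by measurable
      then show ?thesis
        by (simp only: space_\<mu>)
    qed
    \<comment> \<open>If s = 0, then 0 <= t < u 0, so the tail at 0 is compared only when
      \<open>u\<close> is positive there. This leaves room for comparisons that fail for the whole
      interval.\<close>
    have "emeasure M {s..<1} \<le> c * emeasure \<mu> {s..<1}"
      using s t by (intro le) (auto simp: less_le)
    also have "\<dots> \<le> c * emeasure \<mu> {r \<in> {0..<1}. t < u r}"
    proof (intro mult_left_mono emeasure_mono m)
      show "{s..<1} \<subseteq> {r \<in> {0..<1}. t < u r}"
      proof
        fix r assume r: "r \<in> {s..<1}"
        then show "r \<in> {r \<in> {0..<1}. t < u r}"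
          using s mono_onD[OF u(1), of s r] by auto
      qed
    qed simp
    finally show "emeasure M {s..<1} \<le> c * emeasure \<mu> {r \<in> {0..<1}. t < u r}" .
  qed auto
  have mm: "(\<lambda>t. emeasure \<mu> {r \<in> {0..<1}. t < u r} * indicator {0..} t) \<in> borel_measurable lborel"
  proof -
    have [measurable]: "u \<in> borel_measurable \<mu>"
      by (rule um)
    have "(\<lambda>t. \<integral>\<^sup>+r. (if 0 \<le> t \<and> t < u r then 1 else 0 :: ennreal) \<partial>\<mu>) \<in> borel_measurable lborel"
      by measurable
    then show ?thesis
      unfolding level_eq[OF refl] .
  qed
  have "(\<integral>\<^sup>+r. ennreal (u r) \<partial>M) = (\<integral>\<^sup>+t. emeasure M {r \<in> {0..<1}. t < u r} * indicator {0..} t \<partial>lborel)"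
    using fin M by (rule cake)
  also have "\<dots> \<le> (\<integral>\<^sup>+t. c * (emeasure \<mu> {r \<in> {0..<1}. t < u r} * indicator {0..} t) \<partial>lborel)"
    using level by (intro nn_integral_mono) (auto simp: indicator_def)
  also have "\<dots> = c * (\<integral>\<^sup>+t. emeasure \<mu> {r \<in> {0..<1}. t < u r} * indicator {0..} t \<partial>lborel)"
    by (rule nn_integral_cmult[OF mm])
  also have "\<dots> = c * (\<integral>\<^sup>+r. ennreal (u r) \<partial>\<mu>)"
    by (subst cake) (auto intro: finite_measure_axioms)
  finally show ?thesis .
qed

lemma compose_measurable:
  assumes "g \<in> borel_measurable borel" "\<And>r. r \<in> {0..<1} \<Longrightarrow> g r \<in> {0..<1}"
  shows "g \<in> \<mu> \<rightarrow>\<^sub>M \<mu>"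
proof -
  have "g \<in> restrict_space borel {0..<1} \<rightarrow>\<^sub>M restrict_space borel {0..<1}"
    by (rule measurable_restrict_space3) (use assms in auto)
  then show ?thesis
    using sets_\<mu> by (simp cong: measurable_cong_sets)
qed

text \<open>The comparison of tails is applied to the image of \<mu> under g.\<close>

lemma nn_integral_mono_compose_le:
  fixes u g :: "real \<Rightarrow> real" and c :: ennreal
  assumes g: "g \<in> borel_measurable borel" "\<And>r. r \<in> {0..<1} \<Longrightarrow> g r \<in> {0..<1}"
    and u: "mono_on {0..<1} u" "\<And>r. r \<in> {0..<1} \<Longrightarrow> 0 \<le> u r"
    and le: "\<And>s. 0 \<le> s \<Longrightarrow> s < 1 \<Longrightarrow> 0 < s \<or> 0 < u 0 \<Longrightarrow>
      emeasure \<mu> {r \<in> {0..<1}. s \<le> g r} \<le> c * emeasure \<mu> {s..<1}"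
  shows "(\<integral>\<^sup>+r. ennreal (u (g r)) \<partial>\<mu>) \<le> c * (\<integral>\<^sup>+r. ennreal (u r) \<partial>\<mu>)"
proof -
  have gm: "g \<in> \<mu> \<rightarrow>\<^sub>M \<mu>"
    by (rule compose_measurable[OF g])
  have um: "(\<lambda>r. ennreal (u r)) \<in> borel_measurable \<mu>"
    using measurable_mono_on[OF u(1)] by simp
  have "(\<integral>\<^sup>+r. ennreal (u (g r)) \<partial>\<mu>) = (\<integral>\<^sup>+r. ennreal (u r) \<partial>distr \<mu> \<mu> g)"
    using nn_integral_distr[OF gm, of "\<lambda>r. ennreal (u r)"] um by simp
  also have "\<dots> \<le> c * (\<integral>\<^sup>+r. ennreal (u r) \<partial>\<mu>)"
  proof (rule nn_integral_mono_le_of_tails[OF _ _ u])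
    show "finite_measure (distr \<mu> \<mu> g)"
      by (rule finite_measure_distr[OF gm])
    fix s :: real assume s: "0 \<le> s" "s < 1" "0 < s \<or> 0 < u 0"
    have "emeasure (distr \<mu> \<mu> g) {s..<1} = emeasure \<mu> (g -` {s..<1} \<inter> space \<mu>)"
      using s by (intro emeasure_distr gm) (auto simp: sets_\<mu>_iff)
    also have "g -` {s..<1} \<inter> space \<mu> = {r \<in> {0..<1}. s \<le> g r}"
    proof (rule set_eqI)
      fix x show "x \<in> g -` {s..<1} \<inter> space \<mu> \<longleftrightarrow> x \<in> {r \<in> {0..<1}. s \<le> g r}"
        using g(2)[of x] unfolding space_\<mu> by (cases "x \<in> {0..<1}") auto
    qed
    also have "emeasure \<mu> \<dots> \<le> c * emeasure \<mu> {s..<1}"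
      using s by (rule le)
    finally show "emeasure (distr \<mu> \<mu> g) {s..<1} \<le> c * emeasure \<mu> {s..<1}" .
  qed simp_all
  finally show ?thesis .
qed

text \<open>The map r -> (1 + r) / 2 halves the distance to 1, so the tail of its image measure at s
  is the mass at 2 (1 - s).\<close>

lemma doubling_nn_integral:
  assumes C: "1 \<le> C" "\<And>x. 0 < x \<Longrightarrow> mass \<mu> x \<le> C * mass \<mu> (x / 2)"
    and u: "mono_on {0..<1} u" "\<And>r. r \<in> {0..<1} \<Longrightarrow> 0 \<le> u r"
  shows "(\<integral>\<^sup>+r. ennreal (u ((1 + r) / 2)) \<partial>\<mu>) \<le> ennreal C * (\<integral>\<^sup>+r. ennreal (u r) \<partial>\<mu>)"
proof (rule nn_integral_mono_compose_le[OF _ _ u])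
  fix s :: real assume s: "0 \<le> s" "s < 1"
  have e: "2 * (1 - s) / 2 = 1 - s"
    by simp
  have "{r \<in> {0..<1}. s \<le> (1 + r) / 2} = {r \<in> space \<mu>. 1 - r \<le> 2 * (1 - s)}"
    by (auto simp: space_\<mu>)
  then have "emeasure \<mu> {r \<in> {0..<1}. s \<le> (1 + r) / 2} = ennreal (mass \<mu> (2 * (1 - s)))"
    by (simp only: emeasure_mass)
  also have "\<dots> \<le> ennreal (C * mass \<mu> (1 - s))"
    using C(2)[of "2 * (1 - s)", unfolded e] s by (intro ennreal_leI) simp
  also have "\<dots> = ennreal C * emeasure \<mu> {s..<1}"
    using C(1) s by (simp add: emeasure_atLeast ennreal_mult mass_def)
  finally show "emeasure \<mu> {r \<in> {0..<1}. s \<le> (1 + r) / 2} \<le> ennreal C * emeasure \<mu> {s..<1}" .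
qed auto

text \<open>Truncation at 0 preserves the total mass, so nothing is gained at s = 0. Subtracting
  \<open>u 0\<close> makes the integrand vanish at 0, and the contraction is then used only for s >
  0; the subtracted constant is paid for separately.\<close>

lemma contracting_nn_integral:
  assumes K: "1 < K" and C: "1 < C" "\<And>x. 0 < x \<Longrightarrow> x \<le> 1 \<Longrightarrow> C * mass \<mu> (x / K) \<le> mass \<mu> x"
    and u: "mono_on {0..<1} u" "\<And>r. r \<in> {0..<1} \<Longrightarrow> 0 \<le> u r"
  shows "(\<integral>\<^sup>+r. ennreal (u (max 0 (1 - K * (1 - r)))) \<partial>\<mu>) \<le>
    ennreal (u 0 * measure \<mu> (space \<mu>)) + ennreal (1 / C) * (\<integral>\<^sup>+r. ennreal (u r) \<partial>\<mu>)"
proof -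
  let ?g = "\<lambda>r. max 0 (1 - K * (1 - r))"
  have g: "?g \<in> borel_measurable borel"
    by measurable
  have g': "?g r \<in> {0..<1}" if "r \<in> {0..<1}" for r
    using that K by auto
  have ge: "u 0 \<le> u r" if "r \<in> {0..<1}" for r
    using that mono_onD[OF u(1), of 0 r] by auto
  have m: "mono_on {0..<1} (\<lambda>r. u r - u 0)"
    using u(1) by (auto simp: mono_on_def)
  have um: "(\<lambda>r. u (?g r)) \<in> borel_measurable \<mu>"
    by (rule measurable_compose[OF compose_measurable[OF g g'] measurable_mono_on[OF u(1)]])
  have "(\<integral>\<^sup>+r. ennreal (u (?g r)) \<partial>\<mu>) = (\<integral>\<^sup>+r. ennreal (u 0) + ennreal (u (?g r) - u 0) \<partial>\<mu>)"
    by (rule nn_integral_cong) (use ge g' u(2)[of 0] in \<open>simp add: space_\<mu> ennreal_plus[symmetric] del: ennreal_plus\<close>)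
  also have "\<dots> = (\<integral>\<^sup>+r. ennreal (u 0) \<partial>\<mu>) + (\<integral>\<^sup>+r. ennreal (u (?g r) - u 0) \<partial>\<mu>)"
    by (rule nn_integral_add) (use um in auto)
  also have "(\<integral>\<^sup>+r. ennreal (u 0) \<partial>\<mu>) = ennreal (u 0 * measure \<mu> (space \<mu>))"
    using u(2)[of 0] by (simp add: emeasure_eq_measure ennreal_mult)
  also have "(\<integral>\<^sup>+r. ennreal (u (?g r) - u 0) \<partial>\<mu>) \<le> ennreal (1 / C) * (\<integral>\<^sup>+r. ennreal (u r - u 0) \<partial>\<mu>)"
  proof (rule nn_integral_mono_compose_le[where u = "\<lambda>r. u r - u 0", OF g g' m])
    fix s :: real assume s: "0 \<le> s" "s < 1" "0 < s \<or> 0 < u 0 - u 0"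
    then have s0: "0 < s"
      by auto
    have "s \<le> ?g r \<longleftrightarrow> 1 - r \<le> (1 - s) / K" for r
      using s0 K by (auto simp: field_simps max_def)
    then have "{r \<in> {0..<1}. s \<le> ?g r} = {r \<in> space \<mu>. 1 - r \<le> (1 - s) / K}"
      by (auto simp: space_\<mu>)
    then have "emeasure \<mu> {r \<in> {0..<1}. s \<le> ?g r} = ennreal (mass \<mu> ((1 - s) / K))"
      by (simp only: emeasure_mass)
    also have "\<dots> \<le> ennreal (1 / C * mass \<mu> (1 - s))"
      using C(2)[of "1 - s"] C(1) s s0 by (intro ennreal_leI) (simp add: field_simps)
    also have "\<dots> = ennreal (1 / C) * emeasure \<mu> {s..<1}"
      using C(1) s by (simp add: emeasure_atLeast ennreal_mult[symmetric] mass_def)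
    finally show "emeasure \<mu> {r \<in> {0..<1}. s \<le> ?g r} \<le> ennreal (1 / C) * emeasure \<mu> {s..<1}" .
  qed (use ge in auto)
  also have "(\<integral>\<^sup>+r. ennreal (u r - u 0) \<partial>\<mu>) \<le> (\<integral>\<^sup>+r. ennreal (u r) \<partial>\<mu>)"
    using u(2)[of 0] by (intro nn_integral_mono ennreal_leI) simp
  finally show ?thesis
    by (simp add: add_left_mono mult_left_mono)
qed

lemma sets_shifted [simp]: "sets (shifted \<mu> \<beta>) = sets \<mu>"
  and space_shifted [simp]: "space (shifted \<mu> \<beta>) = space \<mu>"
  by (simp_all add: shifted_def)

lemma powr_measurable: "(\<lambda>r. ennreal ((1 - r) powr \<beta>)) \<in> borel_measurable \<mu>"
  by (rule measurable_\<mu>) measurable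

lemma nn_integral_shifted:
  assumes "F \<in> borel_measurable \<mu>"
  shows "(\<integral>\<^sup>+r. F r \<partial>shifted \<mu> \<beta>) = (\<integral>\<^sup>+r. ennreal ((1 - r) powr \<beta>) * F r \<partial>\<mu>)"
  unfolding shifted_def by (rule nn_integral_density[OF powr_measurable assms])

lemma shifted_shifted: "shifted (shifted \<mu> \<alpha>) \<beta> = shifted \<mu> (\<alpha> + \<beta>)"
proof -
  have "(\<lambda>r. ennreal ((1 - r) powr \<alpha>) * ennreal ((1 - r) powr \<beta>)) = (\<lambda>r. ennreal ((1 - r) powr (\<alpha> + \<beta>)))"
    by (simp add: ennreal_mult[symmetric] powr_add)
  then show ?thesis
    unfolding shifted_def by (simp add: density_density_eq powr_measurable)
qed

lemma finite_shifted: "0 \<le> \<beta> \<Longrightarrow> finite_measure (shifted \<mu> \<beta>)"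
proof
  assume \<beta>: "0 \<le> \<beta>"
  have "emeasure (shifted \<mu> \<beta>) (space (shifted \<mu> \<beta>)) = (\<integral>\<^sup>+r. 1 \<partial>shifted \<mu> \<beta>)"
    by simp
  also have "\<dots> = (\<integral>\<^sup>+r. ennreal ((1 - r) powr \<beta>) * 1 \<partial>\<mu>)"
    by (rule nn_integral_shifted) simp
  also have "\<dots> \<le> (\<integral>\<^sup>+r. 1 \<partial>\<mu>)"
    using \<beta> by (intro nn_integral_mono) (auto simp: space_\<mu> intro!: powr_le1)
  also have "\<dots> < \<infinity>"
    using finite_emeasure_space by (simp add: less_top[symmetric])
  finally show "emeasure (shifted \<mu> \<beta>) (space (shifted \<mu> \<beta>)) \<noteq> \<infinity>"
    by simp
qed

lemma shifted_measure_le: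
  assumes \<beta>: "0 \<le> \<beta>" and A: "A \<in> sets \<mu>" and c: "\<And>r. r \<in> A \<Longrightarrow> 1 - r \<le> c" "0 \<le> c"
  shows "measure (shifted \<mu> \<beta>) A \<le> c powr \<beta> * measure \<mu> A"
proof -
  interpret S: finite_measure "shifted \<mu> \<beta>"
    by (rule finite_shifted[OF \<beta>])
  have "ennreal (measure (shifted \<mu> \<beta>) A) = emeasure (shifted \<mu> \<beta>) A"
    by (simp add: S.emeasure_eq_measure)
  also have "\<dots> = (\<integral>\<^sup>+r. ennreal ((1 - r) powr \<beta>) * indicator A r \<partial>\<mu>)"
    unfolding shifted_def by (rule emeasure_density[OF powr_measurable A])
  also have "\<dots> \<le> (\<integral>\<^sup>+r. ennreal (c powr \<beta>) * indicator A r \<partial>\<mu>)"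
    using c \<beta> A by (intro nn_integral_mono) (auto simp: indicator_def space_\<mu> sets_\<mu>_iff intro!: ennreal_leI powr_mono2)
  also have "\<dots> = ennreal (c powr \<beta> * measure \<mu> A)"
    using A by (simp add: nn_integral_cmult emeasure_eq_measure ennreal_mult)
  finally show ?thesis
    by simp
qed

lemma shifted_measure_ge:
  assumes \<beta>: "0 \<le> \<beta>" and A: "A \<in> sets \<mu>" and c: "\<And>r. r \<in> A \<Longrightarrow> c \<le> 1 - r" "0 \<le> c"
  shows "c powr \<beta> * measure \<mu> A \<le> measure (shifted \<mu> \<beta>) A"
proof -
  interpret S: finite_measure "shifted \<mu> \<beta>"
    by (rule finite_shifted[OF \<beta>])
  have "ennreal (c powr \<beta> * measure \<mu> A) = (\<integral>\<^sup>+r. ennreal (c powr \<beta>) * indicator A r \<partial>\<mu>)"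
    using A by (simp add: nn_integral_cmult emeasure_eq_measure ennreal_mult)
  also have "\<dots> \<le> (\<integral>\<^sup>+r. ennreal ((1 - r) powr \<beta>) * indicator A r \<partial>\<mu>)"
    using c \<beta> A by (intro nn_integral_mono) (auto simp: indicator_def space_\<mu> sets_\<mu>_iff intro!: ennreal_leI powr_mono2)
  also have "\<dots> = emeasure (shifted \<mu> \<beta>) A"
    unfolding shifted_def by (rule emeasure_density[OF powr_measurable A, symmetric])
  also have "\<dots> = ennreal (measure (shifted \<mu> \<beta>) A)"
    by (simp add: S.emeasure_eq_measure)
  finally show ?thesis
    by simp
qed

text \<open>The contraction leaves a fixed fraction of the mass of 1 - r <= x in the annulus x / K <
  1 - r <= x, where (1 - r)^\<beta> is comparable with x^\<beta>. Hence the shifted mass at x is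
  comparable with x^\<beta> times the old mass. The contraction itself survives with the same K and
  C, since the density is at least (x / K)^\<beta> on the annulus and at most that inside.\<close>

lemma shifted_regular:
  assumes \<beta>: "0 \<le> \<beta>" and D: "doubling \<mu>" and E: "contracting \<mu>"
  shows "radial (shifted \<mu> \<beta>)" "doubling (shifted \<mu> \<beta>)" "contracting (shifted \<mu> \<beta>)"
proof -
  interpret S: finite_measure "shifted \<mu> \<beta>"
    by (rule finite_shifted[OF \<beta>])
  obtain K C where K: "1 < K" and C: "1 < C" "\<And>x. 0 < x \<Longrightarrow> x \<le> 1 \<Longrightarrow> C * mass \<mu> (x / K) \<le> mass \<mu> x"
    using E by (auto simp: contracting_def)
  obtain B where B: "1 \<le> B" "\<And>x. 0 < x \<Longrightarrow> mass \<mu> x \<le> B * mass \<mu> (x / 2)"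
    using D by (auto simp: doubling_def)
  let ?N = "mass (shifted \<mu> \<beta>)"
  have mset: "{r \<in> space \<mu>. 1 - r \<le> x} \<in> sets \<mu>" for x
    by (rule mass_set)
  have upper: "?N x \<le> x powr \<beta> * mass \<mu> x" if "0 < x" for x
    unfolding mass_def space_shifted by (rule shifted_measure_le[OF \<beta> mset]) (use that in auto)
  have split: "?N (x / K) + (x / K) powr \<beta> * (mass \<mu> x - mass \<mu> (x / K)) \<le> ?N x" if x: "0 < x" for x
  proof -
    let ?A = "{r \<in> space \<mu>. 1 - r \<le> x / K}" and ?B = "{r \<in> space \<mu>. 1 - r \<le> x}"
    have sub: "?A \<subseteq> ?B"
    proof -
      have "x / K \<le> x"
        using x K by (simp add: field_simps)
      then show ?thesis
        by auto
    qed
    have "(x / K) powr \<beta> * measure \<mu> (?B - ?A) \<le> measure (shifted \<mu> \<beta>) (?B - ?A)"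
      by (rule shifted_measure_ge[OF \<beta>]) (use mset x K in auto)
    moreover have "measure \<mu> (?B - ?A) = mass \<mu> x - mass \<mu> (x / K)"
      unfolding mass_def by (rule finite_measure_Diff) (use mset sub in auto)
    moreover have "measure (shifted \<mu> \<beta>) (?B - ?A) = ?N x - ?N (x / K)"
      unfolding mass_def space_shifted by (rule S.finite_measure_Diff) (use mset sub in auto)
    ultimately show ?thesis
      by simp
  qed
  have lower: "(x / K) powr \<beta> * (1 - 1 / C) * mass \<mu> x \<le> ?N x" if x: "0 < x" "x \<le> 1" for x
  proof -
    have "mass \<mu> (x / K) \<le> mass \<mu> x / C"
      using C(2)[OF x] C(1) by (simp add: field_simps)
    then have "(1 - 1 / C) * mass \<mu> x \<le> mass \<mu> x - mass \<mu> (x / K)"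
      by (simp add: algebra_simps)
    then have "(x / K) powr \<beta> * ((1 - 1 / C) * mass \<mu> x) \<le> (x / K) powr \<beta> * (mass \<mu> x - mass \<mu> (x / K))"
      by (rule mult_left_mono) simp
    moreover have "0 \<le> ?N (x / K)"
      by (simp add: mass_def)
    ultimately show ?thesis
      using split[OF x(1)] by (simp add: mult.assoc)
  qed
  have Nmono: "?N x \<le> ?N y" if "x \<le> y" for x y
    unfolding mass_def by (rule S.finite_measure_mono) (use that mset in auto)
  show "radial (shifted \<mu> \<beta>)"
  proof
    show "sets (shifted \<mu> \<beta>) = sets (restrict_space borel {0..<1})"
      by (simp add: sets_\<mu>)
    fix x :: real assume x: "0 < x"
    define y where "y = min x 1"
    have "0 < (y / K) powr \<beta> * (1 - 1 / C) * mass \<mu> y"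
      using x K C(1) mass_pos[of y] by (auto simp: y_def)
    also have "\<dots> \<le> ?N y"
      using x by (intro lower) (auto simp: y_def)
    also have "\<dots> \<le> ?N x"
      by (rule Nmono) (simp add: y_def)
    finally show "0 < ?N x" .
  qed
  show "contracting (shifted \<mu> \<beta>)"
    unfolding contracting_def
  proof (intro exI conjI allI impI)
    fix x :: real assume x: "0 < x" "x \<le> 1"
    have "(C - 1) * ?N (x / K) \<le> (C - 1) * ((x / K) powr \<beta> * mass \<mu> (x / K))"
      using upper[of "x / K"] x K C(1) by (intro mult_left_mono) auto
    also have "\<dots> = (x / K) powr \<beta> * (C * mass \<mu> (x / K) - mass \<mu> (x / K))"
      by (simp add: algebra_simps)
    also have "\<dots> \<le> (x / K) powr \<beta> * (mass \<mu> x - mass \<mu> (x / K))"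
      using C(2)[OF x] by (intro mult_left_mono) auto
    finally show "C * ?N (x / K) \<le> ?N x"
      using split[OF x(1)] by (simp add: algebra_simps)
  qed (use K C in auto)
  \<comment> \<open>The quotient of \<open>upper\<close> at x by \<open>lower\<close> at x / 2, with
    one doubling step in between: (2 K)^\<beta> compares the powers and C / (C - 1) inverts 1 - 1 /
    C.\<close>
  define B' where "B' = (2 * K) powr \<beta> * B * (C / (C - 1))"
  have B': "1 \<le> B'"
  proof -
    have a: "1 \<le> (2 * K) powr \<beta>"
      using K \<beta> by (intro ge_one_powr_ge_zero) auto
    have b: "1 \<le> C / (C - 1)"
      using C(1) by (simp add: field_simps)
    have "1 * 1 \<le> (2 * K) powr \<beta> * B"
      by (rule mult_mono) (use a B(1) in auto)
    then have "1 * 1 \<le> ((2 * K) powr \<beta> * B) * (C / (C - 1))"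
      by (intro mult_mono) (use b in auto)
    then show ?thesis
      by (simp add: B'_def)
  qed
  show "doubling (shifted \<mu> \<beta>)"
    unfolding doubling_def
  proof (intro exI conjI allI impI)
    fix x :: real assume x: "0 < x"
    show "?N x \<le> B' * ?N (x / 2)"
    proof (cases "x \<le> 2")
      case True
      have "?N x \<le> x powr \<beta> * (B * mass \<mu> (x / 2))"
        using upper[OF x] B(2)[OF x] by (meson mult_left_mono order_trans powr_ge_zero)
      also have "\<dots> = B' * ((x / 2 / K) powr \<beta> * (1 - 1 / C) * mass \<mu> (x / 2))"
      proof -
        have 1: "(2 * K) powr \<beta> * (x / 2 / K) powr \<beta> = x powr \<beta>"
          using x K by (subst powr_mult[symmetric]) auto
        have 2: "C / (C - 1) * (1 - 1 / C) = 1"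
          using C(1) by (simp add: field_simps)
        have "(a * B * c) * (a' * c' * m) = (a * a') * (B * m) * (c * c')" for a c a' c' m :: real
          by (simp add: mult_ac)
        then show ?thesis
          unfolding B'_def by (simp only: 1 2 mult_1_right)
      qed
      also have "\<dots> \<le> B' * ?N (x / 2)"
        using B' x True by (intro mult_left_mono lower) auto
      finally show ?thesis .
    next
      case False
      have "{r \<in> space \<mu>. 1 - r \<le> x} = {r \<in> space \<mu>. 1 - r \<le> x / 2}"
        using False by (auto simp: space_\<mu>)
      then have "?N x = 1 * ?N (x / 2)"
        by (simp add: mass_def)
      also have "\<dots> \<le> B' * ?N (x / 2)"
        using B' by (intro mult_right_mono) (auto simp: mass_def)
      finally show ?thesis .
    qed
  qed (use B' in auto)
qed

end

subsection \<open>Littlewood-Paley estimates\<close>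

text \<open>Through polar coordinates this is the p-th power of the Bergman norm. Extended
  nonnegative values allow estimates before membership in the space is known.\<close>

definition mean_integral :: "real measure \<Rightarrow> real \<Rightarrow> (complex \<Rightarrow> complex) \<Rightarrow> ennreal"
  where "mean_integral \<mu> p f = (\<integral>\<^sup>+r. ennreal (circle_mean p f r) \<partial>\<mu>)"

lemma circle_mean_mono_on: "f holomorphic_on disc \<Longrightarrow> 1 < p \<Longrightarrow> mono_on {0..<1} (circle_mean p f)"
  by (intro mono_onI circle_mean_mono) auto

lemma holomorphic_funpow_deriv: "f holomorphic_on disc \<Longrightarrow> (deriv ^^ n) f holomorphic_on disc"
  by (induction n) (auto intro!: holomorphic_deriv)

lemma holomorphic_dilate:
  assumes "f holomorphic_on disc" "0 \<le> t" "t \<le> 1"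
  shows "(\<lambda>z. f (of_real t * z)) holomorphic_on disc"
proof -
  have "norm (of_real t * z) < 1" if "norm z < 1" for z :: complex
    using that assms(2,3) by (simp add: norm_mult) (meson le_less_trans mult_left_le_one_le norm_ge_zero)
  then have "(\<lambda>z. of_real t * z) ` disc \<subseteq> disc"
    by auto
  then show ?thesis
    using holomorphic_on_compose_gen[of "\<lambda>z. of_real t * z" disc f disc] assms(1)
    by (auto simp: o_def intro!: holomorphic_intros)
qed

lemma circle_mean_dilate: "circle_mean p (\<lambda>z. f (of_real t * z)) r = circle_mean p f (t * r)"
  by (simp add: circle_mean_def mult.assoc)

lemma circle_mean_deriv_dilate:
  assumes f: "f holomorphic_on disc" and t: "0 \<le> t" "t \<le> 1" and r: "0 \<le> r" "r < 1" and p: "1 < p"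
  shows "circle_mean p (deriv (\<lambda>z. f (of_real t * z))) r \<le> circle_mean p (deriv f) r"
proof -
  have f': "deriv f holomorphic_on disc"
    using f by (rule holomorphic_deriv) simp
  have tr: "t * r \<le> r" "t * r < 1" "0 \<le> t * r"
    using t r mult_left_le_one_le[of r t] by auto
  have "circle_mean p (deriv (\<lambda>z. f (of_real t * z))) r =
      (LINT \<xi>|circle. t powr p * norm (deriv f (of_real (t * r) * \<xi>)) powr p)"
    unfolding circle_mean_def
  proof (rule Bochner_Integration.integral_cong[OF refl])
    fix \<xi> assume "\<xi> \<in> space circle"
    then have "norm (of_real t * (of_real r * \<xi>)) < 1"
      using tr(2) t r by (simp add: norm_mult)
    then have "(f has_field_derivative deriv f (of_real t * (of_real r * \<xi>))) (at (of_real t * (of_real r * \<xi>)))"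
      using f by (intro holomorphic_derivI[of f disc]) auto
    moreover have "((\<lambda>z. of_real t * z) has_field_derivative of_real t) (at (of_real r * \<xi>))"
      by (auto intro!: derivative_eq_intros)
    ultimately have "((\<lambda>z. f (of_real t * z)) has_field_derivative
        deriv f (of_real t * (of_real r * \<xi>)) * of_real t) (at (of_real r * \<xi>))"
      by (rule DERIV_chain2)
    then have "deriv (\<lambda>z. f (of_real t * z)) (of_real r * \<xi>) = deriv f (of_real t * (of_real r * \<xi>)) * of_real t"
      by (rule DERIV_imp_deriv)
    also have "of_real t * (of_real r * \<xi>) = of_real (t * r) * \<xi>"
      by simp
    finally have "deriv (\<lambda>z. f (of_real t * z)) (of_real r * \<xi>) = of_real t * deriv f (of_real (t * r) * \<xi>)"
      by (simp only: mult.commute)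
    then show "norm (deriv (\<lambda>z. f (of_real t * z)) (of_real r * \<xi>)) powr p =
        t powr p * norm (deriv f (of_real (t * r) * \<xi>)) powr p"
      using t by (simp add: norm_mult powr_mult)
  qed
  also have "\<dots> = t powr p * circle_mean p (deriv f) (t * r)"
    by (simp add: circle_mean_def)
  also have "\<dots> \<le> 1 * circle_mean p (deriv f) r"
    using t p tr r by (intro mult_mono circle_mean_mono f') (auto intro!: powr_le1)
  finally show ?thesis
    by simp
qed

context radial
begin

lemma circle_mean_measurable:
  "f holomorphic_on disc \<Longrightarrow> 1 < p \<Longrightarrow> circle_mean p f \<in> borel_measurable \<mu>"
  by (intro measurable_mono_on circle_mean_mono_on)

lemma mean_integral_shifted:
  assumes "f holomorphic_on disc" "1 < p"
  shows "mean_integral (shifted \<mu> \<beta>) p f = (\<integral>\<^sup>+r. ennreal ((1 - r) powr \<beta> * circle_mean p f r) \<partial>\<mu>)"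
  unfolding mean_integral_def using circle_mean_measurable[OF assms]
  by (subst nn_integral_shifted) (auto simp: ennreal_mult)

text \<open>Cauchy's estimate with the radius (1 - r) / 2 costs exactly the factor (1 - r)^(-p) that
  the shifted measure supplies and moves the mean to (1 + r) / 2; doubling moves it back.\<close>

lemma mean_integral_deriv_le:
  assumes D: "doubling \<mu>" and p: "1 < p"
  shows "\<exists>c\<ge>0. \<forall>f. f holomorphic_on disc \<longrightarrow>
    mean_integral (shifted \<mu> p) p (deriv f) \<le> ennreal c * mean_integral \<mu> p f"
proof -
  obtain C where C: "1 \<le> C" "\<And>x. 0 < x \<Longrightarrow> mass \<mu> x \<le> C * mass \<mu> (x / 2)"
    using D by (auto simp: doubling_def)
  have "mean_integral (shifted \<mu> p) p (deriv f) \<le> ennreal (2 powr p * C) * mean_integral \<mu> p f"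
    if f: "f holomorphic_on disc" for f
  proof -
    have f': "deriv f holomorphic_on disc"
      using f by (rule holomorphic_deriv) simp
    have "mean_integral (shifted \<mu> p) p (deriv f) = (\<integral>\<^sup>+r. ennreal ((1 - r) powr p * circle_mean p (deriv f) r) \<partial>\<mu>)"
      by (rule mean_integral_shifted[OF f' p])
    also have "\<dots> \<le> (\<integral>\<^sup>+r. ennreal (2 powr p) * ennreal (circle_mean p f ((1 + r) / 2)) \<partial>\<mu>)"
    proof (rule nn_integral_mono)
      fix r assume "r \<in> space \<mu>"
      then have r: "0 \<le> r" "r < 1"
        by (auto simp: space_\<mu>)
      have "circle_mean p (deriv f) r \<le> ((1 - r) / 2) powr (- p) * circle_mean p f (r + (1 - r) / 2)"
        using r p by (intro circle_mean_deriv_le f) (auto simp: field_simps)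
      then have "(1 - r) powr p * circle_mean p (deriv f) r \<le>
          (1 - r) powr p * (((1 - r) / 2) powr (- p) * circle_mean p f (r + (1 - r) / 2))"
        by (rule mult_left_mono) simp
      also have "\<dots> = 2 powr p * circle_mean p f ((1 + r) / 2)"
      proof -
        have e1: "(1 - r) powr p * ((1 - r) / 2) powr (- p) = 2 powr p"
          using r by (simp add: powr_divide powr_minus field_simps)
        have e2: "r + (1 - r) / 2 = (1 + r) / 2"
          by (simp add: field_simps)
        show ?thesis
          by (simp only: mult.assoc[symmetric] e1 e2)
      qed
      finally show "ennreal ((1 - r) powr p * circle_mean p (deriv f) r) \<le>
          ennreal (2 powr p) * ennreal (circle_mean p f ((1 + r) / 2))"
        by (simp add: ennreal_mult[symmetric] ennreal_leI)
    qed
    also have "\<dots> = ennreal (2 powr p) * (\<integral>\<^sup>+r. ennreal (circle_mean p f ((1 + r) / 2)) \<partial>\<mu>)"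
    proof (rule nn_integral_cmult)
      have "(\<lambda>r. (1 + r) / 2) \<in> \<mu> \<rightarrow>\<^sub>M \<mu>"
        by (rule compose_measurable) auto
      from measurable_compose[OF this circle_mean_measurable[OF f p]]
      show "(\<lambda>r. ennreal (circle_mean p f ((1 + r) / 2))) \<in> borel_measurable \<mu>"
        by simp
    qed
    also have "\<dots> \<le> ennreal (2 powr p) * (ennreal C * mean_integral \<mu> p f)"
      unfolding mean_integral_def
      by (intro mult_left_mono doubling_nn_integral C circle_mean_mono_on f p) auto
    also have "\<dots> = ennreal (2 powr p * C) * mean_integral \<mu> p f"
      using C(1) by (simp add: ennreal_mult mult.assoc)
    finally show ?thesis .
  qed
  then show ?thesis
    using C(1) by (intro exI[of _ "2 powr p * C"]) auto
qed

text \<open>The mean at r is compared with the mean at max 0 (1 - K (1 - r)). By the contraction the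
  integral of the latter is at most a boundary term plus 1 / C times the full integral, which is
  absorbed; subtracting it is where finiteness is used.\<close>

lemma mean_integral_finite_le:
  assumes p: "1 < p" and K: "1 < K" and C: "1 < C" "\<And>x. 0 < x \<Longrightarrow> x \<le> 1 \<Longrightarrow> C * mass \<mu> (x / K) \<le> mass \<mu> x"
    and f: "f holomorphic_on disc" and fin: "mean_integral \<mu> p f < \<infinity>"
  defines "d \<equiv> (1 - 1 / C) / (2 * (p - 1))"
  defines "c \<equiv> (measure \<mu> (space \<mu>) + d powr (1 - p) * K powr p) / ((1 - 1 / C) / 2)"
  shows "mean_integral \<mu> p f \<le> ennreal c * (ennreal (norm (f 0) powr p) + mean_integral (shifted \<mu> p) p (deriv f))"
proof -
  have f': "deriv f holomorphic_on disc"
    using f by (rule holomorphic_deriv) simp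
  let ?M = "circle_mean p f" and ?M' = "circle_mean p (deriv f)"
  let ?g = "\<lambda>r. max 0 (1 - K * (1 - r))"
  define q where "q = 1 / C"
  have q: "0 < q" "q < 1"
    using C(1) by (auto simp: q_def)
  \<comment> \<open>The left coefficient (1 + q) / 2 lies halfway between q and 1, so subtracting q
    times the integral leaves (1 - q) / 2, the denominator of \<open>c\<close>.\<close>
  have d: "0 < d" "1 - d * (p - 1) = (1 + q) / 2"
    using q p by (auto simp: d_def q_def[symmetric] field_simps)
  define B where "B = d powr (1 - p) * K powr p"
  have B: "0 \<le> B"
    by (simp add: B_def)
  have g: "?g \<in> \<mu> \<rightarrow>\<^sub>M \<mu>"
    by (rule compose_measurable) (use K in auto)
  have m: "?M \<in> borel_measurable \<mu>" "?M' \<in> borel_measurable \<mu>"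
    by (intro circle_mean_measurable f f' p)+
  have mg: "(\<lambda>r. ?M (?g r)) \<in> borel_measurable \<mu>"
    by (rule measurable_compose[OF g m(1)])
  have "ennreal ((1 + q) / 2) * mean_integral \<mu> p f = (\<integral>\<^sup>+r. ennreal ((1 + q) / 2) * ennreal (?M r) \<partial>\<mu>)"
    unfolding mean_integral_def by (rule nn_integral_cmult[symmetric]) (use m in auto)
  also have "\<dots> \<le> (\<integral>\<^sup>+r. ennreal (?M (?g r)) + ennreal B * ennreal ((1 - r) powr p * ?M' r) \<partial>\<mu>)"
  proof (rule nn_integral_mono)
    fix r assume "r \<in> space \<mu>"
    then have r: "0 \<le> r" "r < 1"
      by (auto simp: space_\<mu>)
    have Kr: "1 - r \<le> K * (1 - r)"
      using K r mult_right_mono[of 1 K "1 - r"] by simp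
    then have gr: "?g r \<le> r"
      using r by linarith
    have "?M r * (1 - d * (p - 1)) \<le> ?M (?g r) + d powr (1 - p) * (r - ?g r) powr p * ?M' r"
      by (rule circle_mean_le_deriv[OF f _ gr _ p d(1)]) (use r in auto)
    also have "\<dots> \<le> ?M (?g r) + d powr (1 - p) * (K * (1 - r)) powr p * ?M' r"
    proof -
      have "0 \<le> r - ?g r" "r - ?g r \<le> K * (1 - r)"
        using gr r Kr by linarith+
      then show ?thesis
        using p by (intro add_left_mono mult_right_mono mult_left_mono powr_mono2) simp_all
    qed
    also have "\<dots> = ?M (?g r) + B * ((1 - r) powr p * ?M' r)"
      using r K by (simp add: B_def powr_mult mult_ac)
    finally have "ennreal ((1 + q) / 2 * ?M r) \<le> ennreal (?M (?g r) + B * ((1 - r) powr p * ?M' r))"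
      unfolding d by (simp add: mult.commute ennreal_leI)
    then show "ennreal ((1 + q) / 2) * ennreal (?M r) \<le> ennreal (?M (?g r)) + ennreal B * ennreal ((1 - r) powr p * ?M' r)"
      using q B by (simp add: ennreal_mult[symmetric] ennreal_plus[symmetric] del: ennreal_plus)
  qed
  also have "\<dots> = (\<integral>\<^sup>+r. ennreal (?M (?g r)) \<partial>\<mu>) + (\<integral>\<^sup>+r. ennreal B * ennreal ((1 - r) powr p * ?M' r) \<partial>\<mu>)"
    by (rule nn_integral_add) (use mg m measurable_\<mu>[of "\<lambda>r. (1 - r) powr p" borel] in auto)
  also have "(\<integral>\<^sup>+r. ennreal B * ennreal ((1 - r) powr p * ?M' r) \<partial>\<mu>) = ennreal B * mean_integral (shifted \<mu> p) p (deriv f)"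
    unfolding mean_integral_shifted[OF f' p]
    by (rule nn_integral_cmult) (use m measurable_\<mu>[of "\<lambda>r. (1 - r) powr p" borel] in auto)
  also have "(\<integral>\<^sup>+r. ennreal (?M (?g r)) \<partial>\<mu>) \<le>
      ennreal (?M 0 * measure \<mu> (space \<mu>)) + ennreal q * mean_integral \<mu> p f"
    unfolding q_def mean_integral_def by (intro contracting_nn_integral K C circle_mean_mono_on f p) auto
  finally have main: "ennreal ((1 + q) / 2) * mean_integral \<mu> p f \<le>
      ennreal (norm (f 0) powr p * measure \<mu> (space \<mu>)) + ennreal q * mean_integral \<mu> p f +
      ennreal B * mean_integral (shifted \<mu> p) p (deriv f)"
    by (simp add: add_right_mono)
  obtain s where s: "mean_integral \<mu> p f = ennreal s" "0 \<le> s"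
    using fin by (cases "mean_integral \<mu> p f") auto
  have c: "0 < c"
  proof -
    have "0 < d powr (1 - p) * K powr p"
      using d K by simp
    then show ?thesis
      unfolding c_def q_def[symmetric] using q
      by (intro divide_pos_pos add_nonneg_pos) auto
  qed
  show ?thesis
  proof (cases "mean_integral (shifted \<mu> p) p (deriv f)")
    case top
    then show ?thesis
      using c by (simp add: ennreal_mult_top)
  next
    case (real t)
    have "ennreal ((1 + q) / 2 * s) \<le> ennreal (norm (f 0) powr p * measure \<mu> (space \<mu>) + q * s + B * t)"
      using main real s q B by (simp add: ennreal_mult[symmetric] ennreal_plus[symmetric] del: ennreal_plus)
    then have "(1 + q) / 2 * s \<le> norm (f 0) powr p * measure \<mu> (space \<mu>) + q * s + B * t"
      using real s q B by (subst (asm) ennreal_le_iff) auto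
    then have "(1 - q) / 2 * s \<le> norm (f 0) powr p * measure \<mu> (space \<mu>) + B * t"
      by (simp add: field_simps)
    also have "\<dots> \<le> (measure \<mu> (space \<mu>) + B) * (norm (f 0) powr p + t)"
      using real B by (simp add: algebra_simps)
    finally have "s \<le> c * (norm (f 0) powr p + t)"
      unfolding c_def B_def[symmetric] q_def[symmetric] using q by (simp add: field_simps)
    then show ?thesis
      using s real c by (simp add: ennreal_mult[symmetric] ennreal_plus[symmetric] ennreal_leI del: ennreal_plus)
  qed
qed

text \<open>Fatou's lemma twice, first on each circle and then in r.\<close>

lemma mean_integral_liminf:
  assumes f: "f holomorphic_on disc" and p: "1 < p" and t: "\<And>n. 0 < t n" "\<And>n. t n < 1" "t \<longlonglongrightarrow> 1"
  shows "mean_integral \<mu> p f \<le> liminf (\<lambda>n. mean_integral \<mu> p (\<lambda>z. f (of_real (t n) * z)))"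
proof -
  have h: "(\<lambda>z. f (of_real (t n) * z)) holomorphic_on disc" for n
    using t(1,2)[of n] by (intro holomorphic_dilate f) auto
  have "mean_integral \<mu> p f \<le> (\<integral>\<^sup>+r. liminf (\<lambda>n. ennreal (circle_mean p (\<lambda>z. f (of_real (t n) * z)) r)) \<partial>\<mu>)"
    unfolding mean_integral_def
  proof (rule nn_integral_mono)
    fix r assume "r \<in> space \<mu>"
    then have r: "0 \<le> r" "r < 1"
      by (auto simp: space_\<mu>)
    have cont: "continuous_on disc f"
      using f by (rule holomorphic_on_imp_continuous_on)
    have "ennreal (circle_mean p f r) = (\<integral>\<^sup>+\<xi>. ennreal (norm (f (of_real r * \<xi>)) powr p) \<partial>circle)"
      using r p by (intro ennreal_circle_mean f) auto
    also have "\<dots> = (\<integral>\<^sup>+\<xi>. liminf (\<lambda>n. ennreal (norm (f (of_real (t n) * (of_real r * \<xi>))) powr p)) \<partial>circle)"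
    proof (rule nn_integral_cong)
      fix \<xi> assume "\<xi> \<in> space circle"
      then have x: "of_real r * \<xi> \<in> disc"
        using r by (simp add: norm_mult)
      have "(\<lambda>n. complex_of_real (t n) * (of_real r * \<xi>)) \<longlonglongrightarrow> of_real 1 * (of_real r * \<xi>)"
        by (intro tendsto_intros t)
      then have "(\<lambda>n. f (of_real (t n) * (of_real r * \<xi>))) \<longlonglongrightarrow> f (of_real r * \<xi>)"
        using cont x by (intro isCont_tendsto_compose[of _ f]) (auto simp: continuous_on_eq_continuous_at)
      then have "(\<lambda>n. ennreal (norm (f (of_real (t n) * (of_real r * \<xi>))) powr p)) \<longlonglongrightarrow> ennreal (norm (f (of_real r * \<xi>)) powr p)"
        using p by (intro tendsto_ennrealI tendsto_powr' tendsto_norm tendsto_const) auto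
      then show "ennreal (norm (f (of_real r * \<xi>)) powr p) = liminf (\<lambda>n. ennreal (norm (f (of_real (t n) * (of_real r * \<xi>))) powr p))"
        by (intro lim_imp_Liminf[symmetric]) simp
    qed
    also have "\<dots> \<le> liminf (\<lambda>n. \<integral>\<^sup>+\<xi>. ennreal (norm (f (of_real (t n) * (of_real r * \<xi>))) powr p) \<partial>circle)"
    proof (rule nn_integral_liminf)
      fix n
      have "(\<lambda>\<xi>. norm (f (of_real (t n) * (of_real r * \<xi>))) powr p) \<in> borel_measurable circle"
        using r p by (intro circle_measurableI continuous_on_norm_powr continuous_on_circle_compose[OF h]) auto
      then show "(\<lambda>\<xi>. ennreal (norm (f (of_real (t n) * (of_real r * \<xi>))) powr p)) \<in> borel_measurable circle"
        by simp
    qed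
    also have "\<dots> = liminf (\<lambda>n. ennreal (circle_mean p (\<lambda>z. f (of_real (t n) * z)) r))"
      using r p by (subst ennreal_circle_mean[OF h]) auto
    finally show "ennreal (circle_mean p f r) \<le> liminf (\<lambda>n. ennreal (circle_mean p (\<lambda>z. f (of_real (t n) * z)) r))" .
  qed
  also have "\<dots> \<le> liminf (\<lambda>n. mean_integral \<mu> p (\<lambda>z. f (of_real (t n) * z)))"
    unfolding mean_integral_def
    by (rule nn_integral_liminf) (use circle_mean_measurable[OF h p] in simp)
  finally show ?thesis .
qed

lemma mean_integral_dilate_finite:
  assumes f: "f holomorphic_on disc" and p: "1 < p" and t: "0 \<le> t" "t < 1"
  shows "mean_integral \<mu> p (\<lambda>z. f (of_real t * z)) < \<infinity>"
proof -
  have "mean_integral \<mu> p (\<lambda>z. f (of_real t * z)) \<le> (\<integral>\<^sup>+r. ennreal (circle_mean p f t) \<partial>\<mu>)"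
    unfolding mean_integral_def circle_mean_dilate
    using t by (intro nn_integral_mono ennreal_leI circle_mean_mono f p) (auto simp: space_\<mu> intro!: mult_left_le)
  also have "\<dots> < \<infinity>"
    by (simp add: emeasure_eq_measure ennreal_mult_less_top)
  finally show ?thesis .
qed

text \<open>Removes finiteness: dilates of f have finite integrals, the means of their derivatives
  are dominated by those of f', and the bound is uniform in the dilation.\<close>

lemma mean_integral_le_deriv:
  assumes E: "contracting \<mu>" and p: "1 < p"
  shows "\<exists>c\<ge>0. \<forall>f. f holomorphic_on disc \<longrightarrow>
    mean_integral \<mu> p f \<le> ennreal c * (ennreal (norm (f 0) powr p) + mean_integral (shifted \<mu> p) p (deriv f))"
proof -
  obtain K C where K: "1 < K" and C: "1 < C" "\<And>x. 0 < x \<Longrightarrow> x \<le> 1 \<Longrightarrow> C * mass \<mu> (x / K) \<le> mass \<mu> x"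
    using E by (auto simp: contracting_def)
  define d where "d = (1 - 1 / C) / (2 * (p - 1))"
  define c where "c = (measure \<mu> (space \<mu>) + d powr (1 - p) * K powr p) / ((1 - 1 / C) / 2)"
  have "0 \<le> c"
    unfolding c_def using C(1) by (intro divide_nonneg_nonneg add_nonneg_nonneg) auto
  moreover have "mean_integral \<mu> p f \<le> ennreal c * (ennreal (norm (f 0) powr p) + mean_integral (shifted \<mu> p) p (deriv f))"
    if f: "f holomorphic_on disc" for f
  proof -
    have f': "deriv f holomorphic_on disc"
      using f by (rule holomorphic_deriv) simp
    define t where "t n = 1 - 1 / real (n + 2)" for n :: nat
    have t: "0 < t n" "t n < 1" for n
      by (auto simp: t_def)
    have "t \<longlonglongrightarrow> 1 - 0"
      unfolding t_def by (intro tendsto_diff tendsto_const LIMSEQ_ignore_initial_segment[OF lim_1_over_n])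
    then have lim: "t \<longlonglongrightarrow> 1"
      by simp
    have "mean_integral \<mu> p (\<lambda>z. f (of_real (t n) * z)) \<le>
        ennreal c * (ennreal (norm (f 0) powr p) + mean_integral (shifted \<mu> p) p (deriv f))" for n
    proof -
      let ?f = "\<lambda>z. f (of_real (t n) * z)"
      have h: "?f holomorphic_on disc"
        using t[of n] by (intro holomorphic_dilate f) auto
      have h': "deriv ?f holomorphic_on disc"
        using h by (rule holomorphic_deriv) simp
      have "mean_integral \<mu> p ?f \<le> ennreal c * (ennreal (norm (?f 0) powr p) + mean_integral (shifted \<mu> p) p (deriv ?f))"
        unfolding c_def d_def
        using t[of n] by (intro mean_integral_finite_le p K C h mean_integral_dilate_finite f) auto
      also have "mean_integral (shifted \<mu> p) p (deriv ?f) \<le> mean_integral (shifted \<mu> p) p (deriv f)"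
        unfolding mean_integral_shifted[OF h' p] mean_integral_shifted[OF f' p]
        using t[of n] by (intro nn_integral_mono ennreal_leI mult_left_mono circle_mean_deriv_dilate f p) (auto simp: space_\<mu>)
      finally show ?thesis
        by (simp add: mult_left_mono add_left_mono)
    qed
    then have "limsup (\<lambda>n. mean_integral \<mu> p (\<lambda>z. f (of_real (t n) * z))) \<le>
        ennreal c * (ennreal (norm (f 0) powr p) + mean_integral (shifted \<mu> p) p (deriv f))"
      by (intro Limsup_bounded) auto
    then show ?thesis
      using mean_integral_liminf[OF f p t lim] Liminf_le_Limsup[of sequentially] by (meson order_trans sequentially_bot)
  qed
  ultimately show ?thesis
    by blast
qed

lemma mean_integral_ge_point:
  assumes f: "f holomorphic_on disc" and p: "1 < p"
  shows "ennreal (measure \<mu> (space \<mu>)) * ennreal (norm (f 0) powr p) \<le> mean_integral \<mu> p f"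
proof -
  have "ennreal (measure \<mu> (space \<mu>)) * ennreal (norm (f 0) powr p) = (\<integral>\<^sup>+r. ennreal (circle_mean p f 0) \<partial>\<mu>)"
    by (simp add: emeasure_eq_measure mult.commute)
  also have "\<dots> \<le> mean_integral \<mu> p f"
    unfolding mean_integral_def
    by (intro nn_integral_mono ennreal_leI circle_mean_mono f p) (auto simp: space_\<mu>)
  finally show ?thesis .
qed

lemma mean_integral_shifted_0: "mean_integral (shifted \<mu> 0) p f = mean_integral \<mu> p f"
proof -
  have "shifted \<mu> 0 = density \<mu> (\<lambda>_. 1)"
    unfolding shifted_def by (rule density_cong) (use measurable_\<mu>[of "\<lambda>r. ennreal ((1 - r) powr 0)" borel] in \<open>auto simp: space_\<mu>\<close>)
  then show ?thesis
    by (simp add: density_1)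
qed

lemma mean_integral_iterate:
  assumes D: "doubling \<mu>" and E: "contracting \<mu>" and p: "1 < p"
  shows "\<exists>c\<ge>0. \<forall>f. f holomorphic_on disc \<longrightarrow>
    mean_integral \<mu> p f \<le> ennreal c * ((\<Sum>j<k. ennreal (norm ((deriv ^^ j) f 0) powr p)) +
      mean_integral (shifted \<mu> (real k * p)) p ((deriv ^^ k) f)) \<and>
    mean_integral (shifted \<mu> (real k * p)) p ((deriv ^^ k) f) \<le> ennreal c * mean_integral \<mu> p f"
proof (induction k)
  case 0
  show ?case
    by (intro exI[of _ 1]) (simp add: mean_integral_shifted_0)
next
  case (Suc k)
  then obtain c where c: "0 \<le> c"
    and c1: "\<And>f. f holomorphic_on disc \<Longrightarrow> mean_integral \<mu> p f \<le> ennreal c * ((\<Sum>j<k. ennreal (norm ((deriv ^^ j) f 0) powr p)) +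
      mean_integral (shifted \<mu> (real k * p)) p ((deriv ^^ k) f))"
    and c2: "\<And>f. f holomorphic_on disc \<Longrightarrow> mean_integral (shifted \<mu> (real k * p)) p ((deriv ^^ k) f) \<le> ennreal c * mean_integral \<mu> p f"
    by blast
  let ?\<nu> = "shifted \<mu> (real k * p)"
  have kp: "0 \<le> real k * p"
    using p by simp
  interpret S: radial ?\<nu>
    by (rule shifted_regular(1)[OF kp D E])
  have sh: "shifted ?\<nu> p = shifted \<mu> (real (Suc k) * p)"
    by (simp add: shifted_shifted algebra_simps)
  obtain a where a: "0 \<le> a" "\<And>f. f holomorphic_on disc \<Longrightarrow>
      mean_integral (shifted ?\<nu> p) p (deriv f) \<le> ennreal a * mean_integral ?\<nu> p f"
    using S.mean_integral_deriv_le[OF shifted_regular(2)[OF kp D E] p] by blast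
  obtain b where b: "0 \<le> b" "\<And>f. f holomorphic_on disc \<Longrightarrow>
      mean_integral ?\<nu> p f \<le> ennreal b * (ennreal (norm (f 0) powr p) + mean_integral (shifted ?\<nu> p) p (deriv f))"
    using S.mean_integral_le_deriv[OF shifted_regular(3)[OF kp D E] p] by blast
  define c' where "c' = c * (1 + b) + a * c"
  have c': "0 \<le> c'"
    using a b c by (simp add: c'_def)
  show ?case
  proof (intro exI[of _ c'] conjI allI impI)
    fix f assume f: "f holomorphic_on disc"
    note fk = holomorphic_funpow_deriv[OF f, of k]
    let ?A = "\<Sum>j<k. ennreal (norm ((deriv ^^ j) f 0) powr p)"
    let ?B = "ennreal (norm ((deriv ^^ k) f 0) powr p)"
    let ?T = "mean_integral (shifted \<mu> (real (Suc k) * p)) p ((deriv ^^ Suc k) f)"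
    have b': "mean_integral ?\<nu> p ((deriv ^^ k) f) \<le> ennreal b * (?B + ?T)"
      using b(2)[OF fk] unfolding sh by simp
    have "mean_integral \<mu> p f \<le> ennreal c * (?A + mean_integral ?\<nu> p ((deriv ^^ k) f))"
      by (rule c1[OF f])
    also have "\<dots> \<le> ennreal c * (ennreal (1 + b) * (?A + (?B + ?T)))"
    proof (rule mult_left_mono)
      have "?A + mean_integral ?\<nu> p ((deriv ^^ k) f) \<le> ?A + ennreal b * (?B + ?T)"
        using b' by (rule add_left_mono)
      also have "\<dots> \<le> (?A + (?B + ?T)) + ennreal b * (?A + (?B + ?T))"
        by (intro add_mono mult_left_mono add_increasing2[of "?B + ?T" ?A ?A] add_increasing[of ?A "?B + ?T" "?B + ?T"]) simp_all
      also have "\<dots> = ennreal (1 + b) * (?A + (?B + ?T))"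
        using b(1) by (simp add: ring_distribs)
      finally show "?A + mean_integral ?\<nu> p ((deriv ^^ k) f) \<le> ennreal (1 + b) * (?A + (?B + ?T))" .
    qed simp
    also have "\<dots> = ennreal (c * (1 + b)) * (?A + (?B + ?T))"
      using b(1) c by (simp only: ennreal_mult mult.assoc add_nonneg_nonneg zero_le_one)
    also have "\<dots> \<le> ennreal c' * (?A + (?B + ?T))"
      using a c by (intro mult_right_mono ennreal_leI) (auto simp: c'_def)
    also have "?A + (?B + ?T) = (\<Sum>j<Suc k. ennreal (norm ((deriv ^^ j) f 0) powr p)) + ?T"
      by (simp only: sum.lessThan_Suc add.assoc)
    finally show "mean_integral \<mu> p f \<le> ennreal c' * ((\<Sum>j<Suc k. ennreal (norm ((deriv ^^ j) f 0) powr p)) + ?T)" .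
    have "?T \<le> ennreal a * mean_integral ?\<nu> p ((deriv ^^ k) f)"
      using a(2)[OF fk] unfolding sh by simp
    also have "\<dots> \<le> ennreal a * (ennreal c * mean_integral \<mu> p f)"
      by (intro mult_left_mono c2 f) simp
    also have "\<dots> = ennreal (a * c) * mean_integral \<mu> p f"
      using a c by (simp add: ennreal_mult mult.assoc)
    also have "\<dots> \<le> ennreal c' * mean_integral \<mu> p f"
      using b c by (intro mult_right_mono ennreal_leI) (auto simp: c'_def)
    finally show "?T \<le> ennreal c' * mean_integral \<mu> p f" .
  qed (rule c')
qed

text \<open>Means increase with r, so the value of the k-th derivative at 0 is controlled by its
  integral against the shifted measure, which is finite and nonzero.\<close>

lemma deriv_0_le_mean_integral:
  assumes D: "doubling \<mu>" and E: "contracting \<mu>" and p: "1 < p"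
  shows "\<exists>c\<ge>0. \<forall>f. f holomorphic_on disc \<longrightarrow>
    ennreal (norm ((deriv ^^ k) f 0) powr p) \<le> ennreal c * mean_integral \<mu> p f"
proof -
  let ?\<nu> = "shifted \<mu> (real k * p)"
  have kp: "0 \<le> real k * p"
    using p by simp
  interpret S: radial ?\<nu>
    by (rule shifted_regular(1)[OF kp D E])
  obtain c where c: "0 \<le> c" "\<And>f. f holomorphic_on disc \<Longrightarrow> mean_integral ?\<nu> p ((deriv ^^ k) f) \<le> ennreal c * mean_integral \<mu> p f"
    using mean_integral_iterate[OF D E p, of k] by blast
  define m where "m = measure ?\<nu> (space ?\<nu>)"
  have m: "0 < m"
    using S.mass_pos[of 1] S.mass_ge_1[of 1] by (simp add: m_def)
  have "ennreal (norm ((deriv ^^ k) f 0) powr p) \<le> ennreal (c / m) * mean_integral \<mu> p f"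
    if f: "f holomorphic_on disc" for f
  proof -
    have "ennreal m * ennreal (norm ((deriv ^^ k) f 0) powr p) \<le> ennreal c * mean_integral \<mu> p f"
      using S.mean_integral_ge_point[OF holomorphic_funpow_deriv[OF f] p, of k] c(2)[OF f]
      unfolding m_def by (rule order_trans)
    then have "ennreal (1 / m) * (ennreal m * ennreal (norm ((deriv ^^ k) f 0) powr p)) \<le>
        ennreal (1 / m) * (ennreal c * mean_integral \<mu> p f)"
      by (rule mult_left_mono) simp
    then show ?thesis
      using m c(1) by (simp add: ennreal_mult[symmetric] mult.assoc[symmetric])
  qed
  then show ?thesis
    using m c(1) by (intro exI[of _ "c / m"]) auto
qed

end

subsection \<open>Bergman and Dirichlet spaces in terms of circle means\<close>

context weight
begin

section \<open>Tails of the weight against masses of its image measure\<close>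

lemma tail_antimono: "0 \<le> s \<Longrightarrow> s \<le> t \<Longrightarrow> t < 1 \<Longrightarrow> tail \<omega> t \<le> tail \<omega> s"
proof -
  assume st: "0 \<le> s" "s \<le> t" "t < 1"
  have "ennreal (tail \<omega> t) \<le> ennreal (tail \<omega> s)"
    using st by (simp flip: nn_integral_tail) (intro nn_integral_mono, auto simp: indicator_def)
  then show ?thesis
    using st tail_pos[of s] by simp
qed

lemma emeasure_mass_\<mu>: "ennreal (mass \<mu> x) = (\<integral>\<^sup>+r. indicator {1 - x..} r \<partial>\<mu>)"
proof -
  interpret finite_measure \<mu>
    by (rule finite_measure_\<mu>)
  have s: "{r \<in> space \<mu>. 1 - r \<le> x} \<in> sets \<mu>"
  proof -
    have "{r \<in> space \<mu>. 1 - r \<le> x} = {0..<1} \<inter> {1 - x..}"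
      by auto
    then show ?thesis
      by (simp add: sets_restrict_space_iff)
  qed
  have "ennreal (mass \<mu> x) = (\<integral>\<^sup>+r. indicator {r \<in> space \<mu>. 1 - r \<le> x} r \<partial>\<mu>)"
    using s by (simp add: mass_def emeasure_eq_measure)
  also have "\<dots> = (\<integral>\<^sup>+r. indicator {1 - x..} r \<partial>\<mu>)"
    by (rule nn_integral_cong) (auto simp: indicator_def)
  finally show ?thesis .
qed

text \<open>On the interval [1 - x, 1) the density 2 r omega(r) lies between 2 (1 - x) omega(r) and
  2 omega(r). The lower bound degenerates as x tends to 1, which causes the case distinctions and
  the detours to x / 2 below.\<close>

lemma mass_tail:
  assumes "0 < x" "x \<le> 1"
  shows "mass \<mu> x \<le> 2 * tail \<omega> (1 - x)" and "2 * (1 - x) * tail \<omega> (1 - x) \<le> mass \<mu> x"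
proof -
  have tp: "0 \<le> tail \<omega> (1 - x)"
    using tail_pos[of "1 - x"] assms by simp
  have m: "ennreal (mass \<mu> x) = (\<integral>\<^sup>+r. indicator {1 - x..} r * ennreal (2 * r * profile r) \<partial>lborel)"
    unfolding emeasure_mass_\<mu> by (rule nn_integral_\<mu>_profile) simp
  have t: "ennreal (c * tail \<omega> (1 - x)) = (\<integral>\<^sup>+r. ennreal c * ennreal (indicator {1 - x..} r * profile r) \<partial>lborel)" if "0 \<le> c" for c
    using assms tp that by (subst nn_integral_cmult, measurable, subst nn_integral_tail) (auto simp: ennreal_mult)
  have "ennreal (mass \<mu> x) \<le> ennreal (2 * tail \<omega> (1 - x))"
    unfolding m t[of 2, simplified]
  proof (rule nn_integral_mono)
    fix r
    have "2 * r * profile r \<le> 2 * profile r"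
    proof (cases "r \<in> {0..<1}")
      case True
      then show ?thesis
        using mult_right_mono[of r 1 "profile r"] by simp
    qed (simp add: profile_outside)
    then have "ennreal (2 * r * profile r) \<le> 2 * ennreal (profile r)"
      using ennreal_leI[of "2 * r * profile r" "2 * profile r"] by (simp add: ennreal_mult)
    then show "indicator {1 - x..} r * ennreal (2 * r * profile r) \<le> 2 * ennreal (indicator {1 - x..} r * profile r)"
      by (cases "1 - x \<le> r") simp_all
  qed
  then show "mass \<mu> x \<le> 2 * tail \<omega> (1 - x)"
    using tp by simp
  have "ennreal (2 * (1 - x) * tail \<omega> (1 - x)) \<le> ennreal (mass \<mu> x)"
    unfolding m using assms
  proof (subst t)
    show "(\<integral>\<^sup>+r. ennreal (2 * (1 - x)) * ennreal (indicator {1 - x..} r * profile r) \<partial>lborel) \<le>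
        (\<integral>\<^sup>+r. indicator {1 - x..} r * ennreal (2 * r * profile r) \<partial>lborel)"
    proof (rule nn_integral_mono)
      fix r
      show "ennreal (2 * (1 - x)) * ennreal (indicator {1 - x..} r * profile r) \<le> indicator {1 - x..} r * ennreal (2 * r * profile r)"
      proof (cases "1 - x \<le> r")
        case True
        have "ennreal (2 * (1 - x)) * ennreal (profile r) = ennreal (2 * (1 - x) * profile r)"
          using assms by (intro ennreal_mult[symmetric]) auto
        also have "\<dots> \<le> ennreal (2 * r * profile r)"
          using True by (intro ennreal_leI mult_right_mono) auto
        finally show ?thesis
          using True by simp
      qed simp
    qed
  qed simp
  then show "2 * (1 - x) * tail \<omega> (1 - x) \<le> mass \<mu> x"
    by (simp add: mass_def)
qed

lemma tail_le_mass:
  assumes y: "0 < y" "y \<le> 1 / 2"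
  shows "tail \<omega> (1 - y) \<le> mass \<mu> y"
proof -
  have "1 * tail \<omega> (1 - y) \<le> 2 * (1 - y) * tail \<omega> (1 - y)"
    using y tail_pos[of "1 - y"] by (intro mult_right_mono) auto
  also have "\<dots> \<le> mass \<mu> y"
    using y by (intro mass_tail) auto
  finally show ?thesis
    by simp
qed

sublocale R: radial \<mu>
proof (intro radial.intro radial_axioms.intro)
  show "finite_measure \<mu>"
    by (rule finite_measure_\<mu>)
  interpret finite_measure \<mu>
    by (rule finite_measure_\<mu>)
  fix x :: real assume x: "0 < x"
  define y where "y = min x (1 / 2)"
  have y: "0 < y" "y \<le> 1 / 2" "y \<le> x"
    using x by (auto simp: y_def)
  have "0 < 2 * (1 - y) * tail \<omega> (1 - y)"
    using y tail_pos[of "1 - y"] by simp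
  also have "\<dots> \<le> mass \<mu> y"
    using y by (intro mass_tail) auto
  finally have "0 < ennreal (mass \<mu> y)"
    by simp
  also have "\<dots> \<le> ennreal (mass \<mu> x)"
    unfolding emeasure_mass_\<mu> using y by (intro nn_integral_mono) (auto simp: indicator_def)
  finally show "0 < mass \<mu> x"
    by simp
qed simp

lemma D_hat_iff: "\<omega> \<in> D_hat \<longleftrightarrow> doubling \<mu>"
proof
  assume "\<omega> \<in> D_hat"
  then obtain C where C: "1 \<le> C" "\<And>r. r \<in> {0..<1} \<Longrightarrow> tail \<omega> r \<le> C * tail \<omega> ((1 + r) / 2)"
    by (auto simp: D_hat_def)
  have le1: "mass \<mu> x \<le> 2 * C * mass \<mu> (x / 2)" if x: "0 < x" "x \<le> 1" for x
  proof -
    have "mass \<mu> x \<le> 2 * tail \<omega> (1 - x)"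
      by (rule mass_tail[OF x])
    also have "\<dots> \<le> 2 * (C * tail \<omega> ((1 + (1 - x)) / 2))"
      using C(2)[of "1 - x"] x by simp
    also have "(1 + (1 - x)) / 2 = 1 - x / 2"
      by (simp add: field_simps)
    also have "tail \<omega> (1 - x / 2) \<le> mass \<mu> (x / 2)"
      using x by (intro tail_le_mass) auto
    finally show ?thesis
      using C(1) by (simp add: mult.assoc mult_left_mono)
  qed
  show "doubling \<mu>"
    unfolding doubling_def
  proof (intro exI conjI allI impI)
    show "1 \<le> 2 * C"
      using C by simp
    fix x :: real assume x: "0 < x"
    show "mass \<mu> x \<le> 2 * C * mass \<mu> (x / 2)"
    proof (cases "x \<le> 1")
      case False
      have "mass \<mu> x = mass \<mu> 1"
        using False by (simp add: R.mass_ge_1)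
      also have "\<dots> \<le> 2 * C * mass \<mu> (1 / 2)"
        by (rule le1) auto
      also have "\<dots> \<le> 2 * C * mass \<mu> (x / 2)"
        using False C by (intro mult_left_mono R.mass_mono) auto
      finally show ?thesis .
    qed (use le1 x in auto)
  qed
next
  assume "doubling \<mu>"
  then obtain C where C: "1 \<le> C" "\<And>x. 0 < x \<Longrightarrow> mass \<mu> x \<le> C * mass \<mu> (x / 2)"
    by (auto simp: doubling_def)
  \<comment> \<open>The second summand serves r < 1/2, where the tail is not controlled by the mass:
    there (1 + r) / 2 stays below 3/4 and crude monotonicity suffices.\<close>
  define C' where "C' = 2 * C + tail \<omega> 0 / tail \<omega> (3 / 4)"
  have t34: "0 < tail \<omega> (3 / 4)" "0 < tail \<omega> 0"
    by (auto intro: tail_pos)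
  have "tail \<omega> r \<le> C' * tail \<omega> ((1 + r) / 2)" if r: "r \<in> {0..<1}" for r
  proof (cases "r < 1 / 2")
    case True
    have "tail \<omega> r \<le> tail \<omega> 0"
      using r by (intro tail_antimono) auto
    also have "\<dots> = tail \<omega> 0 / tail \<omega> (3 / 4) * tail \<omega> (3 / 4)"
      using t34 by simp
    also have "\<dots> \<le> C' * tail \<omega> ((1 + r) / 2)"
      using True r C t34 by (intro mult_mono tail_antimono) (auto simp: C'_def)
    finally show ?thesis .
  next
    case False
    have e: "(1 + r) / 2 = 1 - (1 - r) / 2"
      by (simp add: field_simps)
    have tp: "0 < tail \<omega> r" "0 < tail \<omega> ((1 + r) / 2)"
      using r by (auto intro!: tail_pos)
    have "1 * tail \<omega> r \<le> 2 * r * tail \<omega> r"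
      using False tp by (intro mult_right_mono) auto
    also have "\<dots> \<le> mass \<mu> (1 - r)"
      using mass_tail(2)[of "1 - r"] r by simp
    also have "\<dots> \<le> C * mass \<mu> ((1 - r) / 2)"
      using r by (intro C) auto
    also have "mass \<mu> ((1 - r) / 2) \<le> 2 * tail \<omega> ((1 + r) / 2)"
      unfolding e using r by (intro mass_tail) auto
    also have "C * (2 * tail \<omega> ((1 + r) / 2)) \<le> C' * tail \<omega> ((1 + r) / 2)"
    proof -
      have "2 * C * tail \<omega> ((1 + r) / 2) \<le> C' * tail \<omega> ((1 + r) / 2)"
        using t34 tp by (intro mult_right_mono) (auto simp: C'_def)
      then show ?thesis
        by (simp add: mult_ac)
    qed
    finally show ?thesis
      using C(1) by (simp add: mult_left_mono)
  qed
  moreover have "1 \<le> C'"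
    using C t34 by (simp add: C'_def add_increasing2)
  ultimately show "\<omega> \<in> D_hat"
    using radial_weight by (auto simp: D_hat_def)
qed

lemma iterate_contraction:
  fixes h :: "real \<Rightarrow> real"
  assumes K: "1 < K" and C: "1 < C" and h: "\<And>x. 0 < x \<Longrightarrow> x \<le> 1 \<Longrightarrow> C * h (x / K) \<le> h x" and x: "0 < x" "x \<le> 1"
  shows "C ^ n * h (x / K ^ n) \<le> h x"
proof (induction n)
  case (Suc n)
  have "1 \<le> K ^ n"
    using K by simp
  then have "0 < x / K ^ n" "x / K ^ n \<le> 1"
    using x by (auto simp: pos_divide_le_eq intro: order_trans)
  then have "C * h (x / K ^ n / K) \<le> h (x / K ^ n)"
    by (rule h)
  then have "C ^ n * (C * h (x / K ^ n / K)) \<le> C ^ n * h (x / K ^ n)"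
    using C by (intro mult_left_mono) auto
  also note Suc
  finally show ?case
    by (simp add: mult_ac)
qed simp

text \<open>Passing between tail and mass loses constant factors that a contraction constant close
  to 1 could not survive. It is first raised to a high power by iteration, at the price of a larger
  K.\<close>

lemma D_class_iff: "\<omega> \<in> D_class \<longleftrightarrow> doubling \<mu> \<and> contracting \<mu>"
proof (cases "\<omega> \<in> D_hat")
  case True
  then obtain B where B: "1 \<le> B" "\<And>r. r \<in> {0..<1} \<Longrightarrow> tail \<omega> r \<le> B * tail \<omega> ((1 + r) / 2)"
    by (auto simp: D_hat_def)
  have "\<omega> \<in> D_check \<longleftrightarrow> contracting \<mu>"
  proof
    assume "\<omega> \<in> D_check"
    then obtain K C where K: "1 < K" and C: "1 < C"
      and KC: "\<And>r. r \<in> {0..<1} \<Longrightarrow> C * tail \<omega> (1 - (1 - r) / K) \<le> tail \<omega> r"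
      by (auto simp: D_check_def)
    \<comment> \<open>Of the factor 4 B, a factor 2 is spent on mass <= 2 tail and B on the doubling
      step that replaces y by y / 2, where the tail is bounded by the mass; the remaining 2 is the
      new contraction constant.\<close>
    obtain n where n: "4 * B < C ^ n"
      using real_arch_pow[OF C] by blast
    have "n \<noteq> 0"
      using n B by (cases n) auto
    then have Kn: "1 < K ^ n"
      using K by simp
    have "2 * mass \<mu> (y / K ^ n) \<le> mass \<mu> y" if y: "0 < y" "y \<le> 1" for y
    proof -
      have yn: "0 < y / K ^ n" "y / K ^ n \<le> 1"
        using y Kn by (auto simp: pos_divide_le_eq intro: order_trans)
      have it: "C ^ n * tail \<omega> (1 - y / K ^ n) \<le> tail \<omega> (1 - y)"
      proof (rule iterate_contraction[OF K C, of "\<lambda>x. tail \<omega> (1 - x)"])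
        fix x :: real assume "0 < x" "x \<le> 1"
        then show "C * tail \<omega> (1 - x / K) \<le> tail \<omega> (1 - x)"
          using KC[of "1 - x"] by simp
      qed (use y in auto)
      have "4 * B * mass \<mu> (y / K ^ n) \<le> C ^ n * (2 * tail \<omega> (1 - y / K ^ n))"
        using n B yn by (intro mult_mono mass_tail) (auto simp: mass_def)
      also have "\<dots> \<le> 2 * tail \<omega> (1 - y)"
        using it by simp
      also have "\<dots> \<le> 2 * (B * tail \<omega> ((1 + (1 - y)) / 2))"
        using B(2)[of "1 - y"] y by simp
      also have "(1 + (1 - y)) / 2 = 1 - y / 2"
        by (simp add: field_simps)
      also have "tail \<omega> (1 - y / 2) \<le> mass \<mu> (y / 2)"
        using y by (intro tail_le_mass) auto
      also have "mass \<mu> (y / 2) \<le> mass \<mu> y"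
        using y by (intro R.mass_mono) auto
      finally have "2 * B * (2 * mass \<mu> (y / K ^ n)) \<le> 2 * B * mass \<mu> y"
        using B(1) by (simp add: mult_left_mono)
      then show ?thesis
        using B(1) by simp
    qed
    then show "contracting \<mu>"
      unfolding contracting_def using Kn by (intro exI[of _ "K ^ n"] conjI exI[of _ "2::real"]) auto
  next
    assume "contracting \<mu>"
    then obtain K C where K: "1 < K" and C: "1 < C" "\<And>x. 0 < x \<Longrightarrow> x \<le> 1 \<Longrightarrow> C * mass \<mu> (x / K) \<le> mass \<mu> x"
      by (auto simp: contracting_def)
    \<comment> \<open>The first power leaves the constant 2 after the loss in mass <= 2 tail; the
      second brings the argument below 1/2, where the tail is at most the mass.\<close>
    obtain n1 n2 where n12: "4 < C ^ n1" "2 < K ^ n2"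
      using real_arch_pow[OF C(1)] real_arch_pow[OF K] by blast
    define n where "n = max n1 n2"
    have n: "4 < C ^ n" "2 < K ^ n"
      using C(1) K by (auto simp: n_def intro!: less_le_trans[OF n12(1)] less_le_trans[OF n12(2)] power_increasing)
    have "2 * tail \<omega> (1 - (1 - r) / K ^ n) \<le> tail \<omega> r" if r: "r \<in> {0..<1}" for r
    proof -
      let ?y = "1 - r"
      have y: "0 < ?y" "?y \<le> 1"
        using r by auto
      have "?y \<le> 1 / 2 * K ^ n"
        using y n by linarith
      then have yn: "0 < ?y / K ^ n" "?y / K ^ n \<le> 1 / 2"
        using y n by (auto simp: pos_divide_le_eq)
      have "4 * tail \<omega> (1 - ?y / K ^ n) \<le> C ^ n * mass \<mu> (?y / K ^ n)"
        using n tail_le_mass[OF yn] yn tail_pos[of "1 - ?y / K ^ n"] by (intro mult_mono) auto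
      also have "\<dots> \<le> mass \<mu> ?y"
        by (rule iterate_contraction[of K C "mass \<mu>", OF K C y])
      also have "\<dots> \<le> 2 * tail \<omega> (1 - ?y)"
        by (rule mass_tail[OF y])
      finally show ?thesis
        by simp
    qed
    then have "\<forall>r\<in>{0..<1}. 2 * tail \<omega> (1 - (1 - r) / K ^ n) \<le> tail \<omega> r"
      by blast
    moreover have "1 < K ^ n" "1 < (2::real)"
      using n by auto
    ultimately show "\<omega> \<in> D_check"
      unfolding D_check_def using radial_weight by blast
  qed
  then show ?thesis
    using True by (simp add: D_class_def D_hat_iff)
qed (simp add: D_class_def D_hat_iff)

section \<open>Bergman and Dirichlet norms as integrals of circle means\<close>

lemma holomorphic_measurable:
  assumes "f holomorphic_on disc" shows "f \<in> borel_measurable dA"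
proof -
  have "f \<in> borel_measurable (lebesgue_on disc)"
    using holomorphic_on_imp_continuous_on[OF assms]
    by (rule continuous_imp_measurable_on_sets_lebesgue) simp
  then show ?thesis
    by (simp cong: measurable_cong_sets)
qed

lemma nn_integral_holomorphic:
  assumes f: "f holomorphic_on disc" and p: "0 < p"
  shows "(\<integral>\<^sup>+z. ennreal (norm (f z) powr p) \<partial>W) = mean_integral \<mu> p f"
proof -
  let ?F = "\<lambda>z. ennreal (norm (indicator disc z *\<^sub>R f z) powr p)"
  have [measurable]: "(\<lambda>z. indicator disc z *\<^sub>R f z) \<in> borel_measurable borel"
    using holomorphic_on_imp_continuous_on[OF f] by (intro borel_measurable_continuous_on_indicator) auto
  have "(\<integral>\<^sup>+z. ennreal (norm (f z) powr p) \<partial>W) = (\<integral>\<^sup>+z. ?F z \<partial>W)"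
    by (rule nn_integral_cong) simp
  also have "\<dots> = (\<integral>\<^sup>+r. \<integral>\<^sup>+\<xi>. ?F (of_real r * \<xi>) \<partial>circle \<partial>\<mu>)"
    by (rule polar(1)) measurable
  also have "\<dots> = mean_integral \<mu> p f"
    unfolding mean_integral_def
  proof (rule nn_integral_cong)
    fix r assume "r \<in> space \<mu>"
    then have r: "0 \<le> r" "r < 1"
      by auto
    have "(\<integral>\<^sup>+\<xi>. ?F (of_real r * \<xi>) \<partial>circle) = (\<integral>\<^sup>+\<xi>. ennreal (norm (f (of_real r * \<xi>)) powr p) \<partial>circle)"
      by (rule nn_integral_cong) (use r in \<open>auto simp: norm_mult\<close>)
    then show "(\<integral>\<^sup>+\<xi>. ?F (of_real r * \<xi>) \<partial>circle) = ennreal (circle_mean p f r)"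
      using ennreal_circle_mean[OF f r p] by simp
  qed
  finally show ?thesis .
qed

lemma nn_integral_W_norm:
  assumes "f \<in> borel_measurable dA"
  shows "(\<integral>\<^sup>+z. ennreal (norm (f z) powr p) \<partial>W) = (\<integral>\<^sup>+z. ennreal (norm (f z) powr p * \<omega> (norm z)) \<partial>dA)"
proof -
  have "(\<integral>\<^sup>+z. ennreal (norm (f z) powr p) \<partial>W) = (\<integral>\<^sup>+z. ennreal (\<omega> (norm z)) * ennreal (norm (f z) powr p) \<partial>dA)"
    using assms by (intro nn_integral_W) measurable
  also have "\<dots> = (\<integral>\<^sup>+z. ennreal (norm (f z) powr p * \<omega> (norm z)) \<partial>dA)"
    by (rule nn_integral_cong) (simp add: nonneg ennreal_mult mult.commute)
  finally show ?thesis .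
qed

lemma Lp_measurable:
  assumes "f \<in> borel_measurable dA"
  shows "(\<lambda>z. norm (f z) powr p * \<omega> (norm z)) \<in> borel_measurable dA"
  using assms weight_measurable by measurable

lemma Lp_iff: "f \<in> Lp \<omega> p \<longleftrightarrow> f \<in> borel_measurable dA \<and> (\<integral>\<^sup>+z. ennreal (norm (f z) powr p) \<partial>W) < \<infinity>"
proof (cases "f \<in> borel_measurable dA")
  case True
  have "(\<integral>\<^sup>+z. ennreal (norm (norm (f z) powr p * \<omega> (norm z))) \<partial>dA) =
      (\<integral>\<^sup>+z. ennreal (norm (f z) powr p * \<omega> (norm z)) \<partial>dA)"
    by (rule nn_integral_cong) (simp add: nonneg abs_mult)
  then show ?thesis
    unfolding Lp_def nn_integral_W_norm[OF True] using True Lp_measurable[OF True]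
    by (simp add: integrable_iff_bounded)
qed (simp add: Lp_def)

lemma Lp_norm_eq:
  assumes "f \<in> borel_measurable dA"
  shows "Lp_norm \<omega> p f = enn2real (\<integral>\<^sup>+z. ennreal (norm (f z) powr p) \<partial>W) powr (1 / p)"
proof -
  have "(LINT z|dA. norm (f z) powr p * \<omega> (norm z)) =
      enn2real (\<integral>\<^sup>+z. ennreal (norm (f z) powr p * \<omega> (norm z)) \<partial>dA)"
    by (rule integral_eq_nn_integral) (use Lp_measurable[OF assms] nonneg in \<open>auto intro!: AE_I2\<close>)
  then show ?thesis
    unfolding Lp_norm_def nn_integral_W_norm[OF assms] by simp
qed

lemma Bergman_iff: "0 < p \<Longrightarrow> f \<in> Bergman \<omega> p \<longleftrightarrow> f holomorphic_on disc \<and> mean_integral \<mu> p f < \<infinity>"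
  by (auto simp: Bergman_def Lp_iff nn_integral_holomorphic holomorphic_measurable)

lemma Bergman_norm:
  "0 < p \<Longrightarrow> f holomorphic_on disc \<Longrightarrow> Lp_norm \<omega> p f = enn2real (mean_integral \<mu> p f) powr (1 / p)"
  by (simp add: Lp_norm_eq holomorphic_measurable nn_integral_holomorphic)

lemma weight_shifted:
  assumes \<beta>: "0 \<le> \<beta>"
  shows "weight (shifted_weight \<omega> \<beta>)"
proof
  have m: "(\<lambda>r::real. (1 - r) powr \<beta>) \<in> borel_measurable borel"
    by measurable
  have i: "set_integrable lebesgue {0..<1} (\<lambda>r. (1 - r) powr \<beta> * \<omega> r)"
    by (rule nn_integral_profile(2)[OF m]) (use \<beta> in \<open>auto intro!: powr_le1\<close>)
  have "0 < tail (shifted_weight \<omega> \<beta>) s" if s: "0 \<le> s" "s < 1" for s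
  proof -
    have ms: "(\<lambda>r::real. indicator {s..} r * (1 - r) powr \<beta>) \<in> borel_measurable borel"
      by measurable
    have "(\<integral>\<^sup>+r. ennreal (indicator {s..} r * (1 - r) powr \<beta> * profile r) \<partial>lborel) =
        ennreal (LINT r:{0..<1}|lebesgue. indicator {s..} r * (1 - r) powr \<beta> * \<omega> r)"
      by (rule nn_integral_profile(1)[OF ms]) (use \<beta> in \<open>auto simp: indicator_def intro!: powr_le1\<close>)
    also have "(LINT r:{0..<1}|lebesgue. indicator {s..} r * (1 - r) powr \<beta> * \<omega> r) = tail (shifted_weight \<omega> \<beta>) s"
      unfolding tail_def set_lebesgue_integral_def shifted_weight_def
      by (rule Bochner_Integration.integral_cong) (use s in \<open>auto simp: indicator_def\<close>)
    finally have e: "(\<integral>\<^sup>+r. ennreal (indicator {s..} r * (1 - r) powr \<beta> * profile r) \<partial>lborel) =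
      ennreal (tail (shifted_weight \<omega> \<beta>) s)" .
    \<comment> \<open>If the new tail vanished, its integrand would vanish almost everywhere; since
      (1 - r)^\<beta> is positive on [0,1), the tail of \<omega> would vanish too.\<close>
    show ?thesis
    proof (rule ccontr)
      assume "\<not> 0 < tail (shifted_weight \<omega> \<beta>) s"
      then have "(\<integral>\<^sup>+r. ennreal (indicator {s..} r * (1 - r) powr \<beta> * profile r) \<partial>lborel) = 0"
        unfolding e by (simp add: ennreal_neg)
      then have "AE r in lborel. ennreal (indicator {s..} r * (1 - r) powr \<beta> * profile r) = 0"
        by (subst (asm) nn_integral_0_iff_AE) measurable
      then have "AE r in lborel. ennreal (indicator {s..} r * profile r) = 0"
      proof eventually_elim
        case (elim r)
        then show ?case
        proof (cases "r \<in> {0..<1}")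
          case True
          then have "0 < (1 - r) powr \<beta>"
            by simp
          then show ?thesis
            using elim profile_nonneg[of r] by (auto simp: ennreal_eq_0_iff indicator_def mult_le_0_iff split: if_splits)
        qed (simp add: profile_outside)
      qed
      then have "(\<integral>\<^sup>+r. ennreal (indicator {s..} r * profile r) \<partial>lborel) = 0"
        by (subst nn_integral_0_iff_AE) auto
      then show False
        using tail_pos[OF s] by (simp add: nn_integral_tail[OF s] ennreal_eq_0_iff)
    qed
  qed
  moreover have "shifted_weight \<omega> \<beta> = (\<lambda>r. (1 - r) powr \<beta> * \<omega> r)"
    by (simp add: fun_eq_iff shifted_weight_def)
  then have "set_integrable lebesgue {0..<1} (shifted_weight \<omega> \<beta>)"
    using i by simp
  ultimately show "radial_weight (shifted_weight \<omega> \<beta>)"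
    using nonneg by (auto simp: radial_weight_def shifted_weight_def)
qed

lemma disc_measure_shifted: "disc_measure (shifted_weight \<omega> \<beta>) = density W (\<lambda>z. ennreal ((1 - norm z) powr \<beta>))"
proof -
  have pm: "(\<lambda>z. ennreal ((1 - norm z) powr \<beta>)) \<in> borel_measurable dA"
    by (rule borel_measurable_dA) measurable
  have wm: "(\<lambda>z. ennreal (\<omega> (norm z))) \<in> borel_measurable dA"
    by (rule measurable_compose[OF weight_measurable measurable_ennreal])
  have "disc_measure (shifted_weight \<omega> \<beta>) = density dA (\<lambda>z. ennreal (\<omega> (norm z)) * ennreal ((1 - norm z) powr \<beta>))"
    unfolding disc_measure_def shifted_weight_def
  proof (rule density_cong)
    show "(\<lambda>z. ennreal (\<omega> (norm z) * (1 - norm z) powr \<beta>)) \<in> borel_measurable dA"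
    proof (rule measurable_compose[OF _ measurable_ennreal])
      have "(\<lambda>z. (1 - norm z) powr \<beta>) \<in> borel_measurable dA"
        by (rule borel_measurable_dA) measurable
      then show "(\<lambda>z. \<omega> (norm z) * (1 - norm z) powr \<beta>) \<in> borel_measurable dA"
        by (rule borel_measurable_times[OF weight_measurable])
    qed
    show "(\<lambda>z. ennreal (\<omega> (norm z)) * ennreal ((1 - norm z) powr \<beta>)) \<in> borel_measurable dA"
      by (rule borel_measurable_times_ennreal[OF wm pm])
    show "AE z in dA. ennreal (\<omega> (norm z) * (1 - norm z) powr \<beta>) = ennreal (\<omega> (norm z)) * ennreal ((1 - norm z) powr \<beta>)"
      by (rule AE_I2) (simp add: ennreal_mult nonneg)
  qed
  also have "\<dots> = density W (\<lambda>z. ennreal ((1 - norm z) powr \<beta>))"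
    unfolding disc_measure_def by (rule density_density_eq[symmetric, OF wm pm])
  finally show ?thesis .
qed

lemma radial_measure_shifted: "radial_measure (shifted_weight \<omega> \<beta>) = shifted \<mu> \<beta>"
proof -
  have "shifted \<mu> \<beta> = distr (density W (\<lambda>z. ennreal ((1 - norm z) powr \<beta>))) (restrict_space borel {0..<1}) norm"
    unfolding shifted_def radial_measure_def
    by (rule density_distr) (auto intro!: norm_measurable_W measurable_restrict_space1)
  then show ?thesis
    unfolding radial_measure_def disc_measure_shifted by simp
qed

lemma Dirichlet_iff:
  assumes p: "0 < p"
  shows "f \<in> Dirichlet \<omega> p k \<longleftrightarrow>
    f holomorphic_on disc \<and> mean_integral (shifted \<mu> (real k * p)) p ((deriv ^^ k) f) < \<infinity>"
proof -
  interpret S: weight "shifted_weight \<omega> (real k * p)"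
    by (rule weight_shifted) (use p in simp)
  show ?thesis
    using p holomorphic_funpow_deriv by (auto simp: Dirichlet_def S.Bergman_iff radial_measure_shifted)
qed

lemma Dirichlet_norm_eq:
  assumes p: "0 < p" and f: "f holomorphic_on disc"
  shows "Dirichlet_norm \<omega> p k f =
    enn2real (mean_integral (shifted \<mu> (real k * p)) p ((deriv ^^ k) f)) powr (1 / p) +
    (\<Sum>j=0..k. norm ((deriv ^^ j) f 0))"
proof -
  interpret S: weight "shifted_weight \<omega> (real k * p)"
    by (rule weight_shifted) (use p in simp)
  show ?thesis
    using p holomorphic_funpow_deriv[OF f] by (simp add: Dirichlet_norm_def S.Bergman_norm radial_measure_shifted)
qed

lemma Lp_norm_nonneg [simp]: "0 \<le> Lp_norm \<nu> p f"
  by (simp add: Lp_norm_def)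

lemma Dirichlet_norm_nonneg [simp]: "0 \<le> Dirichlet_norm \<nu> p k f"
  by (simp add: Dirichlet_norm_def sum_nonneg Lp_norm_def)

lemma Lp_norm_powr:
  assumes "f \<in> Lp \<omega> p" "0 < p"
  shows "ennreal (Lp_norm \<omega> p f powr p) = (\<integral>\<^sup>+z. ennreal (norm (f z) powr p) \<partial>W)"
  using assms by (simp add: Lp_iff Lp_norm_eq powr_powr)

lemma Bergman_norm_powr:
  assumes "f \<in> Bergman \<omega> p" "0 < p"
  shows "ennreal (Lp_norm \<omega> p f powr p) = mean_integral \<mu> p f"
  using assms Lp_norm_powr[of f p] by (simp add: Bergman_def nn_integral_holomorphic)

lemma powr_le_cmult:
  fixes a b c p :: real
  assumes "a powr p \<le> c * b powr p" "0 \<le> a" "0 \<le> b" "0 \<le> c" "0 < p"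
  shows "a \<le> c powr (1 / p) * b"
proof -
  have "a = (a powr p) powr (1 / p)"
    using assms by (simp add: powr_powr)
  also have "\<dots> \<le> (c * b powr p) powr (1 / p)"
    using assms by (intro powr_mono2) auto
  also have "\<dots> = c powr (1 / p) * b"
    using assms by (simp add: powr_mult powr_powr)
  finally show ?thesis .
qed

theorem Bergman_eq_Dirichlet:
  assumes D: "\<omega> \<in> D_class" and p: "1 < p"
  shows "same_space_equivalent_norms (Bergman \<omega> p) (Lp_norm \<omega> p) (Dirichlet \<omega> p k) (Dirichlet_norm \<omega> p k)"
proof -
  have DE: "doubling \<mu>" "contracting \<mu>"
    using D by (auto simp: D_class_iff)
  have p0: "0 < p"
    using p by simp
  let ?T = "\<lambda>f. mean_integral (shifted \<mu> (real k * p)) p ((deriv ^^ k) f)"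
  obtain c where c: "0 \<le> c"
    and c1: "\<And>f. f holomorphic_on disc \<Longrightarrow> mean_integral \<mu> p f \<le>
      ennreal c * ((\<Sum>j<k. ennreal (norm ((deriv ^^ j) f 0) powr p)) + ?T f)"
    and c2: "\<And>f. f holomorphic_on disc \<Longrightarrow> ?T f \<le> ennreal c * mean_integral \<mu> p f"
    using R.mean_integral_iterate[OF DE p, of k] by blast
  have "\<forall>j. \<exists>a\<ge>0. \<forall>f. f holomorphic_on disc \<longrightarrow>
      ennreal (norm ((deriv ^^ j) f 0) powr p) \<le> ennreal a * mean_integral \<mu> p f"
    using R.deriv_0_le_mean_integral[OF DE p] by blast
  then obtain a where a: "\<And>j. 0 \<le> a j" "\<And>j f. f holomorphic_on disc \<Longrightarrow>
      ennreal (norm ((deriv ^^ j) f 0) powr p) \<le> ennreal (a j) * mean_integral \<mu> p f"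
    by metis
  have eq: "Bergman \<omega> p = Dirichlet \<omega> p k"
  proof (intro set_eqI iffI)
    fix f assume "f \<in> Bergman \<omega> p"
    then have f: "f holomorphic_on disc" "mean_integral \<mu> p f < \<infinity>"
      using p0 by (auto simp: Bergman_iff)
    have "?T f < \<infinity>"
      using c2[OF f(1)] f(2) by (auto simp: ennreal_mult_less_top elim: le_less_trans)
    then show "f \<in> Dirichlet \<omega> p k"
      using f p0 by (simp add: Dirichlet_iff)
  next
    fix f assume "f \<in> Dirichlet \<omega> p k"
    then have f: "f holomorphic_on disc" "?T f < \<infinity>"
      using p0 by (auto simp: Dirichlet_iff)
    have "mean_integral \<mu> p f < \<infinity>"
      using c1[OF f(1)] f(2) by (auto simp: ennreal_mult_less_top elim!: le_less_trans)
    then show "f \<in> Bergman \<omega> p"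
      using f p0 by (simp add: Bergman_iff)
  qed
  \<comment> \<open>The factor k + 1 counts the k point values and the integral, each bounded by the
    Dirichlet norm. In \<open>c4\<close> the point values up to order k each bring their own
    constant, and the summand 1 makes the constants positive.\<close>
  define c3 where "c3 = (c * real (k + 1)) powr (1 / p) + 1"
  define c4 where "c4 = c powr (1 / p) + (\<Sum>j=0..k. a j powr (1 / p)) + 1"
  have c34: "0 < c3" "0 < c4"
    by (auto simp: c3_def c4_def intro!: add_nonneg_pos add_nonneg_nonneg sum_nonneg)
  have "1 / c4 * Dirichlet_norm \<omega> p k f \<le> Lp_norm \<omega> p f \<and> Lp_norm \<omega> p f \<le> c3 * Dirichlet_norm \<omega> p k f"
    if fB: "f \<in> Bergman \<omega> p" for f
  proof -
    have f: "f holomorphic_on disc"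
      using fB p0 by (simp add: Bergman_iff)
    have Tf: "?T f < \<infinity>"
      using fB eq p0 by (simp add: Dirichlet_iff)
    define N where "N = Lp_norm \<omega> p f"
    define t where "t = enn2real (?T f) powr (1 / p)"
    define d where "d j = norm ((deriv ^^ j) f 0)" for j
    have nn: "0 \<le> N" "0 \<le> t" "\<And>j. 0 \<le> d j"
      by (auto simp: N_def t_def d_def)
    have S: "mean_integral \<mu> p f = ennreal (N powr p)"
      using Bergman_norm_powr[OF fB p0] by (simp add: N_def)
    have T: "?T f = ennreal (t powr p)"
      using Tf p0 by (simp add: t_def powr_powr)
    have Dn: "Dirichlet_norm \<omega> p k f = t + (\<Sum>j=0..k. d j)"
      using Dirichlet_norm_eq[OF p0 f] by (simp add: t_def d_def)
    define Dd where "Dd = t + (\<Sum>j=0..k. d j)"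
    have dD: "d j \<le> Dd" if "j \<le> k" for j
    proof -
      have "d j \<le> (\<Sum>j=0..k. d j)"
        using that nn by (intro member_le_sum) auto
      then show ?thesis
        using nn by (simp add: Dd_def)
    qed
    have tD: "t \<le> Dd"
      using nn by (simp add: Dd_def sum_nonneg)
    have "ennreal (N powr p) \<le> ennreal c * ((\<Sum>j<k. ennreal (d j powr p)) + ennreal (t powr p))"
      using c1[OF f] unfolding S T d_def .
    also have "\<dots> = ennreal (c * ((\<Sum>j<k. d j powr p) + t powr p))"
      using c by (simp add: ennreal_mult ennreal_plus sum_nonneg)
    finally have "N powr p \<le> c * ((\<Sum>j<k. d j powr p) + t powr p)"
      using c by (subst (asm) ennreal_le_iff) (auto intro!: mult_nonneg_nonneg add_nonneg_nonneg sum_nonneg)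
    also have "\<dots> \<le> c * ((\<Sum>j<k. Dd powr p) + Dd powr p)"
      using c nn dD tD p0 by (intro mult_left_mono add_mono sum_mono powr_mono2) auto
    also have "\<dots> = c * real (k + 1) * Dd powr p"
      by (simp add: algebra_simps)
    finally have "N \<le> (c * real (k + 1)) powr (1 / p) * Dd"
      using c nn tD p0 by (intro powr_le_cmult) auto
    also have "\<dots> \<le> c3 * Dd"
      using tD nn by (intro mult_right_mono) (auto simp: c3_def)
    finally have 1: "N \<le> c3 * Dd" .
    have "t powr p \<le> c * N powr p"
      using c2[OF f] c unfolding S T by (simp add: ennreal_mult[symmetric])
    then have tN: "t \<le> c powr (1 / p) * N"
      using c nn p0 by (intro powr_le_cmult) auto
    have dN: "d j \<le> a j powr (1 / p) * N" for j
    proof (rule powr_le_cmult)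
      show "d j powr p \<le> a j * N powr p"
        using a(2)[OF f, of j] a(1)[of j] unfolding S d_def by (simp add: ennreal_mult[symmetric])
    qed (use a nn p0 in auto)
    have "Dd \<le> c powr (1 / p) * N + (\<Sum>j=0..k. a j powr (1 / p) * N)"
      unfolding Dd_def by (intro add_mono sum_mono tN dN)
    also have "\<dots> \<le> c4 * N"
      using nn by (simp add: c4_def algebra_simps sum_distrib_left)
    finally have 2: "1 / c4 * Dd \<le> N"
      using c34 by (simp add: field_simps)
    show ?thesis
      using 1 2 Dn by (simp add: N_def Dd_def)
  qed
  moreover have "0 < 1 / c4"
    using c34 by simp
  ultimately show ?thesis
    unfolding same_space_equivalent_norms_def using eq c34(1) by blast
qed

end

subsection \<open>Moments\<close>

lemma powr_exp_bound:
  fixes u x :: real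
  assumes "0 \<le> u" "u \<le> 1 / 2" "0 \<le> x"
  shows "exp (- (2 * u * x)) \<le> (1 - u) powr x"
proof -
  have "- u - 2 * u\<^sup>2 \<le> ln (1 - u)"
    using assms by (intro ln_one_minus_pos_lower_bound) auto
  moreover have "2 * u\<^sup>2 \<le> u"
    using assms mult_left_mono[of "2 * u" 1 u] by (simp add: power2_eq_square)
  ultimately have "x * - (2 * u) \<le> x * ln (1 - u)"
    using assms by (intro mult_left_mono) auto
  then show ?thesis
    using assms by (simp add: powr_def mult_ac)
qed

lemma powr_exp_upper:
  fixes u x :: real
  assumes "0 \<le> u" "u < 1" "0 \<le> x"
  shows "(1 - u) powr x \<le> exp (- (u * x))"
proof -
  have "ln (1 - u) \<le> - u"
    using ln_add_one_self_le_self2[of "- u"] assms by simp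
  then have "x * ln (1 - u) \<le> x * - u"
    using assms by (intro mult_left_mono) auto
  then show ?thesis
    using assms by (simp add: powr_def mult_ac)
qed

context radial
begin

text \<open>For the image measure of a radial weight this is 2 omega_(x+1), because of the factor r
  in the area element.\<close>

definition power_moment :: "real \<Rightarrow> real"
  where "power_moment x = (LINT r|\<mu>. r powr x)"

lemma integrable_bounded:
  fixes F :: "real \<Rightarrow> real"
  assumes "F \<in> borel_measurable borel" "\<And>r. 0 \<le> r \<Longrightarrow> r < 1 \<Longrightarrow> \<bar>F r\<bar> \<le> B"
  shows "integrable \<mu> F"
  by (rule integrable_const_bound[of _ B])
    (use assms in \<open>auto simp: space_\<mu> intro!: AE_I2 measurable_\<mu>\<close>)

lemma integrable_power: "0 \<le> x \<Longrightarrow> integrable \<mu> (\<lambda>r. r powr x)"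
  by (rule integrable_bounded[of _ 1]) (auto intro!: powr_le1)

lemma power_moment_nonneg [simp]: "0 \<le> power_moment x"
  unfolding power_moment_def by simp

lemma power_moment_antimono: "0 \<le> x \<Longrightarrow> x \<le> y \<Longrightarrow> power_moment y \<le> power_moment x"
  unfolding power_moment_def
  by (intro integral_mono integrable_power) (auto simp: space_\<mu> intro!: powr_mono')

lemma nn_integral_power: "0 \<le> x \<Longrightarrow> (\<integral>\<^sup>+r. ennreal (r powr x) \<partial>\<mu>) = ennreal (power_moment x)"
  unfolding power_moment_def by (intro nn_integral_eq_integral integrable_power) auto

lemma mass_integral:
  assumes "x < y"
  shows "mass \<mu> x = (LINT r|\<mu>. indicator {r. 1 - r \<le> x} r)"
    and "mass \<mu> y - mass \<mu> x = (LINT r|\<mu>. indicator {r. x < 1 - r \<and> 1 - r \<le> y} r)"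
    and "integrable \<mu> (\<lambda>r. indicator {r. 1 - r \<le> x} r :: real)"
    and "integrable \<mu> (\<lambda>r. indicator {r. x < 1 - r \<and> 1 - r \<le> y} r :: real)"
proof -
  have m: "mass \<mu> x = (LINT r|\<mu>. indicator {r. 1 - r \<le> x} r)" for x
  proof -
    have "(LINT r|\<mu>. indicator {r. 1 - r \<le> x} r :: real) = (LINT r|\<mu>. indicator {r \<in> space \<mu>. 1 - r \<le> x} r)"
      by (rule Bochner_Integration.integral_cong) (auto simp: indicator_def)
    then show ?thesis
      using mass_set[of x] by (simp add: mass_def)
  qed
  have i: "integrable \<mu> (\<lambda>r. indicator {r. 1 - r \<le> x} r :: real)" for x
    by (rule integrable_bounded[of _ 1]) (auto simp: indicator_def)
  show "mass \<mu> x = (LINT r|\<mu>. indicator {r. 1 - r \<le> x} r)" "integrable \<mu> (\<lambda>r. indicator {r. 1 - r \<le> x} r :: real)"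
    by (rule m i)+
  have e: "indicator {r. x < 1 - r \<and> 1 - r \<le> y} r = (indicator {r. 1 - r \<le> y} r - indicator {r. 1 - r \<le> x} r :: real)" for r
    using assms by (auto simp: indicator_def)
  show "mass \<mu> y - mass \<mu> x = (LINT r|\<mu>. indicator {r. x < 1 - r \<and> 1 - r \<le> y} r)"
    "integrable \<mu> (\<lambda>r. indicator {r. x < 1 - r \<and> 1 - r \<le> y} r :: real)"
    unfolding e using i by (simp_all add: m)
qed

lemma power_moment_ge_mass:
  assumes y: "0 \<le> y" "y < 1" and x: "0 \<le> x"
  shows "(1 - y) powr x * mass \<mu> y \<le> power_moment x"
proof -
  have "(1 - y) powr x * mass \<mu> y = (LINT r|\<mu>. (1 - y) powr x * indicator {r. 1 - r \<le> y} r)"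
    using mass_integral(1)[of y 1] y by simp
  also have "\<dots> \<le> power_moment x"
    unfolding power_moment_def
  proof (rule integral_mono)
    show "integrable \<mu> (\<lambda>r. (1 - y) powr x * indicator {r. 1 - r \<le> y} r)"
      using mass_integral(3)[of y 1] y by simp
    fix r assume "r \<in> space \<mu>"
    then show "(1 - y) powr x * indicator {r. 1 - r \<le> y} r \<le> r powr x"
      using y x by (auto simp: indicator_def space_\<mu> intro!: powr_mono2)
  qed (use x in \<open>simp add: integrable_power\<close>)
  finally show ?thesis .
qed

lemma power_moment_pos: "0 \<le> x \<Longrightarrow> 0 < power_moment x"
proof -
  assume x: "0 \<le> x"
  have "0 < (1 - 1 / 2) powr x * mass \<mu> (1 / 2)"
    using mass_pos[of "1 / 2"] by (intro mult_pos_pos) auto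
  also have "\<dots> \<le> power_moment x"
    using x by (intro power_moment_ge_mass) auto
  finally show "0 < power_moment x" .
qed

text \<open>With u(r) = max 0 (2 r - 1)^x one has u((1 + r) / 2) = r^x, so doubling applies, and 2 r
  - 1 <= r^2 gives u(r) <= r^(2 x).\<close>

lemma power_moment_doubling:
  assumes C: "1 \<le> C" "\<And>x. 0 < x \<Longrightarrow> mass \<mu> x \<le> C * mass \<mu> (x / 2)" and x: "0 \<le> x"
  shows "power_moment x \<le> C * power_moment (2 * x)"
proof -
  let ?u = "\<lambda>r. max 0 (2 * r - 1) powr x"
  have "ennreal (power_moment x) = (\<integral>\<^sup>+r. ennreal (?u ((1 + r) / 2)) \<partial>\<mu>)"
    unfolding nn_integral_power[OF x, symmetric]
    by (rule nn_integral_cong) (auto simp: space_\<mu> field_simps)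
  also have "\<dots> \<le> ennreal C * (\<integral>\<^sup>+r. ennreal (?u r) \<partial>\<mu>)"
    by (rule doubling_nn_integral[OF C]) (use x in \<open>auto intro!: mono_onI powr_mono2\<close>)
  also have "(\<integral>\<^sup>+r. ennreal (?u r) \<partial>\<mu>) \<le> (\<integral>\<^sup>+r. ennreal (r powr (2 * x)) \<partial>\<mu>)"
  proof (intro nn_integral_mono ennreal_leI)
    fix r assume "r \<in> space \<mu>"
    then have r: "0 \<le> r"
      by (simp add: space_\<mu>)
    have "2 * r - 1 \<le> r ^ 2"
      using zero_le_power2[of "r - 1"] by (simp add: power2_diff)
    then have "?u r \<le> (r ^ 2) powr x"
      using x by (intro powr_mono2) auto
    also have "(r ^ 2) powr x = r powr (2 * x)"
      using r by (cases "r = 0") (auto simp: powr_powr[symmetric] powr_numeral)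
    finally show "?u r \<le> r powr (2 * x)" .
  qed
  also have "\<dots> = ennreal (power_moment (2 * x))"
    using x by (intro nn_integral_power) simp
  finally have "ennreal (power_moment x) \<le> ennreal (C * power_moment (2 * x))"
    using C(1) by (simp add: ennreal_mult mult_left_mono)
  then show ?thesis
    using C(1) by (subst (asm) ennreal_le_iff) auto
qed

text \<open>Doubling the exponent j times costs C^j but gains exp (1 - 2^j) on the region 1 - r > 1
  / x. The gain is doubly exponential, so for some fixed j the contribution of that region is at
  most half of the original moment and is absorbed.\<close>

lemma power_moment_le_mass:
  assumes D: "doubling \<mu>"
  shows "\<exists>A\<ge>1. \<forall>x\<ge>1. power_moment x \<le> A * mass \<mu> (1 / x)"
proof -
  obtain C where C: "1 \<le> C" "\<And>x. 0 < x \<Longrightarrow> mass \<mu> x \<le> C * mass \<mu> (x / 2)"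
    using D by (auto simp: doubling_def)
  have iter: "power_moment x \<le> C ^ j * power_moment (2 ^ j * x)" if "0 \<le> x" for j x
  proof (induction j)
    case (Suc j)
    also have "C ^ j * power_moment (2 ^ j * x) \<le> C ^ j * (C * power_moment (2 * (2 ^ j * x)))"
      using C(1) that by (intro mult_left_mono power_moment_doubling C) auto
    finally show ?case
      by (simp add: mult_ac)
  qed simp
  have "((\<lambda>j. exp (real j * a + 1 - 2 ^ j)) \<longlongrightarrow> 0) sequentially" for a :: real
    by real_asymp
  moreover have "C ^ j * exp (1 - 2 ^ j) = exp (real j * ln C + 1 - 2 ^ j)" for j
  proof -
    have "C ^ j = exp (real j * ln C)"
      using C(1) by (simp add: exp_of_nat_mult)
    then show ?thesis
      by (simp add: exp_add[symmetric] algebra_simps)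
  qed
  ultimately have "((\<lambda>j. C ^ j * exp (1 - 2 ^ j)) \<longlongrightarrow> 0) sequentially"
    by simp
  then have "\<forall>\<^sub>F j in sequentially. C ^ j * exp (1 - 2 ^ j) < 1 / 2"
    by (rule order_tendstoD) simp
  then obtain j where j: "C ^ j * exp (1 - 2 ^ j) < 1 / 2"
    by (auto simp: eventually_sequentially)
  have "power_moment x \<le> 2 * C ^ j * mass \<mu> (1 / x)" if x: "1 \<le> x" for x
  proof -
    have x2: "1 / x < 2"
      using x by (simp add: pos_divide_less_eq)
    have "power_moment (2 ^ j * x) \<le> (LINT r|\<mu>. indicator {r. 1 - r \<le> 1 / x} r + exp (1 - 2 ^ j) * r powr x)"
      unfolding power_moment_def
    proof (rule integral_mono)
      show "integrable \<mu> (\<lambda>r. r powr (2 ^ j * x))"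
        using x by (intro integrable_power) auto
      show "integrable \<mu> (\<lambda>r. indicator {r. 1 - r \<le> 1 / x} r + exp (1 - 2 ^ j) * r powr x)"
        using x mass_integral(3)[OF x2] by (intro Bochner_Integration.integrable_add integrable_mult_right integrable_power) auto
      fix r assume "r \<in> space \<mu>"
      then have r: "0 \<le> r" "r < 1"
        by (auto simp: space_\<mu>)
      show "r powr (2 ^ j * x) \<le> indicator {r. 1 - r \<le> 1 / x} r + exp (1 - 2 ^ j) * r powr x"
      proof (cases "1 - r \<le> 1 / x")
        case True
        have "r powr (2 ^ j * x) \<le> 1"
          using r x by (intro powr_le1) auto
        then show ?thesis
          using True by (simp add: add_increasing2)
      next
        case False
        \<comment> \<open>One factor r^x is kept aside to reproduce the moment; the other 2^j - 1
          factors give the decay.\<close>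
        have "r powr ((2 ^ j - 1) * x) \<le> exp (- ((1 - r) * ((2 ^ j - 1) * x)))"
          using powr_exp_upper[of "1 - r" "(2 ^ j - 1) * x"] r x False
          by (cases "r = 0") auto
        also have "\<dots> \<le> exp (1 - 2 ^ j)"
        proof -
          have "1 * (2 ^ j - 1) \<le> ((1 - r) * x) * (2 ^ j - 1 :: real)"
            using False x by (intro mult_right_mono) (auto simp: field_simps)
          then show ?thesis
            by (simp add: mult_ac)
        qed
        finally have "r powr ((2 ^ j - 1) * x) * r powr x \<le> exp (1 - 2 ^ j) * r powr x"
          by (rule mult_right_mono) simp
        also have "r powr ((2 ^ j - 1) * x) * r powr x = r powr (2 ^ j * x)"
          by (simp add: powr_add[symmetric] algebra_simps)
        finally show ?thesis
          using False by simp
      qed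
    qed
    also have "\<dots> = mass \<mu> (1 / x) + exp (1 - 2 ^ j) * power_moment x"
      using x mass_integral(1,3)[OF x2] integrable_power[of x]
      by (simp add: power_moment_def)
    finally have "C ^ j * power_moment (2 ^ j * x) \<le> C ^ j * (mass \<mu> (1 / x) + exp (1 - 2 ^ j) * power_moment x)"
      using C(1) by (intro mult_left_mono) auto
    then have "power_moment x \<le> C ^ j * mass \<mu> (1 / x) + C ^ j * exp (1 - 2 ^ j) * power_moment x"
      using iter[of x j] x by (simp add: algebra_simps)
    also have "C ^ j * exp (1 - 2 ^ j) * power_moment x \<le> 1 / 2 * power_moment x"
      using j by (intro mult_right_mono) auto
    finally show ?thesis
      by simp
  qed
  moreover have "1 \<le> 2 * C ^ j"
    using one_le_power[OF C(1), of j] by simp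
  ultimately show ?thesis
    by blast
qed

lemma mass_doubling_power:
  assumes C: "1 \<le> C" "\<And>x. 0 < x \<Longrightarrow> mass \<mu> x \<le> C * mass \<mu> (x / 2)" and x: "0 < x"
  shows "mass \<mu> x \<le> C ^ j * mass \<mu> (x / 2 ^ j)"
proof (induction j)
  case (Suc j)
  also have "C ^ j * mass \<mu> (x / 2 ^ j) \<le> C ^ j * (C * mass \<mu> (x / 2 ^ j / 2))"
    using C(1) x by (intro mult_left_mono C) auto
  finally show ?case
    by (simp add: mult_ac)
qed simp

lemma mass_doubling_cmult:
  assumes D: "doubling \<mu>" and a: "0 < a"
  shows "\<exists>A\<ge>1. \<forall>x>0. mass \<mu> (a * x) \<le> A * mass \<mu> x"
proof -
  obtain C where C: "1 \<le> C" "\<And>x. 0 < x \<Longrightarrow> mass \<mu> x \<le> C * mass \<mu> (x / 2)"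
    using D by (auto simp: doubling_def)
  obtain j where j: "a < 2 ^ j"
    using real_arch_pow[of 2 a] by auto
  have "mass \<mu> (a * x) \<le> C ^ j * mass \<mu> x" if "0 < x" for x
  proof -
    have "mass \<mu> (a * x) \<le> C ^ j * mass \<mu> (a * x / 2 ^ j)"
      using a that by (intro mass_doubling_power C) auto
    also have "\<dots> \<le> C ^ j * mass \<mu> x"
      using C(1) j that by (intro mult_left_mono mass_mono) (auto simp: pos_divide_le_eq mult.commute)
    finally show ?thesis .
  qed
  then show ?thesis
    using one_le_power[OF C(1), of j] by blast
qed

subsection \<open>Necessity of the doubling conditions\<close>

definition beta_moment :: "real \<Rightarrow> real \<Rightarrow> real"
  where "beta_moment x \<beta> = (LINT r|\<mu>. (1 - r) powr \<beta> * r powr x)"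

lemma integrable_beta: "0 \<le> x \<Longrightarrow> 0 \<le> \<beta> \<Longrightarrow> integrable \<mu> (\<lambda>r. (1 - r) powr \<beta> * r powr x)"
  by (rule integrable_bounded[of _ 1]) (auto intro!: powr_le1 mult_le_one simp: abs_mult)

text \<open>On 1 - r > M / x the factor ((x / M) (1 - r))^\<beta> exceeds 1, so r^x is at most an
  indicator plus a multiple of the integrand of \<open>beta_moment\<close>. For large M the
  hypothesis makes the second part at most half of the moment, hence the moment is at most 2 h(M /
  x). From below it is at least e^(-8 M) h(4 M / x).\<close>

lemma doubling_of_moments:
  assumes p: "0 < p" and \<beta>: "0 < \<beta>" and C: "0 < C"
    and le: "\<And>n. 2 * k \<le> n \<Longrightarrow> 1 \<le> n \<Longrightarrow> real n powr \<beta> * beta_moment (real (n - k) * p) \<beta> \<le> C * power_moment (real n * p)"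
  shows "doubling \<mu>"
proof -
  \<comment> \<open>The third entry makes (p / M)^\<beta> C at most 1/2, the first absorbs the
    rounding of x to a multiple of p, and the second keeps M positive.\<close>
  define M where "M = max (p / 2) (max 1 (p * (2 * C) powr (1 / \<beta>)))"
  have M: "p / 2 \<le> M" "1 \<le> M" "p * (2 * C) powr (1 / \<beta>) \<le> M"
    by (auto simp: M_def)
  have MC: "(p / M) powr \<beta> * C \<le> 1 / 2"
  proof -
    have "2 * C = ((2 * C) powr (1 / \<beta>)) powr \<beta>"
      using C \<beta> by (simp add: powr_powr)
    also have "\<dots> \<le> (M / p) powr \<beta>"
      using M p \<beta> by (intro powr_mono2) (auto simp: field_simps)
    finally have "2 * C * (p / M) powr \<beta> \<le> (M / p) powr \<beta> * (p / M) powr \<beta>"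
      by (rule mult_right_mono) simp
    also have "\<dots> = 1"
      using M p by (simp add: powr_mult[symmetric])
    finally show ?thesis
      by (simp add: mult_ac)
  qed
  \<comment> \<open>The scales differ by 4 rather than by 2, which leaves room for x being
    restricted to the multiples n p.\<close>
  have key: "mass \<mu> (4 * M / x) \<le> 2 * exp (8 * M) * mass \<mu> (M / x)"
    if n: "2 * k \<le> n" "1 \<le> n" and xn: "x = real n * p" and x8: "8 * M \<le> x" for n x
  proof -
    have x: "0 < x"
      using M x8 by linarith
    let ?R = "\<lambda>r. indicator {r. 1 - r \<le> M / x} r + (x / M) powr \<beta> * ((1 - r) powr \<beta> * r powr (real (n - k) * p))"
    have "power_moment x \<le> (LINT r|\<mu>. ?R r)"
      unfolding power_moment_def
    proof (rule integral_mono)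
      show "integrable \<mu> (\<lambda>r. r powr x)"
        using x by (intro integrable_power) auto
      show "integrable \<mu> (\<lambda>r. ?R r)"
        using p \<beta> x8 x mass_integral(3)[of "M / x" "M / x + 1"]
        by (intro Bochner_Integration.integrable_add integrable_mult_right integrable_beta) auto
      fix r assume "r \<in> space \<mu>"
      then have r: "0 \<le> r" "r < 1"
        by (auto simp: space_\<mu>)
      show "r powr x \<le> ?R r"
      proof (cases "1 - r \<le> M / x")
        case True
        have "r powr x \<le> 1"
          using r x by (intro powr_le1) auto
        then show ?thesis
          using True by (simp add: add_increasing2)
      next
        case False
        have "1 * r powr x \<le> ((x / M) * (1 - r)) powr \<beta> * r powr (real (n - k) * p)"
        proof (rule mult_mono)
          have "1 \<le> (x / M) * (1 - r)"
            using False x M by (simp add: field_simps)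
          then show "1 \<le> ((x / M) * (1 - r)) powr \<beta>"
            using \<beta> by (intro ge_one_powr_ge_zero) auto
          show "r powr x \<le> r powr (real (n - k) * p)"
            unfolding xn using r p by (intro powr_mono') auto
        qed auto
        also have "((x / M) * (1 - r)) powr \<beta> = (x / M) powr \<beta> * (1 - r) powr \<beta>"
          by (rule powr_mult)
        finally show ?thesis
          using False by (simp add: mult_ac)
      qed
    qed
    also have "\<dots> = mass \<mu> (M / x) + (x / M) powr \<beta> * beta_moment (real (n - k) * p) \<beta>"
      using p \<beta> mass_integral(1,3)[of "M / x" "M / x + 1"] integrable_beta[of "real (n - k) * p" \<beta>]
      by (simp add: beta_moment_def)
    also have "(x / M) powr \<beta> * beta_moment (real (n - k) * p) \<beta> \<le> 1 / 2 * power_moment x"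
    proof -
      have "(x / M) powr \<beta> = (p / M) powr \<beta> * real n powr \<beta>"
        using p M by (subst powr_mult[symmetric]) (auto simp: xn mult_ac)
      then have "(x / M) powr \<beta> * beta_moment (real (n - k) * p) \<beta> =
          (p / M) powr \<beta> * (real n powr \<beta> * beta_moment (real (n - k) * p) \<beta>)"
        by simp
      also have "\<dots> \<le> (p / M) powr \<beta> * (C * power_moment (real n * p))"
        using n by (intro mult_left_mono le) auto
      also have "\<dots> \<le> 1 / 2 * power_moment x"
        unfolding xn mult.assoc[symmetric] by (intro mult_right_mono MC) auto
      finally show ?thesis .
    qed
    finally have "1 / 2 * power_moment x \<le> mass \<mu> (M / x)"
      by simp
    moreover have "exp (- (8 * M)) * mass \<mu> (4 * M / x) \<le> power_moment x"
    proof -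
      have "exp (- (8 * M)) = exp (- (2 * (4 * M / x) * x))"
        using x by simp
      also have "\<dots> \<le> (1 - 4 * M / x) powr x"
        using x x8 M by (intro powr_exp_bound) (auto simp: field_simps)
      finally have "exp (- (8 * M)) * mass \<mu> (4 * M / x) \<le> (1 - 4 * M / x) powr x * mass \<mu> (4 * M / x)"
        by (rule mult_right_mono) (simp add: mass_def)
      also have "\<dots> \<le> power_moment x"
        using x x8 M by (intro power_moment_ge_mass) (auto simp: field_simps)
      finally show ?thesis .
    qed
    ultimately have "exp (- (8 * M)) * mass \<mu> (4 * M / x) \<le> 2 * mass \<mu> (M / x)"
      by linarith
    then have "exp (8 * M) * (exp (- (8 * M)) * mass \<mu> (4 * M / x)) \<le> exp (8 * M) * (2 * mass \<mu> (M / x))"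
      by (rule mult_left_mono) simp
    then have "(exp (8 * M) * exp (- (8 * M))) * mass \<mu> (4 * M / x) \<le> 2 * exp (8 * M) * mass \<mu> (M / x)"
      by (simp only: mult_ac)
    moreover have "exp (8 * M) * exp (- (8 * M)) = 1"
      by (simp flip: exp_add)
    ultimately show ?thesis
      by (simp only: mult_1_left)
  qed
  \<comment> \<open>Below 1/4 one obtains x >= 8 M, and the second bound guarantees n >= 2
    k.\<close>
  define y0 where "y0 = min (1 / 4) (M / (p * real (k + 1)))"
  have y0_pos: "0 < y0"
    using M p by (simp add: y0_def)
  have y0_le: "y0 \<le> 1 / 4" "y0 \<le> M / (p * real (k + 1))"
    unfolding y0_def by (rule min.cobounded1 min.cobounded2)+
  note y0 = y0_pos y0_le
  have small: "mass \<mu> y \<le> 2 * exp (8 * M) * mass \<mu> (y / 2)" if y: "0 < y" "y \<le> y0" for y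
  proof -
    \<comment> \<open>Rounding down gives 2 M / y <= n p <= 4 M / y, so that y <= 4 M / x and M / x
      <= y / 2 hold simultaneously.\<close>
    define n where "n = nat \<lfloor>4 * M / (y * p)\<rfloor>"
    have pos: "0 < 4 * M / (y * p)"
      using M y p by simp
    have n1: "real n \<le> 4 * M / (y * p)"
      using pos unfolding n_def by linarith
    have n2: "4 * M / (y * p) - 1 \<le> real n"
      using pos unfolding n_def by linarith
    define x where "x = real n * p"
    have x1: "x \<le> 4 * M / y"
      using mult_right_mono[OF n1, of p] p y by (simp add: x_def)
    have "4 * M / y - p \<le> x"
      using mult_right_mono[OF n2, of p] p y by (simp add: x_def left_diff_distrib)
    moreover have "p \<le> 2 * M / y"
    proof -
      have "p * y \<le> p * 1"
        using y y0 p by (intro mult_left_mono) auto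
      then show ?thesis
        using M y by (simp add: field_simps)
    qed
    ultimately have x2: "2 * M / y \<le> x"
      by simp
    have x8: "8 * M \<le> x"
    proof -
      have "8 * M \<le> 2 * M / y"
        using y y0 M by (simp add: field_simps)
      then show ?thesis
        using x2 by simp
    qed
    have nk: "2 * k \<le> n" "1 \<le> n"
    proof -
      have pk: "0 < p * real (k + 1)"
        using p by simp
      have "y \<le> M / (p * real (k + 1))"
        using y y0 by linarith
      then have "y * (p * real (k + 1)) \<le> M"
        unfolding pos_le_divide_eq[OF pk] .
      then have "2 * real (k + 1) * p \<le> 2 * M / y"
        using y by (simp add: field_simps)
      also note x2
      finally have "2 * real (k + 1) \<le> real n"
        using p by (simp add: x_def)
      then show "2 * k \<le> n" "1 \<le> n"
        by auto
    qed
    have x0: "0 < x"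
      using x8 M by linarith
    have "mass \<mu> y \<le> mass \<mu> (4 * M / x)"
      using x1 x0 y by (intro mass_mono) (simp add: field_simps)
    also have "\<dots> \<le> 2 * exp (8 * M) * mass \<mu> (M / x)"
      by (rule key[OF nk x_def x8])
    also have "\<dots> \<le> 2 * exp (8 * M) * mass \<mu> (y / 2)"
      using x2 x0 y by (intro mult_left_mono mass_mono) (auto simp: field_simps)
    finally show ?thesis .
  qed
  define B where "B = 2 * exp (8 * M) + mass \<mu> 1 / mass \<mu> (y0 / 2)"
  have m: "0 < mass \<mu> 1" "0 < mass \<mu> (y0 / 2)"
    using y0 by (auto intro!: mass_pos)
  have "mass \<mu> y \<le> B * mass \<mu> (y / 2)" if y: "0 < y" for y
  proof (cases "y \<le> y0")
    case True
    then have "mass \<mu> y \<le> 2 * exp (8 * M) * mass \<mu> (y / 2)"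
      using y by (intro small)
    also have "\<dots> \<le> B * mass \<mu> (y / 2)"
      using m by (intro mult_right_mono) (auto simp: B_def mass_def)
    finally show ?thesis .
  next
    case False
    have "mass \<mu> y \<le> mass \<mu> (max y 1)"
      by (rule mass_mono) simp
    also have "\<dots> = mass \<mu> 1"
      by (simp add: mass_ge_1)
    also have "\<dots> = mass \<mu> 1 / mass \<mu> (y0 / 2) * mass \<mu> (y0 / 2)"
      using m by simp
    also have "\<dots> \<le> B * mass \<mu> (y / 2)"
      using False m by (intro mult_mono mass_mono) (auto simp: B_def)
    finally show ?thesis .
  qed
  moreover have "1 \<le> B"
  proof -
    have "1 \<le> exp (8 * M)"
      using M by simp
    moreover have "0 \<le> mass \<mu> 1 / mass \<mu> (y0 / 2)"
      using m by simp
    ultimately show ?thesis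
      unfolding B_def by linarith
  qed
  ultimately show ?thesis
    unfolding doubling_def by blast
qed

text \<open>The integral of (n (1 - r))^\<beta> r^((n-k) p) is split at 1 - r = 1 / (L n) and 1 - r
  = L / n. The part nearest to 1 is at most L^(-\<beta>) h(1 / n), the part nearest to 0 is
  exponentially small in L times h(1 / n), and both are absorbed for large L. Thus h(1 / n) is
  bounded by a multiple of the mass of the middle annulus, which is the contraction at the scale 1 /
  n.\<close>

lemma contracting_of_moments:
  assumes D: "doubling \<mu>" and p: "0 < p" and \<beta>: "0 < \<beta>" and C: "0 < C"
    and le: "\<And>n. 2 * k \<le> n \<Longrightarrow> 1 \<le> n \<Longrightarrow> mass \<mu> (1 / real n) \<le> C * (real n powr \<beta> * beta_moment (real (n - k) * p) \<beta>)"
  shows "contracting \<mu>"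
proof -
  obtain A where A: "1 \<le> A" "\<And>x. 1 \<le> x \<Longrightarrow> power_moment x \<le> A * mass \<mu> (1 / x)"
    using power_moment_le_mass[OF D] by blast
  have "0 < 4 / p"
    using p by simp
  then obtain B where B: "1 \<le> B" "\<And>x. 0 < x \<Longrightarrow> mass \<mu> (4 / p * x) \<le> B * mass \<mu> x"
    using mass_doubling_cmult[OF D] by blast
  \<comment> \<open>A bound for the product of the power and half of the exponential decay; the
    other half is kept to produce smallness in L.\<close>
  obtain c1 where c1: "0 < c1" "\<And>u. 0 \<le> u \<Longrightarrow> u powr \<beta> * exp (- (u * p / 8)) \<le> c1"
  proof -
    have "((\<lambda>u. u powr \<beta> * exp (- (u * p / 8))) \<longlongrightarrow> 0) at_top"
      using p \<beta> by real_asymp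
    then have "\<forall>\<^sub>F u in at_top. u powr \<beta> * exp (- (u * p / 8)) < 1"
      by (rule order_tendstoD) simp
    then obtain U where U: "\<And>u. U \<le> u \<Longrightarrow> u powr \<beta> * exp (- (u * p / 8)) < 1"
      by (auto simp: eventually_at_top_linorder)
    define c1 where "c1 = 1 + max 0 U powr \<beta>"
    have "u powr \<beta> * exp (- (u * p / 8)) \<le> c1" if u: "0 \<le> u" for u
    proof (cases "U \<le> u")
      case True
      then show ?thesis
        using U[of u] by (simp add: c1_def add_increasing2)
    next
      case False
      have "u powr \<beta> * exp (- (u * p / 8)) \<le> max 0 U powr \<beta> * 1"
        using False u p \<beta> by (intro mult_mono powr_mono2) auto
      then show ?thesis
        by (simp add: c1_def)
    qed
    moreover have "0 < c1"
      by (simp add: c1_def add_pos_nonneg)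
    ultimately show ?thesis
      using that by blast
  qed
  \<comment> \<open>The two quarters are the shares of h(1 / n) absorbed from the two outer
    parts.\<close>
  obtain L where L: "1 < L" "C * L powr (- \<beta>) \<le> 1 / 4" "C * c1 * A * B * exp (- (L * p / 8)) \<le> 1 / 4"
  proof -
    have "((\<lambda>L. C * L powr (- \<beta>)) \<longlongrightarrow> 0) at_top" "((\<lambda>L. C * c1 * A * B * exp (- (L * p / 8))) \<longlongrightarrow> 0) at_top"
      using p \<beta> by real_asymp+
    from this[THEN order_tendstoD(2), of "1 / 4"]
    have "\<forall>\<^sub>F L in at_top. C * L powr (- \<beta>) < 1 / 4" "\<forall>\<^sub>F L in at_top. C * c1 * A * B * exp (- (L * p / 8)) < 1 / 4"
      by simp_all
    then have "\<forall>\<^sub>F L in at_top. 1 < L \<and> C * L powr (- \<beta>) \<le> 1 / 4 \<and> C * c1 * A * B * exp (- (L * p / 8)) \<le> 1 / 4"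
      using eventually_gt_at_top[of "1::real"] by eventually_elim auto
    then show ?thesis
      using that eventually_happens'[OF trivial_limit_at_top_linorder] by blast
  qed
  define n0 where "n0 = nat \<lceil>max (2 * real k) (max 1 (4 / p))\<rceil>"
  \<comment> \<open>The middle part has the coefficient C L^\<beta>; the factor 2 comes from moving
    half of h(1 / n) to the left.\<close>
  define E where "E = 2 * C * L powr \<beta>"
  have E: "0 < E"
    using C L by (simp add: E_def)
  have step: "(1 + 1 / E) * mass \<mu> (1 / (L * real n)) \<le> mass \<mu> (L / real n)" if n: "n0 \<le> n" for n
  proof -
    have "max (2 * real k) (max 1 (4 / p)) \<le> real n"
      using n unfolding n0_def by linarith
    then have n1: "2 * k \<le> n" "1 \<le> n" and n4: "4 / p \<le> real n"
      by auto
    have n_pos: "0 < real n"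
      using n1 by simp
    define I where "I = real n powr \<beta> * beta_moment (real (n - k) * p) \<beta>"
    have ord: "1 / (L * real n) < L / real n"
    proof -
      have "1 / L < L"
        using L(1) by (simp add: divide_less_eq) (metis less_1_mult)
      then have "1 / L / real n < L / real n"
        using n_pos by (rule divide_strict_right_mono)
      then show ?thesis
        by simp
    qed
    let ?R = "\<lambda>r. L powr (- \<beta>) * indicator {r. 1 - r \<le> 1 / (L * real n)} r +
        (c1 * exp (- (L * p / 8)) * r powr (real n * p / 4) + L powr \<beta> * indicator {r. 1 / (L * real n) < 1 - r \<and> 1 - r \<le> L / real n} r)"
    have "I = (LINT r|\<mu>. real n powr \<beta> * ((1 - r) powr \<beta> * r powr (real (n - k) * p)))"
      by (simp add: I_def beta_moment_def)
    also have "\<dots> \<le> (LINT r|\<mu>. ?R r)"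
    proof (rule integral_mono)
      show "integrable \<mu> (\<lambda>r. real n powr \<beta> * ((1 - r) powr \<beta> * r powr (real (n - k) * p)))"
        using p \<beta> by (intro integrable_mult_right integrable_beta) auto
      show "integrable \<mu> (\<lambda>r. ?R r)"
        using p by (intro Bochner_Integration.integrable_add integrable_mult_right integrable_power mass_integral(3)[OF ord] mass_integral(4)[OF ord]) auto
      fix r assume "r \<in> space \<mu>"
      then have r: "0 \<le> r" "r < 1"
        by (auto simp: space_\<mu>)
      let ?l = "real n powr \<beta> * ((1 - r) powr \<beta> * r powr (real (n - k) * p))"
      have le1: "?l \<le> (real n * (1 - r)) powr \<beta>"
      proof -
        have "(1 - r) powr \<beta> * r powr (real (n - k) * p) \<le> (1 - r) powr \<beta> * 1"
          using r p by (intro mult_left_mono powr_le1) auto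
        then have "?l \<le> real n powr \<beta> * ((1 - r) powr \<beta> * 1)"
          by (rule mult_left_mono) simp
        then show ?thesis
          using r n_pos by (simp add: powr_mult)
      qed
      consider "1 - r \<le> 1 / (L * real n)" | "1 / (L * real n) < 1 - r" "1 - r \<le> L / real n" | "1 / (L * real n) < 1 - r" "L / real n < 1 - r"
        by linarith
      then show "?l \<le> ?R r"
      proof cases
        case 1
        have "(real n * (1 - r)) powr \<beta> \<le> (1 / L) powr \<beta>"
        proof (rule powr_mono2)
          have "real n * (1 - r) \<le> real n * (1 / (L * real n))"
            using 1 n_pos by (intro mult_left_mono) auto
          then show "real n * (1 - r) \<le> 1 / L"
            using n_pos by simp
        qed (use r \<beta> in auto)
        also have "(1 / L) powr \<beta> = L powr (- \<beta>)"
          using L(1) by (simp add: powr_divide powr_minus field_simps)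
        finally show ?thesis
          using le1 1 c1(1) by (auto intro!: order_trans[OF le1] add_increasing2)
      next
        case 2
        have "(real n * (1 - r)) powr \<beta> \<le> L powr \<beta>"
        proof (rule powr_mono2)
          have "real n * (1 - r) \<le> real n * (L / real n)"
            using 2 n_pos by (intro mult_left_mono) auto
          then show "real n * (1 - r) \<le> L"
            using n_pos by simp
        qed (use r \<beta> in auto)
        then show ?thesis
          using le1 2 c1(1) by (auto intro!: order_trans[OF le1] add_increasing)
      next
        case 3
        define u where "u = real n * (1 - r)"
        have u: "L \<le> u"
          using 3 n_pos by (simp add: u_def field_simps)
        have half: "real n / 2 \<le> real (n - k)"
          using n1 by simp
        \<comment> \<open>Since n - k >= n / 2, the exponent contains two copies of n p / 4: one
          becomes exponential decay in u, the other remains as the moment that doubling compares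
          with h(1 / n).\<close>
        have "r powr (real (n - k) * p) \<le> r powr (real n * p / 4 + real n * p / 4)"
        proof (rule powr_mono')
          have "real n / 2 * p \<le> real (n - k) * p"
            using half p by (intro mult_right_mono) auto
          then show "real n * p / 4 + real n * p / 4 \<le> real (n - k) * p"
            by linarith
        qed (use r in auto)
        also have "\<dots> = r powr (real n * p / 4) * r powr (real n * p / 4)"
          by (rule powr_add)
        also have "\<dots> \<le> exp (- (u * p / 4)) * r powr (real n * p / 4)"
        proof (rule mult_right_mono)
          show "r powr (real n * p / 4) \<le> exp (- (u * p / 4))"
            using powr_exp_upper[of "1 - r" "real n * p / 4"] r p
            by (cases "r = 0") (auto simp: u_def mult_ac)
        qed simp
        finally have "?l \<le> u powr \<beta> * (exp (- (u * p / 4)) * r powr (real n * p / 4))"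
          using r n_pos by (simp add: u_def powr_mult mult.assoc mult_left_mono)
        also have "exp (- (u * p / 4)) = exp (- (u * p / 8)) * exp (- (u * p / 8))"
          by (simp add: exp_add[symmetric])
        also have "u powr \<beta> * (exp (- (u * p / 8)) * exp (- (u * p / 8)) * r powr (real n * p / 4)) =
            (u powr \<beta> * exp (- (u * p / 8))) * exp (- (u * p / 8)) * r powr (real n * p / 4)"
          by (simp only: mult.assoc)
        also have "\<dots> \<le> c1 * exp (- (L * p / 8)) * r powr (real n * p / 4)"
          using u L(1) c1 p by (intro mult_right_mono mult_mono) auto
        finally show ?thesis
          using 3 by (auto simp: add_increasing2 add_increasing)
      qed
    qed
    also have "\<dots> = L powr (- \<beta>) * mass \<mu> (1 / (L * real n)) +
        (c1 * exp (- (L * p / 8)) * power_moment (real n * p / 4) + L powr \<beta> * (mass \<mu> (L / real n) - mass \<mu> (1 / (L * real n))))"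
      using p mass_integral[OF ord] integrable_power[of "real n * p / 4"] by (simp add: power_moment_def)
    finally have I: "I \<le> L powr (- \<beta>) * mass \<mu> (1 / (L * real n)) +
        (c1 * exp (- (L * p / 8)) * power_moment (real n * p / 4) + L powr \<beta> * (mass \<mu> (L / real n) - mass \<mu> (1 / (L * real n))))" .
    have m1: "mass \<mu> (1 / (L * real n)) \<le> mass \<mu> (1 / real n)"
      using L(1) n_pos by (intro mass_mono) (simp add: field_simps)
    have "power_moment (real n * p / 4) \<le> A * mass \<mu> (1 / (real n * p / 4))"
      using n4 p by (intro A) (simp add: field_simps)
    also have "1 / (real n * p / 4) = 4 / p * (1 / real n)"
      by simp
    also have "mass \<mu> (4 / p * (1 / real n)) \<le> B * mass \<mu> (1 / real n)"
      using n_pos by (intro B) auto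
    finally have pm: "power_moment (real n * p / 4) \<le> A * B * mass \<mu> (1 / real n)"
      using A(1) by (simp add: mult.assoc mult_left_mono)
    let ?m = "mass \<mu> (1 / real n)" and ?d = "mass \<mu> (L / real n) - mass \<mu> (1 / (L * real n))"
    have m0: "0 \<le> ?m"
      by (simp add: mass_def)
    have "?m \<le> C * I"
      unfolding I_def by (rule le[OF n1])
    also have "\<dots> \<le> C * (L powr (- \<beta>) * ?m + (c1 * exp (- (L * p / 8)) * (A * B * ?m) + L powr \<beta> * ?d))"
      using I m1 pm C c1(1)
      by (intro mult_left_mono order_trans[OF I] add_mono) auto
    also have "\<dots> = (C * L powr (- \<beta>)) * ?m + (C * c1 * A * B * exp (- (L * p / 8))) * ?m + C * L powr \<beta> * ?d"
      by (simp add: algebra_simps)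
    also have "\<dots> \<le> 1 / 4 * ?m + 1 / 4 * ?m + C * L powr \<beta> * ?d"
      by (rule add_mono[OF add_mono[OF mult_right_mono[OF L(2) m0] mult_right_mono[OF L(3) m0]] order_refl])
    finally have "?m \<le> E * ?d"
      by (simp add: E_def)
    then have "mass \<mu> (1 / (L * real n)) \<le> E * ?d"
      using m1 by simp
    then show ?thesis
      using E by (simp add: field_simps)
  qed
  define y0 where "y0 = min 1 (L / real (n0 + 1))"
  have y0: "0 < y0" "y0 \<le> 1" "y0 \<le> L / real (n0 + 1)"
    using L(1) by (auto simp: y0_def)
  \<comment> \<open>For y <= y0 the ratio 2 L^2 works, because n <= 2 L / y. Dividing by y0 extends
    it to y up to 1, since then y / K <= y0 / (2 L^2).\<close>
  define K where "K = 2 * L\<^sup>2 / y0"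
  have L2: "1 < L\<^sup>2"
    using L(1) by (simp add: one_less_power)
  have K: "2 * L\<^sup>2 \<le> K" "1 < K"
  proof -
    have "2 * L\<^sup>2 * y0 \<le> 2 * L\<^sup>2 * 1"
      using y0 by (intro mult_left_mono) auto
    then show "2 * L\<^sup>2 \<le> K"
      using y0 by (simp add: K_def field_simps)
    then show "1 < K"
      using L2 by linarith
  qed
  have small: "(1 + 1 / E) * mass \<mu> (y / (2 * L\<^sup>2)) \<le> mass \<mu> y" if y: "0 < y" "y \<le> y0" for y
  proof -
    \<comment> \<open>Rounding up puts L / n below y, while n <= 2 L / y keeps 1 / (L n) above y /
      (2 L^2).\<close>
    define n where "n = nat \<lceil>L / y\<rceil>"
    have Ly: "real (n0 + 1) \<le> L / y"
    proof -
      have "real (n0 + 1) * y \<le> real (n0 + 1) * (L / real (n0 + 1))"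
        using y y0 by (intro mult_left_mono) auto
      also have "\<dots> = L"
        by simp
      finally show ?thesis
        using y by (simp add: pos_le_divide_eq)
    qed
    have n1: "L / y \<le> real n" "real n \<le> L / y + 1"
      using Ly unfolding n_def by linarith+
    have n0: "n0 \<le> n"
      using n1 Ly by simp
    have n2: "real n \<le> 2 * (L / y)"
      using n1 Ly by simp
    have n_pos: "0 < real n"
      using n1 Ly by simp
    have "y / (2 * L\<^sup>2) \<le> 1 / (L * real n)"
    proof -
      have "real n * y \<le> 2 * L"
        using mult_right_mono[OF n2, of y] y by simp
      then have "L * (real n * y) \<le> L * (2 * L)"
        using L(1) by (intro mult_left_mono) auto
      then show ?thesis
        using L(1) n_pos by (simp add: field_simps power2_eq_square)
    qed
    then have "(1 + 1 / E) * mass \<mu> (y / (2 * L\<^sup>2)) \<le> (1 + 1 / E) * mass \<mu> (1 / (L * real n))"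
      using E by (intro mult_left_mono mass_mono) auto
    also have "\<dots> \<le> mass \<mu> (L / real n)"
      by (rule step[OF n0])
    also have "\<dots> \<le> mass \<mu> y"
      using n1 n_pos y by (intro mass_mono) (simp add: field_simps)
    finally show ?thesis .
  qed
  have "(1 + 1 / E) * mass \<mu> (y / K) \<le> mass \<mu> y" if y: "0 < y" "y \<le> 1" for y
  proof (cases "y \<le> y0")
    case True
    have "(1 + 1 / E) * mass \<mu> (y / K) \<le> (1 + 1 / E) * mass \<mu> (y / (2 * L\<^sup>2))"
    proof (intro mult_left_mono mass_mono divide_left_mono)
      show "0 < K * (2 * L\<^sup>2)"
        using K L2 by (intro mult_pos_pos) linarith+
    qed (use E y K in auto)
    also have "\<dots> \<le> mass \<mu> y"
      using y True by (intro small)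
    finally show ?thesis .
  next
    case False
    have "y / K \<le> 1 / K"
      using y K by (intro divide_right_mono) auto
    also have "1 / K = y0 / (2 * L\<^sup>2)"
      by (simp add: K_def)
    finally have "(1 + 1 / E) * mass \<mu> (y / K) \<le> (1 + 1 / E) * mass \<mu> (y0 / (2 * L\<^sup>2))"
      using E by (intro mult_left_mono mass_mono) auto
    also have "\<dots> \<le> mass \<mu> y0"
      using y0 by (intro small) auto
    also have "\<dots> \<le> mass \<mu> y"
      using False by (intro mass_mono) auto
    finally show ?thesis .
  qed
  then show ?thesis
    unfolding contracting_def using K(2) E by (intro exI[of _ K] conjI exI[of _ "1 + 1 / E"]) auto
qed

end

subsection \<open>Fourier coefficients and the projection\<close>

lemma conjugate_gt_1:
  fixes p q :: real
  assumes "1 < p" "1 / p + 1 / q = 1"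
  shows "1 < q"
proof -
  have "0 < 1 / p" "1 / p < 1"
    using assms(1) by auto
  then have q: "0 < 1 / q" "1 / q < 1"
    using assms(2) by linarith+
  then have "0 < q"
    by simp
  then show ?thesis
    using q(2) by (simp add: divide_less_eq)
qed

text \<open>A and B are bounds for the norms rather than the norms themselves and may be zero. The
  proof divides by A + e and B + e and lets e tend to 0, so no degenerate case has to be treated
  separately.\<close>

lemma nn_holder:
  fixes f g :: "'a \<Rightarrow> real"
  assumes pq: "1 < p" "1 / p + 1 / q = 1"
    and m [measurable]: "f \<in> borel_measurable M" "g \<in> borel_measurable M"
    and nn: "\<And>x. x \<in> space M \<Longrightarrow> 0 \<le> f x" "\<And>x. x \<in> space M \<Longrightarrow> 0 \<le> g x"
    and f: "(\<integral>\<^sup>+x. ennreal (f x powr p) \<partial>M) \<le> ennreal (A powr p)"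
    and g: "(\<integral>\<^sup>+x. ennreal (g x powr q) \<partial>M) \<le> ennreal (B powr q)"
    and AB: "0 \<le> A" "0 \<le> B"
  shows "(\<integral>\<^sup>+x. ennreal (f x * g x) \<partial>M) \<le> ennreal (A * B)"
proof -
  have q: "1 < q"
    by (rule conjugate_gt_1[OF pq])
  have *: "(\<integral>\<^sup>+x. ennreal (f x * g x) \<partial>M) \<le> ennreal (a * b)"
    if ab: "0 < a" "0 < b" "A \<le> a" "B \<le> b" for a b
  proof -
    define c where "c = a * b / (p * a powr p)"
    define d where "d = a * b / (q * b powr q)"
    have cd: "0 \<le> c" "0 \<le> d"
      using ab pq q by (auto simp: c_def d_def)
    have "(\<integral>\<^sup>+x. ennreal (f x * g x) \<partial>M) \<le> (\<integral>\<^sup>+x. ennreal c * ennreal (f x powr p) + ennreal d * ennreal (g x powr q) \<partial>M)"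
    proof (rule nn_integral_mono)
      fix x assume x: "x \<in> space M"
      have "(f x / a) * (g x / b) \<le> (f x / a) powr p / p + (g x / b) powr q / q"
        by (rule Youngs_inequality) (use pq q nn x ab in auto)
      then have "(a * b) * ((f x / a) * (g x / b)) \<le> (a * b) * ((f x / a) powr p / p + (g x / b) powr q / q)"
        using ab by (intro mult_left_mono) auto
      also have "(a * b) * ((f x / a) * (g x / b)) = f x * g x"
        using ab by simp
      also have "(a * b) * ((f x / a) powr p / p + (g x / b) powr q / q) = c * f x powr p + d * g x powr q"
        using ab nn x by (simp add: c_def d_def powr_divide field_simps)
      finally have "ennreal (f x * g x) \<le> ennreal (c * f x powr p + d * g x powr q)"
        by (rule ennreal_leI)
      then show "ennreal (f x * g x) \<le> ennreal c * ennreal (f x powr p) + ennreal d * ennreal (g x powr q)"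
        using cd by (simp add: ennreal_mult ennreal_plus)
    qed
    also have "\<dots> = ennreal c * (\<integral>\<^sup>+x. ennreal (f x powr p) \<partial>M) + ennreal d * (\<integral>\<^sup>+x. ennreal (g x powr q) \<partial>M)"
      by (simp add: nn_integral_add nn_integral_cmult)
    also have "\<dots> \<le> ennreal c * ennreal (a powr p) + ennreal d * ennreal (b powr q)"
      using ab AB pq q by (intro add_mono mult_left_mono order_trans[OF f] order_trans[OF g] ennreal_leI powr_mono2) auto
    also have "\<dots> = ennreal (c * a powr p + d * b powr q)"
      using cd by (simp add: ennreal_mult ennreal_plus)
    also have "c * a powr p + d * b powr q = a * b * (1 / p + 1 / q)"
      using ab by (simp add: c_def d_def field_simps)
    finally show ?thesis
      using pq by simp
  qed
  have "\<forall>\<^sub>F e in at_right (0::real). (\<integral>\<^sup>+x. ennreal (f x * g x) \<partial>M) \<le> ennreal ((A + e) * (B + e))"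
    using eventually_at_right_less[of "0::real"] by eventually_elim (rule *, use AB in auto)
  moreover have "((\<lambda>e. ennreal ((A + e) * (B + e))) \<longlongrightarrow> ennreal ((A + 0) * (B + 0))) (at_right 0)"
    by (intro tendsto_intros)
  ultimately show ?thesis
    using tendsto_lowerbound[of "\<lambda>e. ennreal ((A + e) * (B + e))" "ennreal ((A + 0) * (B + 0))" "at_right 0"] by simp
qed

text \<open>The differences of the coefficients form a power series that sums to 0 on the disc; a
  nonzero coefficient would contradict the isolation of zeros.\<close>

lemma taylor_unique:
  assumes g: "\<And>z. norm z < 1 \<Longrightarrow> (\<lambda>n. a n * z ^ n) sums g z"
  shows "g holomorphic_on disc" and "taylor g n = a n"
proof -
  show h: "g holomorphic_on disc"
    by (rule power_series_holomorphic[where a = a]) (use g in auto)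
  define d where "d n = taylor g n - a n" for n
  have z: "(\<lambda>n. d n * (z - 0) ^ n) sums 0" if "norm (z - 0) < 1" for z
    using sums_diff[OF taylor_sums[OF h, of z] g[of z]] that by (simp add: d_def algebra_simps)
  have "d 0 = 0"
    using z[of 0] by (simp add: sums_iff)
  moreover have "d m = 0" if m: "m > 0" for m
  proof (rule ccontr)
    assume "d m \<noteq> 0"
    show False
    proof (rule powser_0_nonzero[of 1 0 d "\<lambda>_. 0" m])
      fix s :: real assume "0 < s" and "\<And>z::complex. z \<in> cball 0 s - {0} \<Longrightarrow> (0::complex) \<noteq> 0"
      from this(2)[of "of_real s"] this(1) show False
        by simp
    qed (use z m \<open>d m \<noteq> 0\<close> in auto)
  qed
  ultimately have "d n = 0"
    by (cases "n = 0") auto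
  then show "taylor g n = a n"
    by (simp add: d_def)
qed

lemma holomorphic_borel:
  assumes "f holomorphic_on disc"
  shows "(\<lambda>z. indicator disc z *\<^sub>R f z) \<in> borel_measurable borel"
  using holomorphic_on_imp_continuous_on[OF assms] by (intro borel_measurable_continuous_on_indicator) auto

lemma taylor_dilate:
  assumes f: "f holomorphic_on disc" and t: "0 \<le> t" "t \<le> 1"
  shows "taylor (\<lambda>z. f (of_real t * z)) n = taylor f n * of_real t ^ n"
proof (rule taylor_unique(2))
  fix z :: complex assume z: "norm z < 1"
  have "norm (of_real t * z) \<le> 1 * norm z"
    unfolding norm_mult using t by (intro mult_right_mono) auto
  then have "(\<lambda>n. taylor f n * (of_real t * z) ^ n) sums f (of_real t * z)"
    using z by (intro taylor_sums f) auto
  then show "(\<lambda>n. taylor f n * of_real t ^ n * z ^ n) sums f (of_real t * z)"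
    by (simp add: power_mult_distrib mult.assoc)
qed

lemma cnj_power_measurable: "(\<lambda>z. cnj z ^ n) \<in> borel_measurable borel"
  by (intro borel_measurable_continuous_onI continuous_intros)

lemma circle_coefficient:
  assumes f: "f holomorphic_on disc" and r: "0 \<le> r" "r < 1"
  shows "(LINT \<xi>|circle. f (of_real r * \<xi>) * cnj \<xi> ^ n) = taylor f n * of_real r ^ n"
proof -
  have "(\<lambda>m. taylor f m * (LINT \<xi>|circle. \<xi> ^ m * cnj \<xi> ^ n) * of_real r ^ m) sums (LINT \<xi>|circle. f (of_real r * \<xi>) * cnj \<xi> ^ n)"
    using r by (intro circle_convolution_sums[OF f, where B = 1] borel_measurable_circle cnj_power_measurable) (auto simp: norm_power)
  moreover have "(\<lambda>m. taylor f m * (LINT \<xi>|circle. \<xi> ^ m * cnj \<xi> ^ n) * of_real r ^ m) sums (taylor f n * of_real r ^ n)"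
  proof -
    have "(\<lambda>m. taylor f m * (LINT \<xi>|circle. \<xi> ^ m * cnj \<xi> ^ n) * of_real r ^ m) =
        (\<lambda>m. if m = n then taylor f m * of_real r ^ m else 0)"
      by (auto simp: circle_integral_monomial)
    then show ?thesis
      using sums_single[of n "\<lambda>m. taylor f m * of_real r ^ m"] by (simp only:)
  qed
  ultimately show ?thesis
    by (rule sums_unique2)
qed

context weight
begin

text \<open>The identity of nonnegative integrals says that the product measure on radius and circle
  has the image \<open>W\<close> on the Borel sets. Complex integrands then follow from transport of
  integrals; the identity map serves only to pass from Lebesgue to Borel sets.\<close>

lemma integral_polar:
  fixes F :: "complex \<Rightarrow> complex"
  assumes [measurable]: "F \<in> borel_measurable borel" and i: "integrable W F"
  shows "(LINT z|W. F z) = (LINT r|\<mu>. LINT \<xi>|circle. F (of_real r * \<xi>))"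
proof -
  interpret C: prob_space circle
    by (rule prob_space_circle)
  interpret M: finite_measure \<mu>
    by (rule finite_measure_\<mu>)
  interpret P: pair_sigma_finite \<mu> circle ..
  have ids: "(\<lambda>x. x) \<in> \<mu> \<rightarrow>\<^sub>M borel" "(\<lambda>x. x) \<in> circle \<rightarrow>\<^sub>M borel"
    by (rule borel_measurable_\<mu>, simp) (rule borel_measurable_circle, simp)
  define h where "h x = of_real (fst x) * snd x" for x :: "real \<times> complex"
  have [measurable]: "fst \<in> \<mu> \<Otimes>\<^sub>M circle \<rightarrow>\<^sub>M borel" "snd \<in> \<mu> \<Otimes>\<^sub>M circle \<rightarrow>\<^sub>M borel"
    by (rule measurable_compose[OF measurable_fst ids(1)]) (rule measurable_compose[OF measurable_snd ids(2)])
  have h[measurable]: "h \<in> \<mu> \<Otimes>\<^sub>M circle \<rightarrow>\<^sub>M borel"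
    unfolding h_def by measurable
  have id: "(\<lambda>z. z) \<in> W \<rightarrow>\<^sub>M borel"
    by (rule borel_measurable_W) simp
  have "distr W borel (\<lambda>z. z) = distr (\<mu> \<Otimes>\<^sub>M circle) borel h"
  proof (rule measure_eqI)
    fix A assume "A \<in> sets (distr W borel (\<lambda>z. z))"
    then have [measurable]: "A \<in> sets borel"
      by simp
    have "emeasure (distr W borel (\<lambda>z. z)) A = (\<integral>\<^sup>+z. indicator A z \<partial>distr W borel (\<lambda>z. z))"
      by simp
    also have "\<dots> = (\<integral>\<^sup>+z. indicator A z \<partial>W)"
      by (rule nn_integral_distr[OF id]) simp
    also have "\<dots> = (\<integral>\<^sup>+r. \<integral>\<^sup>+\<xi>. indicator A (of_real r * \<xi>) \<partial>circle \<partial>\<mu>)"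
      by (rule polar) simp
    also have "\<dots> = (\<integral>\<^sup>+r. \<integral>\<^sup>+\<xi>. indicator A (h (r, \<xi>)) \<partial>circle \<partial>\<mu>)"
      by (simp add: h_def)
    also have "\<dots> = (\<integral>\<^sup>+x. indicator A (h x) \<partial>(\<mu> \<Otimes>\<^sub>M circle))"
      by (rule C.nn_integral_fst) measurable
    also have "\<dots> = (\<integral>\<^sup>+z. indicator A z \<partial>distr (\<mu> \<Otimes>\<^sub>M circle) borel h)"
      by (rule nn_integral_distr[OF h, symmetric]) simp
    also have "\<dots> = emeasure (distr (\<mu> \<Otimes>\<^sub>M circle) borel h) A"
      by simp
    finally show "emeasure (distr W borel (\<lambda>z. z)) A = emeasure (distr (\<mu> \<Otimes>\<^sub>M circle) borel h) A" .
  qed simp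
  note E = this
  have "(LINT z|W. F z) = (LINT z|distr W borel (\<lambda>z. z). F z)"
    by (rule integral_distr[OF id, symmetric]) simp
  also have "\<dots> = integral\<^sup>L (\<mu> \<Otimes>\<^sub>M circle) (\<lambda>x. F (h x))"
    unfolding E by (rule integral_distr[OF h]) simp
  also have "\<dots> = (LINT r|\<mu>. LINT \<xi>|circle. F (h (r, \<xi>)))"
  proof (rule P.integral_fst'[symmetric])
    have "integrable (distr W borel (\<lambda>z. z)) F"
      using i by (subst integrable_distr_eq[OF id]) simp_all
    then show "integrable (\<mu> \<Otimes>\<^sub>M circle) (\<lambda>x. F (h x))"
      unfolding E by (subst (asm) integrable_distr_eq[OF h]) simp_all
  qed
  finally show ?thesis
    by (simp add: h_def)
qed

lemma integral_dA_weight: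
  fixes F :: "complex \<Rightarrow> complex"
  assumes F: "F \<in> borel_measurable dA"
  shows "(LINT z|dA. F z * complex_of_real (\<omega> (norm z))) = (LINT z|W. F z)"
    and "integrable dA (\<lambda>z. F z * complex_of_real (\<omega> (norm z))) \<longleftrightarrow> integrable W F"
proof -
  have nn: "AE z in dA. 0 \<le> \<omega> (norm z)"
    by (rule AE_I2) (simp add: nonneg)
  show "(LINT z|dA. F z * complex_of_real (\<omega> (norm z))) = (LINT z|W. F z)"
    unfolding disc_measure_def integral_density[OF F weight_measurable nn]
    by (simp add: scaleR_conv_of_real mult.commute)
  show "integrable dA (\<lambda>z. F z * complex_of_real (\<omega> (norm z))) \<longleftrightarrow> integrable W F"
    unfolding disc_measure_def integrable_density[OF F weight_measurable nn]
    by (simp add: scaleR_conv_of_real mult.commute)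
qed

lemma Lp_integrable:
  assumes f: "f \<in> Lp \<omega> p" and p: "1 \<le> p"
  shows "integrable W f"
proof (rule integrableI_bounded)
  have fm: "f \<in> borel_measurable W"
    using f by (simp add: Lp_iff measurable_W)
  then show "f \<in> borel_measurable W" .
  interpret finite_measure W
    by (rule finite_measure_W)
  have "(\<integral>\<^sup>+z. ennreal (norm (f z)) \<partial>W) \<le> (\<integral>\<^sup>+z. 1 + ennreal (norm (f z) powr p) \<partial>W)"
  proof (rule nn_integral_mono)
    fix z
    have "norm (f z) \<le> 1 + norm (f z) powr p"
    proof (cases "norm (f z) \<le> 1")
      case False
      then have "norm (f z) powr 1 \<le> norm (f z) powr p"
        using p by (intro powr_mono) auto
      then show ?thesis
        by simp
    qed (simp add: add_increasing2)
    then have "ennreal (norm (f z)) \<le> ennreal (1 + norm (f z) powr p)"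
      by (rule ennreal_leI)
    then show "ennreal (norm (f z)) \<le> 1 + ennreal (norm (f z) powr p)"
      by (simp add: ennreal_plus)
  qed
  also have "\<dots> = emeasure W (space W) + (\<integral>\<^sup>+z. ennreal (norm (f z) powr p) \<partial>W)"
    using fm by (subst nn_integral_add) auto
  also have "\<dots> < \<infinity>"
    using f emeasure_finite[of "space W"] by (auto simp: Lp_iff less_top[symmetric])
  finally show "(\<integral>\<^sup>+z. ennreal (norm (f z)) \<partial>W) < \<infinity>" .
qed

lemma Lp_pairing:
  assumes f: "f \<in> Lp \<omega> q" and g: "g \<in> Lp \<omega> p" and pq: "1 < p" "1 / p + 1 / q = 1"
  shows "integrable W (\<lambda>z. f z * cnj (g z))"
    and "norm (LINT z|W. f z * cnj (g z)) \<le> Lp_norm \<omega> q f * Lp_norm \<omega> p g"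
proof -
  have q: "1 < q"
    by (rule conjugate_gt_1[OF pq])
  have [measurable]: "f \<in> borel_measurable W" "g \<in> borel_measurable W" "cnj \<in> borel_measurable borel"
    using f g by (auto simp: Lp_iff measurable_W intro!: borel_measurable_continuous_onI continuous_intros)
  have "(\<integral>\<^sup>+z. ennreal (norm (g z) * norm (f z)) \<partial>W) \<le> ennreal (Lp_norm \<omega> p g * Lp_norm \<omega> q f)"
    by (rule nn_holder[OF pq]) (use f g pq q in \<open>auto simp: Lp_norm_powr\<close>)
  then have le: "(\<integral>\<^sup>+z. ennreal (norm (f z * cnj (g z))) \<partial>W) \<le> ennreal (Lp_norm \<omega> q f * Lp_norm \<omega> p g)"
    by (simp add: norm_mult mult.commute)
  show i: "integrable W (\<lambda>z. f z * cnj (g z))"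
    by (rule integrableI_bounded) (measurable, rule le_less_trans[OF le], simp)
  have "ennreal (norm (LINT z|W. f z * cnj (g z))) \<le> ennreal (Lp_norm \<omega> q f * Lp_norm \<omega> p g)"
    using integral_norm_bound_ennreal[OF i] le by (rule order_trans)
  then show "norm (LINT z|W. f z * cnj (g z)) \<le> Lp_norm \<omega> q f * Lp_norm \<omega> p g"
    by (subst (asm) ennreal_le_iff) (auto intro!: mult_nonneg_nonneg)
qed

text \<open>The squared norm of z^n in the Bergman space with exponent 2, that is, the denominator
  in the kernel.\<close>

definition even_moment :: "nat \<Rightarrow> real"
  where "even_moment n = 2 * moment \<omega> (2 * real n + 1)"

lemma even_moment_eq: "even_moment n = (LINT r|\<mu>. r ^ (2 * n))"
proof -
  have "(LINT r|\<mu>. r ^ (2 * n)) = enn2real (\<integral>\<^sup>+r. ennreal (r ^ (2 * n)) \<partial>\<mu>)"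
    by (rule integral_eq_nn_integral) (auto intro!: borel_measurable_\<mu>)
  also have "\<dots> = even_moment n"
    unfolding nn_integral_moment by (simp add: even_moment_def moment_nonneg)
  finally show ?thesis ..
qed

lemma even_moment_power_moment: "1 \<le> n \<Longrightarrow> even_moment n = R.power_moment (2 * real n)"
  unfolding even_moment_eq R.power_moment_def
proof (rule Bochner_Integration.integral_cong[OF refl])
  fix r assume n: "1 \<le> n" and "r \<in> space \<mu>"
  then show "r ^ (2 * n) = r powr (2 * real n)"
    using powr_realpow[of r "2 * n"] by (cases "r = 0") auto
qed

lemma even_moment_pos: "0 < even_moment n"
proof (cases "n = 0")
  case True
  then show ?thesis
    using R.mass_pos[of 1] R.mass_ge_1[of 1] by (simp add: even_moment_eq)
next
  case False
  then show ?thesis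
    using R.power_moment_pos[of "2 * real n"] by (simp add: even_moment_power_moment)
qed

lemma even_moment_ge_mass:
  assumes y: "0 < y" "y < 1"
  shows "(1 - y) ^ (2 * n) * mass \<mu> y \<le> even_moment n"
proof (cases "n = 0")
  case True
  with y show ?thesis
    using R.mass_ge_1[of 1] R.mass_mono[of y 1] by (simp add: even_moment_eq)
next
  case False
  have "(1 - y) ^ (2 * n) = (1 - y) powr (2 * real n)"
    using powr_realpow[of "1 - y" "2 * n"] y by simp
  then show ?thesis
    using R.power_moment_ge_mass[of y "2 * real n"] y False by (simp add: even_moment_power_moment)
qed

lemma summable_inverse_moments:
  assumes "0 \<le> s" "s < 1"
  shows "summable (\<lambda>n. s ^ n / even_moment n)"
proof -
  \<comment> \<open>Then (1 - y)^2 >= 1 - 2 y = (1 + s) / 2 > s, so the moments, which are at least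
    (1 - y)^(2n) h(y), decay more slowly than s^n.\<close>
  define y where "y = (1 - s) / 4"
  have y: "0 < y" "y < 1"
    using assms by (auto simp: y_def)
  have lt: "s / (1 - y) ^ 2 < 1"
  proof -
    have "s < 1 - 2 * y"
      using assms by (simp add: y_def field_simps)
    also have "\<dots> \<le> (1 - y) ^ 2"
      by (simp add: power2_diff)
    finally show ?thesis
      using y by (simp add: divide_less_eq)
  qed
  have m: "0 < mass \<mu> y"
    using y by (intro R.mass_pos)
  have "summable (\<lambda>n. (s / (1 - y) ^ 2) ^ n * (1 / mass \<mu> y))"
    using lt assms by (intro summable_mult2 summable_geometric) auto
  then show ?thesis
  proof (rule summable_comparison_test')
    fix n
    have "s ^ n / even_moment n \<le> s ^ n / ((1 - y) ^ (2 * n) * mass \<mu> y)"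
      using even_moment_ge_mass[OF y, of n] y m assms by (intro divide_left_mono mult_pos_pos even_moment_pos) auto
    then show "norm (s ^ n / even_moment n) \<le> (s / (1 - y) ^ 2) ^ n * (1 / mass \<mu> y)"
      using assms even_moment_pos[of n] by (simp add: power_divide power_mult)
  qed
qed

text \<open>The pairing of f with z^n, without normalization.\<close>

definition fourier :: "(complex \<Rightarrow> complex) \<Rightarrow> nat \<Rightarrow> complex"
  where "fourier f n = (LINT z|W. f z * cnj z ^ n)"

lemma integrable_fourier:
  assumes i: "integrable W f"
  shows "integrable W (\<lambda>z. f z * cnj z ^ n)"
proof (rule Bochner_Integration.integrable_bound[OF i])
  show "(\<lambda>z. f z * cnj z ^ n) \<in> borel_measurable W"
    using i by (intro borel_measurable_times borel_measurable_W[OF cnj_power_measurable]) auto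
  show "AE z in W. norm (f z * cnj z ^ n) \<le> norm (f z)"
    by (rule AE_I2) (auto simp: norm_mult norm_power intro!: mult_right_le_one_le power_le_one)
qed

lemma fourier_holomorphic:
  assumes f: "f holomorphic_on disc" and i: "integrable W f"
  shows "fourier f n = taylor f n * of_real (even_moment n)"
proof -
  let ?F = "\<lambda>z. (indicator disc z *\<^sub>R f z) * cnj z ^ n"
  have "fourier f n = (LINT z|W. ?F z)"
    unfolding fourier_def by (rule Bochner_Integration.integral_cong) auto
  also have "\<dots> = (LINT r|\<mu>. LINT \<xi>|circle. ?F (of_real r * \<xi>))"
  proof (rule integral_polar)
    show "?F \<in> borel_measurable borel"
      by (intro borel_measurable_times cnj_power_measurable holomorphic_borel f)
    have "integrable W ?F \<longleftrightarrow> integrable W (\<lambda>z. f z * cnj z ^ n)"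
      by (rule Bochner_Integration.integrable_cong) auto
    then show "integrable W ?F"
      using integrable_fourier[OF i] by simp
  qed
  also have "\<dots> = (LINT r|\<mu>. taylor f n * of_real (r ^ (2 * n)))"
  proof (rule Bochner_Integration.integral_cong[OF refl])
    fix r assume "r \<in> space \<mu>"
    then have r: "0 \<le> r" "r < 1"
      by auto
    have "(LINT \<xi>|circle. ?F (of_real r * \<xi>)) = (LINT \<xi>|circle. of_real r ^ n * (f (of_real r * \<xi>) * cnj \<xi> ^ n))"
      by (rule Bochner_Integration.integral_cong) (use r in \<open>auto simp: norm_mult power_mult_distrib\<close>)
    also have "\<dots> = of_real r ^ n * (LINT \<xi>|circle. f (of_real r * \<xi>) * cnj \<xi> ^ n)"
      by (rule integral_mult_right_zero)
    also have "(LINT \<xi>|circle. f (of_real r * \<xi>) * cnj \<xi> ^ n) = taylor f n * of_real r ^ n"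
      by (rule circle_coefficient[OF f r])
    also have "of_real r ^ n * (taylor f n * of_real r ^ n) = taylor f n * of_real (r ^ (2 * n))"
      by (simp add: mult_2 power_add)
    finally show "(LINT \<xi>|circle. ?F (of_real r * \<xi>)) = taylor f n * of_real (r ^ (2 * n))" .
  qed
  also have "\<dots> = taylor f n * of_real (even_moment n)"
    unfolding even_moment_eq by (simp del: of_real_power)
  finally show ?thesis .
qed

text \<open>Stated for arbitrary coefficients d because three kernels are of this form: that of the
  projection, that of its derivative, and the dilated representer of a functional.\<close>

lemma fourier_multiplier_sums:
  fixes d :: "nat \<Rightarrow> complex"
  assumes i: "integrable W f" and S: "summable (\<lambda>n. norm (d n) * norm z ^ n)"
  shows "(\<lambda>n. d n * fourier f n * z ^ n) sums (LINT \<zeta>|W. f \<zeta> * (\<Sum>n. d n * (z * cnj \<zeta>) ^ n))"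
    and "norm \<zeta> < 1 \<Longrightarrow> summable (\<lambda>n. d n * (z * cnj \<zeta>) ^ n)"
    and "(\<lambda>\<zeta>. f \<zeta> * (\<Sum>n. d n * (z * cnj \<zeta>) ^ n)) \<in> borel_measurable dA"
proof -
  let ?k = "\<lambda>n \<zeta>. d n * (z * cnj \<zeta>) ^ n"
  let ?t = "\<lambda>n \<zeta>. f \<zeta> * ?k n \<zeta>"
  have fm: "f \<in> borel_measurable W"
    using i by auto
  have [measurable]: "cnj \<in> borel_measurable borel"
    by (intro borel_measurable_continuous_onI continuous_intros)
  have km: "?k n \<in> borel_measurable W" for n
    by (rule borel_measurable_W) measurable
  have kb: "norm (?k n \<zeta>) \<le> norm (d n) * norm z ^ n" if "norm \<zeta> < 1" for n \<zeta>
  proof -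
    have "norm (?k n \<zeta>) = norm (d n) * norm z ^ n * norm \<zeta> ^ n"
      by (simp add: norm_power norm_mult power_mult_distrib)
    also have "\<dots> \<le> norm (d n) * norm z ^ n * 1"
      using that by (intro mult_left_mono power_le_one) auto
    finally show ?thesis
      by simp
  qed
  have ks: "summable (\<lambda>n. ?k n \<zeta>)" if "norm \<zeta> < 1" for \<zeta>
    by (rule summable_norm_cancel, rule summable_comparison_test'[OF S]) (use kb[OF that] in auto)
  then show "norm \<zeta> < 1 \<Longrightarrow> summable (\<lambda>n. ?k n \<zeta>)" .
  have tb: "norm (?t n \<zeta>) \<le> norm (f \<zeta>) * (norm (d n) * norm z ^ n)" if "norm \<zeta> < 1" for n \<zeta>
    unfolding norm_mult[of "f \<zeta>"] by (intro mult_left_mono kb that) auto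
  have it: "integrable W (?t n)" for n
  proof (rule Bochner_Integration.integrable_bound)
    show "integrable W (\<lambda>\<zeta>. norm (f \<zeta>) * (norm (d n) * norm z ^ n))"
      using i by simp
    show "?t n \<in> borel_measurable W"
      by (rule borel_measurable_times[OF fm km])
    show "AE \<zeta> in W. norm (?t n \<zeta>) \<le> norm (norm (f \<zeta>) * (norm (d n) * norm z ^ n))"
    proof (rule AE_I2)
      fix \<zeta> assume "\<zeta> \<in> space W"
      then have "norm (?t n \<zeta>) \<le> norm (f \<zeta>) * (norm (d n) * norm z ^ n)"
        by (intro tb) simp
      also have "\<dots> \<le> norm (norm (f \<zeta>) * (norm (d n) * norm z ^ n))"
        unfolding real_norm_def by (rule abs_ge_self)
      finally show "norm (?t n \<zeta>) \<le> norm (norm (f \<zeta>) * (norm (d n) * norm z ^ n))" .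
    qed
  qed
  have "(\<lambda>n. LINT \<zeta>|W. ?t n \<zeta>) sums (LINT \<zeta>|W. (\<Sum>n. ?t n \<zeta>))"
  proof (rule sums_integral[OF it])
    show "AE \<zeta> in W. summable (\<lambda>n. norm (?t n \<zeta>))"
    proof (rule AE_I2)
      fix \<zeta> assume "\<zeta> \<in> space W"
      then show "summable (\<lambda>n. norm (?t n \<zeta>))"
        using tb by (intro summable_comparison_test'[OF summable_mult[OF S, of "norm (f \<zeta>)"]]) auto
    qed
    show "summable (\<lambda>n. LINT \<zeta>|W. norm (?t n \<zeta>))"
    proof (rule summable_comparison_test'[OF summable_mult[OF S, of "LINT \<zeta>|W. norm (f \<zeta>)"]])
      fix n
      have "(LINT \<zeta>|W. norm (?t n \<zeta>)) \<le> (LINT \<zeta>|W. norm (f \<zeta>) * (norm (d n) * norm z ^ n))"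
      proof (rule integral_mono)
        fix \<zeta> assume "\<zeta> \<in> space W"
        then show "norm (?t n \<zeta>) \<le> norm (f \<zeta>) * (norm (d n) * norm z ^ n)"
          by (intro tb) simp
      qed (use it[of n] i in \<open>auto intro!: integrable_norm\<close>)
      also have "\<dots> = (LINT \<zeta>|W. norm (f \<zeta>)) * (norm (d n) * norm z ^ n)"
        by (rule integral_mult_left_zero)
      finally show "norm (LINT \<zeta>|W. norm (?t n \<zeta>)) \<le> (LINT \<zeta>|W. norm (f \<zeta>)) * (norm (d n) * norm z ^ n)"
        by simp
    qed
  qed
  also have "(\<lambda>n. LINT \<zeta>|W. ?t n \<zeta>) = (\<lambda>n. d n * fourier f n * z ^ n)"
  proof
    fix n
    have "(LINT \<zeta>|W. ?t n \<zeta>) = (LINT \<zeta>|W. (d n * z ^ n) * (f \<zeta> * cnj \<zeta> ^ n))"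
      by (rule Bochner_Integration.integral_cong) (auto simp: power_mult_distrib)
    also have "\<dots> = (d n * z ^ n) * fourier f n"
      unfolding fourier_def by (rule integral_mult_right_zero)
    also have "\<dots> = d n * fourier f n * z ^ n"
      by simp
    finally show "(LINT \<zeta>|W. ?t n \<zeta>) = d n * fourier f n * z ^ n" .
  qed
  also have "(LINT \<zeta>|W. (\<Sum>n. ?t n \<zeta>)) = (LINT \<zeta>|W. f \<zeta> * (\<Sum>n. ?k n \<zeta>))"
  proof (rule Bochner_Integration.integral_cong[OF refl])
    fix \<zeta> assume "\<zeta> \<in> space W"
    then show "(\<Sum>n. ?t n \<zeta>) = f \<zeta> * (\<Sum>n. ?k n \<zeta>)"
      by (intro suminf_mult ks) simp
  qed
  finally show "(\<lambda>n. d n * fourier f n * z ^ n) sums (LINT \<zeta>|W. f \<zeta> * (\<Sum>n. ?k n \<zeta>))" .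
  have "(\<lambda>\<zeta>. f \<zeta> * (\<Sum>n. ?k n \<zeta>)) \<in> borel_measurable W"
    by (intro borel_measurable_suminf borel_measurable_times fm km)
  then show "(\<lambda>\<zeta>. f \<zeta> * (\<Sum>n. ?k n \<zeta>)) \<in> borel_measurable dA"
    by (simp add: measurable_W)
qed

lemma projection_sums:
  assumes i: "integrable W f" and z: "norm z < 1"
  shows "(\<lambda>n. fourier f n / of_real (even_moment n) * z ^ n) sums projection \<omega> f z"
proof -
  define d where "d n = complex_of_real (1 / even_moment n)" for n
  have nd: "norm (d n) = 1 / even_moment n" for n
    unfolding d_def norm_of_real using even_moment_pos[of n] by (intro abs_of_nonneg) simp
  have S: "summable (\<lambda>n. norm (d n) * norm z ^ n)"
    using summable_inverse_moments[OF norm_ge_zero z] by (simp add: nd)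
  note M = fourier_multiplier_sums[OF i S]
  have sk: "(\<Sum>n. d n * (z * cnj \<zeta>) ^ n) = cnj (kernel \<omega> z \<zeta>)" if \<zeta>: "norm \<zeta> < 1" for \<zeta>
  proof -
    have "(\<lambda>n. cnj (d n * (z * cnj \<zeta>) ^ n)) sums cnj (\<Sum>n. d n * (z * cnj \<zeta>) ^ n)"
      using M(2)[OF \<zeta>] by (intro sums_cnj[THEN iffD2] summable_sums)
    also have "(\<lambda>n. cnj (d n * (z * cnj \<zeta>) ^ n)) = (\<lambda>n. (cnj z * \<zeta>) ^ n / of_real (2 * moment \<omega> (2 * real n + 1)))"
      by (simp add: even_moment_def d_def)
    finally have "kernel \<omega> z \<zeta> = cnj (\<Sum>n. d n * (z * cnj \<zeta>) ^ n)"
      unfolding kernel_def by (rule sums_unique[symmetric])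
    then show ?thesis
      by simp
  qed
  have "projection \<omega> f z = (LINT \<zeta>|dA. f \<zeta> * (\<Sum>n. d n * (z * cnj \<zeta>) ^ n) * complex_of_real (\<omega> (norm \<zeta>)))"
    unfolding projection_def
  proof (rule Bochner_Integration.integral_cong[OF refl])
    fix \<zeta> assume "\<zeta> \<in> space dA"
    then have "norm \<zeta> < 1"
      by simp
    then show "f \<zeta> * cnj (kernel \<omega> z \<zeta>) * complex_of_real (\<omega> (norm \<zeta>)) =
        f \<zeta> * (\<Sum>n. d n * (z * cnj \<zeta>) ^ n) * complex_of_real (\<omega> (norm \<zeta>))"
      by (simp only: sk)
  qed
  also have "\<dots> = (LINT \<zeta>|W. f \<zeta> * (\<Sum>n. d n * (z * cnj \<zeta>) ^ n))"
    by (rule integral_dA_weight(1)[OF M(3)])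
  finally show ?thesis
    using M(1) by (simp add: d_def)
qed

lemma projection_holomorphic: "integrable W f \<Longrightarrow> projection \<omega> f holomorphic_on disc"
  and taylor_projection: "integrable W f \<Longrightarrow> taylor (projection \<omega> f) n = fourier f n / of_real (even_moment n)"
  by (rule taylor_unique[OF projection_sums]; simp)+

lemma projection_reproduces:
  assumes f: "f holomorphic_on disc" and i: "integrable W f" and z: "norm z < 1"
  shows "projection \<omega> f z = f z"
proof -
  have "(\<lambda>n. fourier f n / of_real (even_moment n) * z ^ n) sums projection \<omega> f z"
    by (rule projection_sums[OF i z])
  moreover have "(\<lambda>n. fourier f n / of_real (even_moment n) * z ^ n) = (\<lambda>n. taylor f n * z ^ n)"
    using even_moment_pos by (simp add: fourier_holomorphic[OF f i] less_imp_neq[symmetric])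
  ultimately show ?thesis
    using taylor_sums[OF f z] by (metis sums_unique2)
qed

end

subsection \<open>Testing on monomials\<close>

lemma circle_mean_monomial:
  assumes "0 \<le> r"
  shows "circle_mean q (\<lambda>z. c * z ^ m) r = norm c powr q * (r ^ m) powr q"
proof -
  interpret C: prob_space circle
    by (rule prob_space_circle)
  have "circle_mean q (\<lambda>z. c * z ^ m) r = (LINT \<xi>|circle. norm c powr q * (r ^ m) powr q)"
    unfolding circle_mean_def
    by (rule Bochner_Integration.integral_cong) (use assms in \<open>auto simp: norm_mult norm_power powr_mult\<close>)
  then show ?thesis
    using C.prob_space by simp
qed

text \<open>The Pochhammer symbol is the falling factorial n (n - 1) ... (n - k + 1). For n < k the
  truncated difference is 0 and so is the symbol, as it should be.\<close>

lemma funpow_deriv_monomial: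
  "(deriv ^^ k) (\<lambda>z. z ^ n) = (\<lambda>z::complex. of_nat (pochhammer (Suc n - k) k) * z ^ (n - k))"
  using higher_deriv_power[of k 0 n] by (auto simp: pochhammer_of_nat)

lemma power_powr: "0 \<le> r \<Longrightarrow> 1 \<le> n \<Longrightarrow> (r ^ n) powr q = r powr (real n * q)"
  for r q :: real
  by (cases "r = 0") (auto simp: powr_powr powr_realpow[symmetric])

lemma pochhammer_bounds:
  assumes "2 * k \<le> n" "1 \<le> k"
  shows "(real n / 2) ^ k \<le> real (pochhammer (Suc n - k) k)" "real (pochhammer (Suc n - k) k) \<le> real n ^ k"
proof -
  have e: "real (pochhammer (Suc n - k) k) = (\<Prod>i=0..<k. real (Suc n - k + i))"
    by (simp add: pochhammer_prod)
  have "(\<Prod>i=0..<k. real n / 2) \<le> (\<Prod>i=0..<k. real (Suc n - k + i))"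
    by (rule prod_mono) (use assms in auto)
  then show "(real n / 2) ^ k \<le> real (pochhammer (Suc n - k) k)"
    unfolding e by simp
  have "(\<Prod>i=0..<k. real (Suc n - k + i)) \<le> (\<Prod>i=0..<k. real n)"
    by (rule prod_mono) (use assms in auto)
  then show "real (pochhammer (Suc n - k) k) \<le> real n ^ k"
    unfolding e by simp
qed

lemma monomial_holomorphic: "(\<lambda>z::complex. z ^ n) holomorphic_on disc"
  by (intro holomorphic_intros)

context weight
begin

lemma monomial_Bergman:
  assumes n: "1 \<le> n" and q: "0 < q"
  shows "(\<lambda>z. z ^ n) \<in> Bergman \<omega> q" and "Lp_norm \<omega> q (\<lambda>z. z ^ n) = R.power_moment (real n * q) powr (1 / q)"
proof -
  have "mean_integral \<mu> q (\<lambda>z. z ^ n) = (\<integral>\<^sup>+r. ennreal (r powr (real n * q)) \<partial>\<mu>)"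
    unfolding mean_integral_def
    by (rule nn_integral_cong) (use circle_mean_monomial[of _ q 1 n] n in \<open>auto simp: power_powr\<close>)
  also have "\<dots> = ennreal (R.power_moment (real n * q))"
    using q by (intro R.nn_integral_power) auto
  finally have e: "mean_integral \<mu> q (\<lambda>z. z ^ n) = ennreal (R.power_moment (real n * q))" .
  show "(\<lambda>z. z ^ n) \<in> Bergman \<omega> q"
    using q by (simp add: Bergman_iff monomial_holomorphic e)
  show "Lp_norm \<omega> q (\<lambda>z. z ^ n) = R.power_moment (real n * q) powr (1 / q)"
    using q by (simp add: Bergman_norm monomial_holomorphic e)
qed

lemma monomial_Dirichlet:
  assumes n: "2 * k \<le> n" "1 \<le> k" and p: "0 < p"
  shows "(\<lambda>z. z ^ n) \<in> Dirichlet \<omega> p k"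
    and "Dirichlet_norm \<omega> p k (\<lambda>z. z ^ n) =
      real (pochhammer (Suc n - k) k) * R.beta_moment (real (n - k) * p) (real k * p) powr (1 / p)"
proof -
  define a where "a = real (pochhammer (Suc n - k) k)"
  have a: "0 \<le> a"
    by (simp add: a_def)
  have nk: "1 \<le> n - k"
    using n by linarith
  let ?b = "R.beta_moment (real (n - k) * p) (real k * p)"
  have b: "0 \<le> ?b"
    unfolding R.beta_moment_def by simp
  have h: "(deriv ^^ k) (\<lambda>z. z ^ n) = (\<lambda>z::complex. of_real a * z ^ (n - k))"
    by (simp add: funpow_deriv_monomial a_def)
  have "mean_integral (shifted \<mu> (real k * p)) p ((deriv ^^ k) (\<lambda>z. z ^ n)) =
      (\<integral>\<^sup>+r. ennreal ((1 - r) powr (real k * p)) * ennreal (a powr p * r powr (real (n - k) * p)) \<partial>\<mu>)"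
    unfolding mean_integral_def h
  proof (subst R.nn_integral_shifted)
    show "(\<lambda>r. ennreal (circle_mean p (\<lambda>z. of_real a * z ^ (n - k)) r)) \<in> borel_measurable \<mu>"
    proof (subst measurable_cong[where g = "\<lambda>r. ennreal (a powr p * (r ^ (n - k)) powr p)"])
      show "(\<lambda>r. ennreal (a powr p * (r ^ (n - k)) powr p)) \<in> borel_measurable \<mu>"
        by (rule borel_measurable_\<mu>) measurable
    qed (use a in \<open>auto simp: circle_mean_monomial\<close>)
    show "(\<integral>\<^sup>+r. ennreal ((1 - r) powr (real k * p)) * ennreal (circle_mean p (\<lambda>z. of_real a * z ^ (n - k)) r) \<partial>\<mu>) =
      (\<integral>\<^sup>+r. ennreal ((1 - r) powr (real k * p)) * ennreal (a powr p * r powr (real (n - k) * p)) \<partial>\<mu>)"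
      by (rule nn_integral_cong) (use a nk in \<open>auto simp: circle_mean_monomial power_powr\<close>)
  qed
  also have "\<dots> = (\<integral>\<^sup>+r. ennreal (a powr p * ((1 - r) powr (real k * p) * r powr (real (n - k) * p))) \<partial>\<mu>)"
    by (rule nn_integral_cong) (simp add: ennreal_mult[symmetric] mult_ac)
  also have "\<dots> = ennreal (a powr p * ?b)"
    unfolding R.beta_moment_def
    by (subst nn_integral_eq_integral) (use p in \<open>auto intro!: integrable_mult_right R.integrable_beta\<close>)
  finally have e: "mean_integral (shifted \<mu> (real k * p)) p ((deriv ^^ k) (\<lambda>z. z ^ n)) = ennreal (a powr p * ?b)" .
  show "(\<lambda>z. z ^ n) \<in> Dirichlet \<omega> p k"
    using p by (simp add: Dirichlet_iff monomial_holomorphic e)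
  have "(\<Sum>j=0..k. norm ((deriv ^^ j) (\<lambda>z. z ^ n) (0::complex))) = 0"
  proof (rule sum.neutral, rule ballI)
    fix j assume "j \<in> {0..k}"
    then have "n - j \<noteq> 0"
      using n by simp
    then show "norm ((deriv ^^ j) (\<lambda>z. z ^ n) (0::complex)) = 0"
      by (simp add: funpow_deriv_monomial)
  qed
  then have "Dirichlet_norm \<omega> p k (\<lambda>z. z ^ n) = enn2real (ennreal (a powr p * ?b)) powr (1 / p)"
    unfolding Dirichlet_norm_eq[OF p monomial_holomorphic] e by simp
  also have "\<dots> = (a powr p * ?b) powr (1 / p)"
    using a b by simp
  also have "\<dots> = a * ?b powr (1 / p)"
    using a b p by (simp add: powr_mult powr_powr)
  finally show "Dirichlet_norm \<omega> p k (\<lambda>z. z ^ n) = real (pochhammer (Suc n - k) k) * ?b powr (1 / p)"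
    by (simp add: a_def)
qed

text \<open>The Dirichlet norm of z^n is comparable with n^k times the 1/p-th power of a
  \<open>beta_moment\<close>. The first inequality then is the hypothesis for doubling. Given
  doubling, moments are comparable with h(1 / n), so the second one reads h(1 / n) <= C n^k b^(1/p)
  h(1 / n)^(1/p'); dividing by the last factor gives the hypothesis for the contraction.\<close>

lemma D_class_of_monomials:
  assumes pp: "1 < p" "1 / p + 1 / p' = 1" and k: "1 \<le> k"
    and A: "\<And>n. 2 * k \<le> n \<Longrightarrow> Dirichlet_norm \<omega> p k (\<lambda>z. z ^ n) \<le> CA * Lp_norm \<omega> p (\<lambda>z. z ^ n)"
    and B: "\<And>n. 2 * k \<le> n \<Longrightarrow> even_moment n \<le> CB * Dirichlet_norm \<omega> p k (\<lambda>z. z ^ n) * Lp_norm \<omega> p' (\<lambda>z. z ^ n)"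
  shows "\<omega> \<in> D_class"
proof -
  have p': "1 < p'"
    by (rule conjugate_gt_1[OF pp])
  define \<beta> where "\<beta> = real k * p"
  have \<beta>: "0 < \<beta>"
    using k pp by (simp add: \<beta>_def)
  let ?a = "\<lambda>n. real (pochhammer (Suc n - k) k)"
  let ?b = "\<lambda>n. R.beta_moment (real (n - k) * p) \<beta>"
  have b: "0 \<le> ?b n" for n
    unfolding R.beta_moment_def by simp
  have X: "Dirichlet_norm \<omega> p k (\<lambda>z. z ^ n) = ?a n * ?b n powr (1 / p)" if "2 * k \<le> n" for n
    using monomial_Dirichlet(2)[OF that k, of p] pp by (simp add: \<beta>_def)
  have Z: "Lp_norm \<omega> q (\<lambda>z. z ^ n) = R.power_moment (real n * q) powr (1 / q)" if "2 * k \<le> n" "1 < q" for n q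
    using that k by (intro monomial_Bergman) auto
  \<comment> \<open>The given constants may have any sign; the enlarged ones are positive.\<close>
  define CA' where "CA' = \<bar>CA\<bar> + 1"
  define CB' where "CB' = \<bar>CB\<bar> + 1"
  have CA': "0 < CA'" "CA \<le> CA'" and CB': "0 < CB'" "CB \<le> CB'"
    by (auto simp: CA'_def CB'_def)
  have D: "doubling \<mu>"
  proof (rule R.doubling_of_moments[of p \<beta> "(2 ^ k * CA') powr p" k])
    fix n assume n: "2 * k \<le> n" "1 \<le> n"
    have "real n ^ k * ?b n powr (1 / p) = 2 ^ k * ((real n / 2) ^ k * ?b n powr (1 / p))"
      by (simp add: power_divide)
    also have "\<dots> \<le> 2 ^ k * (?a n * ?b n powr (1 / p))"
      using pochhammer_bounds[OF n(1) k] by (intro mult_left_mono mult_right_mono) auto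
    also have "\<dots> \<le> 2 ^ k * (CA' * R.power_moment (real n * p) powr (1 / p))"
    proof (rule mult_left_mono)
      have "?a n * ?b n powr (1 / p) \<le> CA * Lp_norm \<omega> p (\<lambda>z. z ^ n)"
        using A[OF n(1)] X[OF n(1)] by simp
      also have "\<dots> \<le> CA' * Lp_norm \<omega> p (\<lambda>z. z ^ n)"
        using CA' by (intro mult_right_mono) auto
      finally show "?a n * ?b n powr (1 / p) \<le> CA' * R.power_moment (real n * p) powr (1 / p)"
        using Z[OF n(1)] pp by simp
    qed simp
    finally have "(real n ^ k * ?b n powr (1 / p)) powr p \<le> ((2 ^ k * CA') * R.power_moment (real n * p) powr (1 / p)) powr p"
      using pp by (intro powr_mono2) (auto simp: mult.assoc)
    also have "\<dots> = (2 ^ k * CA') powr p * R.power_moment (real n * p)"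
      using pp by (simp add: powr_mult powr_powr)
    also have "(real n ^ k * ?b n powr (1 / p)) powr p = (real n ^ k) powr p * ?b n"
      using pp b by (simp add: powr_mult powr_powr)
    also have "(real n ^ k) powr p = real n powr \<beta>"
      unfolding \<beta>_def using k by (intro power_powr) auto
    finally show "real n powr \<beta> * ?b n \<le> (2 ^ k * CA') powr p * R.power_moment (real n * p)" .
  qed (use pp \<beta> CA' in auto)
  obtain A1 where A1: "1 \<le> A1" "\<And>x. 1 \<le> x \<Longrightarrow> R.power_moment x \<le> A1 * mass \<mu> (1 / x)"
    using R.power_moment_le_mass[OF D] by blast
  obtain A2 where A2: "1 \<le> A2" "\<And>x. 0 < x \<Longrightarrow> mass \<mu> (2 * x) \<le> A2 * mass \<mu> x"
    using R.mass_doubling_cmult[OF D, of 2] by auto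
  \<comment> \<open>The factors stem from the exponential lower bound for the moment of order 2 n,
    the doubling from 1 / (2 n) to 1 / n, the given constant, and the upper bound of the moment of
    order n by the mass.\<close>
  define c where "c = exp 2 * A2 * CB' * A1 powr (1 / p')"
  have c: "0 < c"
    unfolding c_def using A1 A2 CB' by simp
  have "contracting \<mu>"
  proof (rule R.contracting_of_moments[OF D, of p \<beta> "c powr p" k])
    fix n assume n: "2 * k \<le> n" "1 \<le> n"
    let ?m = "mass \<mu> (1 / real n)"
    have m: "0 < ?m"
      using n by (intro R.mass_pos) simp
    have "?m \<le> A2 * mass \<mu> (1 / (2 * real n))"
      using A2(2)[of "1 / (2 * real n)"] n by simp
    also have "mass \<mu> (1 / (2 * real n)) \<le> exp 2 * R.power_moment (2 * real n)"
    proof -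
      have "exp (- 2) = exp (- (2 * (1 / (2 * real n)) * (2 * real n)))"
        using n by simp
      also have "\<dots> \<le> (1 - 1 / (2 * real n)) powr (2 * real n)"
        using n by (intro powr_exp_bound) (auto simp: field_simps)
      finally have "exp (- 2) * mass \<mu> (1 / (2 * real n)) \<le> (1 - 1 / (2 * real n)) powr (2 * real n) * mass \<mu> (1 / (2 * real n))"
        by (rule mult_right_mono) (simp add: mass_def)
      also have "\<dots> \<le> R.power_moment (2 * real n)"
        using n by (intro R.power_moment_ge_mass) (auto simp: field_simps)
      finally have "exp 2 * (exp (- 2) * mass \<mu> (1 / (2 * real n))) \<le> exp 2 * R.power_moment (2 * real n)"
        by (rule mult_left_mono) simp
      moreover have "exp 2 * exp (- 2) = (1::real)"
        by (simp flip: exp_add)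
      ultimately show ?thesis
        by (simp only: mult.assoc[symmetric] mult_1_left)
    qed
    also have "R.power_moment (2 * real n) = even_moment n"
      using n by (simp add: even_moment_power_moment)
    also have "even_moment n \<le> CB' * (real n ^ k * ?b n powr (1 / p)) * (A1 * ?m) powr (1 / p')"
    proof -
      have "even_moment n \<le> CB * Dirichlet_norm \<omega> p k (\<lambda>z. z ^ n) * Lp_norm \<omega> p' (\<lambda>z. z ^ n)"
        by (rule B[OF n(1)])
      also have "\<dots> \<le> CB' * (real n ^ k * ?b n powr (1 / p)) * (A1 * ?m) powr (1 / p')"
      proof (intro mult_mono)
        show "Dirichlet_norm \<omega> p k (\<lambda>z. z ^ n) \<le> real n ^ k * ?b n powr (1 / p)"
          unfolding X[OF n(1)] using pochhammer_bounds[OF n(1) k] by (intro mult_right_mono) auto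
        have "R.power_moment (real n * p') \<le> R.power_moment (real n)"
          using n p' by (intro R.power_moment_antimono) auto
        also have "\<dots> \<le> A1 * ?m"
          using n by (intro A1) auto
        finally show "Lp_norm \<omega> p' (\<lambda>z. z ^ n) \<le> (A1 * ?m) powr (1 / p')"
          unfolding Z[OF n(1) p'] using p' by (intro powr_mono2) auto
      qed (use CB' b in auto)
      finally show ?thesis .
    qed
    finally have "?m \<le> A2 * (exp 2 * (CB' * (real n ^ k * ?b n powr (1 / p)) * (A1 * ?m) powr (1 / p')))"
      using A2(1) by (simp add: mult_left_mono)
    also have "\<dots> = c * (real n ^ k * ?b n powr (1 / p)) * ?m powr (1 / p')"
      using A1(1) m by (simp add: c_def powr_mult mult_ac)
    finally have le: "?m \<le> c * (real n ^ k * ?b n powr (1 / p)) * ?m powr (1 / p')" .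
    have "?m powr (1 / p) * ?m powr (1 / p') = ?m"
      using m pp by (simp add: powr_add[symmetric])
    with le have "?m powr (1 / p) * ?m powr (1 / p') \<le> c * (real n ^ k * ?b n powr (1 / p)) * ?m powr (1 / p')"
      by simp
    then have "?m powr (1 / p) \<le> c * (real n ^ k * ?b n powr (1 / p))"
      using m by (simp add: mult_le_cancel_right)
    then have "(?m powr (1 / p)) powr p \<le> (c * (real n ^ k * ?b n powr (1 / p))) powr p"
      using pp by (intro powr_mono2) auto
    also have "(?m powr (1 / p)) powr p = ?m"
      using m pp by (simp add: powr_powr)
    also have "(c * (real n ^ k * ?b n powr (1 / p))) powr p = c powr p * ((real n ^ k) powr p * ?b n)"
      using pp b c by (simp add: powr_mult powr_powr)
    also have "(real n ^ k) powr p = real n powr \<beta>"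
      unfolding \<beta>_def using k by (intro power_powr) auto
    finally show "?m \<le> c powr p * (real n powr \<beta> * ?b n)" .
  qed (use pp \<beta> c in auto)
  then show ?thesis
    using D by (simp add: D_class_iff)
qed

lemma Bergman_Lp: "f \<in> Bergman \<omega> p \<Longrightarrow> f \<in> Lp \<omega> p"
  by (simp add: Bergman_def)

lemma taylor_monomial: "taylor (\<lambda>z. z ^ n) m = (if m = n then 1 else 0)"
proof (rule taylor_unique(2)[where a = "\<lambda>m. if m = n then 1 else 0"])
  fix z :: complex
  have "(\<lambda>m. (if m = n then 1 else 0) * z ^ m) = (\<lambda>m. if m = n then z ^ m else 0)"
    by auto
  then show "(\<lambda>m. (if m = n then 1 else 0) * z ^ m) sums z ^ n"
    using sums_single[of n "\<lambda>m. z ^ m"] by (simp only:)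
qed

text \<open>Hoelder's inequality for the pairing of z^n with itself.\<close>

lemma even_moment_holder:
  assumes pp: "1 < p" "1 / p + 1 / p' = 1" and n: "1 \<le> n"
  shows "even_moment n \<le> Lp_norm \<omega> p (\<lambda>z. z ^ n) * Lp_norm \<omega> p' (\<lambda>z. z ^ n)"
proof -
  have p': "1 < p'"
    by (rule conjugate_gt_1[OF pp])
  have B: "(\<lambda>z. z ^ n) \<in> Lp \<omega> q" if "1 < q" for q
    using that n by (intro Bergman_Lp monomial_Bergman) auto
  have "taylor (\<lambda>z. z ^ n) n = 1"
    by (simp only: taylor_monomial if_True simp_thms)
  then have "even_moment n = norm (fourier (\<lambda>z. z ^ n) n)"
    using Lp_integrable[OF B[OF pp(1)]] pp even_moment_pos[of n]
    by (simp add: fourier_holomorphic[OF monomial_holomorphic])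
  also have "\<dots> \<le> Lp_norm \<omega> p' (\<lambda>z. z ^ n) * Lp_norm \<omega> p (\<lambda>z. z ^ n)"
    using Lp_pairing(2)[OF B[OF p'] B[OF pp(1)] pp] by (simp add: fourier_def)
  finally show ?thesis
    by (simp add: mult.commute)
qed

theorem D_class_if_same_space:
  assumes pp: "1 < p" "1 / p + 1 / p' = 1" and k: "1 \<le> k"
    and S: "same_space_equivalent_norms (Bergman \<omega> p) (Lp_norm \<omega> p) (Dirichlet \<omega> p k) (Dirichlet_norm \<omega> p k)"
  shows "\<omega> \<in> D_class"
proof -
  obtain c C where c: "0 < c" "0 < C"
    and le: "\<And>f. f \<in> Bergman \<omega> p \<Longrightarrow> c * Dirichlet_norm \<omega> p k f \<le> Lp_norm \<omega> p f \<and> Lp_norm \<omega> p f \<le> C * Dirichlet_norm \<omega> p k f"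
    using S by (auto simp: same_space_equivalent_norms_def)
  show ?thesis
  proof (rule D_class_of_monomials[OF pp k, of "1 / c" C])
    fix n assume n: "2 * k \<le> n"
    then have n1: "1 \<le> n"
      using k by simp
    have B: "(\<lambda>z. z ^ n) \<in> Bergman \<omega> p"
      using n1 pp by (intro monomial_Bergman) auto
    show "Dirichlet_norm \<omega> p k (\<lambda>z. z ^ n) \<le> 1 / c * Lp_norm \<omega> p (\<lambda>z. z ^ n)"
      using le[OF B] c by (simp add: field_simps)
    have "even_moment n \<le> Lp_norm \<omega> p (\<lambda>z. z ^ n) * Lp_norm \<omega> p' (\<lambda>z. z ^ n)"
      by (rule even_moment_holder[OF pp n1])
    also have "\<dots> \<le> C * Dirichlet_norm \<omega> p k (\<lambda>z. z ^ n) * Lp_norm \<omega> p' (\<lambda>z. z ^ n)"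
      using le[OF B] by (intro mult_right_mono) auto
    finally show "even_moment n \<le> C * Dirichlet_norm \<omega> p k (\<lambda>z. z ^ n) * Lp_norm \<omega> p' (\<lambda>z. z ^ n)" .
  qed
qed

lemma Lp_scale:
  assumes f: "f \<in> Lp \<omega> p" and p: "0 < p"
  shows "(\<lambda>z. c * f z) \<in> Lp \<omega> p" and "Lp_norm \<omega> p (\<lambda>z. c * f z) = norm c * Lp_norm \<omega> p f"
proof -
  have m: "f \<in> borel_measurable dA"
    using f by (simp add: Lp_iff)
  then have m': "(\<lambda>z. c * f z) \<in> borel_measurable dA"
    by simp
  have mW: "(\<lambda>z. ennreal (norm (f z) powr p)) \<in> borel_measurable W"
    using m by (simp add: measurable_W)
  have "(\<integral>\<^sup>+z. ennreal (norm (c * f z) powr p) \<partial>W) = (\<integral>\<^sup>+z. ennreal (norm c powr p) * ennreal (norm (f z) powr p) \<partial>W)"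
    by (rule nn_integral_cong) (simp add: norm_mult powr_mult ennreal_mult)
  also have "\<dots> = ennreal (norm c powr p) * (\<integral>\<^sup>+z. ennreal (norm (f z) powr p) \<partial>W)"
    by (rule nn_integral_cmult[OF mW])
  also have "\<dots> = ennreal (norm c powr p * Lp_norm \<omega> p f powr p)"
    using Lp_norm_powr[OF f p] by (simp add: ennreal_mult)
  finally have e: "(\<integral>\<^sup>+z. ennreal (norm (c * f z) powr p) \<partial>W) = ennreal (norm c powr p * Lp_norm \<omega> p f powr p)" .
  show "(\<lambda>z. c * f z) \<in> Lp \<omega> p"
    using m' by (simp add: Lp_iff e)
  show "Lp_norm \<omega> p (\<lambda>z. c * f z) = norm c * Lp_norm \<omega> p f"
    unfolding Lp_norm_eq[OF m'] e using p by (simp add: powr_mult powr_powr)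
qed

lemma Bergman_scale: "f \<in> Bergman \<omega> p \<Longrightarrow> 0 < p \<Longrightarrow> (\<lambda>z. c * f z) \<in> Bergman \<omega> p"
  by (auto simp: Bergman_def Lp_scale intro!: holomorphic_intros)

lemma zero_Bergman: "0 < p \<Longrightarrow> (\<lambda>z. 0) \<in> Bergman \<omega> p"
  using Bergman_scale[OF monomial_Bergman(1)[of 1 p], of 0] by simp

lemma Lp_norm_zero: "0 < p \<Longrightarrow> Lp_norm \<omega> p (\<lambda>z. 0) = 0"
  by (simp add: Lp_norm_def)

section \<open>Dual norms and the pairing with monomials\<close>

lemma dual_norm_le:
  assumes "\<And>f. f \<in> Bergman \<omega> q \<Longrightarrow> norm (\<Lambda> f) \<le> B * Lp_norm \<omega> q f" "0 \<le> B" "0 < q"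
  shows "dual_norm (Bergman \<omega> q) (Lp_norm \<omega> q) \<Lambda> \<le> B"
  unfolding dual_norm_def
proof (rule cSUP_least)
  show "{f \<in> Bergman \<omega> q. Lp_norm \<omega> q f \<le> 1} \<noteq> {}"
    using zero_Bergman[OF assms(3)] Lp_norm_zero[OF assms(3)] by (auto intro!: exI[of _ "\<lambda>z. 0"])
  fix f assume "f \<in> {f \<in> Bergman \<omega> q. Lp_norm \<omega> q f \<le> 1}"
  then have "norm (\<Lambda> f) \<le> B * Lp_norm \<omega> q f" "B * Lp_norm \<omega> q f \<le> B * 1"
    using assms by (auto intro!: mult_left_mono simp del: mult_1_right)
  then show "norm (\<Lambda> f) \<le> B"
    by simp
qed

lemma dual_norm_ge:
  assumes L: "\<Lambda> \<in> dual_space (Bergman \<omega> q) (Lp_norm \<omega> q)" and q: "0 < q" and f: "f \<in> Bergman \<omega> q"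
  shows "norm (\<Lambda> f) \<le> dual_norm (Bergman \<omega> q) (Lp_norm \<omega> q) \<Lambda> * Lp_norm \<omega> q f"
proof -
  obtain C where C: "\<And>f. f \<in> Bergman \<omega> q \<Longrightarrow> norm (\<Lambda> f) \<le> C * Lp_norm \<omega> q f"
    using L unfolding dual_space_def by blast
  define N where "N = Lp_norm \<omega> q f"
  have N: "0 \<le> N"
    by (simp add: N_def)
  show ?thesis
  proof (cases "N = 0")
    case True
    then show ?thesis
      using C[OF f] by (simp add: N_def)
  next
    case False
    let ?g = "\<lambda>z. of_real (1 / N) * f z"
    have g: "?g \<in> Bergman \<omega> q"
      by (rule Bergman_scale[OF f q])
    have "Lp_norm \<omega> q ?g = norm (of_real (1 / N) :: complex) * N"
      unfolding N_def by (rule Lp_scale(2)[OF Bergman_Lp[OF f] q])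
    then have gN: "Lp_norm \<omega> q ?g \<le> 1"
      using False N by (simp add: norm_divide)
    have bdd: "bdd_above ((\<lambda>f. norm (\<Lambda> f)) ` {f \<in> Bergman \<omega> q. Lp_norm \<omega> q f \<le> 1})"
    proof (rule bdd_aboveI2)
      fix f assume "f \<in> {f \<in> Bergman \<omega> q. Lp_norm \<omega> q f \<le> 1}"
      then have "norm (\<Lambda> f) \<le> \<bar>C\<bar> * Lp_norm \<omega> q f" "\<bar>C\<bar> * Lp_norm \<omega> q f \<le> \<bar>C\<bar> * 1"
        using C by (auto intro!: order_trans[OF C] mult_right_mono mult_left_mono simp del: mult_1_right)
      then show "norm (\<Lambda> f) \<le> \<bar>C\<bar>"
        by simp
    qed
    have "norm (\<Lambda> ?g) \<le> dual_norm (Bergman \<omega> q) (Lp_norm \<omega> q) \<Lambda>"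
      unfolding dual_norm_def by (rule cSUP_upper[OF _ bdd]) (use g gN in simp)
    moreover have "\<Lambda> ?g = of_real (1 / N) * \<Lambda> f"
      using L f unfolding dual_space_def by blast
    ultimately have "norm (\<Lambda> f) / N \<le> dual_norm (Bergman \<omega> q) (Lp_norm \<omega> q) \<Lambda>"
      using N by (simp add: norm_mult norm_divide)
    then show ?thesis
      using N False unfolding N_def[symmetric] by (simp add: pos_divide_le_eq)
  qed
qed

lemma pairing_eq:
  assumes f: "f holomorphic_on disc" and lim: "((\<lambda>r. LINT z|W. f (of_real r * z) * cnj (g z)) \<longlongrightarrow> l) (at_left 1)"
    and g: "g \<in> borel_measurable dA"
  shows "pairing \<omega> f g = l"
    and "((\<lambda>r. LINT z|dA. dilated_integrand \<omega> f g r z) \<longlongrightarrow> l) (at_left 1)"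
proof -
  have c: "cnj \<in> borel_measurable borel"
    by (intro borel_measurable_continuous_onI continuous_intros)
  have e: "(LINT z|dA. dilated_integrand \<omega> f g r z) = (LINT z|W. f (of_real r * z) * cnj (g z))" if "0 < r" "r < 1" for r
    unfolding dilated_integrand_def
    by (intro integral_dA_weight borel_measurable_times holomorphic_measurable holomorphic_dilate f measurable_compose[OF g c]) (use that in auto)
  have "\<forall>\<^sub>F r in at_left (1::real). (LINT z|W. f (of_real r * z) * cnj (g z)) = (LINT z|dA. dilated_integrand \<omega> f g r z)"
    unfolding eventually_at_left_field by (rule exI[of _ 0]) (auto simp: e)
  from lim[unfolded tendsto_cong[OF this]]
  show t: "((\<lambda>r. LINT z|dA. dilated_integrand \<omega> f g r z) \<longlongrightarrow> l) (at_left 1)" .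
  show "pairing \<omega> f g = l"
    unfolding pairing_def by (rule tendsto_Lim[OF _ t]) simp
qed

lemma Bergman_integrable: "f \<in> Bergman \<omega> p \<Longrightarrow> 1 \<le> p \<Longrightarrow> integrable W f"
  by (intro Lp_integrable Bergman_Lp)

lemma Bergman_dilate:
  assumes f: "f holomorphic_on disc" and p: "1 < p" and t: "0 \<le> t" "t < 1"
  shows "(\<lambda>z. f (of_real t * z)) \<in> Bergman \<omega> p"
  using R.mean_integral_dilate_finite[OF f p t] t p by (simp add: Bergman_iff holomorphic_dilate f)

text \<open>Dilation by r multiplies the n-th coefficient by r^n, so the limit in the pairing exists
  by inspection.\<close>

lemma pairing_monomial:
  assumes f: "f \<in> Bergman \<omega> q" and q: "1 < q"
  shows "pairing \<omega> f (\<lambda>z. z ^ n) = fourier f n"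
proof -
  have h: "f holomorphic_on disc"
    using f by (simp add: Bergman_def)
  have "((\<lambda>r. taylor f n * of_real r ^ n * of_real (even_moment n)) \<longlongrightarrow> taylor f n * of_real 1 ^ n * of_real (even_moment n)) (at_left 1)"
    by (intro tendsto_intros)
  moreover have "\<forall>\<^sub>F r in at_left (1::real). taylor f n * of_real r ^ n * of_real (even_moment n) = (LINT z|W. f (of_real r * z) * cnj (z ^ n))"
    unfolding eventually_at_left_field
  proof (intro exI[of _ 0] conjI allI impI)
    fix r :: real assume r: "0 < r" "r < 1"
    have "fourier (\<lambda>z. f (of_real r * z)) n = taylor (\<lambda>z. f (of_real r * z)) n * of_real (even_moment n)"
      using r q by (intro fourier_holomorphic Bergman_integrable[of _ q] Bergman_dilate holomorphic_dilate h) auto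
    then show "taylor f n * of_real r ^ n * of_real (even_moment n) = (LINT z|W. f (of_real r * z) * cnj (z ^ n))"
      using taylor_dilate[OF h, of r n] r by (simp add: fourier_def)
  qed simp
  ultimately have "((\<lambda>r. LINT z|W. f (of_real r * z) * cnj (z ^ n)) \<longlongrightarrow> taylor f n * of_real 1 ^ n * of_real (even_moment n)) (at_left 1)"
    by (simp only: tendsto_cong)
  from pairing_eq(1)[OF h this] show ?thesis
    using fourier_holomorphic[OF h Bergman_integrable[OF f]] q by (simp add: holomorphic_measurable monomial_holomorphic)
qed

text \<open>The functional induced by z^n has dual norm at most the norm of z^n in the Bergman space
  with exponent p, by Hoelder; this gives the first monomial inequality. Evaluating the same
  functional at z^n gives the second.\<close>

theorem D_class_if_dual:
  assumes pp: "1 < p" "1 / p + 1 / p' = 1" and k: "1 \<le> k"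
    and S: "dual_via_pairing \<omega> (Bergman \<omega> p') (Lp_norm \<omega> p') (Dirichlet \<omega> p k) (Dirichlet_norm \<omega> p k)"
  shows "\<omega> \<in> D_class"
proof -
  have p': "1 < p'"
    by (rule conjugate_gt_1[OF pp])
  let ?dn = "dual_norm (Bergman \<omega> p') (Lp_norm \<omega> p')"
  obtain c C where c: "0 < c" "0 < C"
    and le: "\<And>g. g \<in> Dirichlet \<omega> p k \<Longrightarrow> c * Dirichlet_norm \<omega> p k g \<le> ?dn (\<lambda>f. pairing \<omega> f g) \<and>
      ?dn (\<lambda>f. pairing \<omega> f g) \<le> C * Dirichlet_norm \<omega> p k g"
    using S by (auto simp: dual_via_pairing_def)
  have L: "(\<lambda>f. pairing \<omega> f g) \<in> dual_space (Bergman \<omega> p') (Lp_norm \<omega> p')" if "g \<in> Dirichlet \<omega> p k" for g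
    using S that by (auto simp: dual_via_pairing_def)
  show ?thesis
  proof (rule D_class_of_monomials[OF pp k, of "1 / c" C])
    fix n assume n: "2 * k \<le> n"
    then have n1: "1 \<le> n"
      using k by simp
    let ?e = "\<lambda>z::complex. z ^ n"
    have B: "?e \<in> Bergman \<omega> q" if "1 < q" for q
      using n1 that by (intro monomial_Bergman) auto
    have D: "?e \<in> Dirichlet \<omega> p k"
      using n k pp by (intro monomial_Dirichlet) auto
    have "?dn (\<lambda>f. pairing \<omega> f ?e) \<le> Lp_norm \<omega> p ?e"
    proof (rule dual_norm_le)
      fix f assume f: "f \<in> Bergman \<omega> p'"
      then show "norm (pairing \<omega> f ?e) \<le> Lp_norm \<omega> p ?e * Lp_norm \<omega> p' f"
        using Lp_pairing(2)[OF Bergman_Lp[OF f] Bergman_Lp[OF B[OF pp(1)]] pp] p'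
        by (simp add: pairing_monomial fourier_def mult.commute)
    qed (use p' in auto)
    then show "Dirichlet_norm \<omega> p k ?e \<le> 1 / c * Lp_norm \<omega> p ?e"
      using le[OF D] c by (simp add: field_simps)
    have "even_moment n = norm (pairing \<omega> ?e ?e)"
      using even_moment_pos[of n] p' Bergman_integrable[OF B[OF p']]
      by (simp add: pairing_monomial[OF B[OF p'] p'] fourier_holomorphic[OF monomial_holomorphic] taylor_monomial del: of_real_mult)
    also have "\<dots> \<le> ?dn (\<lambda>f. pairing \<omega> f ?e) * Lp_norm \<omega> p' ?e"
      using p' by (intro dual_norm_ge L D B) auto
    also have "\<dots> \<le> C * Dirichlet_norm \<omega> p k ?e * Lp_norm \<omega> p' ?e"
      using le[OF D] by (intro mult_right_mono) auto
    finally show "even_moment n \<le> C * Dirichlet_norm \<omega> p k ?e * Lp_norm \<omega> p' ?e" .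
  qed
qed

end

subsection \<open>Surjectivity of the projection\<close>

lemma exists_fast_subsequence:
  fixes t :: "nat \<Rightarrow> real"
  assumes unb: "\<And>B. \<exists>n\<ge>n0. B < t n"
  shows "\<exists>\<sigma>. strict_mono \<sigma> \<and> (\<forall>j. n0 \<le> \<sigma> j \<and> 4 ^ j < t (\<sigma> j))"
proof -
  have step: "\<exists>n>N. n0 \<le> n \<and> B < t n" for N B
  proof -
    \<comment> \<open>Beating the maximum of t over all indices up to N forces the new index beyond
      N.\<close>
    obtain n where n: "n0 \<le> n" "Max (insert B (t ` {..N})) < t n"
      using unb by blast
    have "B < t n"
      using n(2) by (rule le_less_trans[rotated]) (intro Max_ge, auto)
    moreover have "N < n"
    proof (rule ccontr)
      assume "\<not> N < n"
      then have "t n \<le> Max (insert B (t ` {..N}))"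
        by (intro Max_ge) auto
      then show False
        using n(2) by (meson not_le)
    qed
    ultimately show ?thesis
      using n(1) by blast
  qed
  have "\<exists>\<sigma>. \<forall>j. (n0 \<le> \<sigma> j \<and> 4 ^ j < t (\<sigma> j)) \<and> \<sigma> j < \<sigma> (Suc j)"
  proof (rule dependent_nat_choice)
    show "\<exists>n. n0 \<le> n \<and> 4 ^ 0 < t n"
      using step by blast
    fix x j
    show "\<exists>y. (n0 \<le> y \<and> 4 ^ Suc j < t y) \<and> x < y"
      using step by blast
  qed
  then show ?thesis
    by (auto simp: strict_mono_Suc_iff)
qed

text \<open>Jensen's inequality, obtained from the tangent inequality \<open>p v s\<^sup>p\<^sup>-\<^sup>1 \<le> v\<^sup>p + (p - 1) s\<^sup>p\<close>.\<close>

lemma suminf_powr_le: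
  fixes w v :: "nat \<Rightarrow> real"
  assumes p: "1 < p" and w: "\<And>n. 0 \<le> w n" "w sums 1" and v: "\<And>n. 0 \<le> v n" and s: "summable (\<lambda>n. w n * v n)"
  shows "ennreal ((\<Sum>n. w n * v n) powr p) \<le> (\<Sum>n. ennreal (w n * v n powr p))"
proof (cases "(\<Sum>n. ennreal (w n * v n powr p)) = top")
  case False
  have nn: "0 \<le> w n * v n powr p" for n
    using w by simp
  have sp: "summable (\<lambda>n. w n * v n powr p)"
    by (rule summable_suminf_not_top[OF nn False])
  define S where "S = (\<Sum>n. w n * v n)"
  define T where "T = (\<Sum>n. w n * v n powr p)"
  have S: "0 \<le> S"
    unfolding S_def using w v by (intro suminf_nonneg s) auto
  have "S powr p = S * S powr (p - 1)"
    using S by (cases "S = 0") (auto simp: powr_diff)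
  also have "\<dots> = (\<Sum>n. w n * v n * S powr (p - 1))"
    unfolding S_def by (rule suminf_mult2[OF s])
  also have "\<dots> \<le> (\<Sum>n. 1 / p * (w n * v n powr p) + (1 - 1 / p) * S powr p * w n)"
  proof (rule suminf_le)
    fix n
    have "v n * S powr (p - 1) \<le> 1 powr (1 - p) / p * v n powr p + 1 * (1 - 1 / p) * S powr p"
      by (rule young_powr) (use p v S in auto)
    then have "w n * (v n * S powr (p - 1)) \<le> w n * (1 / p * v n powr p + (1 - 1 / p) * S powr p)"
      using w by (intro mult_left_mono) auto
    then show "w n * v n * S powr (p - 1) \<le> 1 / p * (w n * v n powr p) + (1 - 1 / p) * S powr p * w n"
      by (simp add: algebra_simps)
    show "summable (\<lambda>n. w n * v n * S powr (p - 1))"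
      by (rule summable_mult2[OF s])
    show "summable (\<lambda>n. 1 / p * (w n * v n powr p) + (1 - 1 / p) * S powr p * w n)"
      by (intro summable_add summable_mult sp sums_summable[OF w(2)])
  qed
  also have "\<dots> = 1 / p * T + (1 - 1 / p) * S powr p * 1"
    using sums_add[OF sums_mult[OF summable_sums[OF sp], of "1 / p"] sums_mult[OF w(2), of "(1 - 1 / p) * S powr p"]]
    unfolding T_def by (rule sums_unique[symmetric])
  finally have "S powr p \<le> T"
    using p by (simp add: field_simps)
  then show ?thesis
    unfolding S_def[symmetric] suminf_ennreal2[OF nn sp] T_def[symmetric] by (rule ennreal_leI)
qed simp

lemma funpow_deriv_cong:
  fixes f g :: "complex \<Rightarrow> complex"
  assumes "\<And>z. norm z < 1 \<Longrightarrow> f z = g z" "norm z < 1"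
  shows "(deriv ^^ n) f z = (deriv ^^ n) g z"
proof (rule higher_deriv_cong_ev[OF _ refl])
  have "\<forall>\<^sub>F x in nhds z. x \<in> disc"
    using assms(2) by (intro eventually_nhds_in_open) auto
  then show "\<forall>\<^sub>F x in nhds z. f x = g x"
    by eventually_elim (simp add: assms)
qed

context weight
begin

lemma mean_integral_cong:
  assumes "\<And>z. norm z < 1 \<Longrightarrow> f z = g z" and "sets \<nu> = sets \<mu>"
  shows "mean_integral \<nu> p f = mean_integral \<nu> p g"
  unfolding mean_integral_def
proof (rule nn_integral_cong)
  fix r assume "r \<in> space \<nu>"
  then have "0 \<le> r" "r < 1"
    using sets_eq_imp_space_eq[OF assms(2)] by auto
  then have "circle_mean p f r = circle_mean p g r"
    unfolding circle_mean_def by (intro Bochner_Integration.integral_cong) (auto simp: norm_mult assms(1))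
  then show "ennreal (circle_mean p f r) = ennreal (circle_mean p g r)"
    by simp
qed

lemma Dirichlet_norm_cong:
  assumes "f holomorphic_on disc" "g holomorphic_on disc" "\<And>z. norm z < 1 \<Longrightarrow> f z = g z" "0 < p"
  shows "Dirichlet_norm \<omega> p k f = Dirichlet_norm \<omega> p k g"
proof -
  have d: "(deriv ^^ j) f z = (deriv ^^ j) g z" if "norm z < 1" for j z
    using assms(3) that by (rule funpow_deriv_cong)
  have "mean_integral (shifted \<mu> (real k * p)) p ((deriv ^^ k) f) = mean_integral (shifted \<mu> (real k * p)) p ((deriv ^^ k) g)"
    by (rule mean_integral_cong) (auto simp: d)
  then show ?thesis
    using assms by (simp add: Dirichlet_norm_eq d)
qed

text \<open>The mass near 1 stays positive after multiplication by (1 - r)^\<beta>, so these moments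
  decay more slowly than any given geometric sequence. This makes the lacunary series below converge
  in the disc.\<close>

lemma beta_moment_lower:
  assumes y: "0 < y" "y < 1" and \<beta>: "0 \<le> \<beta>"
  shows "\<exists>b>0. \<forall>x\<ge>0. (1 - y) powr x * b \<le> R.beta_moment x \<beta>"
proof -
  let ?F = "\<lambda>r. indicator {r. 1 - r \<le> y} r * (1 - r) powr \<beta> :: real"
  define b where "b = (LINT r|\<mu>. ?F r)"
  have i: "integrable \<mu> ?F"
    by (rule R.integrable_bounded[of _ 1]) (use \<beta> in \<open>auto simp: indicator_def intro!: powr_le1\<close>)
  have "b \<noteq> 0"
  proof
    assume "b = 0"
    then have "AE r in \<mu>. ?F r = 0"
      unfolding b_def using i by (subst (asm) integral_nonneg_eq_0_iff_AE) (auto simp: indicator_def)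
    then have "AE r in \<mu>. indicator {r. 1 - r \<le> y} r = (0::real)"
      using AE_space by eventually_elim (auto simp: indicator_def split: if_splits)
    then have "(LINT r|\<mu>. indicator {r. 1 - r \<le> y} r :: real) = 0"
      by (rule integral_eq_zero_AE)
    then show False
      using R.mass_integral(1)[of y 1] R.mass_pos[OF y(1)] y by simp
  qed
  moreover have "0 \<le> b"
    unfolding b_def by (rule integral_nonneg_AE) (auto simp: indicator_def)
  ultimately have "0 < b"
    by simp
  moreover have "(1 - y) powr x * b \<le> R.beta_moment x \<beta>" if x: "0 \<le> x" for x
  proof -
    have "(1 - y) powr x * b = (LINT r|\<mu>. (1 - y) powr x * ?F r)"
      by (simp add: b_def)
    also have "\<dots> \<le> R.beta_moment x \<beta>"
      unfolding R.beta_moment_def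
    proof (rule integral_mono)
      show "integrable \<mu> (\<lambda>r. (1 - y) powr x * ?F r)"
        using i by simp
      fix r assume "r \<in> space \<mu>"
      then have r: "0 \<le> r" "r < 1"
        by auto
      show "(1 - y) powr x * ?F r \<le> (1 - r) powr \<beta> * r powr x"
      proof (cases "1 - r \<le> y")
        case True
        have "(1 - y) powr x * (1 - r) powr \<beta> \<le> r powr x * (1 - r) powr \<beta>"
          using True y x by (intro mult_right_mono powr_mono2) auto
        then show ?thesis
          using True by (simp add: mult.commute)
      qed simp
    qed (use x \<beta> in \<open>simp add: R.integrable_beta\<close>)
    finally show ?thesis .
  qed
  ultimately show ?thesis
    by blast
qed

text \<open>The first monomial inequality holds because P fixes z^n. For the second, suppose t(n),
  the even moment over the product of the two norms, is unbounded, and choose indices \<sigma> j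
  with t > 4^j. The sum of the normalized monomials z^(\<sigma> j) with weights 2^(-j-1) lies in the
  Dirichlet space; the n-th coefficient of a preimage f bounds the norm of f below by 2^(-j-1) 4^j
  for every j, which is absurd.\<close>

theorem D_class_if_projection:
  assumes pp: "1 < p" "1 / p + 1 / p' = 1" and k: "1 \<le> k"
    and bd: "bounded_operator (projection \<omega>) (Lp \<omega> p) (Lp_norm \<omega> p) (Dirichlet \<omega> p k) (Dirichlet_norm \<omega> p k)"
    and onto: "onto_operator (projection \<omega>) (Lp \<omega> p) (Dirichlet \<omega> p k)"
  shows "\<omega> \<in> D_class"
proof -
  have p': "1 < p'"
    by (rule conjugate_gt_1[OF pp])
  have p0: "0 < p"
    using pp by simp
  have pp': "1 < p'" "1 / p' + 1 / p = 1"
    using p' pp by auto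
  obtain C where C: "\<And>f. f \<in> Lp \<omega> p \<Longrightarrow> Dirichlet_norm \<omega> p k (projection \<omega> f) \<le> C * Lp_norm \<omega> p f"
    using bd by (auto simp: bounded_operator_def)
  let ?e = "\<lambda>n z. (z::complex) ^ n"
  have eB: "?e n \<in> Bergman \<omega> q" if "2 * k \<le> n" "1 < q" for n q
    using that k by (intro monomial_Bergman) auto
  define \<beta> where "\<beta> = real k * p"
  have \<beta>: "0 \<le> \<beta>"
    using p0 by (simp add: \<beta>_def)
  define X where "X n = Dirichlet_norm \<omega> p k (?e n)" for n
  define Z where "Z n = Lp_norm \<omega> p' (?e n)" for n
  define a where "a n = real (pochhammer (Suc n - k) k)" for n
  define b where "b n = R.beta_moment (real (n - k) * p) \<beta>" for n
  have X: "X n = a n * b n powr (1 / p)" if "2 * k \<le> n" for n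
    using monomial_Dirichlet(2)[OF that k p0] by (simp add: X_def a_def b_def \<beta>_def)
  have a1: "1 \<le> a n" if "2 * k \<le> n" for n
  proof -
    have "1 \<le> (real n / 2) ^ k"
      using that k by (intro one_le_power) auto
    then show ?thesis
      using pochhammer_bounds(1)[OF that k] by (simp add: a_def)
  qed
  have low: "\<exists>c>0. \<forall>n\<ge>2 * k. s ^ n * c \<le> X n" if s: "0 < s" "s < 1" for s
  proof -
    have y: "0 < 1 - s" "1 - s < 1"
      using s by auto
    obtain d where d: "0 < d" "\<And>x. 0 \<le> x \<Longrightarrow> (1 - (1 - s)) powr x * d \<le> R.beta_moment x \<beta>"
      using beta_moment_lower[OF y \<beta>] by blast
    have "s ^ n * d powr (1 / p) \<le> X n" if n: "2 * k \<le> n" for n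
    proof -
      have "s ^ n \<le> s ^ (n - k)"
        using s by (intro power_decreasing) auto
      also have "s ^ (n - k) = (s powr (real (n - k) * p)) powr (1 / p)"
        using s p0 by (simp add: powr_powr powr_realpow)
      finally have "s ^ n * d powr (1 / p) \<le> (s powr (real (n - k) * p)) powr (1 / p) * d powr (1 / p)"
        by (rule mult_right_mono) simp
      also have "\<dots> = (s powr (real (n - k) * p) * d) powr (1 / p)"
        using d by (simp add: powr_mult)
      also have "\<dots> \<le> b n powr (1 / p)"
        using d p0 s unfolding b_def by (intro powr_mono2) auto
      also have "\<dots> \<le> a n * b n powr (1 / p)"
        using a1[OF n] mult_right_mono[of 1 "a n" "b n powr (1 / p)"] by simp
      finally show ?thesis
        using X[OF n] by simp
    qed
    then show ?thesis
      using d by (intro exI[of _ "d powr (1 / p)"]) auto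
  qed
  have Xpos: "0 < X n" if n: "2 * k \<le> n" for n
  proof -
    obtain c where c: "0 < c" "(1 / 2) ^ n * c \<le> X n"
      using low[of "1 / 2"] n by auto
    have "0 < (1 / 2) ^ n * c"
      using c by simp
    then show ?thesis
      using c by linarith
  qed
  have Zpos: "0 < Z n" if n: "2 * k \<le> n" for n
    unfolding Z_def using n k p' R.power_moment_pos[of "real n * p'"] by (subst monomial_Bergman) auto
  define t where "t n = even_moment n / (X n * Z n)" for n
  have "\<exists>B. \<forall>n\<ge>2 * k. t n \<le> B"
  proof (rule ccontr)
    assume "\<not> (\<exists>B. \<forall>n\<ge>2 * k. t n \<le> B)"
    then have "\<And>B. \<exists>n\<ge>2 * k. B < t n"
      by (meson not_le)
    from exists_fast_subsequence[OF this] obtain \<sigma> where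
      \<sigma>: "strict_mono \<sigma>" "\<And>j. 2 * k \<le> \<sigma> j" "\<And>j. 4 ^ j < t (\<sigma> j)"
      by blast
    have inj: "inj \<sigma>"
      using \<sigma>(1) by (rule strict_mono_imp_inj_on)
    \<comment> \<open>Weights of total mass 1 supported on the chosen indices, so that Jensen's
      inequality applies to the series.\<close>
    define w where "w n = (if n \<in> range \<sigma> then (1 / 2) ^ Suc (inv \<sigma> n) else 0 :: real)" for n
    have w\<sigma>: "w (\<sigma> j) = (1 / 2) ^ Suc j" for j
      using inj by (simp add: w_def)
    have w0: "0 \<le> w n" for n
      by (simp add: w_def)
    have wz: "w n = 0" if "\<not> 2 * k \<le> n" for n
      using that \<sigma>(2) by (auto simp: w_def)
    have ws: "w sums 1"
    proof (rule sums_mono_reindex[THEN iffD1, OF \<sigma>(1)])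
      show "(\<lambda>j. w (\<sigma> j)) sums 1"
        unfolding w\<sigma> by (rule power_half_series)
    qed (simp add: w_def)
    \<comment> \<open>Differentiating k times shifts the indices by k; no weight is lost, as all
      chosen indices are at least 2 k.\<close>
    have wk: "(\<lambda>n. w (n + k)) sums 1"
    proof -
      have "(\<Sum>i<k. w i) = 0"
        using wz by (intro sum.neutral) auto
      then show ?thesis
        using sums_iff_shift[of w k 1] ws by simp
    qed
    define c where "c n = w n / X n" for n
    have c0: "0 \<le> c n" for n
      using w0[of n] wz[of n] Xpos[of n] by (cases "2 * k \<le> n") (auto simp: c_def)
    have csum: "summable (\<lambda>n. complex_of_real (c n) * z ^ n)" if z: "norm z < 1" for z
    proof -
      define s where "s = (1 + norm z) / 2"
      have s: "0 < s" "s < 1" "norm z \<le> s"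
        using z norm_ge_zero[of z] by (auto simp: s_def add_pos_nonneg simp del: norm_ge_zero)
      obtain d where d: "0 < d" "\<And>n. 2 * k \<le> n \<Longrightarrow> s ^ n * d \<le> X n"
        using low[OF s(1,2)] by blast
      show ?thesis
      proof (rule summable_comparison_test'[OF summable_mult2[OF sums_summable[OF ws], of "1 / d"]])
        fix n
        have "c n * norm z ^ n \<le> w n * (1 / d)"
        proof (cases "2 * k \<le> n")
          case True
          have "c n * norm z ^ n \<le> c n * s ^ n"
            using s c0 by (intro mult_left_mono power_mono) auto
          also have "\<dots> = w n * (s ^ n / X n)"
            by (simp add: c_def)
          also have "\<dots> \<le> w n * (1 / d)"
            using d(1) d(2)[OF True] w0 Xpos[OF True] by (intro mult_left_mono) (auto simp: field_simps)
          finally show ?thesis .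
        qed (use wz in \<open>simp add: c_def\<close>)
        then show "norm (complex_of_real (c n) * z ^ n) \<le> w n * (1 / d)"
          using c0[of n] by (simp add: norm_mult norm_power)
      qed
    qed
    define g where "g z = (\<Sum>n. complex_of_real (c n) * z ^ n)" for z
    have gs: "(\<lambda>n. complex_of_real (c n) * z ^ n) sums g z" if "norm z < 1" for z
      unfolding g_def by (rule summable_sums[OF csum[OF that]])
    have gh: "g holomorphic_on disc" and gt: "\<And>n. taylor g n = of_real (c n)"
      by (rule taylor_unique[OF gs]; simp)+
    define h where "h = (deriv ^^ k) g"
    have hh: "h holomorphic_on disc"
      unfolding h_def by (rule holomorphic_funpow_deriv[OF gh])
    have ht: "taylor h n = of_real (c (n + k) * a (n + k))" for n
    proof -
      have "(deriv ^^ n) h 0 = (deriv ^^ (n + k)) g 0"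
        by (simp add: h_def funpow_add)
      also have "\<dots> = of_real (c (n + k)) * fact (n + k)"
        using gt[of "n + k"] by (simp add: field_simps)
      also have "fact (n + k) = (fact n * of_real (a (n + k)) :: complex)"
      proof -
        have "pochhammer (1::nat) (n + k) = pochhammer 1 n * pochhammer (1 + of_nat n) k"
          by (rule pochhammer_product')
        then have "fact (n + k) = fact n * (pochhammer (Suc n) k)"
          by (simp add: pochhammer_fact)
        then have "(of_nat (fact (n + k)) :: complex) = of_nat (fact n * pochhammer (Suc n) k)"
          by (simp only:)
        then show ?thesis
          by (simp add: a_def)
      qed
      finally show ?thesis
        by simp
    qed
    \<comment> \<open>The modulus, at radius r, of the k-th derivative of the monomial z^(n+k)
      divided by its Dirichlet norm.\<close>
    define v where "v r n = a (n + k) * r ^ n / X (n + k)" for r n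
    have a0: "0 \<le> a n" for n
      by (simp add: a_def)
    have X0: "0 \<le> X n" for n
      by (simp add: X_def)
    have v0: "0 \<le> v r n" if "0 \<le> r" for r n
      using that a0 X0 by (simp add: v_def)
    have hb: "ennreal (norm (h z) powr p) \<le> (\<Sum>n. ennreal (w (n + k) * v (norm z) n powr p))" if z: "norm z < 1" for z
    proof -
      have tv: "norm (taylor h n) * norm z ^ n = w (n + k) * v (norm z) n" for n
      proof -
        have "norm (taylor h n) = c (n + k) * a (n + k)"
          unfolding ht norm_of_real by (intro abs_of_nonneg mult_nonneg_nonneg c0 a0)
        then show ?thesis
          by (simp add: c_def v_def)
      qed
      have sm: "summable (\<lambda>n. w (n + k) * v (norm z) n)"
        using taylor_norm_summable[OF hh norm_ge_zero z] unfolding tv .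
      have "norm (h z) = norm (\<Sum>n. taylor h n * z ^ n)"
        using taylor_sums[OF hh z] by (simp add: sums_iff)
      also have "\<dots> \<le> (\<Sum>n. norm (taylor h n * z ^ n))"
        by (rule summable_norm) (use sm in \<open>simp only: norm_mult norm_power tv\<close>)
      also have "\<dots> = (\<Sum>n. w (n + k) * v (norm z) n)"
        unfolding norm_mult norm_power tv ..
      finally have "ennreal (norm (h z) powr p) \<le> ennreal ((\<Sum>n. w (n + k) * v (norm z) n) powr p)"
        using p0 by (intro ennreal_leI powr_mono2) auto
      also have "\<dots> \<le> (\<Sum>n. ennreal (w (n + k) * v (norm z) n powr p))"
        by (rule suminf_powr_le[OF pp(1) w0 wk v0 sm]) simp
      finally show ?thesis .
    qed
    have vm: "(\<lambda>r. ennreal (w (n + k) * v r n powr p)) \<in> borel_measurable \<mu>" for n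
      unfolding v_def by (rule borel_measurable_\<mu>) measurable
    have "mean_integral (shifted \<mu> \<beta>) p h = (\<integral>\<^sup>+r. ennreal ((1 - r) powr \<beta> * circle_mean p h r) \<partial>\<mu>)"
      by (rule R.mean_integral_shifted[OF hh pp(1)])
    also have "\<dots> \<le> (\<integral>\<^sup>+r. (\<Sum>n. ennreal ((1 - r) powr \<beta>) * ennreal (w (n + k) * v r n powr p)) \<partial>\<mu>)"
    proof (rule nn_integral_mono)
      fix r assume "r \<in> space \<mu>"
      then have r: "0 \<le> r" "r < 1"
        by auto
      interpret CC: prob_space circle
        by (rule prob_space_circle)
      have "ennreal (circle_mean p h r) = (\<integral>\<^sup>+\<xi>. ennreal (norm (h (of_real r * \<xi>)) powr p) \<partial>circle)"
        by (rule ennreal_circle_mean[OF hh r p0])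
      also have "\<dots> \<le> (\<integral>\<^sup>+\<xi>. (\<Sum>n. ennreal (w (n + k) * v r n powr p)) \<partial>circle)"
      proof (rule nn_integral_mono)
        fix \<xi> assume "\<xi> \<in> space circle"
        then have "norm (of_real r * \<xi>) = r"
          using r by (simp add: norm_mult)
        then show "ennreal (norm (h (of_real r * \<xi>)) powr p) \<le> (\<Sum>n. ennreal (w (n + k) * v r n powr p))"
          using hb[of "of_real r * \<xi>"] r by simp
      qed
      also have "\<dots> = (\<Sum>n. ennreal (w (n + k) * v r n powr p))"
        using CC.emeasure_space_1 by simp
      finally have "ennreal ((1 - r) powr \<beta>) * ennreal (circle_mean p h r) \<le> ennreal ((1 - r) powr \<beta>) * (\<Sum>n. ennreal (w (n + k) * v r n powr p))"
        by (rule mult_left_mono) simp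
      then show "ennreal ((1 - r) powr \<beta> * circle_mean p h r) \<le> (\<Sum>n. ennreal ((1 - r) powr \<beta>) * ennreal (w (n + k) * v r n powr p))"
        by (simp add: ennreal_mult)
    qed
    also have "\<dots> = (\<Sum>n. \<integral>\<^sup>+r. ennreal ((1 - r) powr \<beta>) * ennreal (w (n + k) * v r n powr p) \<partial>\<mu>)"
      by (rule nn_integral_suminf) (intro borel_measurable_times_ennreal vm R.powr_measurable)
    \<comment> \<open>Each normalized monomial has integral 1 by the formula for \<open>X\<close>,
      so only its weight remains; indices below 2 k carry weight 0.\<close>
    also have "\<dots> = (\<Sum>n. ennreal (w (n + k)))"
    proof (rule suminf_cong)
      fix n
      show "(\<integral>\<^sup>+r. ennreal ((1 - r) powr \<beta>) * ennreal (w (n + k) * v r n powr p) \<partial>\<mu>) = ennreal (w (n + k))"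
      proof (cases "2 * k \<le> n + k")
        case True
        then have n1: "1 \<le> n"
          using k by simp
        have bp: "0 < b (n + k)"
        proof (rule ccontr)
          assume "\<not> 0 < b (n + k)"
          moreover have "0 \<le> b (n + k)"
            unfolding b_def R.beta_moment_def by simp
          ultimately have "b (n + k) = 0"
            by simp
          then show False
            using Xpos[OF True] by (simp add: X[OF True])
        qed
        have Xp: "X (n + k) powr p = a (n + k) powr p * b (n + k)"
          unfolding X[OF True] using a0 bp p0 by (simp add: powr_mult powr_powr)
        have ap: "0 < a (n + k)"
          using a1[OF True] by simp
        define q where "q = w (n + k) * (a (n + k) powr p / X (n + k) powr p)"
        have q: "0 \<le> q"
          using w0 by (simp add: q_def)
        have "(\<integral>\<^sup>+r. ennreal ((1 - r) powr \<beta>) * ennreal (w (n + k) * v r n powr p) \<partial>\<mu>) =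
            (\<integral>\<^sup>+r. ennreal (q * ((1 - r) powr \<beta> * r powr (real n * p))) \<partial>\<mu>)"
        proof (rule nn_integral_cong)
          fix r assume "r \<in> space \<mu>"
          then have r: "0 \<le> r" "r < 1"
            by auto
          have "v r n powr p = a (n + k) powr p / X (n + k) powr p * r powr (real n * p)"
            using r a0 X0 n1 by (simp add: v_def powr_divide powr_mult power_powr)
          then show "ennreal ((1 - r) powr \<beta>) * ennreal (w (n + k) * v r n powr p) = ennreal (q * ((1 - r) powr \<beta> * r powr (real n * p)))"
            using w0[of "n + k"] by (simp add: q_def ennreal_mult[symmetric] mult_ac)
        qed
        also have "\<dots> = ennreal (q * b (n + k))"
          unfolding b_def R.beta_moment_def
          using q p0 \<beta> R.integrable_beta[of "real n * p" \<beta>] by (subst nn_integral_eq_integral) auto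
        also have "q * b (n + k) = w (n + k)"
          using ap bp by (simp add: q_def Xp)
        finally show ?thesis .
      qed (use wz in simp)
    qed
    also have "\<dots> = ennreal 1"
      using suminf_ennreal2[OF w0 sums_summable[OF wk]] wk by (simp add: sums_iff)
    also have "ennreal 1 < \<infinity>"
      by simp
    finally have "mean_integral (shifted \<mu> \<beta>) p h < \<infinity>" .
    then have "g \<in> Dirichlet \<omega> p k"
      using gh p0 by (simp add: Dirichlet_iff h_def \<beta>_def)
    then obtain f where f: "f \<in> Lp \<omega> p" "\<And>z. z \<in> disc \<Longrightarrow> projection \<omega> f z = g z"
      using onto by (auto simp: onto_operator_def)
    have fi: "integrable W f"
      using f pp by (intro Lp_integrable) auto
    \<comment> \<open>Comparing a single Taylor coefficient isolates one hump: it is a Fourier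
      coefficient of f, which Hoelder bounds by the norm of f times \<open>Z\<close>.\<close>
    have up: "(1 / 2) ^ Suc j * 4 ^ j \<le> Lp_norm \<omega> p f" for j
    proof -
      let ?n = "\<sigma> j"
      note n = \<sigma>(2)[of j]
      have "taylor (projection \<omega> f) ?n = taylor g ?n"
        using f(2) by (subst funpow_deriv_cong[of _ g]) auto
      then have "fourier f ?n = of_real (c ?n * even_moment ?n)"
        unfolding taylor_projection[OF fi] gt using even_moment_pos[of ?n] by (simp add: field_simps)
      then have "c ?n * even_moment ?n = norm (fourier f ?n)"
        using c0[of ?n] even_moment_pos[of ?n] by (simp add: norm_mult)
      also have "\<dots> \<le> Lp_norm \<omega> p f * Z ?n"
        using Lp_pairing(2)[OF f(1) Bergman_Lp[OF eB[OF n p']] pp'] by (simp add: fourier_def Z_def)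
      finally have "w ?n * (even_moment ?n / X ?n) \<le> Lp_norm \<omega> p f * Z ?n"
        by (simp add: c_def)
      then have le: "w ?n * t ?n \<le> Lp_norm \<omega> p f"
        using Zpos[OF n] Xpos[OF n] by (simp add: t_def field_simps)
      have "w ?n * 4 ^ j \<le> w ?n * t ?n"
        using \<sigma>(3)[of j] w0 by (intro mult_left_mono) auto
      from order_trans[OF this le] show ?thesis
        unfolding w\<sigma> .
    qed
    obtain j where "2 * Lp_norm \<omega> p f < 2 ^ j"
      using real_arch_pow[of 2] by auto
    moreover have "(1 / 2) ^ Suc j * 4 ^ j = (2::real) ^ j / 2"
    proof -
      have "(1 / 2) ^ j * 4 ^ j = (2::real) ^ j"
        by (subst power_mult_distrib[symmetric]) simp
      then show ?thesis
        by simp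
    qed
    ultimately show False
      using up[of j] by simp
  qed
  then obtain B where B: "\<And>n. 2 * k \<le> n \<Longrightarrow> t n \<le> B"
    by blast
  show ?thesis
  proof (rule D_class_of_monomials[OF pp k, of C B])
    fix n assume n: "2 * k \<le> n"
    have L: "?e n \<in> Lp \<omega> p"
      by (intro Bergman_Lp eB n pp)
    have i: "integrable W (?e n)"
      using L pp by (intro Lp_integrable) auto
    have "Dirichlet_norm \<omega> p k (?e n) = Dirichlet_norm \<omega> p k (projection \<omega> (?e n))"
      by (intro Dirichlet_norm_cong monomial_holomorphic projection_holomorphic i p0)
        (simp add: projection_reproduces[OF monomial_holomorphic i])
    also have "\<dots> \<le> C * Lp_norm \<omega> p (?e n)"
      by (rule C[OF L])
    finally show "Dirichlet_norm \<omega> p k (?e n) \<le> C * Lp_norm \<omega> p (?e n)" .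
    show "even_moment n \<le> B * Dirichlet_norm \<omega> p k (?e n) * Lp_norm \<omega> p' (?e n)"
      using B[OF n] Xpos[OF n] Zpos[OF n] unfolding t_def X_def[symmetric] Z_def[symmetric]
      by (simp add: field_simps)
  qed
qed

end

subsection \<open>Boundedness of the projection\<close>

context radial
begin

definition outer :: "real \<Rightarrow> real"
  where "outer r = mass \<mu> (1 - r)"

lemma outer_measurable: "outer \<in> borel_measurable borel"
proof -
  have "mono (\<lambda>r. - outer r)"
    unfolding outer_def by (intro monoI) (simp add: mass_mono)
  then have "(\<lambda>r. - (- outer r)) \<in> borel_measurable borel"
    by (intro borel_measurable_uminus borel_measurable_mono)
  then show ?thesis
    by simp
qed

lemma outer_pos: "r < 1 \<Longrightarrow> 0 < outer r"
  unfolding outer_def by (rule mass_pos) simp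

text \<open>The set is closed upwards, and an interval [s,1) contained in it has measure
  \<open>outer s\<close>. So the law of \<open>outer\<close> under \<mu> is dominated by Lebesgue
  measure on the half-line, for every \<mu>.\<close>

lemma emeasure_outer_le:
  assumes u: "0 \<le> u"
  shows "emeasure \<mu> {r \<in> {0..<1}. outer r \<le> u} \<le> ennreal u"
proof (rule emeasure_upset_le[OF refl])
  fix x y assume "y \<in> {r \<in> {0..<1}. outer r \<le> u}" "y \<le> x" "x < 1"
  then show "x \<in> {r \<in> {0..<1}. outer r \<le> u}"
    using mass_mono[of "1 - x" "1 - y"] by (auto simp: outer_def)
next
  fix s assume s: "s \<in> {r \<in> {0..<1}. outer r \<le> u}"
  then have "emeasure \<mu> {s..<1} = ennreal (outer s)"
    unfolding outer_def by (intro emeasure_atLeast) auto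
  also have "\<dots> \<le> ennreal u"
    using s by (intro ennreal_leI) auto
  finally show "emeasure \<mu> {s..<1} \<le> ennreal u" .
qed auto

text \<open>Each point with F positive is charged to a level j, whose set {outer <= u j} has measure
  at most u j; summing values times measures gives S.\<close>

lemma nn_integral_levels:
  assumes F: "\<And>r. r \<in> {0..<1} \<Longrightarrow> 0 < F r \<Longrightarrow> \<exists>j. F r \<le> c j \<and> outer r \<le> u j"
    and nn: "\<And>j. 0 \<le> c j" "\<And>j. 0 \<le> u j" and s: "(\<lambda>j::nat. c j * u j) sums S"
  shows "(\<integral>\<^sup>+r. ennreal (F r) \<partial>\<mu>) \<le> ennreal S"
proof -
  let ?L = "\<lambda>j. {r \<in> {0..<1}. outer r \<le> u j}"
  have L: "?L j \<in> sets \<mu>" for j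
  proof -
    have [measurable]: "outer \<in> borel_measurable borel"
      by (rule outer_measurable)
    have "{r. outer r \<le> u j} \<in> sets borel"
      by measurable
    then have "{0..<1} \<inter> {r. outer r \<le> u j} \<in> sets borel"
      by (intro sets.Int) auto
    moreover have "?L j = {0..<1} \<inter> {r. outer r \<le> u j}"
      by auto
    ultimately show ?thesis
      unfolding sets_\<mu>_iff by auto
  qed
  have "(\<integral>\<^sup>+r. ennreal (F r) \<partial>\<mu>) \<le> (\<integral>\<^sup>+r. (\<Sum>j. ennreal (c j) * indicator (?L j) r) \<partial>\<mu>)"
  proof (rule nn_integral_mono)
    fix r assume "r \<in> space \<mu>"
    then have r: "r \<in> {0..<1}"
      by (simp add: space_\<mu>)
    show "ennreal (F r) \<le> (\<Sum>j. ennreal (c j) * indicator (?L j) r)"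
    proof (cases "0 < F r")
      case True
      then obtain j where j: "F r \<le> c j" "outer r \<le> u j"
        using F r by blast
      define g where "g i = ennreal (c i) * indicator (?L i) r" for i
      have "ennreal (F r) \<le> g j"
        using j r by (simp add: g_def ennreal_leI)
      also have "g j = (\<Sum>i\<in>{j}. g i)"
        by simp
      also have "\<dots> \<le> (\<Sum>i. g i)"
        by (rule sum_le_suminf) auto
      finally show ?thesis
        unfolding g_def .
    qed (simp add: ennreal_neg)
  qed
  also have "\<dots> = (\<Sum>j. \<integral>\<^sup>+r. ennreal (c j) * indicator (?L j) r \<partial>\<mu>)"
    by (rule nn_integral_suminf) (use L in auto)
  also have "\<dots> = (\<Sum>j. ennreal (c j) * emeasure \<mu> (?L j))"
    using L by (simp add: nn_integral_cmult_indicator)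
  also have "\<dots> \<le> (\<Sum>j. ennreal (c j) * ennreal (u j))"
    by (intro suminf_le mult_left_mono emeasure_outer_le nn) auto
  also have "\<dots> = (\<Sum>j. ennreal (c j * u j))"
    by (rule suminf_cong) (rule ennreal_mult[OF nn, symmetric])
  also have "\<dots> = ennreal (\<Sum>j. c j * u j)"
    by (rule suminf_ennreal2[OF mult_nonneg_nonneg[OF nn] sums_summable[OF s]])
  also have "(\<Sum>j. c j * u j) = S"
    by (rule sums_unique[OF s, symmetric])
  finally show ?thesis .
qed

text \<open>The model is the integral of u^(-a) / max H u over u > 0, a multiple of H^(-a): it
  converges at 0 because a < 1 and at infinity because a > 0. Dyadic levels below and above H =
  \<open>outer \<rho>\<close> replace the change of variables.\<close>

lemma nn_integral_outer_powr:
  assumes a: "0 < a" "a < 1"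
  shows "\<exists>C\<ge>0. \<forall>\<rho>. \<rho> < 1 \<longrightarrow>
    (\<integral>\<^sup>+r. ennreal (outer r powr (- a) / max (outer \<rho>) (outer r)) \<partial>\<mu>) \<le> ennreal (C * outer \<rho> powr (- a))"
proof -
  \<comment> \<open>The ratios of the two geometric series, 2^(a-1) for levels below H and 2^(-a)
    for levels above; a in (0,1) makes both less than 1.\<close>
  define q1 where "q1 = 2 powr a / (2::real)"
  define q2 where "q2 = 2 powr (- a - 1) * (2::real)"
  have q: "0 \<le> q1" "q1 < 1" "0 \<le> q2" "q2 < 1"
    using a powr_less_mono[of a 1 "2::real"] powr_less_mono[of "- a - 1" "- 1" "2::real"]
    by (auto simp: q1_def q2_def powr_minus)
  have pw: "((1 / 2) ^ n) powr (- a) = (2 powr a) ^ n" for n :: nat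
  proof (induction n)
    case (Suc n)
    have "(1 / 2) powr (- a) = (2::real) powr a"
      by (simp add: powr_minus powr_divide)
    then show ?case
      by (simp only: power_Suc powr_mult Suc)
  qed simp
  have pw2: "(2 ^ n) powr (- a - 1) = (2 powr (- a - 1)) ^ n" for n :: nat
    by (induction n) (simp_all add: powr_mult)
  define C where "C = 2 powr a * (1 / (1 - q1)) + 2 * (1 / (1 - q2))"
  have C: "0 \<le> C"
    using q by (simp add: C_def)
  have "(\<integral>\<^sup>+r. ennreal (outer r powr (- a) / max (outer \<rho>) (outer r)) \<partial>\<mu>) \<le> ennreal (C * outer \<rho> powr (- a))"
    if \<rho>: "\<rho> < 1" for \<rho>
  proof -
    define H where "H = outer \<rho>"
    have H: "0 < H"
      unfolding H_def by (rule outer_pos[OF \<rho>])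
    define F1 where "F1 r = (if outer r \<le> H then outer r powr (- a) / H else 0)" for r
    define F2 where "F2 r = (if outer r \<le> H then 0 else outer r powr (- a - 1))" for r
    have F12: "outer r powr (- a) / max H (outer r) = F1 r + F2 r" if "r < 1" for r
      using outer_pos[OF that] H by (auto simp: F1_def F2_def max_def powr_diff)
    have Fn: "0 \<le> F1 r" "0 \<le> F2 r" for r
      using H by (auto simp: F1_def F2_def)
    have 1: "(\<integral>\<^sup>+r. ennreal (F1 r) \<partial>\<mu>) \<le> ennreal (2 powr a * H powr (- a) * (1 / (1 - q1)))"
    proof (rule nn_integral_levels[where c = "\<lambda>j. ((1 / 2) ^ Suc j * H) powr (- a) / H" and u = "\<lambda>j. (1 / 2) ^ j * H"])
      fix r :: real assume "r \<in> {0..<1}" and F: "0 < F1 r"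
      then have r: "0 < outer r"
        by (intro outer_pos) auto
      have le: "outer r \<le> H"
        using F by (simp add: F1_def split: if_splits)
      obtain n where n: "(1 / 2) ^ n < outer r / H"
        using real_arch_pow_inv[of "outer r / H" "1 / 2"] r H by auto
      define m where "m = (LEAST n. (1 / 2) ^ n < outer r / H)"
      have m: "(1 / 2) ^ m < outer r / H"
        unfolding m_def by (rule LeastI[of _ n]) (rule n)
      have "m \<noteq> 0"
      proof
        assume "m = 0"
        then show False
          using m le H by simp
      qed
      then obtain j where j: "m = Suc j"
        by (cases m) auto
      have "j < m"
        by (simp add: j)
      then have "\<not> (1 / 2) ^ j < outer r / H"
        unfolding m_def by (rule not_less_Least)
      then have u: "outer r \<le> (1 / 2) ^ j * H"
        using H by (simp add: not_less pos_divide_le_eq)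
      have l: "(1 / 2) ^ Suc j * H \<le> outer r"
        using m H unfolding j by (simp only: pos_less_divide_eq less_imp_le)
      have "outer r powr (- a) \<le> ((1 / 2) ^ Suc j * H) powr (- a)"
        by (rule powr_mono2') (use a H l in auto)
      then have "F1 r \<le> ((1 / 2) ^ Suc j * H) powr (- a) / H"
        using le H unfolding F1_def by (simp only: if_True divide_right_mono less_imp_le)
      with u show "\<exists>j. F1 r \<le> ((1 / 2) ^ Suc j * H) powr (- a) / H \<and> outer r \<le> (1 / 2) ^ j * H"
        by blast
    next
      have "(\<lambda>j. q1 ^ j) sums (1 / (1 - q1))"
        using q by (intro geometric_sums) auto
      then have "(\<lambda>j. 2 powr a * H powr (- a) * q1 ^ j) sums (2 powr a * H powr (- a) * (1 / (1 - q1)))"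
        by (rule sums_mult)
      also have "(\<lambda>j. 2 powr a * H powr (- a) * q1 ^ j) = (\<lambda>j. ((1 / 2) ^ Suc j * H) powr (- a) / H * ((1 / 2) ^ j * H))"
      proof
        fix j
        have "((1 / 2) ^ Suc j * H) powr (- a) = (2 powr a) ^ Suc j * H powr (- a)"
          unfolding powr_mult pw ..
        then show "2 powr a * H powr (- a) * q1 ^ j = ((1 / 2) ^ Suc j * H) powr (- a) / H * ((1 / 2) ^ j * H)"
          using H by (simp add: q1_def power_divide)
      qed
      finally show "(\<lambda>j. ((1 / 2) ^ Suc j * H) powr (- a) / H * ((1 / 2) ^ j * H)) sums (2 powr a * H powr (- a) * (1 / (1 - q1)))" .
    qed (use H in auto)
    have 2: "(\<integral>\<^sup>+r. ennreal (F2 r) \<partial>\<mu>) \<le> ennreal (2 * H powr (- a) * (1 / (1 - q2)))"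
    proof (rule nn_integral_levels[where c = "\<lambda>j. (2 ^ j * H) powr (- a - 1)" and u = "\<lambda>j. 2 ^ Suc j * H"])
      fix r :: real assume "r \<in> {0..<1}" and F: "0 < F2 r"
      have gt: "H < outer r"
        using F by (simp add: F2_def split: if_splits)
      obtain n where n: "outer r / H < 2 ^ n"
        using real_arch_pow[of 2 "outer r / H"] by auto
      define m where "m = (LEAST n. outer r / H < 2 ^ n)"
      have m: "outer r / H < 2 ^ m"
        unfolding m_def by (rule LeastI[of _ n]) (rule n)
      have "m \<noteq> 0"
      proof
        assume "m = 0"
        then show False
          using m gt H by simp
      qed
      then obtain j where j: "m = Suc j"
        by (cases m) auto
      have "j < m"
        by (simp add: j)
      then have "\<not> outer r / H < 2 ^ j"
        unfolding m_def by (rule not_less_Least)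
      then have l: "2 ^ j * H \<le> outer r"
        using H by (simp add: not_less pos_le_divide_eq)
      have u: "outer r \<le> 2 ^ Suc j * H"
        using m H unfolding j by (simp only: pos_divide_less_eq less_imp_le)
      have "outer r powr (- a - 1) \<le> (2 ^ j * H) powr (- a - 1)"
        by (rule powr_mono2') (use a H l in auto)
      then have "F2 r \<le> (2 ^ j * H) powr (- a - 1)"
        using gt by (simp add: F2_def)
      with u show "\<exists>j. F2 r \<le> (2 ^ j * H) powr (- a - 1) \<and> outer r \<le> 2 ^ Suc j * H"
        by blast
    next
      have "(\<lambda>j. q2 ^ j) sums (1 / (1 - q2))"
        using q by (intro geometric_sums) auto
      then have "(\<lambda>j. 2 * H powr (- a) * q2 ^ j) sums (2 * H powr (- a) * (1 / (1 - q2)))"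
        by (rule sums_mult)
      also have "(\<lambda>j. 2 * H powr (- a) * q2 ^ j) = (\<lambda>j. (2 ^ j * H) powr (- a - 1) * (2 ^ Suc j * H))"
      proof
        fix j
        have "H powr (- a - 1) * H = H powr (- a)"
          using H by (simp add: powr_diff)
        moreover have "(2 ^ j * H) powr (- a - 1) = (2 powr (- a - 1)) ^ j * H powr (- a - 1)"
          unfolding powr_mult pw2 ..
        ultimately show "2 * H powr (- a) * q2 ^ j = (2 ^ j * H) powr (- a - 1) * (2 ^ Suc j * H)"
          by (simp add: q2_def power_mult_distrib mult_ac)
      qed
      finally show "(\<lambda>j. (2 ^ j * H) powr (- a - 1) * (2 ^ Suc j * H)) sums (2 * H powr (- a) * (1 / (1 - q2)))" .
    qed (use H in auto)
    have om: "outer \<in> borel_measurable \<mu>"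
      by (rule measurable_\<mu>[OF outer_measurable])
    note om[measurable]
    have Fm: "F1 \<in> borel_measurable \<mu>" "F2 \<in> borel_measurable \<mu>"
      unfolding F1_def F2_def by measurable
    have "(\<integral>\<^sup>+r. ennreal (outer r powr (- a) / max (outer \<rho>) (outer r)) \<partial>\<mu>) = (\<integral>\<^sup>+r. ennreal (F1 r) + ennreal (F2 r) \<partial>\<mu>)"
      unfolding H_def[symmetric]
      by (rule nn_integral_cong) (simp add: space_\<mu> F12 Fn flip: ennreal_plus)
    also have "\<dots> = (\<integral>\<^sup>+r. ennreal (F1 r) \<partial>\<mu>) + (\<integral>\<^sup>+r. ennreal (F2 r) \<partial>\<mu>)"
      by (rule nn_integral_add) (use Fm in auto)
    also have "\<dots> \<le> ennreal (2 powr a * H powr (- a) * (1 / (1 - q1))) + ennreal (2 * H powr (- a) * (1 / (1 - q2)))"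
      by (rule add_mono[OF 1 2])
    also have "\<dots> = ennreal (C * H powr (- a))"
      using q by (simp add: C_def algebra_simps flip: ennreal_plus)
    finally show ?thesis
      by (simp add: H_def)
  qed
  then show ?thesis
    using C by blast
qed

end

section \<open>Circle means of the derivative of the kernel\<close>

lemma taylor_deriv: "taylor (deriv f) n = of_nat (Suc n) * taylor f (Suc n)"
  by (simp add: funpow_Suc_right del: funpow.simps of_nat_Suc)

lemma norm_powr_2: "norm v powr 2 = (norm v)\<^sup>2"
  by (cases "norm v = 0") (auto simp: powr_numeral)

text \<open>The series for the convolution of F with the conjugate of its own boundary values; each
  Fourier coefficient is the conjugate of the corresponding Taylor term.\<close>

lemma parseval:
  assumes F: "F holomorphic_on disc" and r: "0 \<le> r" "r < 1"
  shows "(\<lambda>n. (norm (taylor F n))\<^sup>2 * r ^ (2 * n)) sums circle_mean 2 F r"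
proof -
  define v where "v \<xi> = F (of_real r * \<xi>)" for \<xi>
  have v: "continuous_on (sphere 0 1) v"
    unfolding v_def using r by (intro continuous_on_circle_compose F) auto
  have cv: "continuous_on (sphere 0 1) (\<lambda>\<xi>. cnj (v \<xi>))"
    using v by (intro continuous_intros)
  have "compact (v ` sphere 0 1)"
    by (rule compact_continuous_image[OF v]) simp
  then obtain B where B: "\<And>\<xi>. norm \<xi> = 1 \<Longrightarrow> norm (v \<xi>) \<le> B"
    by (fastforce dest: compact_imp_bounded simp: bounded_iff)
  have co: "(LINT \<xi>|circle. \<xi> ^ n * cnj (v \<xi>)) = cnj (taylor F n * of_real r ^ n)" for n
  proof -
    have i: "integrable circle (\<lambda>\<xi>. v \<xi> * cnj \<xi> ^ n)"
      by (intro circle_integrable_continuous continuous_intros v)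
    have "(LINT \<xi>|circle. \<xi> ^ n * cnj (v \<xi>)) = (LINT \<xi>|circle. cnj (v \<xi> * cnj \<xi> ^ n))"
      by (simp add: mult.commute)
    also have "\<dots> = cnj (LINT \<xi>|circle. v \<xi> * cnj \<xi> ^ n)"
      by (rule integral_bounded_linear[OF bounded_linear_cnj i])
    finally show ?thesis
      unfolding v_def circle_coefficient[OF F r] .
  qed
  have "(\<lambda>n. taylor F n * (LINT \<xi>|circle. \<xi> ^ n * cnj (v \<xi>)) * of_real r ^ n) sums (LINT \<xi>|circle. F (of_real r * \<xi>) * cnj (v \<xi>))"
    using r B by (intro circle_convolution_sums[OF F, where B = B] circle_measurableI cv) auto
  moreover have "taylor F n * (LINT \<xi>|circle. \<xi> ^ n * cnj (v \<xi>)) * of_real r ^ n = of_real ((norm (taylor F n))\<^sup>2 * r ^ (2 * n))" for n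
  proof -
    have "taylor F n * cnj (taylor F n * of_real r ^ n) * of_real r ^ n = (taylor F n * cnj (taylor F n)) * (of_real r ^ n * of_real r ^ n)"
      by simp
    also have "\<dots> = of_real ((norm (taylor F n))\<^sup>2 * r ^ (2 * n))"
      unfolding complex_norm_square[symmetric] by (simp add: mult_2 power_add)
    finally show ?thesis
      unfolding co .
  qed
  moreover have "(LINT \<xi>|circle. F (of_real r * \<xi>) * cnj (v \<xi>)) = of_real (circle_mean 2 F r)"
    unfolding circle_mean_def v_def[symmetric] norm_powr_2 complex_norm_square[symmetric]
    by (rule integral_complex_of_real)
  ultimately show ?thesis
    by (simp only: sums_of_real_iff)
qed

context weight
begin

text \<open>The kernel as a function of the single variable cnj z * \<zeta>, on which alone it
  depends.\<close>

definition kernel_series :: "complex \<Rightarrow> complex"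
  where "kernel_series w = (\<Sum>n. of_real (1 / even_moment n) * w ^ n)"

abbreviation "dkernel \<equiv> deriv kernel_series"

lemma kernel_series:
  shows kernel_series_holomorphic: "kernel_series holomorphic_on disc"
    and taylor_kernel_series: "taylor kernel_series n = of_real (1 / even_moment n)"
proof -
  have "(\<lambda>n. complex_of_real (1 / even_moment n) * z ^ n) sums kernel_series z" if z: "norm z < 1" for z
    unfolding kernel_series_def
  proof (rule summable_sums, rule summable_norm_cancel)
    have "norm (complex_of_real (1 / even_moment n) * z ^ n) = norm z ^ n / even_moment n" for n
      using even_moment_pos[of n] by (simp add: norm_mult norm_power norm_divide)
    then show "summable (\<lambda>n. norm (complex_of_real (1 / even_moment n) * z ^ n))"
      using summable_inverse_moments[OF norm_ge_zero z] by simp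
  qed
  from taylor_unique[OF this] show "kernel_series holomorphic_on disc" "taylor kernel_series n = of_real (1 / even_moment n)"
    by auto
qed

lemma dkernel_holomorphic: "dkernel holomorphic_on disc"
  using kernel_series_holomorphic by (rule holomorphic_deriv) simp

lemma taylor_dkernel: "taylor dkernel n = of_real (real (Suc n) / even_moment (Suc n))"
  unfolding taylor_deriv taylor_kernel_series by simp

lemma norm_dkernel_cnj:
  assumes "norm w < 1" shows "norm (dkernel (cnj w)) = norm (dkernel w)"
proof -
  have "(\<lambda>n. cnj (taylor dkernel n * w ^ n)) sums cnj (dkernel w)"
    using taylor_sums[OF dkernel_holomorphic assms] by (simp only: sums_cnj)
  moreover have "cnj (taylor dkernel n * w ^ n) = taylor dkernel n * cnj w ^ n" for n
    unfolding taylor_dkernel by simp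
  ultimately have "(\<lambda>n. taylor dkernel n * cnj w ^ n) sums cnj (dkernel w)"
    by (simp only:)
  moreover have "(\<lambda>n. taylor dkernel n * cnj w ^ n) sums dkernel (cnj w)"
    using assms by (intro taylor_sums dkernel_holomorphic) simp
  ultimately have "dkernel (cnj w) = cnj (dkernel w)"
    by (rule sums_unique2[symmetric])
  then show ?thesis
    by simp
qed

text \<open>Differentiating the kernel in z produces a factor cnj \<zeta>. It is moved to f, where
  it shifts the Fourier coefficients by one, and is finally bounded by 1.\<close>

lemma deriv_projection_le:
  assumes i: "integrable W f" and z: "norm z < 1"
  shows "ennreal (norm (deriv (projection \<omega> f) z)) \<le> (\<integral>\<^sup>+\<zeta>. ennreal (norm (f \<zeta>) * norm (dkernel (cnj z * \<zeta>))) \<partial>W)"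
proof -
  define f1 where "f1 \<zeta> = f \<zeta> * cnj \<zeta>" for \<zeta>
  have i1: "integrable W f1"
    unfolding f1_def using integrable_fourier[OF i, of 1] by simp
  have F1: "fourier f1 n = fourier f (Suc n)" for n
    by (simp add: fourier_def f1_def mult.assoc)
  have S: "summable (\<lambda>n. norm (taylor dkernel n) * norm z ^ n)"
    using z by (intro taylor_norm_summable dkernel_holomorphic) auto
  have dP: "deriv (projection \<omega> f) holomorphic_on disc"
    using projection_holomorphic[OF i] by (rule holomorphic_deriv) simp
  let ?I = "LINT \<zeta>|W. f1 \<zeta> * (\<Sum>n. taylor dkernel n * (z * cnj \<zeta>) ^ n)"
  have "(\<lambda>n. taylor dkernel n * fourier f1 n * z ^ n) sums ?I"
    by (rule fourier_multiplier_sums(1)[OF i1 S])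
  moreover have "(\<lambda>n. taylor dkernel n * fourier f1 n * z ^ n) sums deriv (projection \<omega> f) z"
  proof -
    have "taylor (deriv (projection \<omega> f)) n = taylor dkernel n * fourier f1 n" for n
      unfolding taylor_deriv taylor_projection[OF i] F1 taylor_kernel_series by simp
    then show ?thesis
      using taylor_sums[OF dP z] by (simp only:)
  qed
  ultimately have e: "deriv (projection \<omega> f) z = ?I"
    by (rule sums_unique2[symmetric])
  have "ennreal (norm ?I) \<le> (\<integral>\<^sup>+\<zeta>. ennreal (norm (f1 \<zeta> * (\<Sum>n. taylor dkernel n * (z * cnj \<zeta>) ^ n))) \<partial>W)"
  \<comment> \<open>Without integrability the Bochner integral is 0 by convention, so the bound
    still holds.\<close>
  proof (cases "integrable W (\<lambda>\<zeta>. f1 \<zeta> * (\<Sum>n. taylor dkernel n * (z * cnj \<zeta>) ^ n))")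
    case True
    then show ?thesis
      by (rule integral_norm_bound_ennreal)
  qed (simp add: not_integrable_integral_eq)
  also have "\<dots> \<le> (\<integral>\<^sup>+\<zeta>. ennreal (norm (f \<zeta>) * norm (dkernel (cnj z * \<zeta>))) \<partial>W)"
  proof (intro nn_integral_mono ennreal_leI)
    fix \<zeta> assume "\<zeta> \<in> space W"
    then have \<zeta>: "norm \<zeta> < 1"
      by simp
    have w: "norm (cnj z * \<zeta>) < 1"
      using z \<zeta> mult_strict_mono[of "norm z" 1 "norm \<zeta>" 1] by (simp add: norm_mult)
    have "(\<Sum>n. taylor dkernel n * (z * cnj \<zeta>) ^ n) = dkernel (cnj (cnj z * \<zeta>))"
      using taylor_sums[OF dkernel_holomorphic, of "cnj (cnj z * \<zeta>)"] w by (simp add: sums_iff norm_mult)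
    then have "norm (f1 \<zeta> * (\<Sum>n. taylor dkernel n * (z * cnj \<zeta>) ^ n)) = norm (f \<zeta>) * norm \<zeta> * norm (dkernel (cnj z * \<zeta>))"
      using norm_dkernel_cnj[OF w] by (simp add: f1_def norm_mult)
    also have "\<dots> \<le> norm (f \<zeta>) * 1 * norm (dkernel (cnj z * \<zeta>))"
      using \<zeta> by (intro mult_right_mono mult_left_mono) auto
    finally show "norm (f1 \<zeta> * (\<Sum>n. taylor dkernel n * (z * cnj \<zeta>) ^ n)) \<le> norm (f \<zeta>) * norm (dkernel (cnj z * \<zeta>))"
      by simp
  qed
  finally show ?thesis
    unfolding e .
qed

text \<open>Second differences are avoided by pairing with \<open>1 - s \<xi>\<close> in Cauchy--Schwarz: only the first
  differences of the coefficients enter, and \<open>1 / (1 - s \<xi>)\<close> has square mean \<open>1 / (1 - s\<^sup>2)\<close>.\<close>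

lemma circle_mean_dkernel:
  assumes D: "doubling \<mu>"
  shows "\<exists>C>0. \<forall>s. 0 \<le> s \<longrightarrow> s < 1 \<longrightarrow> circle_mean 1 dkernel s \<le> C / ((1 - s) * mass \<mu> (1 - s))"
proof -
  obtain C where C: "1 \<le> C" "\<And>x. 0 < x \<Longrightarrow> mass \<mu> x \<le> C * mass \<mu> (x / 2)"
    using D by (auto simp: doubling_def)
  define m where "m = even_moment"
  have m: "0 < m n" for n
    by (simp add: m_def even_moment_pos)
  define d where "d n = real (Suc n) / m (Suc n)" for n
  \<comment> \<open>First differences of the coefficients d: the coefficients of (1 - w) times the
    derivative of the kernel.\<close>
  define e where "e n = d n - (if n = 0 then 0 else d (n - 1))" for n
  define F where "F w = dkernel w - w * dkernel w" for w
  have F: "F holomorphic_on disc" and tF: "taylor F n = of_real (e n)" for n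
  proof -
    have "(\<lambda>n. complex_of_real (e n) * w ^ n) sums F w" if w: "norm w < 1" for w
    proof -
      have a: "(\<lambda>n. complex_of_real (d n) * w ^ n) sums dkernel w"
        using taylor_sums[OF dkernel_holomorphic w] unfolding taylor_dkernel d_def m_def .
      let ?g = "\<lambda>n. if n = 0 then 0 else complex_of_real (d (n - 1)) * w ^ n"
      have "(\<lambda>n. w * (complex_of_real (d n) * w ^ n)) sums (w * dkernel w)"
        by (rule sums_mult[OF a])
      also have "(\<lambda>n. w * (complex_of_real (d n) * w ^ n)) = (\<lambda>n. ?g (Suc n))"
        by (simp add: mult_ac)
      finally have "?g sums (w * dkernel w)"
        using sums_Suc_iff[of ?g "w * dkernel w"] by simp
      from sums_diff[OF a this] have "(\<lambda>n. complex_of_real (d n) * w ^ n - ?g n) sums F w"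
        by (simp add: F_def)
      also have "(\<lambda>n. complex_of_real (d n) * w ^ n - ?g n) = (\<lambda>n. complex_of_real (e n) * w ^ n)"
        by (auto simp: e_def algebra_simps)
      finally show ?thesis .
    qed
    from taylor_unique[OF this] show "F holomorphic_on disc" "taylor F n = of_real (e n)"
      by auto
  qed
  define G where "G w = 1 / (1 - w)" for w :: complex
  have G: "G holomorphic_on disc" and tG: "taylor G n = 1" for n
  proof -
    have "(\<lambda>n. 1 * w ^ n) sums G w" if "norm w < 1" for w
      using geometric_sums[OF that] by (simp add: G_def)
    from taylor_unique[OF this] show "G holomorphic_on disc" "taylor G n = 1"
      by auto
  qed
  \<comment> \<open>The difference splits into 1 / m(n+1) and n (m(n) - m(n+1)) / (m(n) m(n+1)). In
    the latter n r^n (1 - r) <= 1 reduces n (r^(2n) - r^(2n+2)) to 2 r^n, whose integral doubling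
    bounds by a multiple of m(n).\<close>
  have eb: "\<bar>e n\<bar> \<le> (1 + 2 * C) / m (Suc n)" for n
  proof (cases "n = 0")
    case True
    then show ?thesis
      using m[of 1] C by (simp add: e_def d_def divide_right_mono)
  next
    case False
    have pm: "R.power_moment (real n) \<le> C * m n"
      using R.power_moment_doubling[OF C, of "real n"] False by (simp add: m_def even_moment_power_moment)
    have i: "integrable \<mu> (\<lambda>r. r ^ j)" for j
      by (rule R.integrable_bounded[of _ 1]) (auto intro!: power_le_one)
    have diff: "m n - m (Suc n) = (LINT r|\<mu>. r ^ (2 * n) - r ^ (2 * Suc n))"
      unfolding m_def even_moment_eq by (rule Bochner_Integration.integral_diff[symmetric]) (rule i)+
    have d0: "0 \<le> m n - m (Suc n)"
      unfolding diff by (rule integral_nonneg_AE, rule AE_I2) (auto intro!: power_decreasing simp del: power_Suc)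
    have "real n * (m n - m (Suc n)) = (LINT r|\<mu>. real n * (r ^ (2 * n) - r ^ (2 * Suc n)))"
      unfolding diff by simp
    also have "\<dots> \<le> (LINT r|\<mu>. 2 * r powr real n)"
    proof (rule integral_mono)
      show "integrable \<mu> (\<lambda>r. real n * (r ^ (2 * n) - r ^ (2 * Suc n)))"
        using i by (intro integrable_mult_right Bochner_Integration.integrable_diff)
      show "integrable \<mu> (\<lambda>r. 2 * r powr real n)"
        by (intro integrable_mult_right R.integrable_power) simp
      fix r assume "r \<in> space \<mu>"
      then have r: "0 \<le> r" "r < 1"
        by auto
      have "real n * r ^ n * (1 - r) \<le> 1"
      proof -
        have "real n * r ^ n = (\<Sum>i<n. r ^ n)"
          by simp
        also have "\<dots> \<le> (\<Sum>i<n. r ^ i)"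
          using r by (intro sum_mono power_decreasing) auto
        also have "\<dots> = (1 - r ^ n) / (1 - r)"
          using r by (simp add: sum_gp_strict)
        also have "\<dots> \<le> 1 / (1 - r)"
          using r by (intro divide_right_mono) auto
        finally have "real n * r ^ n * (1 - r) \<le> 1 / (1 - r) * (1 - r)"
          using r by (intro mult_right_mono) auto
        then show ?thesis
          using r by simp
      qed
      then have L: "real n * r ^ n * (1 - r) * ((1 + r) * r ^ n) \<le> 1 * (2 * r ^ n)"
        using r by (intro mult_mono) auto
      have E: "real n * (r ^ (2 * n) - r ^ (2 * Suc n)) = real n * r ^ n * (1 - r) * ((1 + r) * r ^ n)"
      proof -
        have "r ^ (2 * n) = r ^ n * r ^ n" "r ^ (2 * Suc n) = r * r * (r ^ n * r ^ n)"
          by (simp_all add: mult_2 power_add)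
        then show ?thesis
          by (simp only:) (simp add: algebra_simps)
      qed
      have P: "r powr real n = r ^ n"
        using r False by (cases "r = 0") (auto simp: powr_realpow)
      show "real n * (r ^ (2 * n) - r ^ (2 * Suc n)) \<le> 2 * r powr real n"
        unfolding E P using L by (simp only: mult_1_left)
    qed
    also have "\<dots> = 2 * R.power_moment (real n)"
      by (simp add: R.power_moment_def)
    also have "\<dots> \<le> 2 * C * m n"
      using pm by simp
    finally have le: "real n * (m n - m (Suc n)) \<le> 2 * C * m n" .
    have "e n = 1 / m (Suc n) + real n * (m n - m (Suc n)) / (m n * m (Suc n))"
      using False m[of n] m[of "Suc n"] by (simp add: e_def d_def field_simps)
    moreover have "real n * (m n - m (Suc n)) / (m n * m (Suc n)) \<le> 2 * C / m (Suc n)"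
    proof -
      have "real n * (m n - m (Suc n)) / (m n * m (Suc n)) \<le> (2 * C * m n) / (m n * m (Suc n))"
        using le m[of n] m[of "Suc n"] by (intro divide_right_mono) auto
      then show ?thesis
        using m[of n] by simp
    qed
    moreover have "0 \<le> real n * (m n - m (Suc n)) / (m n * m (Suc n))" "0 \<le> 1 / m (Suc n)"
      using d0 m[of n] m[of "Suc n"] by simp_all
    ultimately show ?thesis
      by (simp add: add_divide_distrib)
  qed
  \<comment> \<open>The factor 16/9 is the inverse of (3/4)^2, from (1 - y)^2 with y <= 1/4; the
    square of C accounts for two doublings from (1 - s) / 4 to 1 - s.\<close>
  define C3 where "C3 = (1 + 2 * C) * (16 / 9) * C\<^sup>2"
  have C3: "0 < C3"
    using C by (simp add: C3_def)
  have "circle_mean 1 dkernel s \<le> C3 / ((1 - s) * mass \<mu> (1 - s))" if s: "0 \<le> s" "s < 1" for s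
  proof -
    \<comment> \<open>By Bernoulli (1 - y)^4 >= s, so one of the two factors s^n compensates the
      decay of the squared moment and the other leaves a geometric series.\<close>
    define y where "y = (1 - s) / 4"
    have y: "0 < y" "y < 1" "y \<le> 1 / 4"
      using s by (auto simp: y_def)
    have mp: "0 < mass \<mu> y"
      by (rule R.mass_pos[OF y(1)])
    define A where "A = (1 + 2 * C) * (16 / 9) / mass \<mu> y"
    have A: "0 < A"
      using C mp by (simp add: A_def)
    have term_le: "(e n)\<^sup>2 * s ^ (2 * n) \<le> A\<^sup>2 * s ^ n" for n
    proof -
      have s4: "s \<le> (1 - y) ^ 4"
      proof -
        have "s = 1 + real 4 * (- y)"
          by (simp add: y_def field_simps)
        also have "\<dots> \<le> (1 + (- y)) ^ 4"
          using y by (intro Bernoulli_inequality) auto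
        finally show ?thesis
          by simp
      qed
      have "s ^ n * (9 / 16 * mass \<mu> y)\<^sup>2 \<le> ((1 - y) ^ 4) ^ n * ((1 - y)\<^sup>2 * mass \<mu> y)\<^sup>2"
      proof (intro mult_mono power_mono s4)
        have "(3 / 4)\<^sup>2 \<le> (1 - y)\<^sup>2"
          using y by (intro power_mono) auto
        then show "9 / 16 \<le> (1 - y)\<^sup>2"
          by (simp add: power2_eq_square)
      qed (use s mp in auto)
      also have "\<dots> = ((1 - y) ^ (2 * Suc n) * mass \<mu> y)\<^sup>2"
      proof -
        have "((1 - y) ^ 4) ^ n * ((1 - y)\<^sup>2 * mass \<mu> y)\<^sup>2 = ((1 - y) ^ (2 * n) * ((1 - y)\<^sup>2 * mass \<mu> y))\<^sup>2"
          by (simp add: power_mult_distrib power_mult[symmetric] mult_ac)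
        also have "(1 - y) ^ (2 * n) * ((1 - y)\<^sup>2 * mass \<mu> y) = (1 - y) ^ (2 * Suc n) * mass \<mu> y"
          by (simp add: power2_eq_square mult_ac)
        finally show ?thesis .
      qed
      also have "\<dots> \<le> (m (Suc n))\<^sup>2"
        using even_moment_ge_mass[OF y(1,2), of "Suc n"] mp y unfolding m_def by (intro power_mono) auto
      finally have l: "s ^ n * (9 / 16 * mass \<mu> y)\<^sup>2 \<le> (m (Suc n))\<^sup>2" .
      have "(e n)\<^sup>2 \<le> ((1 + 2 * C) / m (Suc n))\<^sup>2"
        using eb[of n] by (simp only: abs_le_square_iff[symmetric])
      then have "(e n)\<^sup>2 * (m (Suc n))\<^sup>2 \<le> (1 + 2 * C)\<^sup>2"
        using m[of "Suc n"] by (simp add: power_divide field_simps)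
      then have "(e n)\<^sup>2 * (s ^ n * (9 / 16 * mass \<mu> y)\<^sup>2) \<le> (1 + 2 * C)\<^sup>2"
        using mult_left_mono[OF l, of "(e n)\<^sup>2"] by simp
      then have "(e n)\<^sup>2 * s ^ n * (9 / 16 * mass \<mu> y)\<^sup>2 \<le> (1 + 2 * C)\<^sup>2"
        by (simp only: mult.assoc)
      moreover have "A\<^sup>2 = (1 + 2 * C)\<^sup>2 / (9 / 16 * mass \<mu> y)\<^sup>2"
        unfolding A_def power_divide[symmetric] by simp
      ultimately have "(e n)\<^sup>2 * s ^ n \<le> A\<^sup>2"
        using mp by (simp add: pos_le_divide_eq)
      then have "(e n)\<^sup>2 * s ^ n * s ^ n \<le> A\<^sup>2 * s ^ n"
        using s by (intro mult_right_mono) auto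
      then show ?thesis
        by (simp add: mult_2 power_add mult.assoc)
    qed
    have cF: "circle_mean 2 F s \<le> A\<^sup>2 * (1 / (1 - s))"
    proof (rule sums_le)
      show "(\<lambda>n. (e n)\<^sup>2 * s ^ (2 * n)) sums circle_mean 2 F s"
        using parseval[OF F s] unfolding tF norm_of_real by simp
      show "(\<lambda>n. A\<^sup>2 * s ^ n) sums (A\<^sup>2 * (1 / (1 - s)))"
        using s by (intro sums_mult geometric_sums) auto
    qed (rule term_le)
    have cG: "circle_mean 2 G s \<le> 1 / (1 - s)"
    proof (rule sums_le)
      show "(\<lambda>n. s ^ (2 * n)) sums circle_mean 2 G s"
        using parseval[OF G s] unfolding tG by simp
      show "(\<lambda>n. s ^ n) sums (1 / (1 - s))"
        using s by (intro geometric_sums) auto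
    qed (use s in \<open>auto intro!: power_decreasing\<close>)
    define B where "B = 1 / sqrt (1 - s)"
    have B: "0 < B" "B powr 2 = 1 / (1 - s)" "B * B = 1 / (1 - s)"
      using s by (auto simp: B_def powr_numeral power_divide)
    have mF: "(\<lambda>\<xi>. norm (F (of_real s * \<xi>))) \<in> borel_measurable circle"
      using s by (intro circle_measurableI continuous_on_norm continuous_on_circle_compose F) auto
    have mG: "(\<lambda>\<xi>. norm (G (of_real s * \<xi>))) \<in> borel_measurable circle"
      using s by (intro circle_measurableI continuous_on_norm continuous_on_circle_compose G) auto
    have "(\<integral>\<^sup>+\<xi>. ennreal (norm (F (of_real s * \<xi>)) * norm (G (of_real s * \<xi>))) \<partial>circle) \<le> ennreal ((A * B) * B)"
    proof (rule nn_holder[of 2 2, OF _ _ mF mG])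
      have "(\<integral>\<^sup>+\<xi>. ennreal (norm (F (of_real s * \<xi>)) powr 2) \<partial>circle) = ennreal (circle_mean 2 F s)"
        using s by (intro ennreal_circle_mean[symmetric] F) auto
      also have "\<dots> \<le> ennreal ((A * B) powr 2)"
        using cF A B by (intro ennreal_leI) (simp add: powr_mult powr_numeral)
      finally show "(\<integral>\<^sup>+\<xi>. ennreal (norm (F (of_real s * \<xi>)) powr 2) \<partial>circle) \<le> ennreal ((A * B) powr 2)" .
      have "(\<integral>\<^sup>+\<xi>. ennreal (norm (G (of_real s * \<xi>)) powr 2) \<partial>circle) = ennreal (circle_mean 2 G s)"
        using s by (intro ennreal_circle_mean[symmetric] G) auto
      also have "\<dots> \<le> ennreal (B powr 2)"
        using cG B by (intro ennreal_leI) simp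
      finally show "(\<integral>\<^sup>+\<xi>. ennreal (norm (G (of_real s * \<xi>)) powr 2) \<partial>circle) \<le> ennreal (B powr 2)" .
    qed (use A B in auto)
    also have "(\<integral>\<^sup>+\<xi>. ennreal (norm (F (of_real s * \<xi>)) * norm (G (of_real s * \<xi>))) \<partial>circle) =
        (\<integral>\<^sup>+\<xi>. ennreal (norm (dkernel (of_real s * \<xi>)) powr 1) \<partial>circle)"
    proof (rule nn_integral_cong)
      fix \<xi> assume "\<xi> \<in> space circle"
      then have "norm (of_real s * \<xi>) < 1"
        using s by (simp add: norm_mult)
      then have "1 - of_real s * \<xi> \<noteq> 0"
        by auto
      moreover have "F (of_real s * \<xi>) = (1 - of_real s * \<xi>) * dkernel (of_real s * \<xi>)"
        by (simp add: F_def algebra_simps)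
      ultimately have "F (of_real s * \<xi>) * G (of_real s * \<xi>) = dkernel (of_real s * \<xi>)"
        by (simp add: G_def)
      then have "norm (F (of_real s * \<xi>)) * norm (G (of_real s * \<xi>)) = norm (dkernel (of_real s * \<xi>))"
        by (simp only: norm_mult[symmetric])
      then show "ennreal (norm (F (of_real s * \<xi>)) * norm (G (of_real s * \<xi>))) = ennreal (norm (dkernel (of_real s * \<xi>)) powr 1)"
        by simp
    qed
    also have "\<dots> = ennreal (circle_mean 1 dkernel s)"
      using s by (intro ennreal_circle_mean[symmetric] dkernel_holomorphic) auto
    finally have "circle_mean 1 dkernel s \<le> (A * B) * B"
      using A B by (subst (asm) ennreal_le_iff) auto
    also have "\<dots> = A / (1 - s)"
      using B(3) by (simp add: mult.assoc)
    also have "\<dots> \<le> C3 / ((1 - s) * mass \<mu> (1 - s))"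
    proof -
      have M1: "0 < mass \<mu> (1 - s)"
        using s by (intro R.mass_pos) simp
      have "mass \<mu> (1 - s) \<le> C\<^sup>2 * mass \<mu> ((1 - s) / 2\<^sup>2)"
        using s by (intro R.mass_doubling_power C) auto
      also have "(1 - s) / 2\<^sup>2 = y"
        by (simp add: y_def)
      finally have "A * mass \<mu> (1 - s) \<le> A * (C\<^sup>2 * mass \<mu> y)"
        using A by (intro mult_left_mono) auto
      also have "\<dots> = C3"
        using mp by (simp add: A_def C3_def)
      finally have "A \<le> C3 / mass \<mu> (1 - s)"
        using M1 by (simp add: pos_le_divide_eq)
      then have "A / (1 - s) \<le> C3 / mass \<mu> (1 - s) / (1 - s)"
        using s by (intro divide_right_mono) auto
      then show ?thesis
        by (simp add: mult.commute)
    qed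
    finally show ?thesis .
  qed
  then show ?thesis
    using C3 by blast
qed

end

section \<open>Schur test for the derivative of the projection\<close>

context weight
begin

lemma kernel_polar:
  assumes [measurable]: "g \<in> borel_measurable borel" and g: "\<And>r. 0 \<le> r \<Longrightarrow> r < 1 \<Longrightarrow> 0 \<le> g r" and w: "norm w < 1"
  shows "(\<integral>\<^sup>+\<zeta>. ennreal (g (norm \<zeta>) * norm (dkernel (w * \<zeta>))) \<partial>W) =
    (\<integral>\<^sup>+r. ennreal (g r * circle_mean 1 dkernel (norm w * r)) \<partial>\<mu>)"
proof -
  define D where "D z = indicator disc z *\<^sub>R dkernel z" for z
  have D[measurable]: "D \<in> borel_measurable borel"
    unfolding D_def by (rule holomorphic_borel[OF dkernel_holomorphic])
  have wz: "norm (w * \<zeta>) < 1" if "norm \<zeta> < 1" for \<zeta>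
    using w that mult_strict_mono[of "norm w" 1 "norm \<zeta>" 1] by (simp add: norm_mult)
  have Dw: "D (w * \<zeta>) = dkernel (w * \<zeta>)" if "norm \<zeta> < 1" for \<zeta>
    using wz[OF that] by (simp add: D_def)
  have "(\<integral>\<^sup>+\<zeta>. ennreal (g (norm \<zeta>) * norm (dkernel (w * \<zeta>))) \<partial>W) =
      (\<integral>\<^sup>+\<zeta>. ennreal (g (norm \<zeta>)) * ennreal (norm (D (w * \<zeta>))) \<partial>W)"
    by (rule nn_integral_cong) (simp add: g Dw ennreal_mult)
  also have "\<dots> = (\<integral>\<^sup>+r. \<integral>\<^sup>+\<xi>. ennreal (g (norm (of_real r * \<xi>))) * ennreal (norm (D (w * (of_real r * \<xi>)))) \<partial>circle \<partial>\<mu>)"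
    by (rule polar(1)) measurable
  also have "\<dots> = (\<integral>\<^sup>+r. ennreal (g r * circle_mean 1 dkernel (norm w * r)) \<partial>\<mu>)"
  proof (rule nn_integral_cong)
    fix r assume "r \<in> space \<mu>"
    then have r: "0 \<le> r" "r < 1"
      by auto
    have wr: "norm (w * of_real r) < 1"
      using wz[of "of_real r"] r by simp
    have "(\<integral>\<^sup>+\<xi>. ennreal (g (norm (of_real r * \<xi>))) * ennreal (norm (D (w * (of_real r * \<xi>)))) \<partial>circle) =
        (\<integral>\<^sup>+\<xi>. ennreal (g r) * ennreal (norm (dkernel ((w * of_real r) * \<xi>)) powr 1) \<partial>circle)"
      by (rule nn_integral_cong) (use r in \<open>auto simp: norm_mult Dw mult.assoc\<close>)
    also have "\<dots> = ennreal (g r) * (\<integral>\<^sup>+\<xi>. ennreal (norm (dkernel ((w * of_real r) * \<xi>)) powr 1) \<partial>circle)"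
    proof (rule nn_integral_cmult)
      have "(\<lambda>\<xi>. norm (dkernel ((w * of_real r) * \<xi>)) powr 1) \<in> borel_measurable circle"
        using wr by (intro circle_measurableI continuous_on_norm_powr continuous_on_circle_compose dkernel_holomorphic) auto
      then show "(\<lambda>\<xi>. ennreal (norm (dkernel ((w * of_real r) * \<xi>)) powr 1)) \<in> borel_measurable circle"
        by simp
    qed
    also have "(\<integral>\<^sup>+\<xi>. ennreal (norm (dkernel ((w * of_real r) * \<xi>)) powr 1) \<partial>circle) =
        ennreal (LINT \<xi>|circle. norm (dkernel ((w * of_real r) * \<xi>)) powr 1)"
      using wr by (intro nn_integral_eq_integral circle_integrable_continuous continuous_on_norm_powr
          continuous_on_circle_compose dkernel_holomorphic) auto
    also have "(LINT \<xi>|circle. norm (dkernel ((w * of_real r) * \<xi>)) powr 1) = circle_mean 1 dkernel (norm (w * of_real r))"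
      by (rule circle_mean_rotate[OF dkernel_holomorphic wr]) simp
    also have "norm (w * of_real r) = norm w * r"
      using r by (simp add: norm_mult)
    finally show "(\<integral>\<^sup>+\<xi>. ennreal (g (norm (of_real r * \<xi>))) * ennreal (norm (D (w * (of_real r * \<xi>)))) \<partial>circle) =
        ennreal (g r * circle_mean 1 dkernel (norm w * r))"
      using g r by (simp add: ennreal_mult)
  qed
  finally show ?thesis .
qed

text \<open>Since \<rho> r lies below both radii, 1 - \<rho> r exceeds both 1 - \<rho> and 1 - r,
  and the mass at 1 - \<rho> r exceeds both values of \<open>outer\<close>. The mean bound for the
  kernel then becomes a constant over the larger of the two values, whose integral against
  \<open>outer\<close> to the power -a is known. The two inequalities differ in which radius takes
  the factor 1 - r.\<close>

lemma schur_bounds: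
  assumes D: "doubling \<mu>" and a: "0 < a" "a < 1"
  shows "\<exists>C>0. \<forall>w. norm w < 1 \<longrightarrow>
    (\<integral>\<^sup>+\<zeta>. ennreal (R.outer (norm \<zeta>) powr (- a) * norm (dkernel (w * \<zeta>))) \<partial>W) \<le>
      ennreal (C * R.outer (norm w) powr (- a) / (1 - norm w)) \<and>
    (\<integral>\<^sup>+\<zeta>. ennreal ((1 - norm \<zeta>) * R.outer (norm \<zeta>) powr (- a) * norm (dkernel (w * \<zeta>))) \<partial>W) \<le>
      ennreal (C * R.outer (norm w) powr (- a))"
proof -
  obtain C1 where C1: "0 < C1" "\<And>s. 0 \<le> s \<Longrightarrow> s < 1 \<Longrightarrow> circle_mean 1 dkernel s \<le> C1 / ((1 - s) * mass \<mu> (1 - s))"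
    using circle_mean_dkernel[OF D] by blast
  obtain C2 where C2: "0 \<le> C2" "\<And>\<rho>. \<rho> < 1 \<Longrightarrow>
      (\<integral>\<^sup>+r. ennreal (R.outer r powr (- a) / max (R.outer \<rho>) (R.outer r)) \<partial>\<mu>) \<le> ennreal (C2 * R.outer \<rho> powr (- a))"
    using R.nn_integral_outer_powr[OF a] by blast
  have [measurable]: "R.outer \<in> borel_measurable borel"
    by (rule R.outer_measurable)
  have point: "(1 - x) * circle_mean 1 dkernel (\<rho> * r) \<le> C1 / max (R.outer \<rho>) (R.outer r)"
    if \<rho>: "0 \<le> \<rho>" "\<rho> < 1" and r: "0 \<le> r" "r < 1" and x: "x = \<rho> \<or> x = r" for \<rho> r x
  proof -
    have le: "\<rho> * r \<le> \<rho>" "\<rho> * r \<le> r"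
      using \<rho> r by (auto intro: mult_left_le mult_left_le_one_le)
    have lt: "\<rho> * r < 1" "0 \<le> \<rho> * r"
      using le \<rho> r by auto
    have M: "max (R.outer \<rho>) (R.outer r) \<le> mass \<mu> (1 - \<rho> * r)"
      unfolding R.outer_def using le by (auto intro!: R.mass_mono)
    have M0: "0 < max (R.outer \<rho>) (R.outer r)"
      using R.outer_pos[OF \<rho>(2)] by simp
    have x1: "0 \<le> 1 - x" "1 - x \<le> 1 - \<rho> * r"
      using x le \<rho> r by auto
    have "(1 - x) * circle_mean 1 dkernel (\<rho> * r) \<le> (1 - \<rho> * r) * (C1 / ((1 - \<rho> * r) * mass \<mu> (1 - \<rho> * r)))"
      using x1 lt by (intro mult_mono C1) auto
    also have "\<dots> = C1 / mass \<mu> (1 - \<rho> * r)"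
      using lt by simp
    also have "\<dots> \<le> C1 / max (R.outer \<rho>) (R.outer r)"
      using M M0 C1 by (intro divide_left_mono mult_pos_pos) auto
    finally show ?thesis .
  qed
  define C where "C = C1 * (C2 + 1)"
  have C: "0 < C" "C1 * C2 \<le> C"
    using C1 C2 by (auto simp: C_def)
  \<comment> \<open>Used with g = 1 and c = 1 / (1 - |w|), and with g r = 1 - r and c = 1.\<close>
  have main: "(\<integral>\<^sup>+\<zeta>. ennreal (g (norm \<zeta>) * R.outer (norm \<zeta>) powr (- a) * norm (dkernel (w * \<zeta>))) \<partial>W) \<le>
      ennreal (c * (C * R.outer (norm w) powr (- a)))"
    if w: "norm w < 1" and g[measurable]: "g \<in> borel_measurable borel"
      and g0: "\<And>r. r < 1 \<Longrightarrow> 0 \<le> g r" and c: "0 \<le> c"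
      and le: "\<And>r. 0 \<le> r \<Longrightarrow> r < 1 \<Longrightarrow>
        g r * circle_mean 1 dkernel (norm w * r) \<le> c * (C1 / max (R.outer (norm w)) (R.outer r))" for w g c
  proof -
    let ?h = "\<lambda>r. R.outer r powr (- a) / max (R.outer (norm w)) (R.outer r)"
    have "(\<integral>\<^sup>+\<zeta>. ennreal (g (norm \<zeta>) * R.outer (norm \<zeta>) powr (- a) * norm (dkernel (w * \<zeta>))) \<partial>W) =
        (\<integral>\<^sup>+r. ennreal (g r * R.outer r powr (- a) * circle_mean 1 dkernel (norm w * r)) \<partial>\<mu>)"
      by (rule kernel_polar[where g = "\<lambda>r. g r * R.outer r powr (- a)", OF _ _ w]) (auto simp: g0)
    also have "\<dots> \<le> (\<integral>\<^sup>+r. ennreal (c * C1) * ennreal (?h r) \<partial>\<mu>)"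
    proof (rule nn_integral_mono)
      fix r assume "r \<in> space \<mu>"
      then have r: "0 \<le> r" "r < 1"
        by auto
      have "R.outer r powr (- a) * (g r * circle_mean 1 dkernel (norm w * r)) \<le>
          R.outer r powr (- a) * (c * (C1 / max (R.outer (norm w)) (R.outer r)))"
        by (intro mult_left_mono le r) simp
      then have "ennreal (g r * R.outer r powr (- a) * circle_mean 1 dkernel (norm w * r)) \<le> ennreal (c * C1 * ?h r)"
        by (intro ennreal_leI) (simp add: mult_ac)
      also have "\<dots> = ennreal (c * C1) * ennreal (?h r)"
        using C1 c R.outer_pos[OF w] by (intro ennreal_mult) (auto simp: le_max_iff_disj)
      finally show "ennreal (g r * R.outer r powr (- a) * circle_mean 1 dkernel (norm w * r)) \<le> ennreal (c * C1) * ennreal (?h r)" .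
    qed
    also have "\<dots> = ennreal (c * C1) * (\<integral>\<^sup>+r. ennreal (?h r) \<partial>\<mu>)"
      by (rule nn_integral_cmult) (rule borel_measurable_\<mu>, measurable)
    also have "\<dots> \<le> ennreal (c * C1) * ennreal (C2 * R.outer (norm w) powr (- a))"
      by (intro mult_left_mono C2 w) simp
    also have "\<dots> = ennreal (c * (C1 * C2 * R.outer (norm w) powr (- a)))"
      using c C1 C2 by (simp add: ennreal_mult[symmetric] mult.assoc)
    also have "\<dots> \<le> ennreal (c * (C * R.outer (norm w) powr (- a)))"
      using C c by (intro ennreal_leI mult_left_mono mult_right_mono) auto
    finally show ?thesis .
  qed
  show ?thesis
  proof (intro exI[of _ C] conjI allI impI)
    fix w :: complex assume w: "norm w < 1"
    have "(\<integral>\<^sup>+\<zeta>. ennreal (1 * R.outer (norm \<zeta>) powr (- a) * norm (dkernel (w * \<zeta>))) \<partial>W) \<le>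
        ennreal (1 / (1 - norm w) * (C * R.outer (norm w) powr (- a)))"
    proof (rule main[OF w])
      fix r :: real assume r: "0 \<le> r" "r < 1"
      show "1 * circle_mean 1 dkernel (norm w * r) \<le> 1 / (1 - norm w) * (C1 / max (R.outer (norm w)) (R.outer r))"
      proof -
        have "circle_mean 1 dkernel (norm w * r) * (1 - norm w) \<le> C1 / max (R.outer (norm w)) (R.outer r)"
          using point[OF _ w r, of "norm w"] by (simp add: mult.commute)
        then have "circle_mean 1 dkernel (norm w * r) \<le> C1 / max (R.outer (norm w)) (R.outer r) / (1 - norm w)"
          using w by (subst pos_le_divide_eq) auto
        then show ?thesis
          by (simp add: mult.commute)
      qed
    qed (use w in auto)
    then show "(\<integral>\<^sup>+\<zeta>. ennreal (R.outer (norm \<zeta>) powr (- a) * norm (dkernel (w * \<zeta>))) \<partial>W) \<le>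
        ennreal (C * R.outer (norm w) powr (- a) / (1 - norm w))"
      by simp
    have "(\<integral>\<^sup>+\<zeta>. ennreal ((1 - norm \<zeta>) * R.outer (norm \<zeta>) powr (- a) * norm (dkernel (w * \<zeta>))) \<partial>W) \<le>
        ennreal (1 * (C * R.outer (norm w) powr (- a)))"
      by (rule main[OF w]) (use point[OF _ w] in auto)
    then show "(\<integral>\<^sup>+\<zeta>. ennreal ((1 - norm \<zeta>) * R.outer (norm \<zeta>) powr (- a) * norm (dkernel (w * \<zeta>))) \<partial>W) \<le>
        ennreal (C * R.outer (norm w) powr (- a))"
      by simp
  qed (rule C(1))
qed

text \<open>The Hoelder half of Schur's test: the kernel is divided between f and the test function
  with exponents 1/p and 1/p', and the factor without f is bounded by the first Schur
  inequality.\<close>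

lemma deriv_projection_powr_le:
  assumes pp: "1 < p" "1 / p + 1 / p' = 1" and f: "f \<in> Lp \<omega> p" and z: "norm z < 1" and C: "0 < C"
    and A: "(\<integral>\<^sup>+\<zeta>. ennreal (R.outer (norm \<zeta>) powr (- (1 / p)) * norm (dkernel (cnj z * \<zeta>))) \<partial>W) \<le>
      ennreal (C * R.outer (norm z) powr (- (1 / p)) / (1 - norm z))"
  shows "ennreal ((1 - norm z) powr p * norm (deriv (projection \<omega> f) z) powr p) \<le>
    ennreal (C powr (p - 1) * ((1 - norm z) * R.outer (norm z) powr (- (1 / p')))) *
    (\<integral>\<^sup>+\<zeta>. ennreal (norm (f \<zeta>) powr p * R.outer (norm \<zeta>) powr (1 / p') * norm (dkernel (cnj z * \<zeta>))) \<partial>W)"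
proof -
  have p': "1 < p'"
    by (rule conjugate_gt_1[OF pp])
  \<comment> \<open>With this exponent the p-th power of the test function is \<open>outer\<close>
    to the power 1/p' and the p'-th power of its inverse is \<open>outer\<close> to the power
    -1/p.\<close>
  define c where "c = 1 / (p * p')"
  have cp: "c * p = 1 / p'" "c * p' = 1 / p"
    using pp p' by (auto simp: c_def)
  have pq: "p / p' = p - 1" "1 / p * (p - 1) = 1 / p'"
  proof -
    have "1 / p' = 1 - 1 / p"
      using pp by simp
    then have "p * (1 / p') = p * (1 - 1 / p)"
      by (simp only:)
    then show "p / p' = p - 1"
      using pp by (simp add: right_diff_distrib)
    show "1 / p * (p - 1) = 1 / p'"
      using pp \<open>1 / p' = 1 - 1 / p\<close> by (simp add: field_simps)
  qed
  define H where "H = R.outer"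
  have H: "0 < H r" if "r < 1" for r
    unfolding H_def by (rule R.outer_pos[OF that])
  have [measurable]: "H \<in> borel_measurable borel"
    unfolding H_def by (rule R.outer_measurable)
  let ?k = "\<lambda>\<zeta>. norm (dkernel (cnj z * \<zeta>))"
  let ?I = "\<integral>\<^sup>+\<zeta>. ennreal (norm (f \<zeta>) powr p * H (norm \<zeta>) powr (1 / p') * ?k \<zeta>) \<partial>W"
  let ?q = "C powr (p - 1) * ((1 - norm z) * H (norm z) powr (- (1 / p')))"
  let ?x = "norm (deriv (projection \<omega> f) z)"
  have q: "0 < ?q"
    using C z H[OF z] by simp
  have "ennreal ((1 - norm z) powr p * ?x powr p) \<le> ennreal ?q * ?I"
  proof (cases "?I = \<top>")
    case True
    have "ennreal ?q \<noteq> 0"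
      using q by (simp only: ennreal_eq_0_iff not_le)
    then have "ennreal ?q * \<top> = \<top>"
      by (intro ennreal_mult_eq_top_iff[THEN iffD2] disjI2 conjI refl)
    then show ?thesis
      unfolding True by (simp only: top_greatest)
  next
    case False
    define i where "i = enn2real ?I"
    have i: "?I = ennreal i" "0 \<le> i"
      using False by (auto simp: i_def less_top)
    define T where "T = C * H (norm z) powr (- (1 / p)) / (1 - norm z)"
    have T: "0 < T"
      using C z H[OF z] by (simp add: T_def)
    define f1 where "f1 \<zeta> = norm (f \<zeta>) * H (norm \<zeta>) powr c * ?k \<zeta> powr (1 / p)" for \<zeta>
    define g1 where "g1 \<zeta> = H (norm \<zeta>) powr (- c) * ?k \<zeta> powr (1 / p')" for \<zeta>
    have fm: "f \<in> borel_measurable W"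
      using f by (simp add: Lp_iff measurable_W)
    have km: "(\<lambda>\<zeta>. dkernel (cnj z * \<zeta>)) \<in> borel_measurable W"
    proof -
      have "(\<lambda>\<zeta>. dkernel (cnj z * \<zeta>)) holomorphic_on disc"
      proof -
        have "(\<lambda>\<zeta>. cnj z * \<zeta>) ` disc \<subseteq> disc"
          using z by (auto simp: norm_mult intro!: mult_strict_mono[of "norm z" 1 _ 1, simplified])
        then show ?thesis
          using holomorphic_on_compose_gen[of "\<lambda>\<zeta>. cnj z * \<zeta>" disc dkernel disc] dkernel_holomorphic
          by (auto simp: o_def intro!: holomorphic_intros)
      qed
      then show ?thesis
        unfolding measurable_W by (rule holomorphic_measurable)
    qed
    have On: "(\<lambda>\<zeta>. H (norm \<zeta>)) \<in> borel_measurable W"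
      by (rule borel_measurable_W) measurable
    note [measurable] = fm km On
    have mf1: "f1 \<in> borel_measurable W" and mg1: "g1 \<in> borel_measurable W"
      unfolding f1_def g1_def by measurable
    have "(\<integral>\<^sup>+\<zeta>. ennreal (f1 \<zeta> * g1 \<zeta>) \<partial>W) \<le> ennreal (i powr (1 / p) * T powr (1 / p'))"
    proof (rule nn_holder[OF pp mf1 mg1])
      have "(\<integral>\<^sup>+\<zeta>. ennreal (f1 \<zeta> powr p) \<partial>W) = ?I"
        by (rule nn_integral_cong) (use pp in \<open>simp add: f1_def powr_mult powr_powr cp\<close>)
      then show "(\<integral>\<^sup>+\<zeta>. ennreal (f1 \<zeta> powr p) \<partial>W) \<le> ennreal ((i powr (1 / p)) powr p)"
        using i pp by (simp add: powr_powr)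
      have "(\<integral>\<^sup>+\<zeta>. ennreal (g1 \<zeta> powr p') \<partial>W) = (\<integral>\<^sup>+\<zeta>. ennreal (H (norm \<zeta>) powr (- (1 / p)) * ?k \<zeta>) \<partial>W)"
        by (rule nn_integral_cong) (use p' in \<open>simp add: g1_def powr_mult powr_powr cp\<close>)
      also have "\<dots> \<le> ennreal T"
        using A unfolding T_def H_def .
      finally show "(\<integral>\<^sup>+\<zeta>. ennreal (g1 \<zeta> powr p') \<partial>W) \<le> ennreal ((T powr (1 / p')) powr p')"
        using T p' by (simp add: powr_powr)
    qed (auto simp: f1_def g1_def)
    also have "(\<integral>\<^sup>+\<zeta>. ennreal (f1 \<zeta> * g1 \<zeta>) \<partial>W) = (\<integral>\<^sup>+\<zeta>. ennreal (norm (f \<zeta>) * ?k \<zeta>) \<partial>W)"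
    proof (rule nn_integral_cong)
      fix \<zeta> assume "\<zeta> \<in> space W"
      then have "0 < H (norm \<zeta>)"
        by (intro H) simp
      then have 1: "H (norm \<zeta>) powr c * H (norm \<zeta>) powr (- c) = 1"
        by (simp add: powr_add[symmetric])
      have 2: "?k \<zeta> powr (1 / p) * ?k \<zeta> powr (1 / p') = ?k \<zeta>"
        unfolding powr_add[symmetric] pp(2) by simp
      have "f1 \<zeta> * g1 \<zeta> = norm (f \<zeta>) * (H (norm \<zeta>) powr c * H (norm \<zeta>) powr (- c)) * (?k \<zeta> powr (1 / p) * ?k \<zeta> powr (1 / p'))"
        unfolding f1_def g1_def by (simp only: mult_ac)
      then show "ennreal (f1 \<zeta> * g1 \<zeta>) = ennreal (norm (f \<zeta>) * ?k \<zeta>)"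
        unfolding 1 2 by simp
    qed
    finally have "(\<integral>\<^sup>+\<zeta>. ennreal (norm (f \<zeta>) * ?k \<zeta>) \<partial>W) \<le> ennreal (i powr (1 / p) * T powr (1 / p'))" .
    moreover have "ennreal ?x \<le> (\<integral>\<^sup>+\<zeta>. ennreal (norm (f \<zeta>) * ?k \<zeta>) \<partial>W)"
      using f pp z by (intro deriv_projection_le Lp_integrable) auto
    ultimately have "ennreal ?x \<le> ennreal (i powr (1 / p) * T powr (1 / p'))"
      by (rule order_trans[rotated])
    then have "?x \<le> i powr (1 / p) * T powr (1 / p')"
      by (subst (asm) ennreal_le_iff) auto
    then have "?x powr p \<le> (i powr (1 / p) * T powr (1 / p')) powr p"
      using pp by (intro powr_mono2) auto
    also have "\<dots> = i * T powr (p - 1)"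
      using i T pp pq by (simp add: powr_mult powr_powr)
    also have "T powr (p - 1) = C powr (p - 1) * H (norm z) powr (- (1 / p')) / (1 - norm z) powr (p - 1)"
    proof -
      have "- (1 / p) * (p - 1) = - (1 / p')"
        using pq(2) by simp
      then show ?thesis
        unfolding T_def by (simp add: powr_mult powr_divide powr_powr)
    qed
    finally have "(1 - norm z) powr p * ?x powr p \<le>
        (1 - norm z) powr p * (i * (C powr (p - 1) * H (norm z) powr (- (1 / p')) / (1 - norm z) powr (p - 1)))"
      by (rule mult_left_mono) simp
    \<comment> \<open>The first Schur inequality costs (1 - |z|)^(1-p); against (1 - |z|)^p one
      power survives, and it is the factor in the second Schur inequality.\<close>
    also have "\<dots> = ?q * i"
    proof -
      have "(1 - norm z) powr p / (1 - norm z) powr (p - 1) = 1 - norm z"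
        using z by (simp add: powr_diff[symmetric])
      then have "(1 - norm z) powr p = (1 - norm z) * (1 - norm z) powr (p - 1)"
        using z by (simp add: divide_eq_eq)
      then show ?thesis
        using z by simp
    qed
    finally have "ennreal ((1 - norm z) powr p * ?x powr p) \<le> ennreal (?q * i)"
      by (rule ennreal_leI)
    then show ?thesis
      unfolding i(1) using q i(2) by (simp add: ennreal_mult)
  qed
  then show ?thesis
    by (simp add: H_def)
qed

text \<open>The Fubini half of Schur's test: after exchanging the integrals, the second Schur
  inequality in the variable z cancels the power of \<open>outer\<close> left by Hoelder.\<close>

lemma mean_integral_deriv_projection_le:
  assumes D: "doubling \<mu>" and pp: "1 < p" "1 / p + 1 / p' = 1"
  shows "\<exists>C\<ge>0. \<forall>f. f \<in> Lp \<omega> p \<longrightarrow>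
    mean_integral (shifted \<mu> p) p (deriv (projection \<omega> f)) \<le> ennreal (C * Lp_norm \<omega> p f powr p)"
proof -
  have p': "1 < p'"
    by (rule conjugate_gt_1[OF pp])
  have a1: "0 < 1 / p" "1 / p < 1" and a2: "0 < 1 / p'" "1 / p' < 1"
    using pp p' by auto
  obtain C1 where C1: "0 < C1" "\<And>w. norm w < 1 \<Longrightarrow>
      (\<integral>\<^sup>+\<zeta>. ennreal (R.outer (norm \<zeta>) powr (- (1 / p)) * norm (dkernel (w * \<zeta>))) \<partial>W) \<le>
      ennreal (C1 * R.outer (norm w) powr (- (1 / p)) / (1 - norm w))"
    using schur_bounds[OF D a1] by blast
  obtain C2 where C2: "0 < C2" "\<And>w. norm w < 1 \<Longrightarrow>
      (\<integral>\<^sup>+\<zeta>. ennreal ((1 - norm \<zeta>) * R.outer (norm \<zeta>) powr (- (1 / p')) * norm (dkernel (w * \<zeta>))) \<partial>W) \<le>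
      ennreal (C2 * R.outer (norm w) powr (- (1 / p')))"
    using schur_bounds[OF D a2] by blast
  interpret W: finite_measure W
    by (rule finite_measure_W)
  interpret PW: pair_sigma_finite W W ..
  have [measurable]: "R.outer \<in> borel_measurable borel"
    by (rule R.outer_measurable)
  \<comment> \<open>Extension by zero makes the kernel Borel on the whole plane, which gives joint
    measurability in both variables.\<close>
  define K where "K z = indicator disc z *\<^sub>R dkernel z" for z
  have [measurable]: "K \<in> borel_measurable borel"
    unfolding K_def by (rule holomorphic_borel[OF dkernel_holomorphic])
  have [measurable]: "cnj \<in> borel_measurable borel"
    by (intro borel_measurable_continuous_onI continuous_intros)
  have idW: "(\<lambda>z. z) \<in> W \<rightarrow>\<^sub>M borel"
    by (rule borel_measurable_W) simp
  have mult_lt: "norm (cnj z * \<zeta>) < 1" if "norm z < 1" "norm \<zeta> < 1" for z \<zeta>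
    using that mult_strict_mono[of "norm z" 1 "norm \<zeta>" 1] by (simp add: norm_mult)
  define c0 where "c0 = C1 powr (p - 1)"
  have c0: "0 \<le> c0"
    by (simp add: c0_def)
  have "mean_integral (shifted \<mu> p) p (deriv (projection \<omega> f)) \<le> ennreal (c0 * C2 * Lp_norm \<omega> p f powr p)"
    if f: "f \<in> Lp \<omega> p" for f
  proof -
    let ?a = "\<lambda>\<zeta>. ennreal (c0 * (norm (f \<zeta>) powr p * R.outer (norm \<zeta>) powr (1 / p')))"
    let ?b = "\<lambda>\<zeta> z. ennreal ((1 - norm z) * R.outer (norm z) powr (- (1 / p')) * norm (K (cnj z * \<zeta>)))"
    have i: "integrable W f"
      using f pp by (intro Lp_integrable) auto
    have dP: "deriv (projection \<omega> f) holomorphic_on disc"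
      using projection_holomorphic[OF i] by (rule holomorphic_deriv) simp
    have fm: "f \<in> borel_measurable W"
      using f by (simp add: Lp_iff measurable_W)
    interpret S: weight "shifted_weight \<omega> p"
      by (rule weight_shifted) (use pp in simp)
    have "mean_integral (shifted \<mu> p) p (deriv (projection \<omega> f)) =
        (\<integral>\<^sup>+z. ennreal (norm (deriv (projection \<omega> f) z) powr p) \<partial>disc_measure (shifted_weight \<omega> p))"
      using S.nn_integral_holomorphic[OF dP, of p] pp by (simp add: radial_measure_shifted)
    also have "\<dots> = (\<integral>\<^sup>+z. ennreal ((1 - norm z) powr p) * ennreal (norm (deriv (projection \<omega> f) z) powr p) \<partial>W)"
      unfolding disc_measure_shifted
    proof (rule nn_integral_density)
      show "(\<lambda>z. ennreal ((1 - norm z) powr p)) \<in> borel_measurable W"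
        by (rule borel_measurable_W) measurable
      have [measurable]: "deriv (projection \<omega> f) \<in> borel_measurable W"
        unfolding measurable_W by (rule holomorphic_measurable[OF dP])
      show "(\<lambda>z. ennreal (norm (deriv (projection \<omega> f) z) powr p)) \<in> borel_measurable W"
        by measurable
    qed
    also have "\<dots> \<le> (\<integral>\<^sup>+z. (\<integral>\<^sup>+\<zeta>. ?a \<zeta> * ?b \<zeta> z \<partial>W) \<partial>W)"
    proof (rule nn_integral_mono)
      fix z assume "z \<in> space W"
      then have z: "norm z < 1"
        by simp
      define q where "q = (1 - norm z) * R.outer (norm z) powr (- (1 / p'))"
      have q: "0 \<le> q"
        using z by (simp add: q_def)
      have mI: "(\<lambda>\<zeta>. ennreal (norm (f \<zeta>) powr p * R.outer (norm \<zeta>) powr (1 / p') * norm (K (cnj z * \<zeta>)))) \<in> borel_measurable W"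
      proof -
        have [measurable]: "f \<in> borel_measurable W" "(\<lambda>\<zeta>. R.outer (norm \<zeta>)) \<in> borel_measurable W" "(\<lambda>\<zeta>. K (cnj z * \<zeta>)) \<in> borel_measurable W"
          by (rule fm) (rule borel_measurable_W, measurable)+
        show ?thesis
          by measurable
      qed
      have "ennreal ((1 - norm z) powr p) * ennreal (norm (deriv (projection \<omega> f) z) powr p) =
          ennreal ((1 - norm z) powr p * norm (deriv (projection \<omega> f) z) powr p)"
        by (simp add: ennreal_mult)
      also have "\<dots> \<le> ennreal (c0 * q) *
          (\<integral>\<^sup>+\<zeta>. ennreal (norm (f \<zeta>) powr p * R.outer (norm \<zeta>) powr (1 / p') * norm (dkernel (cnj z * \<zeta>))) \<partial>W)"
        unfolding c0_def q_def using C1(2)[of "cnj z"] z by (intro deriv_projection_powr_le[OF pp f z C1(1)]) simp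
      also have "(\<integral>\<^sup>+\<zeta>. ennreal (norm (f \<zeta>) powr p * R.outer (norm \<zeta>) powr (1 / p') * norm (dkernel (cnj z * \<zeta>))) \<partial>W) =
          (\<integral>\<^sup>+\<zeta>. ennreal (norm (f \<zeta>) powr p * R.outer (norm \<zeta>) powr (1 / p') * norm (K (cnj z * \<zeta>))) \<partial>W)"
        by (rule nn_integral_cong) (use mult_lt[OF z] in \<open>simp add: K_def\<close>)
      also have "ennreal (c0 * q) * \<dots> = (\<integral>\<^sup>+\<zeta>. ennreal (c0 * q) * ennreal (norm (f \<zeta>) powr p * R.outer (norm \<zeta>) powr (1 / p') * norm (K (cnj z * \<zeta>))) \<partial>W)"
        by (rule nn_integral_cmult[OF mI, symmetric])
      also have "\<dots> = (\<integral>\<^sup>+\<zeta>. ?a \<zeta> *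
        ennreal (q * norm (K (cnj z * \<zeta>))) \<partial>W)"
      proof (rule nn_integral_cong)
        fix \<zeta>
        show "ennreal (c0 * q) * ennreal (norm (f \<zeta>) powr p * R.outer (norm \<zeta>) powr (1 / p') * norm (K (cnj z * \<zeta>))) =
          ?a \<zeta> * ennreal (q * norm (K (cnj z * \<zeta>)))"
          using c0 q by (simp add: ennreal_mult[symmetric] mult_ac)
      qed
      finally show "ennreal ((1 - norm z) powr p) * ennreal (norm (deriv (projection \<omega> f) z) powr p) \<le>
          (\<integral>\<^sup>+\<zeta>. ?a \<zeta> * ?b \<zeta> z \<partial>W)"
        unfolding q_def .
    qed
    also have "\<dots> = (\<integral>\<^sup>+\<zeta>. (\<integral>\<^sup>+z. ?a \<zeta> * ?b \<zeta> z \<partial>W) \<partial>W)"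
    proof (rule PW.Fubini')
      have [measurable]: "(\<lambda>x. f (fst x)) \<in> borel_measurable (W \<Otimes>\<^sub>M W)"
        "fst \<in> W \<Otimes>\<^sub>M W \<rightarrow>\<^sub>M borel" "snd \<in> W \<Otimes>\<^sub>M W \<rightarrow>\<^sub>M borel"
        by (rule measurable_compose[OF measurable_fst fm], rule measurable_compose[OF measurable_fst idW], rule measurable_compose[OF measurable_snd idW])
      show "(\<lambda>(\<zeta>, z). ?a \<zeta> * ?b \<zeta> z) \<in> borel_measurable (W \<Otimes>\<^sub>M W)"
        unfolding case_prod_beta by measurable
    qed
    also have "\<dots> \<le> (\<integral>\<^sup>+\<zeta>. ennreal (c0 * C2) * ennreal (norm (f \<zeta>) powr p) \<partial>W)"
    proof (rule nn_integral_mono)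
      fix \<zeta> assume "\<zeta> \<in> space W"
      then have \<zeta>: "norm \<zeta> < 1"
        by simp
      define r where "r = c0 * (norm (f \<zeta>) powr p * R.outer (norm \<zeta>) powr (1 / p'))"
      have r: "0 \<le> r"
        using c0 by (simp add: r_def)
      have "(\<integral>\<^sup>+z. ennreal r * ?b \<zeta> z \<partial>W) =
          ennreal r * (\<integral>\<^sup>+z. ?b \<zeta> z \<partial>W)"
        by (rule nn_integral_cmult) (rule borel_measurable_W, measurable)
      also have "(\<integral>\<^sup>+z. ?b \<zeta> z \<partial>W) =
          (\<integral>\<^sup>+z. ennreal ((1 - norm z) * R.outer (norm z) powr (- (1 / p')) * norm (dkernel (cnj \<zeta> * z))) \<partial>W)"
      proof (rule nn_integral_cong)
        fix z assume "z \<in> space W"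
        then have z: "norm z < 1"
          by simp
        have "norm (K (cnj z * \<zeta>)) = norm (dkernel (cnj z * \<zeta>))"
          using mult_lt[OF z \<zeta>] by (simp add: K_def)
        also have "\<dots> = norm (dkernel (cnj (cnj z * \<zeta>)))"
          by (rule norm_dkernel_cnj[OF mult_lt[OF z \<zeta>], symmetric])
        also have "cnj (cnj z * \<zeta>) = cnj \<zeta> * z"
          by (simp add: mult.commute)
        finally show "?b \<zeta> z =
            ennreal ((1 - norm z) * R.outer (norm z) powr (- (1 / p')) * norm (dkernel (cnj \<zeta> * z)))"
          by (simp only:)
      qed
      also have "ennreal r * \<dots> \<le> ennreal r * ennreal (C2 * R.outer (norm \<zeta>) powr (- (1 / p')))"
        using C2(2)[of "cnj \<zeta>"] \<zeta> by (intro mult_left_mono) auto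
      also have "\<dots> = ennreal (c0 * C2 * norm (f \<zeta>) powr p)"
      proof -
        have 1: "R.outer (norm \<zeta>) powr (1 / p') * R.outer (norm \<zeta>) powr (- (1 / p')) = 1"
          using R.outer_pos[OF \<zeta>] by (simp add: powr_add[symmetric])
        have "r * (C2 * R.outer (norm \<zeta>) powr (- (1 / p'))) = c0 * C2 * norm (f \<zeta>) powr p *
            (R.outer (norm \<zeta>) powr (1 / p') * R.outer (norm \<zeta>) powr (- (1 / p')))"
          unfolding r_def by (simp only: mult_ac)
        then have "r * (C2 * R.outer (norm \<zeta>) powr (- (1 / p'))) = c0 * C2 * norm (f \<zeta>) powr p"
          unfolding 1 by (simp only: mult_1_right)
        moreover have "ennreal (r * (C2 * R.outer (norm \<zeta>) powr (- (1 / p')))) =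
            ennreal r * ennreal (C2 * R.outer (norm \<zeta>) powr (- (1 / p')))"
          using r C2(1) by (intro ennreal_mult) auto
        ultimately show ?thesis
          by (simp only:)
      qed
      also have "\<dots> = ennreal (c0 * C2) * ennreal (norm (f \<zeta>) powr p)"
        using c0 C2(1) by (intro ennreal_mult) auto
      finally show "(\<integral>\<^sup>+z. ?a \<zeta> * ?b \<zeta> z \<partial>W) \<le>
          ennreal (c0 * C2) * ennreal (norm (f \<zeta>) powr p)"
        unfolding r_def .
    qed
    also have "\<dots> = ennreal (c0 * C2) * (\<integral>\<^sup>+\<zeta>. ennreal (norm (f \<zeta>) powr p) \<partial>W)"
      using fm by (intro nn_integral_cmult) measurable
    also have "\<dots> = ennreal (c0 * C2 * Lp_norm \<omega> p f powr p)"
      using Lp_norm_powr[OF f] pp c0 C2(1) by (simp add: ennreal_mult)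
    finally show ?thesis .
  qed
  then show ?thesis
    using c0 C2(1) by (intro exI[of _ "c0 * C2"]) auto
qed

lemma bounded_Lp:
  assumes f: "f \<in> borel_measurable dA" and B: "\<And>z. norm z < 1 \<Longrightarrow> norm (f z) \<le> B" and B0: "0 \<le> B" and p: "0 < p"
  shows "f \<in> Lp \<omega> p" and "Lp_norm \<omega> p f \<le> B * measure W (space W) powr (1 / p)"
proof -
  interpret W: finite_measure W
    by (rule finite_measure_W)
  have "(\<integral>\<^sup>+z. ennreal (norm (f z) powr p) \<partial>W) \<le> (\<integral>\<^sup>+z. ennreal (B powr p) \<partial>W)"
    using B p by (intro nn_integral_mono ennreal_leI powr_mono2) auto
  also have "\<dots> = ennreal (B powr p * measure W (space W))"
    by (simp add: W.emeasure_eq_measure ennreal_mult)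
  finally have le: "(\<integral>\<^sup>+z. ennreal (norm (f z) powr p) \<partial>W) \<le> ennreal (B powr p * measure W (space W))" .
  show fL: "f \<in> Lp \<omega> p"
    using f le by (simp add: Lp_iff le_less_trans)
  have "Lp_norm \<omega> p f powr p \<le> measure W (space W) * B powr p"
    using le unfolding Lp_norm_powr[OF fL p, symmetric] by (subst (asm) ennreal_le_iff) (auto simp: mult.commute)
  then have "Lp_norm \<omega> p f \<le> measure W (space W) powr (1 / p) * B"
    using B0 p by (intro powr_le_cmult) auto
  then show "Lp_norm \<omega> p f \<le> B * measure W (space W) powr (1 / p)"
    by (simp add: mult.commute)
qed

theorem projection_bounded:
  assumes D: "\<omega> \<in> D_class" and p: "1 < p"
  shows "\<exists>C\<ge>0. \<forall>f. f \<in> Lp \<omega> p \<longrightarrow>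
    projection \<omega> f \<in> Bergman \<omega> p \<and> Lp_norm \<omega> p (projection \<omega> f) \<le> C * Lp_norm \<omega> p f"
proof -
  have DE: "doubling \<mu>" "contracting \<mu>"
    using D by (auto simp: D_class_iff)
  define p' where "p' = p / (p - 1)"
  have pp: "1 / p + 1 / p' = 1"
    using p by (simp add: p'_def field_simps)
  have p': "1 < p'"
    by (rule conjugate_gt_1[OF p pp])
  obtain C1 where C1: "0 \<le> C1" "\<And>f. f \<in> Lp \<omega> p \<Longrightarrow>
      mean_integral (shifted \<mu> p) p (deriv (projection \<omega> f)) \<le> ennreal (C1 * Lp_norm \<omega> p f powr p)"
    using mean_integral_deriv_projection_le[OF DE(1) p pp] by blast
  obtain C2 where C2: "0 \<le> C2" "\<And>f. f holomorphic_on disc \<Longrightarrow>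
      mean_integral \<mu> p f \<le> ennreal C2 * (ennreal (norm (f 0) powr p) + mean_integral (shifted \<mu> p) p (deriv f))"
    using R.mean_integral_le_deriv[OF DE(2) p] by blast
  have one: "(\<lambda>_. 1) \<in> Lp \<omega> p'"
    by (rule bounded_Lp[of _ 1]) (use p' in auto)
  \<comment> \<open>Bounds the value of the projection at 0, which is the mean of f and is estimated
    by Hoelder against the constant 1.\<close>
  define L where "L = Lp_norm \<omega> p' (\<lambda>_. 1) / even_moment 0"
  have L: "0 \<le> L"
    using even_moment_pos[of 0] by (simp add: L_def)
  define C where "C = C2 * (L powr p + C1)"
  have C: "0 \<le> C"
    using C1 C2 by (simp add: C_def)
  have "projection \<omega> f \<in> Bergman \<omega> p \<and> Lp_norm \<omega> p (projection \<omega> f) \<le> C powr (1 / p) * Lp_norm \<omega> p f"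
    if f: "f \<in> Lp \<omega> p" for f
  proof -
    have i: "integrable W f"
      using f p by (intro Lp_integrable) auto
    have h: "projection \<omega> f holomorphic_on disc"
      by (rule projection_holomorphic[OF i])
    let ?N = "Lp_norm \<omega> p f"
    have "projection \<omega> f 0 = fourier f 0 / of_real (even_moment 0)"
      using taylor_projection[OF i, of 0] by simp
    then have "norm (projection \<omega> f 0) = norm (fourier f 0) / even_moment 0"
      using even_moment_pos[of 0] by (simp add: norm_divide)
    also have "norm (fourier f 0) \<le> ?N * Lp_norm \<omega> p' (\<lambda>_. 1)"
      using Lp_pairing(2)[OF f one p'] pp by (simp add: fourier_def add.commute)
    finally have "norm (projection \<omega> f 0) \<le> L * ?N"
      using even_moment_pos[of 0] by (simp add: L_def divide_right_mono mult.commute)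
    then have 0: "norm (projection \<omega> f 0) powr p \<le> L powr p * ?N powr p"
      using p L by (subst powr_mult[symmetric]) (auto intro!: powr_mono2)
    have "mean_integral \<mu> p (projection \<omega> f) \<le>
        ennreal C2 * (ennreal (norm (projection \<omega> f 0) powr p) + mean_integral (shifted \<mu> p) p (deriv (projection \<omega> f)))"
      by (rule C2(2)[OF h])
    also have "\<dots> \<le> ennreal C2 * (ennreal (L powr p * ?N powr p) + ennreal (C1 * ?N powr p))"
      using 0 C1(2)[OF f] by (intro mult_left_mono add_mono ennreal_leI) auto
    also have "\<dots> = ennreal (C * ?N powr p)"
      using C1(1) C2(1) by (simp add: C_def ennreal_mult[symmetric] ennreal_plus[symmetric] algebra_simps del: ennreal_plus)
    finally have le: "mean_integral \<mu> p (projection \<omega> f) \<le> ennreal (C * ?N powr p)" .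
    have B: "projection \<omega> f \<in> Bergman \<omega> p"
      using h le p by (simp add: Bergman_iff le_less_trans)
    have "Lp_norm \<omega> p (projection \<omega> f) powr p \<le> C * ?N powr p"
    proof -
      have "ennreal (Lp_norm \<omega> p (projection \<omega> f) powr p) \<le> ennreal (C * ?N powr p)"
        using Bergman_norm_powr[OF B] p le by simp
      then show ?thesis
        using C by (subst (asm) ennreal_le_iff) auto
    qed
    then have "Lp_norm \<omega> p (projection \<omega> f) \<le> C powr (1 / p) * ?N"
      using C p by (intro powr_le_cmult) auto
    then show ?thesis
      using B by simp
  qed
  then show ?thesis
    by (intro exI[of _ "C powr (1 / p)"]) auto
qed

end

section \<open>Dilations and the pairing between conjugate Bergman spaces\<close>

lemma norm_diff_powr_le:
  fixes a b :: complex
  assumes "0 < q"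
  shows "norm (a - b) powr q \<le> 2 powr q * (norm a powr q + norm b powr q)"
proof -
  have "norm (a - b) powr q \<le> (2 * max (norm a) (norm b)) powr q"
    using norm_triangle_ineq4[of a b] assms by (intro powr_mono2) auto
  also have "\<dots> = 2 powr q * max (norm a) (norm b) powr q"
    by (rule powr_mult)
  also have "\<dots> \<le> 2 powr q * (norm a powr q + norm b powr q)"
    by (intro mult_left_mono) (auto simp: max_def)
  finally show ?thesis .
qed

lemma circle_mean_diff_le:
  assumes f: "f holomorphic_on disc" and g: "g holomorphic_on disc" and q: "0 < q" and r: "0 \<le> r" "r < 1"
  shows "circle_mean q (\<lambda>z. f z - g z) r \<le> 2 powr q * (circle_mean q f r + circle_mean q g r)"
proof -
  have i: "integrable circle (\<lambda>\<xi>. norm (h (of_real r * \<xi>)) powr q)" if "h holomorphic_on disc" for h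
    using r q by (intro circle_integrable_continuous continuous_on_norm_powr continuous_on_circle_compose that) auto
  have "circle_mean q (\<lambda>z. f z - g z) r \<le>
      (LINT \<xi>|circle. 2 powr q * (norm (f (of_real r * \<xi>)) powr q + norm (g (of_real r * \<xi>)) powr q))"
    unfolding circle_mean_def
    using i[OF holomorphic_on_diff[OF f g]] i[OF f] i[OF g] norm_diff_powr_le[OF q]
    by (intro integral_mono) auto
  also have "\<dots> = 2 powr q * (circle_mean q f r + circle_mean q g r)"
    unfolding circle_mean_def using i[OF f] i[OF g] by simp
  finally show ?thesis .
qed

lemma dual_space_add: "\<Lambda> \<in> dual_space X N \<Longrightarrow> f \<in> X \<Longrightarrow> h \<in> X \<Longrightarrow> \<Lambda> (\<lambda>z. f z + h z) = \<Lambda> f + \<Lambda> h"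
  and dual_space_scale: "\<Lambda> \<in> dual_space X N \<Longrightarrow> f \<in> X \<Longrightarrow> \<Lambda> (\<lambda>z. c * f z) = c * \<Lambda> f"
  by (simp_all add: dual_space_def)

context weight
begin

lemma Bergman_diff:
  assumes f: "f \<in> Bergman \<omega> q" and g: "g \<in> Bergman \<omega> q" and q: "1 < q"
  shows "(\<lambda>z. f z - g z) \<in> Bergman \<omega> q"
proof -
  have h: "f holomorphic_on disc" "g holomorphic_on disc"
    using f g by (auto simp: Bergman_def)
  have "mean_integral \<mu> q (\<lambda>z. f z - g z) \<le>
      (\<integral>\<^sup>+r. ennreal (2 powr q) * (ennreal (circle_mean q f r) + ennreal (circle_mean q g r)) \<partial>\<mu>)"
    unfolding mean_integral_def
  proof (rule nn_integral_mono)
    fix r assume "r \<in> space \<mu>"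
    then have "circle_mean q (\<lambda>z. f z - g z) r \<le> 2 powr q * (circle_mean q f r + circle_mean q g r)"
      using q by (intro circle_mean_diff_le h) auto
    then have "ennreal (circle_mean q (\<lambda>z. f z - g z) r) \<le> ennreal (2 powr q * (circle_mean q f r + circle_mean q g r))"
      by (rule ennreal_leI)
    then show "ennreal (circle_mean q (\<lambda>z. f z - g z) r) \<le> ennreal (2 powr q) * (ennreal (circle_mean q f r) + ennreal (circle_mean q g r))"
      by (simp add: ennreal_mult)
  qed
  also have "\<dots> = ennreal (2 powr q) * (mean_integral \<mu> q f + mean_integral \<mu> q g)"
    unfolding mean_integral_def using R.circle_mean_measurable[OF h(1) q] R.circle_mean_measurable[OF h(2) q]
    by (subst nn_integral_cmult) (auto simp: nn_integral_add)
  also have "\<dots> < \<infinity>"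
    using f g q by (simp add: Bergman_iff ennreal_mult_less_top)
  finally show ?thesis
    using h q by (simp add: Bergman_iff holomorphic_on_diff)
qed

lemma Lp_norm_cong:
  assumes "f holomorphic_on disc" "g holomorphic_on disc" "\<And>z. norm z < 1 \<Longrightarrow> f z = g z" "0 < p"
  shows "Lp_norm \<omega> p f = Lp_norm \<omega> p g"
  using assms mean_integral_cong[of f g \<mu> p] by (simp add: Bergman_norm)

text \<open>Dominated convergence twice. On a fixed circle f is bounded on the closed disc of radius
  r; in r the means of the dilates are dominated by those of f because means increase.\<close>

lemma dilation_tendsto:
  assumes f: "f \<in> Bergman \<omega> q" and q: "1 < q"
  shows "((\<lambda>r. Lp_norm \<omega> q (\<lambda>z. f (of_real r * z) - f z)) \<longlongrightarrow> 0) (at_left 1)"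
proof (rule tendsto_at_left_sequentially[of 0])
  fix t :: "nat \<Rightarrow> real"
  assume t: "\<And>n. t n < 1" "\<And>n. 0 < t n" "t \<longlonglongrightarrow> 1"
  have h: "f holomorphic_on disc"
    using f by (simp add: Bergman_def)
  have hd: "(\<lambda>z. f (of_real (t n) * z)) holomorphic_on disc" for n
    using t(1,2)[of n] by (intro holomorphic_dilate h) auto
  define F where "F n z = f (of_real (t n) * z) - f z" for n z
  have hF: "F n holomorphic_on disc" for n
    unfolding F_def by (intro holomorphic_on_diff hd h)
  have cont: "isCont f z" if "norm z < 1" for z
    using holomorphic_on_imp_continuous_on[OF h] that by (auto simp: continuous_on_eq_continuous_at)
  have lim: "(\<lambda>n. norm (F n z) powr q) \<longlonglongrightarrow> 0" if z: "norm z < 1" for z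
  proof -
    have "(\<lambda>n. complex_of_real (t n) * z) \<longlonglongrightarrow> of_real 1 * z"
      by (intro tendsto_intros t)
    then have "(\<lambda>n. f (of_real (t n) * z)) \<longlonglongrightarrow> f z"
      using cont[OF z] by (intro isCont_tendsto_compose[of _ f]) auto
    then have "(\<lambda>n. norm (F n z)) \<longlonglongrightarrow> norm (f z - f z)"
      unfolding F_def by (intro tendsto_intros)
    then show ?thesis
      using q tendsto_powr'[of "\<lambda>n. norm (F n z)" 0 sequentially "\<lambda>_. q" q] by simp
  qed
  have "(\<lambda>n. \<integral>\<^sup>+r. ennreal (circle_mean q (F n) r) \<partial>\<mu>) \<longlonglongrightarrow> (\<integral>\<^sup>+r. 0 \<partial>\<mu>)"
  proof (rule nn_integral_dominated_convergence)
    let ?w = "\<lambda>r. ennreal (2 powr q) * ennreal (2 * circle_mean q f r)"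
    show "?w \<in> borel_measurable \<mu>"
      using R.circle_mean_measurable[OF h q] by simp
    have "(\<integral>\<^sup>+r. ?w r \<partial>\<mu>) = (\<integral>\<^sup>+r. ennreal (2 powr q * 2) * ennreal (circle_mean q f r) \<partial>\<mu>)"
      by (rule nn_integral_cong) (simp add: ennreal_mult[symmetric])
    also have "\<dots> = ennreal (2 powr q * 2) * mean_integral \<mu> q f"
      unfolding mean_integral_def using R.circle_mean_measurable[OF h q] by (intro nn_integral_cmult) simp
    also have "\<dots> < \<infinity>"
      using f q by (simp add: Bergman_iff ennreal_mult_less_top)
    finally show "(\<integral>\<^sup>+r. ?w r \<partial>\<mu>) < \<infinity>" .
    show "(\<lambda>r. ennreal (circle_mean q (F n) r)) \<in> borel_measurable \<mu>" for n
      using R.circle_mean_measurable[OF hF q] by simp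
    show "AE r in \<mu>. ennreal (circle_mean q (F n) r) \<le> ?w r" for n
    proof (rule AE_I2)
      fix r assume "r \<in> space \<mu>"
      then have r: "0 \<le> r" "r < 1"
        by auto
      have "circle_mean q (F n) r \<le> 2 powr q * (circle_mean q (\<lambda>z. f (of_real (t n) * z)) r + circle_mean q f r)"
        unfolding F_def using q by (intro circle_mean_diff_le hd h r) simp
      also have "circle_mean q (\<lambda>z. f (of_real (t n) * z)) r \<le> circle_mean q f r"
        unfolding circle_mean_dilate using t(1,2)[of n] r
        by (intro circle_mean_mono h q mult_left_le_one_le) auto
      finally have "circle_mean q (F n) r \<le> 2 powr q * (2 * circle_mean q f r)"
        by simp
      then have "ennreal (circle_mean q (F n) r) \<le> ennreal (2 powr q * (2 * circle_mean q f r))"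
        by (rule ennreal_leI)
      also have "\<dots> = ?w r"
        by (intro ennreal_mult) auto
      finally show "ennreal (circle_mean q (F n) r) \<le> ?w r" .
    qed
    show "AE r in \<mu>. (\<lambda>n. ennreal (circle_mean q (F n) r)) \<longlonglongrightarrow> 0"
    proof (rule AE_I2)
      fix r assume "r \<in> space \<mu>"
      then have r: "0 \<le> r" "r < 1"
        by auto
      have "compact (f ` cball 0 r)"
        using r by (intro compact_continuous_image holomorphic_on_imp_continuous_on holomorphic_on_subset[OF h]) auto
      then obtain B where B: "\<And>z. norm z \<le> r \<Longrightarrow> norm (f z) \<le> B"
        by (fastforce dest: compact_imp_bounded simp: bounded_iff)
      interpret C: prob_space circle
        by (rule prob_space_circle)
      have "(\<lambda>n. circle_mean q (F n) r) \<longlonglongrightarrow> (LINT \<xi>|circle. 0)"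
        unfolding circle_mean_def
      proof (rule integral_dominated_convergence[where w = "\<lambda>_. (B + B) powr q"])
        show "(\<lambda>\<xi>. norm (F n (of_real r * \<xi>)) powr q) \<in> borel_measurable circle" for n
          using r q by (intro circle_measurableI continuous_on_norm_powr continuous_on_circle_compose hF) auto
        show "AE \<xi> in circle. (\<lambda>n. norm (F n (of_real r * \<xi>)) powr q) \<longlonglongrightarrow> 0"
          using r by (intro AE_I2 lim) (simp add: norm_mult)
        show "AE \<xi> in circle. norm (norm (F n (of_real r * \<xi>)) powr q) \<le> (B + B) powr q" for n
        proof (rule AE_I2)
          fix \<xi> assume \<xi>: "\<xi> \<in> space circle"
          have "norm (F n (of_real r * \<xi>)) \<le> norm (f (of_real (t n) * (of_real r * \<xi>))) + norm (f (of_real r * \<xi>))"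
            unfolding F_def by (rule norm_triangle_ineq4)
          also have "\<dots> \<le> B + B"
            using r \<xi> t(1,2)[of n] by (intro add_mono B) (auto simp: norm_mult intro!: mult_left_le_one_le)
          finally show "norm (norm (F n (of_real r * \<xi>)) powr q) \<le> (B + B) powr q"
            using q by (auto intro!: powr_mono2)
        qed
      qed auto
      then have "(\<lambda>n. ennreal (circle_mean q (F n) r)) \<longlonglongrightarrow> ennreal (LINT \<xi>|circle. 0)"
        by (rule tendsto_ennrealI)
      then show "(\<lambda>n. ennreal (circle_mean q (F n) r)) \<longlonglongrightarrow> 0"
        by simp
    qed
  qed auto
  then have "(\<lambda>n. mean_integral \<mu> q (F n)) \<longlonglongrightarrow> ennreal 0"
    by (simp add: mean_integral_def)
  then have "(\<lambda>n. enn2real (mean_integral \<mu> q (F n))) \<longlonglongrightarrow> 0"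
    by (rule tendsto_enn2real) auto
  then have "(\<lambda>n. enn2real (mean_integral \<mu> q (F n)) powr (1 / q)) \<longlonglongrightarrow> 0"
    using q tendsto_powr'[of "\<lambda>n. enn2real (mean_integral \<mu> q (F n))" 0 sequentially "\<lambda>_. 1 / q" "1 / q"] by simp
  then have "(\<lambda>n. Lp_norm \<omega> q (F n)) \<longlonglongrightarrow> 0"
    using q Bergman_norm[OF _ hF, of q] by simp
  then show "(\<lambda>n. Lp_norm \<omega> q (\<lambda>z. f (of_real (t n) * z) - f z)) \<longlonglongrightarrow> 0"
    by (simp add: F_def[abs_def])
qed simp

lemma eventually_at_left_1: "(\<And>r. 0 < r \<Longrightarrow> r < 1 \<Longrightarrow> P r) \<Longrightarrow> \<forall>\<^sub>F r in at_left (1::real). P r"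
  unfolding eventually_at_left_field by (rule exI[of _ 0]) auto

lemma dilated_pairing_tendsto:
  assumes pp: "1 < p" "1 / p + 1 / q = 1" and f: "f \<in> Lp \<omega> q" and g: "g \<in> Bergman \<omega> p"
  shows "((\<lambda>r. LINT z|W. f z * cnj (g (of_real r * z))) \<longlongrightarrow> (LINT z|W. f z * cnj (g z))) (at_left 1)"
proof (rule Lim_transform_eventually[OF _ eventually_at_left_1])
  let ?d = "\<lambda>r. LINT z|W. f z * cnj (g (of_real r * z) - g z)"
  have h: "g holomorphic_on disc"
    using g by (simp add: Bergman_def)
  have B: "(\<lambda>z. g (of_real r * z)) \<in> Bergman \<omega> p" if "0 < r" "r < 1" for r
    using that pp by (intro Bergman_dilate h) auto
  have "(?d \<longlongrightarrow> 0) (at_left 1)"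
  proof (rule Lim_null_comparison[OF eventually_at_left_1])
    fix r :: real assume r: "0 < r" "r < 1"
    show "norm (?d r) \<le> Lp_norm \<omega> q f * Lp_norm \<omega> p (\<lambda>z. g (of_real r * z) - g z)"
      by (rule Lp_pairing(2)[OF f Bergman_Lp[OF Bergman_diff[OF B[OF r] g pp(1)]] pp])
  next
    show "((\<lambda>r. Lp_norm \<omega> q f * Lp_norm \<omega> p (\<lambda>z. g (of_real r * z) - g z)) \<longlongrightarrow> 0) (at_left 1)"
      using tendsto_mult[OF tendsto_const dilation_tendsto[OF g pp(1)], of "Lp_norm \<omega> q f"] by simp
  qed
  from tendsto_add[OF this tendsto_const]
  show "((\<lambda>r. ?d r + (LINT z|W. f z * cnj (g z))) \<longlongrightarrow> (LINT z|W. f z * cnj (g z))) (at_left 1)"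
    by simp
  fix r :: real assume r: "0 < r" "r < 1"
  note i = Lp_pairing(1)[OF f Bergman_Lp[OF B[OF r]] pp] Lp_pairing(1)[OF f Bergman_Lp[OF g] pp]
  show "?d r + (LINT z|W. f z * cnj (g z)) = (LINT z|W. f z * cnj (g (of_real r * z)))"
    using i by (simp add: right_diff_distrib)
qed

text \<open>The pairing dilates its first argument, the preceding convergence its second;
  conjugation exchanges the roles.\<close>

lemma pairing_Bergman:
  assumes pp: "1 < p" "1 / p + 1 / q = 1" and f: "f \<in> Bergman \<omega> q" and g: "g \<in> Bergman \<omega> p"
  shows "pairing \<omega> f g = (LINT z|W. f z * cnj (g z))" and "pairing_defined \<omega> f g"
proof -
  have q: "1 < q"
    by (rule conjugate_gt_1[OF pp])
  have qp: "1 / q + 1 / p = 1"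
    using pp by simp
  have h: "f holomorphic_on disc" and gm: "g \<in> borel_measurable dA"
    using f g by (auto simp: Bergman_def holomorphic_measurable)
  have cf: "(LINT z|W. g z * cnj (F z)) = cnj (LINT z|W. F z * cnj (g z))" for F
  proof -
    have "(LINT z|W. g z * cnj (F z)) = (LINT z|W. cnj (F z * cnj (g z)))"
      by (rule Bochner_Integration.integral_cong) (auto simp: mult.commute)
    then show ?thesis
      by (simp only: Bochner_Integration.integral_cnj)
  qed
  have "((\<lambda>r. cnj (LINT z|W. g z * cnj (f (of_real r * z)))) \<longlongrightarrow> cnj (LINT z|W. g z * cnj (f z))) (at_left 1)"
    by (intro tendsto_cnj dilated_pairing_tendsto[OF q qp Bergman_Lp[OF g] f])
  then have l: "((\<lambda>r. LINT z|W. f (of_real r * z) * cnj (g z)) \<longlongrightarrow> (LINT z|W. f z * cnj (g z))) (at_left 1)"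
    unfolding cf complex_cnj_cnj .
  show "pairing \<omega> f g = (LINT z|W. f z * cnj (g z))"
    by (rule pairing_eq(1)[OF h l gm])
  show "pairing_defined \<omega> f g"
    unfolding pairing_defined_def
  proof (intro conjI ballI exI)
    show "((\<lambda>r. LINT z|dA. dilated_integrand \<omega> f g r z) \<longlongrightarrow> (LINT z|W. f z * cnj (g z))) (at_left 1)"
      by (rule pairing_eq(2)[OF h l gm])
    fix r :: real assume "r \<in> {0<..<1}"
    then have "(\<lambda>z. f (of_real r * z)) \<in> Bergman \<omega> q"
      using q by (intro Bergman_dilate h) auto
    note i = Lp_pairing(1)[OF Bergman_Lp[OF this] Bergman_Lp[OF g] pp]
    have "(\<lambda>z. f (of_real r * z) * cnj (g z)) \<in> borel_measurable dA"
      using borel_measurable_integrable[OF i] by (simp add: measurable_W)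
    from integral_dA_weight(2)[OF this] i show "integrable dA (dilated_integrand \<omega> f g r)"
      by (simp add: dilated_integrand_def[abs_def])
  qed
qed

lemma Bergman_add:
  assumes f: "f \<in> Bergman \<omega> q" and g: "g \<in> Bergman \<omega> q" and q: "1 < q"
  shows "(\<lambda>z. f z + g z) \<in> Bergman \<omega> q"
  using Bergman_diff[OF f Bergman_scale[OF g, of "-1"] q] q by simp

lemma pairing_dual_space:
  assumes pp: "1 < p" "1 / p + 1 / q = 1" and g: "g \<in> Bergman \<omega> p"
  shows "(\<lambda>f. pairing \<omega> f g) \<in> dual_space (Bergman \<omega> q) (Lp_norm \<omega> q)"
    and "dual_norm (Bergman \<omega> q) (Lp_norm \<omega> q) (\<lambda>f. pairing \<omega> f g) \<le> Lp_norm \<omega> p g"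
proof -
  have q: "1 < q"
    by (rule conjugate_gt_1[OF pp])
  note P = pairing_Bergman(1)[OF pp _ g]
  have i: "integrable W (\<lambda>z. f z * cnj (g z))" if "f \<in> Bergman \<omega> q" for f
    by (rule Lp_pairing(1)[OF Bergman_Lp[OF that] Bergman_Lp[OF g] pp])
  have b: "norm (pairing \<omega> f g) \<le> Lp_norm \<omega> p g * Lp_norm \<omega> q f" if "f \<in> Bergman \<omega> q" for f
    using Lp_pairing(2)[OF Bergman_Lp[OF that] Bergman_Lp[OF g] pp] by (simp add: P[OF that] mult.commute)
  show "(\<lambda>f. pairing \<omega> f g) \<in> dual_space (Bergman \<omega> q) (Lp_norm \<omega> q)"
    unfolding dual_space_def
  proof (intro CollectI conjI ballI allI)
    show "pairing \<omega> (\<lambda>z. f z + h z) g = pairing \<omega> f g + pairing \<omega> h g"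
      if fh: "f \<in> Bergman \<omega> q" "h \<in> Bergman \<omega> q" for f h
      using i[OF fh(1)] i[OF fh(2)] by (simp add: P fh Bergman_add q distrib_right)
    show "pairing \<omega> (\<lambda>z. c * f z) g = c * pairing \<omega> f g" if f: "f \<in> Bergman \<omega> q" for c f
      using f q by (simp add: P Bergman_scale mult.assoc)
    show "\<exists>C. \<forall>f\<in>Bergman \<omega> q. norm (pairing \<omega> f g) \<le> C * Lp_norm \<omega> q f"
      using b by blast
  qed
  show "dual_norm (Bergman \<omega> q) (Lp_norm \<omega> q) (\<lambda>f. pairing \<omega> f g) \<le> Lp_norm \<omega> p g"
    using q by (intro dual_norm_le b) auto
qed

lemma dual_diff_le:
  assumes L: "\<Lambda> \<in> dual_space (Bergman \<omega> q) (Lp_norm \<omega> q)" and q: "1 < q"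
    and f: "f \<in> Bergman \<omega> q" and g: "g \<in> Bergman \<omega> q"
  shows "norm (\<Lambda> f - \<Lambda> g) \<le> dual_norm (Bergman \<omega> q) (Lp_norm \<omega> q) \<Lambda> * Lp_norm \<omega> q (\<lambda>z. f z - g z)"
proof -
  have d: "(\<lambda>z. f z - g z) \<in> Bergman \<omega> q"
    by (rule Bergman_diff[OF f g q])
  then have "\<Lambda> (\<lambda>z. (f z - g z) + g z) = \<Lambda> (\<lambda>z. f z - g z) + \<Lambda> g"
    by (rule dual_space_add[OF L _ g])
  then have "\<Lambda> f - \<Lambda> g = \<Lambda> (\<lambda>z. f z - g z)"
    by simp
  then show ?thesis
    using dual_norm_ge[OF L _ d] q by simp
qed

lemma dual_norm_nonneg:
  assumes "\<Lambda> \<in> dual_space (Bergman \<omega> q) (Lp_norm \<omega> q)" "1 < q"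
  shows "0 \<le> dual_norm (Bergman \<omega> q) (Lp_norm \<omega> q) \<Lambda>"
proof -
  have q: "0 < q"
    using assms(2) by simp
  note e1 = monomial_Bergman(1)[OF le_refl q]
  have e2: "0 < Lp_norm \<omega> q (\<lambda>z. z ^ 1)"
    unfolding monomial_Bergman(2)[OF le_refl q] using R.power_moment_pos[of q] q by simp
  have "0 \<le> norm (\<Lambda> (\<lambda>z. z ^ 1))"
    by simp
  also have "\<dots> \<le> dual_norm (Bergman \<omega> q) (Lp_norm \<omega> q) \<Lambda> * Lp_norm \<omega> q (\<lambda>z. z ^ 1)"
    by (rule dual_norm_ge[OF assms(1) q e1])
  finally show ?thesis
    using e2 by (simp only: zero_le_mult_iff) linarith
qed

text \<open>The bound is uniform in n and includes n = 0, as is needed for the convergence of series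
  with coefficients \<Lambda>(z^n).\<close>

lemma polynomial_Bergman:
  assumes q: "1 < q"
  shows "(\<lambda>z. z ^ n) \<in> Bergman \<omega> q"
    and "Lp_norm \<omega> q (\<lambda>z. z ^ n) \<le> measure W (space W) powr (1 / q)"
    and "(\<lambda>z. \<Sum>n<N. a n * z ^ n) \<in> Bergman \<omega> q"
proof -
  have m: "(\<lambda>z::complex. z ^ n) \<in> borel_measurable dA" for n
    by (rule holomorphic_measurable[OF monomial_holomorphic])
  have "norm (z ^ n) \<le> 1" if "norm z < 1" for z :: complex and n
    using that by (simp add: norm_power power_le_one)
  note b = bounded_Lp[OF m this, of q]
  then have B: "(\<lambda>z. z ^ n) \<in> Bergman \<omega> q" for n
    using b(1) q by (simp add: Bergman_def monomial_holomorphic)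
  then show "(\<lambda>z. z ^ n) \<in> Bergman \<omega> q" .
  show "Lp_norm \<omega> q (\<lambda>z. z ^ n) \<le> measure W (space W) powr (1 / q)"
    using b(2) q by simp
  show "(\<lambda>z. \<Sum>n<N. a n * z ^ n) \<in> Bergman \<omega> q"
  proof (induction N)
    case 0
    then show ?case
      using zero_Bergman[of q] q by simp
  next
    case (Suc N)
    then show ?case
      using q by (simp add: Bergman_add Bergman_scale B)
  qed
qed

text \<open>The Taylor sums of a dilate converge uniformly on the disc, hence in norm since the
  measure is finite, so the functional may be applied termwise.\<close>

lemma dual_power_series:
  assumes L: "\<Lambda> \<in> dual_space (Bergman \<omega> q) (Lp_norm \<omega> q)" and q: "1 < q"
    and h: "h holomorphic_on disc" and t: "0 \<le> t" "t < 1"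
  shows "(\<lambda>n. taylor h n * \<Lambda> (\<lambda>z. z ^ n) * of_real t ^ n) sums \<Lambda> (\<lambda>z. h (of_real t * z))"
proof -
  define a where "a n = taylor h n * of_real t ^ n" for n
  let ?S = "\<lambda>N z. \<Sum>n<N. a n * z ^ n"
  let ?h = "\<lambda>z. h (of_real t * z)"
  let ?M = "measure W (space W) powr (1 / q)"
  let ?D = "dual_norm (Bergman \<omega> q) (Lp_norm \<omega> q) \<Lambda>"
  have sa: "summable (\<lambda>n. norm (a n))"
    using taylor_norm_summable[OF h t] t by (simp add: a_def norm_mult norm_power norm_divide)
  have sN: "summable (\<lambda>n. norm (a (n + N)))" for N
    using sa summable_iff_shift[of "\<lambda>n. norm (a n)" N] by simp
  have B: "?h \<in> Bergman \<omega> q"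
    by (rule Bergman_dilate[OF h q t])
  have L_S: "\<Lambda> (?S N) = (\<Sum>n<N. a n * \<Lambda> (\<lambda>z. z ^ n))" for N
  proof (induction N)
    case 0
    have "\<Lambda> (\<lambda>z. 0 * z ^ 0) = 0 * \<Lambda> (\<lambda>z. z ^ 0)"
      by (rule dual_space_scale[OF L polynomial_Bergman(1)[OF q]])
    then show ?case
      by simp
  next
    case (Suc N)
    have e: "(\<lambda>z. z ^ N) \<in> Bergman \<omega> q"
      by (rule polynomial_Bergman(1)[OF q])
    have "\<Lambda> (\<lambda>z. ?S N z + a N * z ^ N) = \<Lambda> (?S N) + \<Lambda> (\<lambda>z. a N * z ^ N)"
      using q by (intro dual_space_add[OF L] polynomial_Bergman(3) Bergman_scale e) auto
    moreover have "\<Lambda> (\<lambda>z. a N * z ^ N) = a N * \<Lambda> (\<lambda>z. z ^ N)"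
      by (rule dual_space_scale[OF L e])
    ultimately show ?case
      using Suc by simp
  qed
  have "(\<lambda>N. \<Lambda> (?S N) - \<Lambda> ?h) \<longlonglongrightarrow> 0"
  proof (rule Lim_null_comparison)
    let ?T = "\<lambda>N. \<Sum>n. norm (a (n + N))"
    show "(\<lambda>N. ?D * (?T N * ?M)) \<longlonglongrightarrow> 0"
      using tendsto_mult[OF tendsto_const tendsto_mult[OF suminf_exist_split2[OF sa] tendsto_const], of ?D ?M] by simp
    show "\<forall>\<^sub>F N in sequentially. norm (\<Lambda> (?S N) - \<Lambda> ?h) \<le> ?D * (?T N * ?M)"
    proof (rule always_eventually, rule allI)
      fix N
      have T: "0 \<le> ?T N"
        by (intro suminf_nonneg sN) simp
      have D: "0 \<le> ?D"
        by (rule dual_norm_nonneg[OF L q])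
      have "norm (?S N z - ?h z) \<le> ?T N" if z: "norm z < 1" for z
      proof -
        have "norm (of_real t * z) < 1"
          using t z mult_strict_mono[of t 1 "norm z" 1] by (simp add: norm_mult)
        from taylor_sums[OF h this] have s: "(\<lambda>n. a n * z ^ n) sums ?h z"
          by (simp add: a_def power_mult_distrib mult.assoc)
        have "(\<lambda>n. a (n + N) * z ^ (n + N)) sums (?h z - ?S N z)"
          using sums_split_initial_segment[OF s, of N] .
        then have "norm (?h z - ?S N z) = norm (\<Sum>n. a (n + N) * z ^ (n + N))"
          by (simp add: sums_iff)
        also have "\<dots> \<le> ?T N"
        proof (rule norm_suminf_le)
          fix n
          have "norm (a (n + N)) * norm z ^ (n + N) \<le> norm (a (n + N)) * 1"
            using z by (intro mult_left_mono power_le_one) auto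
          then show "norm (a (n + N) * z ^ (n + N)) \<le> norm (a (n + N))"
            by (simp add: norm_mult norm_power)
        qed (rule sN)
        finally show ?thesis
          by (simp add: norm_minus_commute)
      qed
      moreover have "(\<lambda>z. ?S N z - ?h z) \<in> borel_measurable dA"
        using Bergman_diff[OF polynomial_Bergman(3)[OF q] B q] by (simp add: Bergman_def holomorphic_measurable)
      ultimately have "Lp_norm \<omega> q (\<lambda>z. ?S N z - ?h z) \<le> ?T N * ?M"
        using T q by (intro bounded_Lp(2)) auto
      then have "?D * Lp_norm \<omega> q (\<lambda>z. ?S N z - ?h z) \<le> ?D * (?T N * ?M)"
        using D by (rule mult_left_mono)
      with dual_diff_le[OF L q polynomial_Bergman(3)[OF q] B, of a N]
      show "norm (\<Lambda> (?S N) - \<Lambda> ?h) \<le> ?D * (?T N * ?M)"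
        by (rule order_trans)
    qed
  qed
  then have "(\<lambda>N. \<Sum>n<N. a n * \<Lambda> (\<lambda>z. z ^ n)) \<longlonglongrightarrow> \<Lambda> ?h"
    unfolding L_S by (simp add: Lim_null[symmetric])
  then show ?thesis
    unfolding sums_def a_def by (simp add: mult_ac)
qed

end

section \<open>Representation of bounded functionals\<close>

context weight
begin

text \<open>The only candidate: the pairing of z^n with g is the conjugate of the n-th coefficient
  of g times the even moment, which dictates the conjugate and the division.\<close>

definition representer :: "((complex \<Rightarrow> complex) \<Rightarrow> complex) \<Rightarrow> complex \<Rightarrow> complex"
  where "representer \<Lambda> z = (\<Sum>n. cnj (\<Lambda> (\<lambda>z. z ^ n)) / of_real (even_moment n) * z ^ n)"

lemma representer:
  assumes L: "\<Lambda> \<in> dual_space (Bergman \<omega> q) (Lp_norm \<omega> q)" and q: "1 < q"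
  shows representer_holomorphic: "representer \<Lambda> holomorphic_on disc"
    and taylor_representer: "taylor (representer \<Lambda>) n = cnj (\<Lambda> (\<lambda>z. z ^ n)) / of_real (even_moment n)"
proof -
  let ?D = "dual_norm (Bergman \<omega> q) (Lp_norm \<omega> q) \<Lambda>"
  let ?M = "measure W (space W) powr (1 / q)"
  have s: "(\<lambda>n. cnj (\<Lambda> (\<lambda>z. z ^ n)) / of_real (even_moment n) * z ^ n) sums representer \<Lambda> z" if z: "norm z < 1" for z
    unfolding representer_def
  proof (rule summable_sums, rule summable_norm_cancel, rule summable_comparison_test')
    show "summable (\<lambda>n. ?D * ?M * (1 / even_moment n * norm z ^ n))"
      using summable_inverse_moments[OF norm_ge_zero z] by (intro summable_mult) simp
    fix n
    have "norm (\<Lambda> (\<lambda>z. z ^ n)) \<le> ?D * Lp_norm \<omega> q (\<lambda>z. z ^ n)"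
      using q by (intro dual_norm_ge[OF L] polynomial_Bergman(1)) auto
    also have "\<dots> \<le> ?D * ?M"
      by (intro mult_left_mono polynomial_Bergman(2) q dual_norm_nonneg[OF L])
    finally have "norm (\<Lambda> (\<lambda>z. z ^ n)) * (1 / even_moment n * norm z ^ n) \<le> ?D * ?M * (1 / even_moment n * norm z ^ n)"
      using even_moment_pos[of n] by (intro mult_right_mono) auto
    then show "norm (norm (cnj (\<Lambda> (\<lambda>z. z ^ n)) / of_real (even_moment n) * z ^ n)) \<le> ?D * ?M * (1 / even_moment n * norm z ^ n)"
      using even_moment_pos[of n] by (simp add: norm_mult norm_divide norm_power)
  qed
  show "representer \<Lambda> holomorphic_on disc"
    by (rule taylor_unique(1)[OF s])
  show "taylor (representer \<Lambda>) n = cnj (\<Lambda> (\<lambda>z. z ^ n)) / of_real (even_moment n)"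
    by (rule taylor_unique(2)[OF s])
qed

text \<open>Both sides have the same expansion in powers of t: the even moments cancel between the
  coefficients of the projection and those of the representer. The function h need not be
  holomorphic, which is what makes norm testing possible.\<close>

lemma dual_projection:
  assumes L: "\<Lambda> \<in> dual_space (Bergman \<omega> q) (Lp_norm \<omega> q)" and q: "1 < q"
    and h: "integrable W h" and t: "0 \<le> t" "t < 1"
  shows "\<Lambda> (\<lambda>z. projection \<omega> h (of_real t * z)) = (LINT z|W. h z * cnj (representer \<Lambda> (of_real t * z)))"
proof -
  define d where "d n = cnj (taylor (representer \<Lambda>) n)" for n
  have rh: "representer \<Lambda> holomorphic_on disc"
    by (rule representer_holomorphic[OF L q])
  have nt: "norm (complex_of_real t) = t"
    using t by simp
  have nd: "norm (d n) = norm (taylor (representer \<Lambda>) n)" for n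
    unfolding d_def by (rule complex_mod_cnj)
  have "summable (\<lambda>n. norm (d n) * norm (complex_of_real t) ^ n)"
    unfolding nd nt by (rule taylor_norm_summable[OF rh t])
  note M = fourier_multiplier_sums[OF h this]
  have dn: "d n * fourier h n = taylor (projection \<omega> h) n * \<Lambda> (\<lambda>z. z ^ n)" for n
    unfolding d_def taylor_representer[OF L q] taylor_projection[OF h] by simp
  have "(\<lambda>n. d n * fourier h n * of_real t ^ n) sums \<Lambda> (\<lambda>z. projection \<omega> h (of_real t * z))"
    unfolding dn by (rule dual_power_series[OF L q projection_holomorphic[OF h] t])
  then have "\<Lambda> (\<lambda>z. projection \<omega> h (of_real t * z)) = (LINT \<zeta>|W. h \<zeta> * (\<Sum>n. d n * (of_real t * cnj \<zeta>) ^ n))"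
    using M(1) by (rule sums_unique2)
  also have "\<dots> = (LINT \<zeta>|W. h \<zeta> * cnj (representer \<Lambda> (of_real t * \<zeta>)))"
  proof (rule Bochner_Integration.integral_cong[OF refl])
    fix \<zeta> assume "\<zeta> \<in> space W"
    then have "norm (of_real t * \<zeta>) < 1"
      using t mult_strict_mono[of t 1 "norm \<zeta>" 1] by (simp add: norm_mult)
    then have "(\<lambda>n. cnj (taylor (representer \<Lambda>) n * (of_real t * \<zeta>) ^ n)) sums cnj (representer \<Lambda> (of_real t * \<zeta>))"
      by (intro sums_cnj[THEN iffD2] taylor_sums rh)
    also have "(\<lambda>n. cnj (taylor (representer \<Lambda>) n * (of_real t * \<zeta>) ^ n)) = (\<lambda>n. d n * (of_real t * cnj \<zeta>) ^ n)"
      unfolding d_def by (simp only: complex_cnj_mult complex_cnj_power complex_cnj_complex_of_real)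
    finally show "h \<zeta> * (\<Sum>n. d n * (of_real t * cnj \<zeta>) ^ n) = h \<zeta> * cnj (representer \<Lambda> (of_real t * \<zeta>))"
      by (simp only: sums_iff)
  qed
  finally show ?thesis .
qed

lemma Bergman_dilate_le:
  assumes f: "f \<in> Bergman \<omega> p" and p: "1 < p" and t: "0 \<le> t" "t < 1"
  shows "Lp_norm \<omega> p (\<lambda>z. f (of_real t * z)) \<le> Lp_norm \<omega> p f"
proof -
  have h: "f holomorphic_on disc"
    using f by (simp add: Bergman_def)
  have "mean_integral \<mu> p (\<lambda>z. f (of_real t * z)) \<le> mean_integral \<mu> p f"
    unfolding mean_integral_def circle_mean_dilate
    using t by (intro nn_integral_mono ennreal_leI circle_mean_mono h p) (auto intro!: mult_left_le_one_le)
  then have "Lp_norm \<omega> p (\<lambda>z. f (of_real t * z)) powr p \<le> 1 * Lp_norm \<omega> p f powr p"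
    using Bergman_norm_powr[OF f] Bergman_norm_powr[OF Bergman_dilate[OF h p t]] p
    by (simp add: ennreal_le_iff[symmetric] del: ennreal_le_iff)
  then have "Lp_norm \<omega> p (\<lambda>z. f (of_real t * z)) \<le> 1 powr (1 / p) * Lp_norm \<omega> p f"
    using p by (intro powr_le_cmult) auto
  then show ?thesis
    by simp
qed

text \<open>The extremal function for a dilate of the representer is not holomorphic and so no
  admissible argument of \<Lambda>; its projection is. The identity above turns the p-th power of
  the norm N into a value of \<Lambda>, and boundedness gives N^p <= D C N^(p-1).\<close>

lemma representer_dilate_le:
  assumes pp: "1 < p" "1 / p + 1 / q = 1" and L: "\<Lambda> \<in> dual_space (Bergman \<omega> q) (Lp_norm \<omega> q)"
    and C: "0 \<le> C" "\<And>f. f \<in> Lp \<omega> q \<Longrightarrow> projection \<omega> f \<in> Bergman \<omega> q \<and> Lp_norm \<omega> q (projection \<omega> f) \<le> C * Lp_norm \<omega> q f"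
    and t: "0 \<le> t" "t < 1"
  shows "Lp_norm \<omega> p (\<lambda>z. representer \<Lambda> (of_real t * z)) \<le> dual_norm (Bergman \<omega> q) (Lp_norm \<omega> q) \<Lambda> * C"
proof -
  have q: "1 < q"
    by (rule conjugate_gt_1[OF pp])
  let ?D = "dual_norm (Bergman \<omega> q) (Lp_norm \<omega> q) \<Lambda>"
  define g where "g z = representer \<Lambda> (of_real t * z)" for z
  define N where "N = Lp_norm \<omega> p g"
  have gB: "g \<in> Bergman \<omega> p"
    unfolding g_def by (rule Bergman_dilate[OF representer_holomorphic[OF L q] pp(1) t])
  then have gm: "g \<in> borel_measurable dA"
    by (auto simp: Bergman_def holomorphic_measurable)
  have N: "0 \<le> N" "ennreal (N powr p) = (\<integral>\<^sup>+z. ennreal (norm (g z) powr p) \<partial>W)"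
    using Lp_norm_powr[OF Bergman_Lp[OF gB]] pp by (auto simp: N_def)
  have pq: "(p - 1) * q = p"
    using pp q by (simp add: field_simps)
  define h where "h z = cnj (dual_factor p (g z))" for z
  have hm: "h \<in> borel_measurable dA"
  proof -
    have [measurable]: "cnj \<in> borel_measurable borel"
      by (intro borel_measurable_continuous_onI continuous_intros)
    show ?thesis
      unfolding h_def using gm by measurable
  qed
  have nh: "norm (h z) powr q = norm (g z) powr p" for z
    unfolding h_def complex_mod_cnj norm_dual_factor powr_powr pq ..
  have hL: "h \<in> Lp \<omega> q"
    using hm N(2)[symmetric] by (simp add: Lp_iff nh)
  have "ennreal (Lp_norm \<omega> q h powr q) = ennreal (N powr p)"
    using Lp_norm_powr[OF hL] q by (simp add: nh N(2))
  then have hn: "Lp_norm \<omega> q h powr q = N powr p"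
    by simp
  have "Lp_norm \<omega> q h = (Lp_norm \<omega> q h powr q) powr (1 / q)"
    using q by (simp add: powr_powr)
  also have "\<dots> = (N powr ((p - 1) * q)) powr (1 / q)"
    unfolding hn pq ..
  also have "\<dots> = N powr (p - 1)"
    using q by (simp add: powr_powr)
  finally have hN: "Lp_norm \<omega> q h = N powr (p - 1)" .
  have u: "projection \<omega> h \<in> Bergman \<omega> q" "Lp_norm \<omega> q (projection \<omega> h) \<le> C * N powr (p - 1)"
    using C(2)[OF hL] by (simp_all add: hN)
  have "(LINT z|W. norm (g z) powr p) = enn2real (\<integral>\<^sup>+z. ennreal (norm (g z) powr p) \<partial>W)"
    using gm by (intro integral_eq_nn_integral) (auto simp: measurable_W)
  then have "(LINT z|W. norm (g z) powr p) = N powr p"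
    unfolding N(2)[symmetric] by simp
  then have "of_real (N powr p) = (LINT z|W. complex_of_real (norm (g z) powr p))"
    by (simp only: integral_complex_of_real)
  also have "\<dots> = (LINT z|W. h z * cnj (g z))"
  proof (rule Bochner_Integration.integral_cong[OF refl])
    fix z
    have "h z * cnj (g z) = cnj (g z * dual_factor p (g z))"
      by (simp only: h_def complex_cnj_mult mult.commute)
    then show "complex_of_real (norm (g z) powr p) = h z * cnj (g z)"
      unfolding mult_dual_factor by (simp only: complex_cnj_complex_of_real)
  qed
  also have "\<dots> = \<Lambda> (\<lambda>z. projection \<omega> h (of_real t * z))"
    unfolding g_def using q by (intro dual_projection[OF L q _ t, symmetric] Lp_integrable[OF hL]) auto
  finally have "N powr p = norm (\<Lambda> (\<lambda>z. projection \<omega> h (of_real t * z)))"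
    by (metis abs_of_nonneg norm_of_real powr_ge_zero)
  also have "\<dots> \<le> ?D * Lp_norm \<omega> q (\<lambda>z. projection \<omega> h (of_real t * z))"
    using q u(1) t by (intro dual_norm_ge[OF L] Bergman_dilate) (auto simp: Bergman_def)
  also have "\<dots> \<le> ?D * (C * N powr (p - 1))"
    by (intro mult_left_mono order_trans[OF Bergman_dilate_le[OF u(1) q t] u(2)] dual_norm_nonneg[OF L q])
  finally have le: "N powr p \<le> ?D * C * N powr (p - 1)"
    by (simp only: mult.assoc)
  have "N \<le> ?D * C"
  proof (cases "N = 0")
    case True
    then show ?thesis
      using C(1) dual_norm_nonneg[OF L q] by simp
  next
    \<comment> \<open>Cancelling the power of N is legitimate because N is the norm of a dilate and
      so finite from the outset.\<close>
    case False
    then have "N powr p = N * N powr (p - 1)"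
      using N(1) powr_add[of N 1 "p - 1"] by simp
    then show ?thesis
      using le False N(1) by simp
  qed
  then show ?thesis
    unfolding N_def g_def .
qed

lemma representer_Bergman:
  assumes pp: "1 < p" "1 / p + 1 / q = 1" and L: "\<Lambda> \<in> dual_space (Bergman \<omega> q) (Lp_norm \<omega> q)"
    and C: "0 \<le> C" "\<And>f. f \<in> Lp \<omega> q \<Longrightarrow> projection \<omega> f \<in> Bergman \<omega> q \<and> Lp_norm \<omega> q (projection \<omega> f) \<le> C * Lp_norm \<omega> q f"
  shows "representer \<Lambda> \<in> Bergman \<omega> p"
    and "Lp_norm \<omega> p (representer \<Lambda>) \<le> dual_norm (Bergman \<omega> q) (Lp_norm \<omega> q) \<Lambda> * C"
proof -
  have q: "1 < q"
    by (rule conjugate_gt_1[OF pp])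
  let ?g = "representer \<Lambda>"
  let ?B = "dual_norm (Bergman \<omega> q) (Lp_norm \<omega> q) \<Lambda> * C"
  define t where "t n = real (Suc n) / real (Suc (Suc n))" for n
  have t: "0 < t n" "t n < 1" for n
    by (auto simp: t_def)
  have tl: "t \<longlonglongrightarrow> 1"
    unfolding t_def by real_asymp
  have gh: "?g holomorphic_on disc"
    by (rule representer_holomorphic[OF L q])
  have b: "mean_integral \<mu> p (\<lambda>z. ?g (of_real (t n) * z)) \<le> ennreal (?B powr p)" for n
  proof -
    have t0: "0 \<le> t n" "t n < 1"
      using t[of n] by auto
    have "mean_integral \<mu> p (\<lambda>z. ?g (of_real (t n) * z)) = ennreal (Lp_norm \<omega> p (\<lambda>z. ?g (of_real (t n) * z)) powr p)"
      using pp by (intro Bergman_norm_powr[symmetric] Bergman_dilate gh t0) auto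
    also have "\<dots> \<le> ennreal (?B powr p)"
      using pp by (intro ennreal_leI powr_mono2 representer_dilate_le[OF pp L C t0]) auto
    finally show ?thesis .
  qed
  have "mean_integral \<mu> p ?g \<le> liminf (\<lambda>n. mean_integral \<mu> p (\<lambda>z. ?g (of_real (t n) * z)))"
    by (rule R.mean_integral_liminf[OF gh pp(1) t tl])
  also have "\<dots> \<le> limsup (\<lambda>n. mean_integral \<mu> p (\<lambda>z. ?g (of_real (t n) * z)))"
    by (rule Liminf_le_Limsup) simp
  also have "\<dots> \<le> ennreal (?B powr p)"
    by (intro Limsup_bounded always_eventually allI b)
  finally have le: "mean_integral \<mu> p ?g \<le> ennreal (?B powr p)" .
  show B: "?g \<in> Bergman \<omega> p"
    using gh le pp by (simp add: Bergman_iff le_less_trans)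
  have "ennreal (Lp_norm \<omega> p ?g powr p) \<le> ennreal (?B powr p)"
    using Bergman_norm_powr[OF B] pp le by simp
  then have "Lp_norm \<omega> p ?g powr p \<le> 1 * ?B powr p"
    by (subst (asm) ennreal_le_iff) auto
  then have "Lp_norm \<omega> p ?g \<le> 1 powr (1 / p) * ?B"
    using pp C(1) dual_norm_nonneg[OF L q] by (intro powr_le_cmult) auto
  then show "Lp_norm \<omega> p ?g \<le> ?B"
    by simp
qed

text \<open>As f is its own projection, the value of \<Lambda> at a dilate of f is the integral of f
  against the dilated representer. Letting r tend to 1 on both sides gives the claim.\<close>

lemma dual_eq_pairing:
  assumes pp: "1 < p" "1 / p + 1 / q = 1" and L: "\<Lambda> \<in> dual_space (Bergman \<omega> q) (Lp_norm \<omega> q)"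
    and g: "representer \<Lambda> \<in> Bergman \<omega> p" and f: "f \<in> Bergman \<omega> q"
  shows "\<Lambda> f = pairing \<omega> f (representer \<Lambda>)"
proof -
  have q: "1 < q"
    by (rule conjugate_gt_1[OF pp])
  have h: "f holomorphic_on disc"
    using f by (simp add: Bergman_def)
  have i: "integrable W f"
    using f q by (intro Bergman_integrable) auto
  let ?D = "dual_norm (Bergman \<omega> q) (Lp_norm \<omega> q) \<Lambda>"
  let ?R = "\<lambda>r. LINT z|W. f z * cnj (representer \<Lambda> (of_real r * z))"
  have "((\<lambda>r. ?R r - \<Lambda> f) \<longlongrightarrow> 0) (at_left 1)"
  proof (rule Lim_null_comparison[OF eventually_at_left_1])
    fix r :: real assume r: "0 < r" "r < 1"
    have B: "(\<lambda>z. projection \<omega> f (of_real r * z)) \<in> Bergman \<omega> q"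
      using r by (intro Bergman_dilate projection_holomorphic i q) auto
    have "Lp_norm \<omega> q (\<lambda>z. projection \<omega> f (of_real r * z) - f z) = Lp_norm \<omega> q (\<lambda>z. f (of_real r * z) - f z)"
    proof (rule Lp_norm_cong)
      have d: "F holomorphic_on disc \<Longrightarrow> (\<lambda>z. F (of_real r * z) - f z) holomorphic_on disc" for F
        using r by (intro holomorphic_on_diff holomorphic_dilate h) auto
      show "(\<lambda>z. projection \<omega> f (of_real r * z) - f z) holomorphic_on disc" "(\<lambda>z. f (of_real r * z) - f z) holomorphic_on disc"
        by (rule d[OF projection_holomorphic[OF i]], rule d[OF h])
      fix z :: complex assume z: "norm z < 1"
      have "norm (of_real r * z) < 1"
        using r z mult_strict_mono[of r 1 "norm z" 1] by (simp add: norm_mult)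
      then show "projection \<omega> f (of_real r * z) - f z = f (of_real r * z) - f z"
        by (simp only: projection_reproduces[OF h i])
    qed (use q in simp)
    then show "norm (?R r - \<Lambda> f) \<le> ?D * Lp_norm \<omega> q (\<lambda>z. f (of_real r * z) - f z)"
      using dual_diff_le[OF L q B f] dual_projection[OF L q i, of r] r by simp
  next
    show "((\<lambda>r. ?D * Lp_norm \<omega> q (\<lambda>z. f (of_real r * z) - f z)) \<longlongrightarrow> 0) (at_left 1)"
      using tendsto_mult[OF tendsto_const dilation_tendsto[OF f q], of ?D] by simp
  qed
  then have "(?R \<longlongrightarrow> \<Lambda> f) (at_left 1)"
    by (simp add: Lim_null[symmetric])
  moreover have "(?R \<longlongrightarrow> (LINT z|W. f z * cnj (representer \<Lambda> z))) (at_left 1)"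
    by (rule dilated_pairing_tendsto[OF pp Bergman_Lp[OF f] g])
  ultimately have "\<Lambda> f = (LINT z|W. f z * cnj (representer \<Lambda> z))"
    by (rule tendsto_unique[rotated]) simp
  then show ?thesis
    by (simp add: pairing_Bergman(1)[OF pp f g])
qed

text \<open>Testing on z^n recovers every Taylor coefficient, since the even moments do not
  vanish.\<close>

lemma pairing_inject:
  assumes pp: "1 < p" "1 / p + 1 / q = 1" and g: "g \<in> Bergman \<omega> p" and h: "h \<in> Bergman \<omega> p"
    and eq: "\<And>f. f \<in> Bergman \<omega> q \<Longrightarrow> pairing \<omega> f g = pairing \<omega> f h" and z: "norm z < 1"
  shows "g z = h z"
proof -
  have q: "1 < q"
    by (rule conjugate_gt_1[OF pp])
  have hol: "g holomorphic_on disc" "h holomorphic_on disc"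
    using g h by (auto simp: Bergman_def)
  have t: "pairing \<omega> (\<lambda>z. z ^ n) u = cnj (taylor u n * of_real (even_moment n))" if u: "u \<in> Bergman \<omega> p" for u n
  proof -
    have "pairing \<omega> (\<lambda>z. z ^ n) u = (LINT z|W. z ^ n * cnj (u z))"
      by (rule pairing_Bergman(1)[OF pp polynomial_Bergman(1)[OF q] u])
    also have "\<dots> = (LINT z|W. cnj (u z * cnj z ^ n))"
      by (rule Bochner_Integration.integral_cong) (auto simp: mult.commute)
    also have "\<dots> = cnj (fourier u n)"
      unfolding fourier_def by (rule Bochner_Integration.integral_cnj)
    also have "fourier u n = taylor u n * of_real (even_moment n)"
      using u pp by (intro fourier_holomorphic Bergman_integrable[OF u]) (auto simp: Bergman_def)
    finally show ?thesis .
  qed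
  have "taylor g n = taylor h n" for n
  proof -
    have "cnj (taylor g n * of_real (even_moment n)) = cnj (taylor h n * of_real (even_moment n))"
      unfolding t[OF g, symmetric] t[OF h, symmetric] by (rule eq[OF polynomial_Bergman(1)[OF q]])
    then have "taylor g n * of_real (even_moment n) = taylor h n * of_real (even_moment n)"
      by (simp only: complex_cnj_cancel_iff)
    then show ?thesis
      using even_moment_pos[of n] by (subst (asm) mult_right_cancel) auto
  qed
  then show ?thesis
    using taylor_sums[OF hol(1) z] taylor_sums[OF hol(2) z] by (simp only:) (rule sums_unique2)
qed

text \<open>Norm equivalence from below: g agrees on the disc with the representer of the functional
  it induces, whose norm is bounded by the dual norm. The Bergman norm is then exchanged for the
  Dirichlet norm.\<close>

theorem dual_if_D_class:
  assumes D: "\<omega> \<in> D_class" and pp: "1 < p" "1 / p + 1 / q = 1"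
  shows "dual_via_pairing \<omega> (Bergman \<omega> q) (Lp_norm \<omega> q) (Dirichlet \<omega> p k) (Dirichlet_norm \<omega> p k)"
proof -
  have q: "1 < q"
    by (rule conjugate_gt_1[OF pp])
  obtain a b where Y: "Bergman \<omega> p = Dirichlet \<omega> p k" and a: "0 < a" and b: "0 < b"
    and ab: "\<And>f. f \<in> Bergman \<omega> p \<Longrightarrow> a * Dirichlet_norm \<omega> p k f \<le> Lp_norm \<omega> p f \<and> Lp_norm \<omega> p f \<le> b * Dirichlet_norm \<omega> p k f"
    using Bergman_eq_Dirichlet[OF D pp(1), of k] by (auto simp: same_space_equivalent_norms_def)
  obtain C where C: "0 \<le> C" "\<And>f. f \<in> Lp \<omega> q \<Longrightarrow> projection \<omega> f \<in> Bergman \<omega> q \<and> Lp_norm \<omega> q (projection \<omega> f) \<le> C * Lp_norm \<omega> q f"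
    using projection_bounded[OF D q] by blast
  let ?X = "dual_space (Bergman \<omega> q) (Lp_norm \<omega> q)"
  let ?dn = "dual_norm (Bergman \<omega> q) (Lp_norm \<omega> q)"
  note R = representer_Bergman[OF pp _ C]
  note P = pairing_dual_space[OF pp]
  have lower: "Lp_norm \<omega> p g \<le> (C + 1) * ?dn (\<lambda>f. pairing \<omega> f g)" if g: "g \<in> Bergman \<omega> p" for g
  proof -
    let ?L = "\<lambda>f. pairing \<omega> f g"
    note L = P(1)[OF g]
    have "g z = representer ?L z" if "norm z < 1" for z
      by (rule pairing_inject[OF pp g R(1)[OF L] dual_eq_pairing[OF pp L R(1)[OF L]] that])
    then have "Lp_norm \<omega> p g = Lp_norm \<omega> p (representer ?L)"
      using g R(1)[OF L] pp by (intro Lp_norm_cong) (auto simp: Bergman_def)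
    also have "\<dots> \<le> ?dn ?L * C"
      by (rule R(2)[OF L])
    also have "\<dots> \<le> (C + 1) * ?dn ?L"
      using dual_norm_nonneg[OF L q] by (simp add: algebra_simps)
    finally show ?thesis .
  qed
  show ?thesis
    unfolding dual_via_pairing_def Y[symmetric]
  proof (intro conjI ballI)
    show "pairing_defined \<omega> f g" if "g \<in> Bergman \<omega> p" "f \<in> Bergman \<omega> q" for f g
      by (rule pairing_Bergman(2)[OF pp that(2,1)])
    show "(\<lambda>f. pairing \<omega> f g) \<in> ?X" if "g \<in> Bergman \<omega> p" for g
      by (rule P(1)[OF that])
    show "\<exists>g\<in>Bergman \<omega> p. (\<forall>f\<in>Bergman \<omega> q. \<Lambda> f = pairing \<omega> f g) \<and>
        (\<forall>h\<in>Bergman \<omega> p. (\<forall>f\<in>Bergman \<omega> q. \<Lambda> f = pairing \<omega> f h) \<longrightarrow> (\<forall>z\<in>disc. h z = g z))"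
      if L: "\<Lambda> \<in> ?X" for \<Lambda>
    proof (intro bexI[of _ "representer \<Lambda>"] conjI ballI impI)
      note g = R(1)[OF L]
      show "representer \<Lambda> \<in> Bergman \<omega> p"
        by (rule g)
      show e: "\<Lambda> f = pairing \<omega> f (representer \<Lambda>)" if "f \<in> Bergman \<omega> q" for f
        by (rule dual_eq_pairing[OF pp L g that])
      fix h z assume h: "h \<in> Bergman \<omega> p" and eq: "\<forall>f\<in>Bergman \<omega> q. \<Lambda> f = pairing \<omega> f h" and z: "z \<in> disc"
      show "h z = representer \<Lambda> z"
      proof (rule pairing_inject[OF pp h g])
        show "pairing \<omega> f h = pairing \<omega> f (representer \<Lambda>)" if "f \<in> Bergman \<omega> q" for f
          using bspec[OF eq that] e[OF that] by (rule trans[OF sym])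
        show "norm z < 1"
          using z by simp
      qed
    qed
    show "\<exists>c>0. \<exists>C>0. \<forall>g\<in>Bergman \<omega> p. c * Dirichlet_norm \<omega> p k g \<le> ?dn (\<lambda>f. pairing \<omega> f g) \<and>
        ?dn (\<lambda>f. pairing \<omega> f g) \<le> C * Dirichlet_norm \<omega> p k g"
    proof (intro exI conjI ballI)
      \<comment> \<open>The projection bound C is only known to be nonnegative, so C + 1 is used as
        the divisor.\<close>
      show "0 < a / (C + 1)"
        using a C(1) by simp
      show "0 < b"
        by (rule b)
      fix g assume g: "g \<in> Bergman \<omega> p"
      have "a * Dirichlet_norm \<omega> p k g \<le> (C + 1) * ?dn (\<lambda>f. pairing \<omega> f g)"
        using ab[OF g] lower[OF g] by (blast intro: order_trans)
      then show "a / (C + 1) * Dirichlet_norm \<omega> p k g \<le> ?dn (\<lambda>f. pairing \<omega> f g)"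
        using C(1) by (simp add: pos_divide_le_eq mult.commute)
      show "?dn (\<lambda>f. pairing \<omega> f g) \<le> b * Dirichlet_norm \<omega> p k g"
        using P(2)[OF g] ab[OF g] by (blast intro: order_trans)
    qed
  qed
qed

theorem projection_if_D_class:
  assumes D: "\<omega> \<in> D_class" and p: "1 < p"
  shows "bounded_operator (projection \<omega>) (Lp \<omega> p) (Lp_norm \<omega> p) (Dirichlet \<omega> p k) (Dirichlet_norm \<omega> p k)"
    and "onto_operator (projection \<omega>) (Lp \<omega> p) (Dirichlet \<omega> p k)"
proof -
  obtain a where Y: "Bergman \<omega> p = Dirichlet \<omega> p k" and a: "0 < a"
    and le: "\<And>f. f \<in> Bergman \<omega> p \<Longrightarrow> a * Dirichlet_norm \<omega> p k f \<le> Lp_norm \<omega> p f"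
    using Bergman_eq_Dirichlet[OF D p, of k] by (auto simp: same_space_equivalent_norms_def)
  obtain C where C: "\<And>f. f \<in> Lp \<omega> p \<Longrightarrow> projection \<omega> f \<in> Bergman \<omega> p \<and> Lp_norm \<omega> p (projection \<omega> f) \<le> C * Lp_norm \<omega> p f"
    using projection_bounded[OF D p] by blast
  show "bounded_operator (projection \<omega>) (Lp \<omega> p) (Lp_norm \<omega> p) (Dirichlet \<omega> p k) (Dirichlet_norm \<omega> p k)"
    unfolding bounded_operator_def Y[symmetric]
  proof (intro conjI ballI exI)
    show "projection \<omega> f \<in> Bergman \<omega> p" if "f \<in> Lp \<omega> p" for f
      using C[OF that] by blast
    fix f assume f: "f \<in> Lp \<omega> p"
    have "a * Dirichlet_norm \<omega> p k (projection \<omega> f) \<le> C * Lp_norm \<omega> p f"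
      using le C[OF f] by (blast intro: order_trans)
    then show "Dirichlet_norm \<omega> p k (projection \<omega> f) \<le> C / a * Lp_norm \<omega> p f"
      using a by (simp add: pos_le_divide_eq mult.commute)
  qed
  show "onto_operator (projection \<omega>) (Lp \<omega> p) (Dirichlet \<omega> p k)"
    unfolding onto_operator_def Y[symmetric]
  proof (intro ballI)
    fix g assume g: "g \<in> Bergman \<omega> p"
    have "\<forall>z\<in>disc. projection \<omega> g z = g z"
      using g p projection_reproduces[OF _ Bergman_integrable[OF g]] by (auto simp: Bergman_def)
    then show "\<exists>f\<in>Lp \<omega> p. \<forall>z\<in>disc. projection \<omega> f z = g z"
      using Bergman_Lp[OF g] by blast
  qed
qed

end

section \<open>Assembly: each of the first three statements is tied to the fourth\<close>

theorem theorem12: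
  fixes \<omega> :: "real \<Rightarrow> real" and p p' :: real and k :: nat
  assumes "radial_weight \<omega>"
    and "1 < p" and "1 / p + 1 / p' = 1"
    and "1 \<le> k"
  defines "i \<equiv>
      bounded_operator (projection \<omega>) (Lp \<omega> p) (Lp_norm \<omega> p)
        (Dirichlet \<omega> p k) (Dirichlet_norm \<omega> p k) \<and>
      onto_operator (projection \<omega>) (Lp \<omega> p) (Dirichlet \<omega> p k)"
    and "ii \<equiv>
      dual_via_pairing \<omega> (Bergman \<omega> p') (Lp_norm \<omega> p')
        (Dirichlet \<omega> p k) (Dirichlet_norm \<omega> p k)"
    and "iii \<equiv>
      same_space_equivalent_norms (Bergman \<omega> p) (Lp_norm \<omega> p)
        (Dirichlet \<omega> p k) (Dirichlet_norm \<omega> p k)"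
    and "iv \<equiv> \<omega> \<in> D_class"
  shows "(i \<longleftrightarrow> ii) \<and> (ii \<longleftrightarrow> iii) \<and> (iii \<longleftrightarrow> iv)"
proof -
  interpret weight \<omega>
    by standard (rule assms(1))
  have "i \<longleftrightarrow> iv"
    unfolding i_def iv_def using D_class_if_projection[OF assms(2-4)] projection_if_D_class[OF _ assms(2), of k] by blast
  moreover have "ii \<longleftrightarrow> iv"
    unfolding ii_def iv_def using D_class_if_dual[OF assms(2-4)] dual_if_D_class[OF _ assms(2,3)] by blast
  moreover have "iii \<longleftrightarrow> iv"
    unfolding iii_def iv_def using D_class_if_same_space[OF assms(2-4)] Bergman_eq_Dirichlet[OF _ assms(2)] by blast
  ultimately show ?thesis
    by blast
qed



end
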